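(* Let $V$ be a homogeneous potential of degree $k=2$ in $n$ complex variables satisfying the following assumptions: (1) $V$ has a proper Darboux point, i.e. there exists a non-zero vector $d\in\mathbb{C}^n$ in the domain of $V$ such that $V'(d)=\gamma d$ with $\gamma\in\mathbb{C}\setminus\{0\}$; (2) the Hessian matrix $\gamma^{-1}V''(d)$ is diagonalisable with eigenvalues $\lambda_1=\omega_1^2,\ldots,\lambda_n=\omega_n^2$ such that $\omega_1,\ldots,\omega_n\in\mathbb{C}$ are $\mathbb{Z}$-linearly independent; (3) $V$ is integrable in the Liouville sense. Then $$V(q)=\tfrac12\, q^{T}V''(d)\,q .$$ In other words, in the (orthonormal) eigenbasis of $V''(d)$ the Hamiltonian has the form $$H=\frac12\sum_{i=1}^n\left(p_i^2+\gamma\,\omega_i^2q_i^2\right).$$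
   Context: Everything is complex. A homogeneous potential $V$ of degree $k$ is a complex function homogeneous of degree $k$ (i.e. $V(sq)=s^kV(q)$ for $s\in\mathbb{C}\setminus\{0\}$), holomorphic on a connected open set $U\subset\mathbb{C}^n$ stable under multiplication by $\mathbb{C}\setminus\{0\}$ (in particular holomorphic near the Darboux point $d\in U$). $V'=\operatorname{grad}V$ and $V''$ is the Hessian matrix. The associated Hamiltonian is $H(q,p)=\frac12\sum_{i=1}^n p_i^2+V(q)$ on $U\times\mathbb{C}^n$ with its canonical symplectic structure, and Hamilton's equations are $\dot q=p$, $\dot p=-V'(q)$. "$V$ is integrable in the Liouville sense" means that this Hamiltonian system admits $n$ functionally independent meromorphic first integrals that pairwise Poisson commute. *)

theory Defs
  imports "HOL-Analysis.Analysis"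
begin

section \<open>Functions of several complex variables\<close>

text \<open>Holomorphy in several variables: at every point of the (open) set the function has a
  Frechet derivative that is complex linear.\<close>

definition mv_holomorphic_on :: "(complex^'m \<Rightarrow> complex) \<Rightarrow> (complex^'m) set \<Rightarrow> bool" where
  "mv_holomorphic_on f S \<longleftrightarrow>
     (\<forall>z\<in>S. \<exists>f'. (f has_derivative f') (at z) \<and> (\<forall>c v. f' (c *s v) = c * f' v))"

text \<open>A meromorphic function is locally a quotient of holomorphic functions whose denominator does
  not vanish identically.  It is represented by a total function; its values at the points where
  it cannot be written locally with a nonvanishing denominator are irrelevant.\<close>

definition mv_meromorphic_on :: "(complex^'m \<Rightarrow> complex) \<Rightarrow> (complex^'m) set \<Rightarrow> bool" where
  "mv_meromorphic_on f W \<longleftrightarrow>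
     (\<forall>x\<in>W. \<exists>N g h. open N \<and> connected N \<and> x \<in> N \<and> N \<subseteq> W \<and>
        mv_holomorphic_on g N \<and> mv_holomorphic_on h N \<and> (\<exists>z\<in>N. h z \<noteq> 0) \<and>
        (\<forall>z\<in>N. h z \<noteq> 0 \<longrightarrow> f z = g z / h z))"

text \<open>The points near which (the chosen representative of) a function is holomorphic.  For a
  meromorphic function on an open set \<open>W\<close> they form an open dense subset of \<open>W\<close>; identities between
  meromorphic functions are required there.\<close>

definition regular_points :: "(complex^'m \<Rightarrow> complex) \<Rightarrow> (complex^'m) set \<Rightarrow> (complex^'m) set" where
  "regular_points f W = {z. \<exists>N. open N \<and> z \<in> N \<and> N \<subseteq> W \<and> mv_holomorphic_on f N}"

definition partial_deriv :: "'m \<Rightarrow> (complex^'m \<Rightarrow> complex) \<Rightarrow> complex^'m \<Rightarrow> complex" where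
  "partial_deriv i f z = deriv (\<lambda>t. f (z + t *s axis i 1)) 0"

definition grad :: "(complex^'n \<Rightarrow> complex) \<Rightarrow> complex^'n \<Rightarrow> complex^'n" where
  "grad V q = (\<chi> i. partial_deriv i V q)"

definition hessian :: "(complex^'n \<Rightarrow> complex) \<Rightarrow> complex^'n \<Rightarrow> complex^'n^'n" where
  "hessian V q = (\<chi> i j. partial_deriv i (partial_deriv j V) q)"

section \<open>Homogeneous potentials\<close>

definition homogeneous_potential ::
    "int \<Rightarrow> (complex^'n) set \<Rightarrow> (complex^'n \<Rightarrow> complex) \<Rightarrow> bool" where
  "homogeneous_potential k U V \<longleftrightarrow>
     open U \<and> connected U \<and> (\<forall>q\<in>U. \<forall>s. s \<noteq> 0 \<longrightarrow> s *s q \<in> U) \<and>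
     mv_holomorphic_on V U \<and>
     (\<forall>q\<in>U. \<forall>s. s \<noteq> 0 \<longrightarrow> V (s *s q) = s powi k * V q)"

definition proper_darboux_point ::
    "(complex^'n) set \<Rightarrow> (complex^'n \<Rightarrow> complex) \<Rightarrow> complex^'n \<Rightarrow> complex \<Rightarrow> bool" where
  "proper_darboux_point U V d \<gamma> \<longleftrightarrow> d \<in> U \<and> d \<noteq> 0 \<and> \<gamma> \<noteq> 0 \<and> grad V d = \<gamma> *s d"

section \<open>The Hamiltonian system\<close>

text \<open>Phase space is \<open>complex^('n + 'n)\<close>: the coordinate \<open>Inl i\<close> is \<open>q\<^sub>i\<close> and \<open>Inr i\<close> is \<open>p\<^sub>i\<close>.\<close>

definition phase_point :: "complex^'n \<Rightarrow> complex^'n \<Rightarrow> complex^('n + 'n)" where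
  "phase_point q p = (\<chi> m. case m of Inl i \<Rightarrow> q $ i | Inr i \<Rightarrow> p $ i)"

definition position :: "complex^('n + 'n) \<Rightarrow> complex^'n" where
  "position z = (\<chi> i. z $ Inl i)"

definition momentum :: "complex^('n + 'n) \<Rightarrow> complex^'n" where
  "momentum z = (\<chi> i. z $ Inr i)"

definition phase_space :: "(complex^'n) set \<Rightarrow> (complex^('n + 'n)) set" where
  "phase_space U = {z. position z \<in> U}"

definition hamiltonian :: "(complex^'n \<Rightarrow> complex) \<Rightarrow> complex^('n + 'n) \<Rightarrow> complex" where
  "hamiltonian V z = 1/2 * (\<Sum>i\<in>UNIV. (momentum z $ i)\<^sup>2) + V (position z)"

definition hamilton_field ::
    "(complex^('n::finite + 'n) \<Rightarrow> complex) \<Rightarrow> complex^('n + 'n) \<Rightarrow> complex^('n + 'n)" where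
  "hamilton_field H z =
     phase_point (\<chi> i. partial_deriv (Inr i) H z) (\<chi> i. - partial_deriv (Inl i) H z)"

definition poisson_bracket ::
    "(complex^('n::finite + 'n) \<Rightarrow> complex) \<Rightarrow> (complex^('n + 'n) \<Rightarrow> complex) \<Rightarrow>
     complex^('n + 'n) \<Rightarrow> complex" where
  "poisson_bracket F G z =
     (\<Sum>i\<in>UNIV. partial_deriv (Inl i) F z * partial_deriv (Inr i) G z
              - partial_deriv (Inr i) F z * partial_deriv (Inl i) G z)"

definition meromorphic_first_integral ::
    "(complex^'m \<Rightarrow> complex^'m) \<Rightarrow> (complex^'m) set \<Rightarrow> (complex^'m \<Rightarrow> complex) \<Rightarrow> bool" where
  "meromorphic_first_integral X W F \<longleftrightarrow>
     mv_meromorphic_on F W \<and>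
     (\<forall>z\<in>regular_points F W. (\<Sum>m\<in>UNIV. partial_deriv m F z * X z $ m) = 0)"

text \<open>Functional independence: the differentials are linearly independent on a dense open subset.\<close>

definition functionally_independent ::
    "(complex^'m) set \<Rightarrow> ('n::finite \<Rightarrow> complex^'m \<Rightarrow> complex) \<Rightarrow> bool" where
  "functionally_independent W F \<longleftrightarrow>
     (\<exists>D. open D \<and> D \<subseteq> W \<and> W \<subseteq> closure D \<and>
        (\<forall>z\<in>D. (\<forall>i. z \<in> regular_points (F i) W) \<and>
               (\<forall>c :: 'n \<Rightarrow> complex. (\<Sum>i\<in>UNIV. c i *s grad (F i) z) = 0 \<longrightarrow> (\<forall>i. c i = 0))))"

text \<open>The \<open>n\<close> first integrals are indexed by the same type \<open>'n\<close> as the coordinates.\<close>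

definition liouville_integrable :: "(complex^'n) set \<Rightarrow> (complex^'n \<Rightarrow> complex) \<Rightarrow> bool" where
  "liouville_integrable U V \<longleftrightarrow>
     (\<exists>F :: 'n \<Rightarrow> complex^('n + 'n) \<Rightarrow> complex.
        (\<forall>i. meromorphic_first_integral (hamilton_field (hamiltonian V)) (phase_space U) (F i)) \<and>
        functionally_independent (phase_space U) F \<and>
        (\<forall>i j. \<forall>z \<in> regular_points (F i) (phase_space U) \<inter> regular_points (F j) (phase_space U).
           poisson_bracket (F i) (F j) z = 0))"

text \<open>Hamilton's equations of this system are \<open>q' = p\<close>, \<open>p' = - V'(q)\<close>.\<close>

lemma hamilton_field_hamiltonian:
  "hamilton_field (hamiltonian V) z = phase_point (momentum z) (- grad V (position z))"
proof -
  have p: "partial_deriv (Inr i) (hamiltonian V) z = momentum z $ i" for i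
  proof -
    have "position (z + t *s axis (Inr i) 1) = position z" for t
      by (simp add: position_def vec_eq_iff axis_def)
    moreover have "momentum (z + t *s axis (Inr i) 1) $ j
        = momentum z $ j + t * (if j = i then 1 else 0)" for t j
      by (simp add: momentum_def axis_def)
    ultimately have "(\<lambda>t. hamiltonian V (z + t *s axis (Inr i) 1)) =
      (\<lambda>t. 1/2 * (\<Sum>j\<in>UNIV. (momentum z $ j + t * (if j = i then 1 else 0))\<^sup>2) + V (position z))"
      by (simp add: hamiltonian_def)
    moreover have "((\<lambda>t. 1/2 * (\<Sum>j\<in>UNIV. (momentum z $ j + t * (if j = i then 1 else 0))\<^sup>2)
        + V (position z)) has_field_derivative
        1/2 * (\<Sum>j\<in>UNIV. 2 * momentum z $ j * (if j = i then 1 else 0))) (at 0)"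
      by (rule derivative_eq_intros refl | simp add: mult_ac)+
    ultimately have "partial_deriv (Inr i) (hamiltonian V) z
        = 1/2 * (\<Sum>j\<in>UNIV. 2 * momentum z $ j * (if j = i then 1 else 0))"
      unfolding partial_deriv_def by (simp only: DERIV_imp_deriv)
    then show ?thesis by (simp add: if_distrib cong: if_cong)
  qed
  have q: "partial_deriv (Inl i) (hamiltonian V) z = grad V (position z) $ i" for i
  proof -
    define C where "C = 1/2 * (\<Sum>j\<in>UNIV. (momentum z $ j)\<^sup>2)"
    have "momentum (z + t *s axis (Inl i) 1) = momentum z" for t
      by (simp add: momentum_def vec_eq_iff axis_def)
    moreover have "position (z + t *s axis (Inl i) 1) = position z + t *s axis i 1" for t
      by (simp add: position_def vec_eq_iff axis_def)
    ultimately have e: "(\<lambda>t. hamiltonian V (z + t *s axis (Inl i) 1)) =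
      (\<lambda>t. C + V (position z + t *s axis i 1))"
      by (simp add: hamiltonian_def C_def)
    have d: "((\<lambda>t. C + f t) has_field_derivative D) (at 0) \<longleftrightarrow> (f has_field_derivative D) (at 0)"
      for f :: "complex \<Rightarrow> complex" and D
      using DERIV_add[OF DERIV_const[of C], of f D 0 UNIV]
        DERIV_add[OF DERIV_const[of "-C"], of "\<lambda>t. C + f t" D 0 UNIV] by auto
    show ?thesis
      unfolding partial_deriv_def grad_def e by (simp add: deriv_def d)
  qed
  show ?thesis
    unfolding hamilton_field_def p q
    by (simp add: phase_point_def vec_eq_iff split: sum.split)
qed

section \<open>Linear algebra\<close>

definition diagonal_matrix :: "('n \<Rightarrow> complex) \<Rightarrow> complex^'n^'n" where
  "diagonal_matrix l = (\<chi> i j. if i = j then l i else 0)"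

definition diagonalisable_with_eigenvalues :: "complex^'n^'n \<Rightarrow> ('n \<Rightarrow> complex) \<Rightarrow> bool" where
  "diagonalisable_with_eigenvalues A l \<longleftrightarrow>
     (\<exists>P. invertible P \<and> A = P ** diagonal_matrix l ** matrix_inv P)"

definition int_linearly_independent :: "('n::finite \<Rightarrow> complex) \<Rightarrow> bool" where
  "int_linearly_independent w \<longleftrightarrow>
     (\<forall>c :: 'n \<Rightarrow> int. (\<Sum>i\<in>UNIV. of_int (c i) * w i) = 0 \<longrightarrow> (\<forall>i. c i = 0))"

text \<open>Orthonormality refers to the complex bilinear form \<open>x\<^sup>T y\<close>, not to a Hermitian product.\<close>

definition orthonormal_eigenbasis ::
    "complex^'n^'n \<Rightarrow> ('n \<Rightarrow> complex) \<Rightarrow> complex^'n^'n \<Rightarrow> bool" where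
  "orthonormal_eigenbasis A l P \<longleftrightarrow>
     orthogonal_matrix P \<and> (\<forall>i. A *v column i P = l i *s column i P)"

end

theory Submission
  imports Defs "HOL-Complex_Analysis.Complex_Analysis"
begin

text \<open>Write \<open>q = P u\<close> in an orthonormal eigenbasis.  Homogeneity makes \<open>d\<close> an eigenvector with \<open>\<omega>\<^sub>a\<^sup>2 = 1\<close>,
  so \<open>(e\<^sup>t - e\<^bsup>-t\<^esup>) d\<close> solves the equations of motion in a rescaled time; it vanishes exactly on \<open>\<pi>i\<int>\<close>.  Suppose that
  \<open>V\<close> is not quadratic and let \<open>T\<close>, of degree \<open>r + 1\<close>, be the leading term at \<open>d\<close> of the gradient of its
  non-quadratic part.  At distance \<open>eps\<close> from the solution, variation of constants gives a slow system \<open>c' = eps\<^sup>r Y\<close>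
  whose limit for \<open>eps \<longrightarrow> 0\<close> is \<open>T\<close> divided by \<open>(e\<^sup>t - e\<^bsup>-t\<^esup>)\<^sup>r\<close>.  A loop around \<open>0, \<pi>i, \<dots>, l\<pi>i\<close> therefore acts on the
  initial values by \<open>c \<mapsto> c + eps\<^sup>r K\<^sub>l(c) + \<dots>\<close>, with \<open>K\<^sub>l\<close> given by residues, and preserves the first integrals.
  Truncated logarithms of these maps almost annihilate \<open>n\<close> independent functions in involution, so \<open>K\<^sub>0(c)\<close> and
  \<open>K\<^sub>l(c)\<close> are symplectically orthogonal.  As a function of \<open>l\<close> this relation is an exponential sum with frequencies
  \<open>\<pi>i \<kappa>\<cdot>\<omega>\<close>, pairwise different modulo \<open>2\<pi>i\<close> by independence.  Its terms of highest degree in \<open>\<kappa>\<close> are products of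
  coefficients of \<open>T\<close> with residues of \<open>e\<^bsup>\<Omega>t\<^esup> / (e\<^sup>t - e\<^bsup>-t\<^esup>)\<^sup>r\<close>, which are nonzero for \<open>\<Omega> \<notin> \<int>\<close>; this forces \<open>T = 0\<close>.\<close>

text \<open>Two obstacles shape the argument. One is that the integrals are only meromorphic: all of
  them may be singular along the straight-line solution, and their differentials may become
  dependent there, so nothing can be restricted to that curve. Everything is followed at distance
  \<open>eps\<close> instead, where for generic initial values the integrals grow at most like a
  power of \<open>1 / eps\<close> and a determinant built from their differentials decays at most
  like a power of \<open>eps\<close>. Such losses have a fixed exponent and are beaten by making
  each approximation accurate to an arbitrary order \<open>eps ^ M\<close>. Hence finite Picard
  iterates and finite-difference logarithms suffice, and no exact flow is constructed. The other is
  that symplectic orthogonality is quadratic in \<open>T\<close>. Fixing one loop around the single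
  pole 0 makes it linear in the other loop; what remains is a product of a coefficient of
  \<open>T\<close> with a polynomial that contains all coefficients of its component, so that one
  nonzero coefficient is contradictory. Normalising the frequency of the Darboux direction to 1
  turns integer independence into independence modulo integers of the other frequencies.\<close>

no_notation fps_nth (infixl "$" 75)

section \<open>Holomorphic functions of several variables\<close>

lemma holomorphic_second_order_bound:
  fixes \<phi> :: "complex \<Rightarrow> complex"
  assumes hol: "\<phi> holomorphic_on ball z \<rho>" and \<rho>: "0 < \<rho>"
    and B: "\<And>w. w \<in> ball z \<rho> \<Longrightarrow> norm (\<phi> w) \<le> B"
    and \<eta>: "norm \<eta> \<le> \<rho> / 2"
  shows "norm (\<phi> (z + \<eta>) - \<phi> z - \<eta> * deriv \<phi> z) \<le> 32 * B / \<rho>\<^sup>2 * (norm \<eta>)\<^sup>2"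
proof -
  have B0: "0 \<le> B" using B[of z] \<rho> norm_ge_zero order_trans by (metis centre_in_ball)
  \<comment> \<open>Cauchy's inequality on a disc of radius \<open>\<rho> / 4\<close> around a point
    of the half disc: the factor 32 is \<open>fact 2 * 4 ^ 2\<close>.\<close>
  have d2: "norm (deriv (deriv \<phi>) w) \<le> 32 * B / \<rho>\<^sup>2" if w: "w \<in> cball z (\<rho>/2)" for w
  proof -
    have sub: "cball w (\<rho>/4) \<subseteq> ball z \<rho>"
    proof
      fix u assume "u \<in> cball w (\<rho>/4)"
      then show "u \<in> ball z \<rho>" using w \<rho> dist_triangle[of z u w] by auto
    qed
    have "norm ((deriv ^^ 2) \<phi> w) \<le> fact 2 * B / (\<rho>/4)^2"
      using sub \<rho> ball_subset_cball[of w "\<rho>/4"]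
      by (intro Cauchy_inequality holomorphic_on_imp_continuous_on)
         (auto intro!: holomorphic_on_subset[OF hol] B simp: dist_norm subset_iff)
    then show ?thesis by (simp add: power2_eq_square numeral_2_eq_2)
  qed
  have hd: "deriv \<phi> holomorphic_on ball z \<rho>" using hol by (intro holomorphic_deriv) auto
  have d1: "norm (deriv \<phi> w - deriv \<phi> z) \<le> 32 * B / \<rho>\<^sup>2 * norm (w - z)" if w: "w \<in> cball z (\<rho>/2)" for w
    by (rule field_differentiable_bound[where S = "cball z (\<rho>/2)" and f' = "deriv (deriv \<phi>)"])
       (use w \<rho> d2 in \<open>auto intro!: holomorphic_derivI[OF hd]\<close>)
  have "norm ((\<phi> (z+\<eta>) - (z+\<eta>) * deriv \<phi> z) - (\<phi> z - z * deriv \<phi> z)) \<le> (32 * B / \<rho>\<^sup>2 * norm \<eta>) * norm (z + \<eta> - z)"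
  proof (rule field_differentiable_bound[where S = "cball z (norm \<eta>)" and f' = "\<lambda>w. deriv \<phi> w - deriv \<phi> z"])
    fix w assume w: "w \<in> cball z (norm \<eta>)"
    then have w': "w \<in> ball z \<rho>" using \<eta> \<rho> by (auto simp: dist_norm norm_minus_commute)
    show "((\<lambda>w. \<phi> w - w * deriv \<phi> z) has_field_derivative deriv \<phi> w - deriv \<phi> z) (at w within cball z (norm \<eta>))"
      by (rule derivative_eq_intros holomorphic_derivI[OF hol] w' open_ball refl)+ simp
    have "norm (deriv \<phi> w - deriv \<phi> z) \<le> 32 * B / \<rho>\<^sup>2 * norm (w - z)" using w \<eta> by (intro d1) auto
    also have "\<dots> \<le> 32 * B / \<rho>\<^sup>2 * norm \<eta>"
      using w B0 by (intro mult_left_mono) (auto simp: dist_norm norm_minus_commute)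
    finally show "norm (deriv \<phi> w - deriv \<phi> z) \<le> 32 * B / \<rho>\<^sup>2 * norm \<eta>" .
  qed (auto simp: dist_norm)
  then show ?thesis by (simp add: algebra_simps power2_eq_square)
qed

text \<open>The bound depends on \<open>\<phi>\<close> only through \<open>\<rho>\<close> and
  \<open>B\<close>, so it is uniform over every family that is uniformly bounded on a common disc.
  That uniformity drives the results on parameters below.\<close>

lemma difference_quotient_bound:
  fixes \<phi> :: "complex \<Rightarrow> complex"
  assumes "\<phi> holomorphic_on ball z \<rho>" "0 < \<rho>"
    and "\<And>w. w \<in> ball z \<rho> \<Longrightarrow> norm (\<phi> w) \<le> B"
    and "norm \<eta> \<le> \<rho> / 2" "\<eta> \<noteq> 0"
  shows "norm ((\<phi> (z + \<eta>) - \<phi> z) / \<eta> - deriv \<phi> z) \<le> 32 * B / \<rho>\<^sup>2 * norm \<eta>"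
proof -
  have "norm (((\<phi> (z + \<eta>) - \<phi> z) / \<eta> - deriv \<phi> z) * \<eta>) \<le> 32 * B / \<rho>\<^sup>2 * (norm \<eta>)\<^sup>2"
  proof -
    have "((\<phi> (z + \<eta>) - \<phi> z) / \<eta> - deriv \<phi> z) * \<eta> = \<phi> (z + \<eta>) - \<phi> z - \<eta> * deriv \<phi> z"
      using assms(5) by (simp only: left_diff_distrib nonzero_divide_eq_eq) (simp add: field_simps)
    then show ?thesis using holomorphic_second_order_bound[OF assms(1-4)] by simp
  qed
  then have "norm ((\<phi> (z + \<eta>) - \<phi> z) / \<eta> - deriv \<phi> z) * norm \<eta> \<le> (32 * B / \<rho>\<^sup>2 * norm \<eta>) * norm \<eta>"
    by (simp add: norm_mult power2_eq_square[of "norm \<eta>"] mult_ac)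
  then show ?thesis using assms(5) by (simp only: mult_le_cancel_right) auto
qed

text \<open>Near a given point the derivative is approximated within \<open>e / 4\<close> by a
  difference quotient with one fixed step \<open>\<eta>\<close>, and such a quotient is jointly
  continuous because \<open>f\<close> is. Joint continuity at the point also supplies the common
  bound \<open>B\<close> on which the choice of \<open>\<eta>\<close> depends.\<close>

lemma continuous_on_deriv_parametric:
  fixes f :: "'a::metric_space \<Rightarrow> complex \<Rightarrow> complex"
  assumes U: "open U" and hol: "\<And>x. x \<in> X \<Longrightarrow> f x holomorphic_on U"
    and cont: "continuous_on (X \<times> U) (\<lambda>(x,z). f x z)"
  shows "continuous_on (X \<times> U) (\<lambda>(x,z). deriv (f x) z)"
proof -
  have main: "\<exists>d>0. \<forall>y\<in>X. \<forall>w\<in>U. dist (y,w) (x,z) < d \<longrightarrow> dist (deriv (f y) w) (deriv (f x) z) < e"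
    if x: "x \<in> X" and z: "z \<in> U" and e: "e > 0" for x z e
  proof -
    have xz: "(x,z) \<in> X \<times> U" using x z by auto
    obtain d1 where d1: "d1 > 0" "\<And>p. p \<in> X \<times> U \<Longrightarrow> dist p (x,z) < d1 \<Longrightarrow> dist (case p of (x,z) \<Rightarrow> f x z) (f x z) < 1"
      using cont[unfolded continuous_on_iff, rule_format, OF xz, of 1] by auto
    obtain d2 where d2: "d2 > 0" "ball z d2 \<subseteq> U" using U z open_contains_ball by blast
    define \<rho> where "\<rho> = min (d1/4) (d2/4)"
    have \<rho>: "\<rho> > 0" "4*\<rho> \<le> d1" "4*\<rho> \<le> d2" using d1 d2 by (auto simp: \<rho>_def)
    define B where "B = norm (f x z) + 1"
    have B0: "B > 0" by (simp add: B_def add_nonneg_pos)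
    have bd: "norm (f y w) \<le> B" if "y \<in> X" "dist y x < \<rho>" "dist w z < 3*\<rho>" for y w
    proof -
      have "w \<in> U" using that \<rho> d2 by (auto simp: subset_iff dist_commute)
      moreover have "dist (y,w) (x,z) \<le> dist y x + dist w z" by (simp add: dist_Pair_Pair sqrt_sum_squares_le_sum)
      ultimately have "dist (f y w) (f x z) < 1" using d1(2)[of "(y,w)"] that \<rho> by auto
      then show ?thesis unfolding B_def dist_norm by (smt (verit) norm_triangle_sub)
    qed
    \<comment> \<open>The first entry is the largest step allowed by
      \<open>difference_quotient_bound\<close>; the second makes the error
      \<open>32 * B / \<rho>\<^sup>2 * \<eta>\<close> at most \<open>e / 4\<close>.\<close>
    define \<eta> where "\<eta> = min (\<rho>/2) (e * \<rho>\<^sup>2 / (32 * B * 4))"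
    have \<eta>: "\<eta> > 0" "\<eta> \<le> \<rho>/2" "32 * B / \<rho>\<^sup>2 * \<eta> \<le> e/4"
    proof -
      show "\<eta> > 0" using \<rho> e B0 by (auto simp: \<eta>_def)
      show "\<eta> \<le> \<rho>/2" by (simp add: \<eta>_def)
      have "32 * B / \<rho>\<^sup>2 * \<eta> \<le> 32 * B / \<rho>\<^sup>2 * (e * \<rho>\<^sup>2 / (32 * B * 4))"
        using B0 by (intro mult_left_mono) (auto simp: \<eta>_def)
      then show "32 * B / \<rho>\<^sup>2 * \<eta> \<le> e/4" using B0 \<rho> by (simp add: field_simps)
    qed
    let ?q = "\<lambda>y w. (f y (w + of_real \<eta>) - f y w) / of_real \<eta>"
    have appr: "norm (?q y w - deriv (f y) w) \<le> e/4" if "y \<in> X" "dist y x < \<rho>" "dist w z < \<rho>" for y w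
    proof -
      have sub: "ball w \<rho> \<subseteq> ball z (3*\<rho>)"
        using that \<rho> by (auto simp: subset_iff) (smt (verit) dist_commute dist_triangle)
      have subU: "ball w \<rho> \<subseteq> U" using sub subset_ball[of "3*\<rho>" d2 z] \<rho> d2 by auto
      have subB: "norm (f y u) \<le> B" if "dist w u < \<rho>" for u
        using that sub \<open>y \<in> X\<close> \<open>dist y x < \<rho>\<close> by (intro bd) (auto simp: subset_iff dist_commute)
      have "norm (?q y w - deriv (f y) w) \<le> 32 * B / \<rho>\<^sup>2 * norm (of_real \<eta> :: complex)"
        by (rule difference_quotient_bound)
           (use that \<rho> \<eta> subU subB in \<open>auto intro!: holomorphic_on_subset[OF hol]\<close>)
      then show ?thesis using \<eta> by simp
    qed
    have cq: "continuous_on (X \<times> ball z \<rho>) (\<lambda>p. ?q (fst p) (snd p))"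
    proof -
      have s: "w + of_real \<eta> \<in> U" "w \<in> U" if "dist z w < \<rho>" for w
      proof -
        have "dist z (w + of_real \<eta>) \<le> dist z w + \<eta>"
          using dist_triangle[of z "w + of_real \<eta>" w] \<eta> by (simp add: dist_norm)
        then have "w + of_real \<eta> \<in> ball z d2" using that \<eta> \<rho> by auto
        then show "w + of_real \<eta> \<in> U" using d2 by auto
        have "w \<in> ball z d2" using that \<rho> by auto
        then show "w \<in> U" using d2 by auto
      qed
      have c1: "continuous_on (X \<times> ball z \<rho>) (\<lambda>p. f (fst p) (snd p))"
      proof -
        have "X \<times> ball z \<rho> \<subseteq> X \<times> U" using s by auto
        from continuous_on_subset[OF cont this] show ?thesis by (simp add: case_prod_unfold)
      qed
      have c2: "continuous_on (X \<times> ball z \<rho>) (\<lambda>p. f (fst p) (snd p + of_real \<eta>))"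
      proof -
        have "continuous_on (X \<times> ball z \<rho>) (\<lambda>p. (fst p, snd p + complex_of_real \<eta>))"
          by (intro continuous_intros)
        moreover have "(\<lambda>p. (fst p, snd p + complex_of_real \<eta>)) ` (X \<times> ball z \<rho>) \<subseteq> X \<times> U" using s by auto
        ultimately show ?thesis using continuous_on_compose2[OF cont, of "X \<times> ball z \<rho>" "\<lambda>p. (fst p, snd p + complex_of_real \<eta>)"] by (simp add: case_prod_unfold)
      qed
      show ?thesis by (intro continuous_intros c1 c2) (use \<eta> in auto)
    qed
    have "(x,z) \<in> X \<times> ball z \<rho>" using x \<rho> by auto
    then obtain d3 where d3: "d3 > 0"
      "\<And>p. p \<in> X \<times> ball z \<rho> \<Longrightarrow> dist p (x,z) < d3 \<Longrightarrow> dist (?q (fst p) (snd p)) (?q x z) < e/4"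
      using cq[unfolded continuous_on_iff, rule_format, of "(x,z)" "e/4"] e by auto
    show ?thesis
    proof (intro exI[of _ "min d3 \<rho>"] conjI ballI impI)
      show "min d3 \<rho> > 0" using d3 \<rho> by auto
      fix y w assume y: "y \<in> X" "w \<in> U" and d: "dist (y,w) (x,z) < min d3 \<rho>"
      have dd: "dist y x < \<rho>" "dist w z < \<rho>"
        using d dist_fst_le[of "(y,w)" "(x,z)"] dist_snd_le[of "(y,w)" "(x,z)"] by auto
      have "dist (?q y w) (?q x z) < e/4" using d3(2)[of "(y,w)"] y d dd by (auto simp: dist_commute)
      moreover have "norm (?q y w - deriv (f y) w) \<le> e/4" "norm (?q x z - deriv (f x) z) \<le> e/4"
        using appr[of y w] appr[of x z] y x dd \<rho> by auto
      ultimately have "dist (?q y w) (?q x z) < e/4" "dist (?q y w) (deriv (f y) w) \<le> e/4"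
        "dist (?q x z) (deriv (f x) z) \<le> e/4" by (auto simp: dist_norm)
      moreover have "dist (deriv (f y) w) (deriv (f x) z)
          \<le> dist (deriv (f y) w) (?q y w) + (dist (?q y w) (?q x z) + dist (?q x z) (deriv (f x) z))"
        by (meson add_left_mono dist_triangle order_trans)
      ultimately show "dist (deriv (f y) w) (deriv (f x) z) < e"
        using e by (simp add: dist_commute[of "deriv (f y) w"])
    qed
  qed
  show ?thesis unfolding continuous_on_iff
  proof (intro ballI allI impI)
    fix p :: "'a \<times> complex" and e :: real assume p: "p \<in> X \<times> U" and e: "0 < e"
    obtain x z where pz: "p = (x,z)" "x \<in> X" "z \<in> U" using p by auto
    from main[OF pz(2,3) e] obtain d where "d > 0"
      "\<forall>y\<in>X. \<forall>w\<in>U. dist (y,w) (x,z) < d \<longrightarrow> dist (deriv (f y) w) (deriv (f x) z) < e" by blast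
    then show "\<exists>d>0. \<forall>x'\<in>X \<times> U. dist x' p < d \<longrightarrow>
        dist (case x' of (x, z) \<Rightarrow> deriv (f x) z) (case p of (x, z) \<Rightarrow> deriv (f x) z) < e"
      using pz(1) by (intro exI[of _ d]) auto
  qed
qed

text \<open>One null sequence of steps serves all parameters, locally uniformly. Weierstrass'
  theorem can then be applied to the quotients as functions of the parameter, which yields both the
  holomorphy of the derivative and the symmetry of mixed derivatives.\<close>

lemma uniform_limit_difference_quotient:
  fixes f :: "complex \<Rightarrow> complex \<Rightarrow> complex"
  assumes X: "open X" and U: "open U" "z \<in> U" and hol: "\<forall>x\<in>X. f x holomorphic_on U"
    and cont: "continuous_on (X \<times> U) (\<lambda>(x,z). f x z)"
  shows "\<exists>\<eta> :: nat \<Rightarrow> complex. (\<forall>n. \<eta> n \<noteq> 0) \<and> (\<forall>n. z + \<eta> n \<in> U) \<and> \<eta> \<longlonglongrightarrow> 0 \<and>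
    (\<forall>x\<in>X. \<exists>d>0. cball x d \<subseteq> X \<and>
       uniform_limit (cball x d) (\<lambda>n x. (f x (z + \<eta> n) - f x z) / \<eta> n) (\<lambda>x. deriv (f x) z) sequentially)"
proof -
  obtain \<rho> where \<rho>: "\<rho> > 0" "cball z \<rho> \<subseteq> U" using U open_contains_cball by blast
  define \<eta> where "\<eta> = (\<lambda>n::nat. (of_real (\<rho> / (2 * (of_nat n + 1))) :: complex))"
  have n\<eta>: "norm (\<eta> n) = \<rho> / 2 * inverse (real (Suc n))" for n
  proof -
    have "norm (\<eta> n) = \<bar>\<rho> / (2 * (real n + 1))\<bar>" unfolding \<eta>_def norm_of_real ..
    also have "\<dots> = \<rho> / (2 * (real n + 1))" using \<rho> by simp
    finally show ?thesis by (simp add: field_simps)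
  qed
  have \<eta>: "norm (\<eta> n) \<le> \<rho>/2" "\<eta> n \<noteq> 0" for n
  proof -
    have "inverse (real (Suc n)) \<le> 1" by (simp add: field_simps)
    then have "\<rho>/2 * inverse (real (Suc n)) \<le> \<rho>/2 * 1" using \<rho> by (intro mult_left_mono) auto
    then show "norm (\<eta> n) \<le> \<rho>/2" unfolding n\<eta> by simp
    have "norm (\<eta> n) \<noteq> 0" unfolding n\<eta> using \<rho> by simp
    then show "\<eta> n \<noteq> 0" by simp
  qed
  have z\<eta>: "z + \<eta> n \<in> U" for n
  proof -
    have "z + \<eta> n \<in> cball z \<rho>" using \<eta>(1)[of n] \<rho> by (simp add: dist_norm)
    then show ?thesis using \<rho> by blast
  qed
  have lim: "(\<lambda>n. norm (\<eta> n)) \<longlonglongrightarrow> 0"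
  proof -
    have "(\<lambda>n. \<rho>/2 * inverse (real (Suc n))) \<longlonglongrightarrow> \<rho>/2 * 0"
      by (intro tendsto_mult tendsto_const LIMSEQ_inverse_real_of_nat)
    then show ?thesis unfolding n\<eta> by simp
  qed
  have "\<exists>d>0. cball x d \<subseteq> X \<and>
       uniform_limit (cball x d) (\<lambda>n x. (f x (z + \<eta> n) - f x z) / \<eta> n) (\<lambda>x. deriv (f x) z) sequentially"
    if "x \<in> X" for x
  proof -
    obtain d where d: "d > 0" "cball x d \<subseteq> X" using X \<open>x \<in> X\<close> open_contains_cball by blast
    have "compact ((\<lambda>(x,z). f x z) ` (cball x d \<times> cball z \<rho>))"
      using d \<rho> by (intro compact_continuous_image compact_Times continuous_on_subset[OF cont]) auto
    then obtain B where "\<And>p. p \<in> (\<lambda>(x,z). f x z) ` (cball x d \<times> cball z \<rho>) \<Longrightarrow> norm p \<le> B"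
      using compact_imp_bounded bounded_iff by meson
    then have B: "norm (f y w) \<le> B" if "y \<in> cball x d" "w \<in> cball z \<rho>" for y w
      using that by fastforce
    have "uniform_limit (cball x d) (\<lambda>n x. (f x (z + \<eta> n) - f x z) / \<eta> n) (\<lambda>x. deriv (f x) z) sequentially"
    proof (rule uniform_limitI)
      fix e :: real assume e: "e > 0"
      have "(\<lambda>n. 32 * B / \<rho>\<^sup>2 * norm (\<eta> n)) \<longlonglongrightarrow> 32 * B / \<rho>\<^sup>2 * 0" by (intro tendsto_mult tendsto_const lim)
      then have "\<forall>\<^sub>F n in sequentially. 32 * B / \<rho>\<^sup>2 * norm (\<eta> n) < e" using e by (simp add: order_tendsto_iff)
      then show "\<forall>\<^sub>F n in sequentially. \<forall>y\<in>cball x d. dist ((f y (z + \<eta> n) - f y z) / \<eta> n) (deriv (f y) z) < e"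
      proof eventually_elim
        case (elim n)
        show ?case
        proof
          fix y assume y: "y \<in> cball x d"
          have "ball z \<rho> \<subseteq> U" using \<rho> by auto
          then have "norm ((f y (z + \<eta> n) - f y z) / \<eta> n - deriv (f y) z) \<le> 32 * B / \<rho>\<^sup>2 * norm (\<eta> n)"
            using y \<rho> d \<eta>[of n] by (intro difference_quotient_bound holomorphic_on_subset[OF hol[rule_format]] B) auto
          then show "dist ((f y (z + \<eta> n) - f y z) / \<eta> n) (deriv (f y) z) < e" using elim by (simp add: dist_norm)
        qed
      qed
    qed
    then show ?thesis using d by blast
  qed
  moreover have "\<eta> \<longlonglongrightarrow> 0" using lim by (rule tendsto_norm_zero_cancel)
  ultimately show ?thesis using \<eta> z\<eta> by (intro exI[of _ \<eta>]) blast
qed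

lemma holomorphic_deriv_parametric:
  fixes f :: "complex \<Rightarrow> complex \<Rightarrow> complex"
  assumes X: "open X" and U: "open U" "z \<in> U" and hol: "\<And>x. x \<in> X \<Longrightarrow> f x holomorphic_on U"
    and hol2: "\<And>w. w \<in> U \<Longrightarrow> (\<lambda>x. f x w) holomorphic_on X"
    and cont: "continuous_on (X \<times> U) (\<lambda>(x,z). f x z)"
  shows "(\<lambda>x. deriv (f x) z) holomorphic_on X"
proof -
  have hol': "\<forall>x\<in>X. f x holomorphic_on U" using hol by blast
  obtain \<eta> where \<eta>: "\<forall>n. \<eta> n \<noteq> 0" "\<forall>n. z + \<eta> n \<in> U" "\<eta> \<longlonglongrightarrow> 0"
    "\<forall>x\<in>X. \<exists>d>0. cball x d \<subseteq> X \<and>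
       uniform_limit (cball x d) (\<lambda>n x. (f x (z + \<eta> n) - f x z) / \<eta> n) (\<lambda>x. deriv (f x) z) sequentially"
    using uniform_limit_difference_quotient[where f = f, OF X U hol' cont] by (elim exE conjE)
  show ?thesis
    by (rule holomorphic_uniform_sequence[OF X _ \<eta>(4)[rule_format]]) (intro holomorphic_intros hol2 \<eta>[rule_format] U)
qed

text \<open>Both sides are limits of the same quotients of
  \<open>deriv (\<lambda>x. f x w) x\<close> along the steps \<open>\<eta>\<close>: the left one
  since differentiation in \<open>x\<close> passes through a locally uniform limit of holomorphic
  functions, the right one by definition of the derivative in the other variable.\<close>

lemma deriv_deriv_commute:
  fixes f :: "complex \<Rightarrow> complex \<Rightarrow> complex"
  assumes X: "open X" "x \<in> X" and U: "open U" "z \<in> U" and hol: "\<And>x. x \<in> X \<Longrightarrow> f x holomorphic_on U"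
    and hol2: "\<And>w. w \<in> U \<Longrightarrow> (\<lambda>x. f x w) holomorphic_on X"
    and cont: "continuous_on (X \<times> U) (\<lambda>(x,z). f x z)"
  shows "deriv (\<lambda>x. deriv (f x) z) x = deriv (\<lambda>w. deriv (\<lambda>x. f x w) x) z"
proof -
  have hol': "\<forall>x\<in>X. f x holomorphic_on U" using hol by blast
  obtain \<eta> where \<eta>: "\<forall>n. \<eta> n \<noteq> 0" "\<forall>n. z + \<eta> n \<in> U" "\<eta> \<longlonglongrightarrow> 0"
    "\<forall>x\<in>X. \<exists>d>0. cball x d \<subseteq> X \<and>
       uniform_limit (cball x d) (\<lambda>n x. (f x (z + \<eta> n) - f x z) / \<eta> n) (\<lambda>x. deriv (f x) z) sequentially"
    using uniform_limit_difference_quotient[where f = f, OF X(1) U hol' cont] by (elim exE conjE)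
  obtain d where d: "d > 0" "cball x d \<subseteq> X" and ul:
       "uniform_limit (cball x d) (\<lambda>n x. (f x (z + \<eta> n) - f x z) / \<eta> n) (\<lambda>x. deriv (f x) z) sequentially"
    using \<eta>(4)[rule_format, OF X(2)] by blast
  have bX: "ball x d \<subseteq> X" using d by auto
  have h2: "(\<lambda>x. f x w) holomorphic_on ball x d" if "w \<in> U" for w
    using hol2[OF that] bX holomorphic_on_subset by blast
  have "((\<lambda>n. (deriv ^^ 1) (\<lambda>x. (f x (z + \<eta> n) - f x z) / \<eta> n) x) \<longlonglongrightarrow> (deriv ^^ 1) (\<lambda>x. deriv (f x) z) x)"
  proof (rule higher_deriv_complex_uniform_limit)
    show "uniform_limit (ball x d) (\<lambda>n x. (f x (z + \<eta> n) - f x z) / \<eta> n) (\<lambda>x. deriv (f x) z) sequentially"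
      by (rule uniform_limit_on_subset[OF ul]) auto
    show "\<forall>\<^sub>F n in sequentially. (\<lambda>x. (f x (z + \<eta> n) - f x z) / \<eta> n) holomorphic_on ball x d"
      by (intro always_eventually allI holomorphic_intros h2 \<eta>[rule_format] U)
  qed (use d in auto)
  moreover have "(deriv ^^ 1) (\<lambda>x. (f x (z + \<eta> n) - f x z) / \<eta> n) x
      = (deriv (\<lambda>x. f x (z + \<eta> n)) x - deriv (\<lambda>x. f x z) x) / \<eta> n" for n
  proof -
    have "x \<in> ball x d" using d by simp
    then have "((\<lambda>x. (f x (z + \<eta> n) - f x z) / \<eta> n) has_field_derivative
      (deriv (\<lambda>x. f x (z + \<eta> n)) x - deriv (\<lambda>x. f x z) x) / \<eta> n) (at x)"
      by (intro DERIV_cdivide DERIV_diff holomorphic_derivI[OF h2[OF \<eta>(2)[rule_format]]] holomorphic_derivI[OF h2[OF U(2)]] open_ball)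
    then show ?thesis by (simp add: DERIV_imp_deriv)
  qed
  ultimately have l1: "(\<lambda>n. (deriv (\<lambda>x. f x (z + \<eta> n)) x - deriv (\<lambda>x. f x z) x) / \<eta> n)
     \<longlonglongrightarrow> deriv (\<lambda>x. deriv (f x) z) x" by simp
  have swap: "continuous_on (U \<times> X) (\<lambda>(w,x). f x w)"
  proof -
    have "continuous_on (U \<times> X) (\<lambda>p. (\<lambda>(x,z). f x z) (snd p, fst p))"
      by (rule continuous_on_compose2[OF cont]) (auto intro!: continuous_intros)
    then show ?thesis by (simp add: case_prod_unfold)
  qed
  have "(\<lambda>w. deriv (\<lambda>x. f x w) x) holomorphic_on U"
    by (rule holomorphic_deriv_parametric[OF U(1) X hol2 hol swap])
  then have "((\<lambda>w. deriv (\<lambda>x. f x w) x) has_field_derivative deriv (\<lambda>w. deriv (\<lambda>x. f x w) x) z) (at z)"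
    using U holomorphic_derivI by blast
  then have "((\<lambda>h. (deriv (\<lambda>x. f x (z + h)) x - deriv (\<lambda>x. f x z) x) / h) \<longlongrightarrow> deriv (\<lambda>w. deriv (\<lambda>x. f x w) x) z) (at 0)"
    by (simp add: DERIV_def)
  moreover have "filterlim \<eta> (at 0) sequentially" using \<eta> by (simp add: filterlim_at)
  ultimately have "(\<lambda>n. (deriv (\<lambda>x. f x (z + \<eta> n)) x - deriv (\<lambda>x. f x z) x) / \<eta> n) \<longlonglongrightarrow> deriv (\<lambda>w. deriv (\<lambda>x. f x w) x) z"
    by (rule filterlim_compose)
  with l1 show ?thesis using LIMSEQ_unique by blast
qed

section \<open>Derivatives and closure properties in several variables\<close>

lemma bounded_linear_axis: "bounded_linear (axis i :: 'b::real_normed_vector \<Rightarrow> 'b^'i)"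
proof (rule bounded_linear_intro[where K = 1])
  show "norm (axis i x :: 'b^'i) \<le> norm x * 1" for x
  proof -
    have "norm (axis i x :: 'b^'i) \<le> (\<Sum>j\<in>UNIV. norm ((axis i x :: 'b^'i) $ j))"
      by (simp add: norm_vec_def L2_set_le_sum)
    also have "\<dots> = (\<Sum>j\<in>UNIV. if j = i then norm x else 0)"
      by (intro sum.cong) (auto simp: axis_def)
    finally show ?thesis by simp
  qed
qed (auto simp: vec_eq_iff axis_def)

lemma has_derivative_vec_lambda:
  fixes f :: "'i::finite \<Rightarrow> 'a::real_normed_vector \<Rightarrow> 'b::real_normed_vector"
  assumes "\<And>i. (f i has_derivative f' i) F"
  shows "((\<lambda>x. \<chi> i. f i x) has_derivative (\<lambda>h. \<chi> i. f' i h)) F"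
proof -
  have e: "(\<chi> i. g i) = (\<Sum>i\<in>UNIV. axis i (g i))" for g :: "'i \<Rightarrow> 'b"
    by (simp add: vec_eq_iff axis_def)
  show ?thesis unfolding e
    by (intro has_derivative_sum bounded_linear.has_derivative[OF bounded_linear_axis] assms)
qed

lemma norm_vector_scalar_mult: "norm (c *s (v::complex^'m)) = norm c * norm v"
  by (simp add: norm_vec_def L2_set_def norm_mult power_mult_distrib real_sqrt_mult flip: sum_distrib_left)

lemma continuous_on_vector_scalar_mult [continuous_intros]:
  fixes f :: "'a::topological_space \<Rightarrow> complex" and g :: "'a \<Rightarrow> complex^'m"
  assumes "continuous_on S f" "continuous_on S g"
  shows "continuous_on S (\<lambda>x. f x *s g x)"
  unfolding vector_scalar_mult_def by (intro continuous_intros assms)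

lemma norm_le_sum_components: "norm (v::'b::real_normed_vector^'m) \<le> (\<Sum>i\<in>UNIV. norm (v $ i))"
  by (simp add: norm_vec_def L2_set_le_sum)

text \<open>\<open>mv_holomorphic_on\<close> only asserts some complex linear derivative. Evaluating
  it on the axis vectors identifies it and fixes the normal form in which derivatives are handled
  from here on.\<close>

lemma mv_holomorphic_on_has_derivative:
  assumes "mv_holomorphic_on f S" "z \<in> S"
  shows "(f has_derivative (\<lambda>v. \<Sum>i\<in>UNIV. v $ i * partial_deriv i f z)) (at z)"
proof -
  obtain f' where f': "(f has_derivative f') (at z)" "\<And>c v. f' (c *s v) = c * f' v"
    using assms unfolding mv_holomorphic_on_def by blast
  have p: "f' (axis i 1) = partial_deriv i f z" for i
  proof -
    have l: "((\<lambda>t. z + t *s axis i 1) has_derivative (\<lambda>h. h *s axis i 1)) (at 0)"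
    proof -
      have "((\<lambda>t. \<chi> j. z $ j + t * axis i 1 $ j) has_derivative (\<lambda>h. \<chi> j. h * axis i 1 $ j)) (at (0::complex))"
        by (intro has_derivative_vec_lambda derivative_eq_intros | simp)+
      moreover have "(\<lambda>t. z + t *s axis i 1) = (\<lambda>t. \<chi> j. z $ j + t * axis i 1 $ j)"
        by (simp add: fun_eq_iff vec_eq_iff)
      moreover have "(\<lambda>h. h *s axis i 1) = (\<lambda>h::complex. \<chi> j. h * axis i 1 $ j)"
        by (simp add: fun_eq_iff vec_eq_iff)
      ultimately show ?thesis by simp
    qed
    have "((\<lambda>t. f (z + t *s axis i 1)) has_derivative (\<lambda>h. f' (h *s axis i 1))) (at 0)"
      using has_derivative_compose[OF l, of f f'] f' by simp
    then have "((\<lambda>t. f (z + t *s axis i 1)) has_field_derivative f' (axis i 1)) (at 0)"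
      unfolding has_field_derivative_def f'(2) by (simp add: mult.commute[of _ "f' (axis i 1)"])
    then show ?thesis unfolding partial_deriv_def by (simp add: DERIV_imp_deriv)
  qed
  have "f' v = (\<Sum>i\<in>UNIV. v $ i * partial_deriv i f z)" for v
  proof -
    have "v = (\<Sum>i\<in>UNIV. v $ i *s axis i 1)"
      by (simp add: vec_eq_iff axis_def if_distrib cong: if_cong)
    then have "f' v = (\<Sum>i\<in>UNIV. f' (v $ i *s axis i 1))"
      using linear_sum[OF has_derivative_linear[OF f'(1)], of "\<lambda>i. v $ i *s axis i 1" UNIV] by simp
    then show ?thesis by (simp add: f'(2) p)
  qed
  then have "f' = (\<lambda>v. \<Sum>i\<in>UNIV. v $ i * partial_deriv i f z)" by blast
  then show ?thesis using f'(1) by simp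
qed

lemma mv_holomorphic_onI:
  assumes "\<And>z. z \<in> S \<Longrightarrow> (f has_derivative (\<lambda>v. \<Sum>i\<in>UNIV. v $ i * D z i)) (at z)"
  shows "mv_holomorphic_on f S"
  unfolding mv_holomorphic_on_def
proof
  fix z assume "z \<in> S"
  then show "\<exists>f'. (f has_derivative f') (at z) \<and> (\<forall>c v. f' (c *s v) = c * f' v)"
    using assms[of z] by (intro exI[of _ "\<lambda>v. \<Sum>i\<in>UNIV. v $ i * D z i"])
      (simp add: sum_distrib_left mult.assoc)
qed

lemma mv_holomorphic_on_subset: "mv_holomorphic_on f S \<Longrightarrow> T \<subseteq> S \<Longrightarrow> mv_holomorphic_on f T"
  unfolding mv_holomorphic_on_def by blast

lemma mv_holomorphic_on_imp_continuous_on: "mv_holomorphic_on f S \<Longrightarrow> continuous_on S f"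
  unfolding mv_holomorphic_on_def
  by (meson continuous_at_imp_continuous_on has_derivative_continuous)

lemma mv_holomorphic_on_curve:
  fixes H :: "complex \<Rightarrow> complex^'m"
  assumes "mv_holomorphic_on f S" "H ze \<in> S"
    and "\<And>i. ((\<lambda>ze. H ze $ i) has_field_derivative H' i) (at ze)"
  shows "((\<lambda>ze. f (H ze)) has_field_derivative (\<Sum>i\<in>UNIV. H' i * partial_deriv i f (H ze))) (at ze)"
proof -
  have "((\<lambda>ze. \<chi> i. H ze $ i) has_derivative (\<lambda>h. \<chi> i. H' i * h)) (at ze)"
    using assms(3) by (intro has_derivative_vec_lambda) (simp add: has_field_derivative_def)
  then have "(H has_derivative (\<lambda>h. \<chi> i. H' i * h)) (at ze)" by simp
  from has_derivative_compose[OF this mv_holomorphic_on_has_derivative[OF assms(1,2)]]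
  moreover have "(\<lambda>h. \<Sum>i\<in>UNIV. (\<chi> i. H' i * h) $ i * partial_deriv i f (H ze))
      = (*) (\<Sum>i\<in>UNIV. H' i * partial_deriv i f (H ze))"
    by (simp add: fun_eq_iff sum_distrib_left mult_ac)
  ultimately show ?thesis unfolding has_field_derivative_def by simp
qed

lemma mv_holomorphic_on_compose:
  fixes H :: "complex^'k \<Rightarrow> complex^'m"
  assumes f: "mv_holomorphic_on f S" and H: "\<And>i. mv_holomorphic_on (\<lambda>z. H z $ i) T" and sub: "\<And>z. z \<in> T \<Longrightarrow> H z \<in> S"
  shows "mv_holomorphic_on (\<lambda>z. f (H z)) T"
  unfolding mv_holomorphic_on_def
proof
  fix z assume z: "z \<in> T"
  define D where "D = (\<lambda>v::complex^'k. \<chi> i. \<Sum>j\<in>UNIV. v $ j * partial_deriv j (\<lambda>z. H z $ i) z)"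
  have "((\<lambda>z. \<chi> i. H z $ i) has_derivative D) (at z)"
    unfolding D_def by (intro has_derivative_vec_lambda mv_holomorphic_on_has_derivative[OF H z])
  then have d: "(H has_derivative D) (at z)" by simp
  have D: "D (c *s v) = c *s D v" for c v
    by (simp add: D_def vec_eq_iff sum_distrib_left mult.assoc)
  obtain f' where f': "(f has_derivative f') (at (H z))" "\<And>c v. f' (c *s v) = c * f' v"
    using f sub[OF z] unfolding mv_holomorphic_on_def by blast
  have "((\<lambda>z. f (H z)) has_derivative (\<lambda>v. f' (D v))) (at z)"
    by (rule has_derivative_compose[OF d f'(1)])
  then show "\<exists>f'. ((\<lambda>z. f (H z)) has_derivative f') (at z) \<and> (\<forall>c v. f' (c *s v) = c * f' v)"
    by (intro exI[of _ "\<lambda>v. f' (D v)"]) (simp add: D f'(2))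
qed

lemma mv_holomorphic_on_const: "mv_holomorphic_on (\<lambda>z. c) S"
  unfolding mv_holomorphic_on_def by (auto intro!: exI[of _ "\<lambda>v. 0"] derivative_intros)

lemma mv_holomorphic_on_component: "mv_holomorphic_on (\<lambda>z. z $ i) S"
  unfolding mv_holomorphic_on_def
  by (auto intro!: exI[of _ "\<lambda>v. v $ i"] bounded_linear_imp_has_derivative bounded_linear_vec_nth)

lemma mv_holomorphic_on_add:
  assumes "mv_holomorphic_on f S" "mv_holomorphic_on g S"
  shows "mv_holomorphic_on (\<lambda>z. f z + g z) S"
  unfolding mv_holomorphic_on_def
proof
  fix z assume "z \<in> S"
  then obtain f' g' where "(f has_derivative f') (at z)" "\<forall>c v. f' (c *s v) = c * f' v"
    "(g has_derivative g') (at z)" "\<forall>c v. g' (c *s v) = c * g' v"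
    using assms unfolding mv_holomorphic_on_def by metis
  then show "\<exists>h. ((\<lambda>z. f z + g z) has_derivative h) (at z) \<and> (\<forall>c v. h (c *s v) = c * h v)"
    by (intro exI[of _ "\<lambda>v. f' v + g' v"]) (auto intro!: derivative_intros simp: distrib_left)
qed

lemma mv_holomorphic_on_mult:
  assumes "mv_holomorphic_on f S" "mv_holomorphic_on g S"
  shows "mv_holomorphic_on (\<lambda>z. f z * g z) S"
  unfolding mv_holomorphic_on_def
proof
  fix z assume "z \<in> S"
  then obtain f' g' where fg: "(f has_derivative f') (at z)" "\<forall>c v. f' (c *s v) = c * f' v"
    "(g has_derivative g') (at z)" "\<forall>c v. g' (c *s v) = c * g' v"
    using assms unfolding mv_holomorphic_on_def by metis
  have "((\<lambda>z. f z * g z) has_derivative (\<lambda>v. f z * g' v + f' v * g z)) (at z)"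
    by (rule has_derivative_mult[OF fg(1,3)])
  then show "\<exists>h. ((\<lambda>z. f z * g z) has_derivative h) (at z) \<and> (\<forall>c v. h (c *s v) = c * h v)"
    using fg(2,4) by (intro exI[of _ "\<lambda>v. f z * g' v + f' v * g z"]) (auto simp: algebra_simps)
qed

lemma mv_holomorphic_on_divide:
  assumes "mv_holomorphic_on f S" "mv_holomorphic_on g S" "\<And>z. z \<in> S \<Longrightarrow> g z \<noteq> 0"
  shows "mv_holomorphic_on (\<lambda>z. f z / g z) S"
  unfolding mv_holomorphic_on_def
proof
  fix z assume z: "z \<in> S"
  then obtain f' g' where fg: "(f has_derivative f') (at z)" "\<forall>c v. f' (c *s v) = c * f' v"
    "(g has_derivative g') (at z)" "\<forall>c v. g' (c *s v) = c * g' v"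
    using assms unfolding mv_holomorphic_on_def by metis
  have "((\<lambda>z. f z / g z) has_derivative (\<lambda>v. (f' v * g z - f z * g' v) / (g z * g z))) (at z)"
    by (rule has_derivative_divide'[OF fg(1,3) assms(3)[OF z]])
  then show "\<exists>h. ((\<lambda>z. f z / g z) has_derivative h) (at z) \<and> (\<forall>c v. h (c *s v) = c * h v)"
    using fg(2,4) by (intro exI[of _ "\<lambda>v. (f' v * g z - f z * g' v) / (g z * g z)"]) (simp add: right_diff_distrib mult_ac)
qed

lemma mv_holomorphic_on_sum:
  "(\<And>i. i \<in> I \<Longrightarrow> mv_holomorphic_on (f i) S) \<Longrightarrow> mv_holomorphic_on (\<lambda>z. \<Sum>i\<in>I. f i z) S"
  by (induction I rule: infinite_finite_induct) (auto intro!: mv_holomorphic_on_const mv_holomorphic_on_add)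

lemma mv_holomorphic_on_prod:
  "(\<And>i. i \<in> I \<Longrightarrow> mv_holomorphic_on (f i) S) \<Longrightarrow> mv_holomorphic_on (\<lambda>z. \<Prod>i\<in>I. f i z) S"
  by (induction I rule: infinite_finite_induct) (auto intro!: mv_holomorphic_on_const mv_holomorphic_on_mult)

lemma mv_holomorphic_on_diff:
  assumes "mv_holomorphic_on f S" "mv_holomorphic_on g S"
  shows "mv_holomorphic_on (\<lambda>z. f z - g z) S"
proof -
  have "mv_holomorphic_on (\<lambda>z. f z + (-1) * g z) S"
    by (intro mv_holomorphic_on_add mv_holomorphic_on_mult mv_holomorphic_on_const assms)
  then show ?thesis by simp
qed

lemma mv_holomorphic_on_power: "mv_holomorphic_on f S \<Longrightarrow> mv_holomorphic_on (\<lambda>z. f z ^ k) S"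
  by (induction k) (auto intro!: mv_holomorphic_on_const mv_holomorphic_on_mult)

lemmas mv_holomorphic_intros = mv_holomorphic_on_const mv_holomorphic_on_component mv_holomorphic_on_add
  mv_holomorphic_on_mult mv_holomorphic_on_diff mv_holomorphic_on_sum mv_holomorphic_on_prod mv_holomorphic_on_power

lemma field_differentiable_along_line:
  assumes "mv_holomorphic_on f S" "z + ze *s v \<in> S"
  shows "((\<lambda>ze. f (z + ze *s v)) has_field_derivative
     (\<Sum>i\<in>UNIV. v $ i * partial_deriv i f (z + ze *s v))) (at ze)"
  by (rule mv_holomorphic_on_curve[OF assms(1)]) (auto intro!: assms derivative_eq_intros)

lemma open_line_vimage: "open S \<Longrightarrow> open {ze. z + ze *s v \<in> (S :: (complex^'m) set)}"
  using open_vimage[of S "\<lambda>ze. z + ze *s v"] by (simp add: vimage_def continuous_intros)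

lemma mv_holomorphic_on_line:
  assumes "mv_holomorphic_on f S"
  shows "(\<lambda>ze. f (z + ze *s v)) holomorphic_on {ze. z + ze *s v \<in> S}"
  using field_differentiable_along_line[OF assms, of z]
  unfolding holomorphic_on_def field_differentiable_def
  by (blast intro: has_field_derivative_at_within)

text \<open>The hypotheses of Osgood's lemma, with differentiability required along all complex
  lines; the locale shows that they imply holomorphy. Functions obtained as partial derivatives or
  as integrals over a parameter are treated by this criterion, because continuity and
  differentiability on lines are within reach of the one-variable theory.\<close>

locale line_holomorphic =
  fixes f :: "complex^'m \<Rightarrow> complex" and S :: "(complex^'m) set"
  assumes open_S: "open S" and cont: "continuous_on S f"
    and diff: "\<And>z v. z \<in> S \<Longrightarrow> (\<lambda>ze. f (z + ze *s v)) field_differentiable (at 0)"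
begin

lemma line: "(\<lambda>ze. f (z + ze *s v)) holomorphic_on {ze. z + ze *s v \<in> S}"
proof -
  have "(\<lambda>ze. f (z + ze *s v)) field_differentiable (at a)" if a: "z + a *s v \<in> S" for a
  proof -
    obtain D where D: "((\<lambda>ze. f ((z + a *s v) + ze *s v)) has_field_derivative D) (at 0)"
      using diff[OF a] unfolding field_differentiable_def by blast
    have "((\<lambda>ze. f (z + (ze + a) *s v)) has_field_derivative D) (at 0)"
      using D by (simp add: vector_sadd_rdistrib add_ac)
    then show ?thesis using DERIV_shift[of "\<lambda>ze. f (z + ze *s v)" D 0 a]
      unfolding field_differentiable_def by auto
  qed
  then show ?thesis unfolding holomorphic_on_def using field_differentiable_at_within by blast
qed

definition D where "D z v = deriv (\<lambda>ze. f (z + ze *s v)) 0"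

lemma has_D: "z \<in> S \<Longrightarrow> ((\<lambda>ze. f (z + ze *s v)) has_field_derivative D z v) (at 0)"
  unfolding D_def using diff DERIV_deriv_iff_field_differentiable by blast

lemma D_scale: assumes "z \<in> S" shows "D z (c *s v) = c * D z v"
proof -
  have "((\<lambda>ze. f (z + (c * ze) *s v)) has_field_derivative D z v * c) (at 0)"
    using DERIV_chain2[of "\<lambda>ze. f (z + ze *s v)" "D z v" "\<lambda>ze. c * ze" 0 c UNIV] has_D[OF assms, of v]
    by (auto intro!: derivative_eq_intros)
  then show ?thesis using has_D[OF assms, of "c *s v"] DERIV_unique
    by (auto simp: vector_smult_assoc mult.commute)
qed

lemma local_bound:
  assumes "z \<in> S"
  obtains \<rho> B where "\<rho> > 0" "ball z (2*\<rho>) \<subseteq> S" "\<And>w. w \<in> ball z (2*\<rho>) \<Longrightarrow> norm (f w) \<le> B"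
proof -
  obtain e where e: "e > 0" "cball z e \<subseteq> S" using assms open_S open_contains_cball by blast
  have "compact (f ` cball z e)"
    using e by (intro compact_continuous_image continuous_on_subset[OF cont]) auto
  then obtain B where "\<And>p. p \<in> f ` cball z e \<Longrightarrow> norm p \<le> B"
    using compact_imp_bounded bounded_iff by meson
  then have "\<And>w. w \<in> ball z (2*(e/2)) \<Longrightarrow> norm (f w) \<le> B" by auto
  moreover have "ball z (2*(e/2)) \<subseteq> S" using e by auto
  ultimately show thesis using that[of "e/2" B] e by auto
qed

lemma in_ball_line:
  assumes "p \<in> ball z \<rho>" "norm v \<le> K" "norm ze * K < \<rho>" shows "p + ze *s (v::complex^'m) \<in> ball z (2*\<rho>)"
proof -
  have "norm (ze *s v) \<le> norm ze * K" unfolding norm_vector_scalar_mult using assms by (intro mult_left_mono) auto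
  moreover have "dist z (p + ze *s v) \<le> dist z p + norm (ze *s v)"
    using dist_triangle[of z "p + ze *s v" p] by (simp add: dist_norm)
  ultimately show ?thesis using assms by auto
qed

lemma continuous_D: "continuous_on S (\<lambda>z. D z v)"
proof (rule continuous_at_imp_continuous_on, rule ballI)
  fix z assume z: "z \<in> S"
  obtain \<rho> B where \<rho>: "\<rho> > 0" "ball z (2*\<rho>) \<subseteq> S" "\<And>w. w \<in> ball z (2*\<rho>) \<Longrightarrow> norm (f w) \<le> B"
    using local_bound[OF z] by metis
  define K where "K = norm v + 1"
  have K: "K > 0" "norm v \<le> K" by (auto simp: K_def add_nonneg_pos)
  let ?U = "ball 0 (\<rho>/K) :: complex set"
  have in2: "p + ze *s v \<in> ball z (2*\<rho>)" if "p \<in> ball z \<rho>" "ze \<in> ?U" for p ze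
    using that K by (intro in_ball_line[of p z \<rho> v K]) (auto simp: field_simps)
  have "continuous_on (ball z \<rho> \<times> ?U) (\<lambda>(x,ze). deriv (\<lambda>ze. f (x + ze *s v)) ze)"
  proof (rule continuous_on_deriv_parametric)
    show "(\<lambda>ze. f (x + ze *s v)) holomorphic_on ?U" if "x \<in> ball z \<rho>" for x
      by (rule holomorphic_on_subset[OF line]) (use in2[OF that] \<rho> in blast)
    have "continuous_on (ball z \<rho> \<times> ?U) (\<lambda>p. f (fst p + snd p *s v))"
      by (rule continuous_on_compose2[OF cont]) (use in2 \<rho> in \<open>auto intro!: continuous_intros\<close>)
    then show "continuous_on (ball z \<rho> \<times> ?U) (\<lambda>(x, ze). f (x + ze *s v))" by (simp add: case_prod_unfold)
  qed auto
  then have "continuous_on (ball z \<rho>) (\<lambda>x. (\<lambda>(x,ze). deriv (\<lambda>ze. f (x + ze *s v)) ze) (x, 0))"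
    by (rule continuous_on_compose2) (use \<rho> K in \<open>auto intro!: continuous_intros\<close>)
  then show "isCont (\<lambda>z. D z v) z"
    unfolding D_def using \<rho> by (simp add: continuous_on_eq_continuous_at)
qed

text \<open>The quotient of \<open>f\<close> for the direction \<open>v + w\<close> minus the one
  for \<open>v\<close> is a difference quotient in direction \<open>w\<close> at the moved point
  \<open>z + ze *s v\<close>. It differs from the derivative there by a uniform multiple of
  \<open>norm ze\<close>, and that derivative tends to \<open>D z w\<close> by
  \<open>continuous_D\<close>.\<close>

lemma D_add: assumes z: "z \<in> S" shows "D z (v + w) = D z v + D z w"
proof -
  obtain \<rho> B where \<rho>: "\<rho> > 0" "ball z (2*\<rho>) \<subseteq> S" "\<And>w. w \<in> ball z (2*\<rho>) \<Longrightarrow> norm (f w) \<le> B"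
    using local_bound[OF z] by metis
  define K where "K = norm v + norm w + 1"
  have K: "K > 0" "norm v \<le> K" "norm w \<le> K" by (auto simp: K_def add_nonneg_pos)
  have small: "\<forall>\<^sub>F ze in at (0::complex). norm ze < \<rho>/K/2"
    using eventually_at_ball[of "\<rho>/K/2" "0::complex" UNIV] \<rho> K by (simp add: dist_norm)
  let ?q = "\<lambda>ze. (f (z + ze *s (v+w)) - f z) / ze" and ?q1 = "\<lambda>ze. (f (z + ze *s v) - f z) / ze"
  have l0: "((\<lambda>ze. ?q ze - ?q1 ze - D (z + ze *s v) w) \<longlongrightarrow> 0) (at 0)"
  proof (rule Lim_null_comparison)
    show "\<forall>\<^sub>F ze in at 0. norm (?q ze - ?q1 ze - D (z + ze *s v) w) \<le> 32 * B / (\<rho>/K)\<^sup>2 * norm ze"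
      using small eventually_neq_at_within[of "0::complex" "0::complex" UNIV]
    proof eventually_elim
      case (elim ze)
      then have nz: "norm ze < \<rho>/K" "norm ze * K < \<rho>" using \<rho> K by (auto simp: field_simps)
      let ?p = "z + ze *s v"
      have p: "?p \<in> ball z \<rho>"
      proof -
        have "norm (ze *s v) \<le> norm ze * K" unfolding norm_vector_scalar_mult using K by (intro mult_left_mono) auto
        then show ?thesis using nz by (simp add: dist_norm)
      qed
      have in2: "?p + \<xi> *s w \<in> ball z (2*\<rho>)" if "norm \<xi> < \<rho>/K" for \<xi>
        using that K p by (intro in_ball_line[of ?p z \<rho> w K]) (auto simp: field_simps)
      show ?case
      proof -
        have False: "ze \<noteq> 0" using elim by simp
        have "norm ((f (?p + (0+ze) *s w) - f (?p + 0 *s w)) / ze - deriv (\<lambda>\<xi>. f (?p + \<xi> *s w)) 0) \<le> 32 * B / (\<rho>/K)\<^sup>2 * norm ze"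
          by (rule difference_quotient_bound[where \<rho> = "\<rho>/K"])
             (use in2 \<rho> K(1) elim False divide_pos_pos[OF \<rho>(1) K(1)] in \<open>auto intro!: holomorphic_on_subset[OF line] simp del: zero_less_divide_iff\<close>)
        moreover have "?p + ze *s w = z + ze *s (v+w)" by (simp add: vector_add_ldistrib)
        ultimately show ?thesis by (simp add: D_def diff_divide_distrib)
      qed
    qed
    show "((\<lambda>ze::complex. 32 * B / (\<rho>/K)\<^sup>2 * norm ze) \<longlongrightarrow> 0) (at 0)"
      by (intro tendsto_mult_right_zero tendsto_norm_zero tendsto_ident_at)
  qed
  have l1: "(?q \<longlongrightarrow> D z (v+w)) (at 0)" "(?q1 \<longlongrightarrow> D z v) (at 0)"
    using has_D[OF z, of "v + w"] has_D[OF z, of v] by (simp_all add: DERIV_def)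
  have "isCont (\<lambda>z. D z w) z" using continuous_D open_S z continuous_on_eq_continuous_at by blast
  moreover have "((\<lambda>ze. z + ze *s v) \<longlongrightarrow> z) (at 0)"
  proof -
    have "isCont (\<lambda>ze. z + ze *s v) 0"
      by (rule continuous_on_interior[of UNIV]) (auto intro!: continuous_intros)
    then show ?thesis by (simp add: isCont_def)
  qed
  ultimately have l2: "((\<lambda>ze. D (z + ze *s v) w) \<longlongrightarrow> D z w) (at 0)"
    using isCont_tendsto_compose by blast
  have "((\<lambda>ze. ?q ze - ?q1 ze - D (z + ze *s v) w) \<longlongrightarrow> D z (v+w) - D z v - D z w) (at 0)"
    by (intro tendsto_diff l1 l2)
  with l0 have "D z (v+w) - D z v - D z w = 0" using tendsto_unique[OF trivial_limit_at] by blast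
  then show ?thesis by (simp add: algebra_simps)
qed

text \<open>The second-order estimate on lines has a constant that does not depend on the unit
  direction \<open>u\<close>, so the linear map \<open>D z\<close> is a Frechet derivative.\<close>

lemma holomorphic: "mv_holomorphic_on f S"
  unfolding mv_holomorphic_on_def
proof
  fix z assume z: "z \<in> S"
  obtain \<rho> B where \<rho>: "\<rho> > 0" "ball z (2*\<rho>) \<subseteq> S" "\<And>w. w \<in> ball z (2*\<rho>) \<Longrightarrow> norm (f w) \<le> B"
    using local_bound[OF z] by metis
  have scR: "D z (r *\<^sub>R v) = r *\<^sub>R D z v" for r v
  proof -
    have "r *\<^sub>R v = complex_of_real r *s v"
      by (simp only: vec_eq_iff vector_scaleR_component vector_smult_component) (simp add: scaleR_conv_of_real)
    then show ?thesis using D_scale[OF z] by (simp add: scaleR_conv_of_real)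
  qed
  have lin: "bounded_linear (D z)"
    unfolding linear_conv_bounded_linear[symmetric] by (rule linearI) (simp_all add: D_add[OF z] scR)
  have "(f has_derivative D z) (at z)"
  proof (rule has_derivativeI_sandwich[where e = "\<rho>/2" and s = UNIV and H = "\<lambda>y. 32 * B / \<rho>\<^sup>2 * norm (y - z)"])
    fix y assume y: "y \<noteq> z" "dist y z < \<rho> / 2"
    define n where "n = norm (y - z)"
    define u where "u = of_real (inverse n) *s (y - z)"
    have n: "n > 0" "n < \<rho>/2" using y by (auto simp: n_def dist_norm)
    have u: "norm u = 1" unfolding u_def norm_vector_scalar_mult norm_of_real using n by (simp add: n_def[symmetric] del: vector_ssub_ldistrib)
    have yz: "of_real n *s u = y - z"
    proof -
      have "of_real n *s u = (of_real n * of_real (inverse n)) *s (y - z)" by (simp only: u_def vector_smult_assoc)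
      moreover have "(of_real n * of_real (inverse n) :: complex) = 1"
        using n by (simp only: of_real_mult[symmetric]) simp
      ultimately show ?thesis by simp
    qed
    have "norm (f (z + (0 + of_real n) *s u) - f (z + 0 *s u) - of_real n * deriv (\<lambda>ze. f (z + ze *s u)) 0)
        \<le> 32 * B / \<rho>\<^sup>2 * (norm (of_real n :: complex))\<^sup>2"
    proof (rule holomorphic_second_order_bound)
      have in2: "z + ze *s u \<in> ball z (2*\<rho>)" if "norm ze < \<rho>" for ze
        using that \<rho> u by (simp add: dist_norm norm_vector_scalar_mult)
      then show "(\<lambda>ze. f (z + ze *s u)) holomorphic_on ball 0 \<rho>"
        using \<rho> by (intro holomorphic_on_subset[OF line]) auto
      show "norm (f (z + w *s u)) \<le> B" if "w \<in> ball 0 \<rho>" for w using in2[of w] \<rho> that by auto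
    qed (use \<rho> n in auto)
    then have "norm (f y - f z - D z (y - z)) \<le> 32 * B / \<rho>\<^sup>2 * n\<^sup>2"
      using D_scale[OF z, of "of_real n" u] n by (simp add: yz D_def)
    then have "norm (f y - f z - D z (y - z)) / n \<le> 32 * B / \<rho>\<^sup>2 * n"
      using n by (simp add: divide_le_eq power2_eq_square mult.assoc)
    then show "norm ((f y - f z) - D z (y - z)) / norm (y - z) \<le> 32 * B / \<rho>\<^sup>2 * norm (y - z)"
      by (simp add: n_def)
  next
    show "((\<lambda>y. 32 * B / \<rho>\<^sup>2 * norm (y - z)) \<longlongrightarrow> 0) (at z)"
      by (intro tendsto_mult_right_zero tendsto_norm_zero LIM_zero tendsto_ident_at)
  qed (use \<rho> lin in auto)
  then show "\<exists>f'. (f has_derivative f') (at z) \<and> (\<forall>c v. f' (c *s v) = c * f' v)"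
    using D_scale[OF z] by blast
qed

end

lemma (in line_holomorphic) in_S_product:
  assumes "z \<in> S"
  obtains \<rho> where "\<rho> > 0" "\<And>\<tau> ze. norm \<tau> < \<rho> \<Longrightarrow> norm ze < \<rho> \<Longrightarrow> z + \<tau> *s v + ze *s w \<in> S"
proof -
  obtain e where e: "e > 0" "ball z e \<subseteq> S" using assms open_S open_contains_ball by blast
  define K where "K = norm v + norm w + 1"
  have K: "K > 0" by (auto simp: K_def intro: add_nonneg_pos)
  show thesis
  proof (rule that[of "e / K"])
    fix \<tau> ze :: complex assume a: "norm \<tau> < e / K" "norm ze < e / K"
    have "norm (\<tau> *s v + ze *s w) \<le> norm \<tau> * norm v + norm ze * norm w"
      by (metis norm_triangle_ineq norm_vector_scalar_mult)
    also have "\<dots> \<le> e / K * norm v + e / K * norm w"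
      using a by (intro add_mono mult_right_mono) auto
    also have "\<dots> < e"
    proof -
      have "e * (norm v + norm w) < e * K" using e by (intro mult_strict_left_mono) (auto simp: K_def)
      then show ?thesis using K by (simp add: divide_less_eq distrib_left add_divide_distrib[symmetric])
    qed
    finally have "z + \<tau> *s v + ze *s w \<in> ball z e"
      by (metis add.assoc add_diff_cancel_left' dist_commute dist_norm mem_ball)
    then show "z + \<tau> *s v + ze *s w \<in> S" using e by blast
  qed (use e K in auto)
qed

lemma line_holomorphicI: "mv_holomorphic_on f S \<Longrightarrow> open S \<Longrightarrow> line_holomorphic f S"
proof
  fix z v assume "mv_holomorphic_on f S" "z \<in> S"
  then show "(\<lambda>ze. f (z + ze *s v)) field_differentiable at 0"
    using field_differentiable_along_line[of f S z 0 v] unfolding field_differentiable_def by auto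
qed (auto simp: mv_holomorphic_on_imp_continuous_on)

text \<open>Everything takes place on the slice
  \<open>\<lambda>\<tau> ze. f (z + \<tau> *s v + ze *s axis i 1)\<close> of two complex variables,
  to which the parametric lemmas apply; the direction \<open>v = axis j 1\<close> gives the
  symmetry.\<close>

lemma
  fixes f :: "complex^'m \<Rightarrow> complex"
  assumes f: "mv_holomorphic_on f S" and S: "open S" and z: "z \<in> S"
  shows field_differentiable_partial_deriv_line: "(\<lambda>\<tau>. partial_deriv i f (z + \<tau> *s w)) field_differentiable (at 0)"
    and partial_deriv_commute: "partial_deriv j (partial_deriv i f) z = partial_deriv i (partial_deriv j f) z"
proof -
  interpret line_holomorphic f S by (rule line_holomorphicI[OF f S])
  have *: "(\<lambda>\<tau>. partial_deriv i f (z + \<tau> *s v)) field_differentiable (at 0) \<and>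
     (v = axis j 1 \<longrightarrow> partial_deriv j (partial_deriv i f) z = partial_deriv i (partial_deriv j f) z)" for v
  proof -
  let ?e = "axis i 1 :: complex^'m"
  let ?g = "\<lambda>\<tau> ze. f (z + \<tau> *s v + ze *s ?e)"
  obtain \<rho> where \<rho>: "\<rho> > 0" "\<And>\<tau> ze. norm \<tau> < \<rho> \<Longrightarrow> norm ze < \<rho> \<Longrightarrow> z + \<tau> *s v + ze *s ?e \<in> S"
    using in_S_product[OF z] by metis
  let ?U = "ball 0 \<rho> :: complex set"
  have 1: "?g \<tau> holomorphic_on ?U" if "\<tau> \<in> ?U" for \<tau>
    by (rule holomorphic_on_subset[OF line[of "z + \<tau> *s v" ?e]]) (use \<rho> that in auto)
  have 2: "(\<lambda>\<tau>. ?g \<tau> ze) holomorphic_on ?U" if "ze \<in> ?U" for ze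
  proof -
    have "z + ze *s ?e + \<tau> *s v \<in> S" if "norm \<tau> < \<rho>" for \<tau>
      using \<rho>(2)[of \<tau> ze] that \<open>ze \<in> ?U\<close> by (simp add: add_ac)
    then have "(\<lambda>\<tau>. f (z + ze *s ?e + \<tau> *s v)) holomorphic_on ?U"
      by (intro holomorphic_on_subset[OF line]) auto
    moreover have "(\<lambda>\<tau>. f (z + ze *s ?e + \<tau> *s v)) = (\<lambda>\<tau>. ?g \<tau> ze)"
      by (intro ext arg_cong[where f = f]) (simp add: add_ac)
    ultimately show ?thesis by simp
  qed
  have 3: "continuous_on (?U \<times> ?U) (\<lambda>(\<tau>, ze). ?g \<tau> ze)"
  proof -
    have "continuous_on (?U \<times> ?U) (\<lambda>p. f (z + fst p *s v + snd p *s ?e))"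
      by (rule continuous_on_compose2[OF cont]) (use \<rho> in \<open>auto intro!: continuous_intros\<close>)
    then show ?thesis by (simp add: case_prod_unfold)
  qed
  have 0: "0 \<in> ?U" using \<rho> by auto
  have "(\<lambda>\<tau>. deriv (?g \<tau>) 0) holomorphic_on ?U"
    by (rule holomorphic_deriv_parametric[OF open_ball open_ball 0 1 2 3])
  then have fd: "(\<lambda>\<tau>. partial_deriv i f (z + \<tau> *s v)) field_differentiable (at 0)"
    unfolding partial_deriv_def using \<rho> by (simp add: holomorphic_on_imp_differentiable_at)
  have "deriv (\<lambda>\<tau>. deriv (?g \<tau>) 0) 0 = deriv (\<lambda>ze. deriv (\<lambda>\<tau>. ?g \<tau> ze) 0) 0"
    by (rule deriv_deriv_commute[OF open_ball 0 open_ball 0 1 2 3])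
  then have "v = axis j 1 \<longrightarrow> partial_deriv j (partial_deriv i f) z = partial_deriv i (partial_deriv j f) z"
    unfolding partial_deriv_def by (auto simp: add_ac)
  with fd show ?thesis by blast
  qed
  show "(\<lambda>\<tau>. partial_deriv i f (z + \<tau> *s w)) field_differentiable (at 0)" using * by blast
  show "partial_deriv j (partial_deriv i f) z = partial_deriv i (partial_deriv j f) z" using * by blast
qed

text \<open>Continuity comes from \<open>continuous_D\<close> and differentiability on lines from
  the slice argument, so Osgood's criterion applies a second time and derivatives can be
  iterated.\<close>

lemma mv_holomorphic_on_partial_deriv:
  fixes f :: "complex^'m \<Rightarrow> complex"
  assumes f: "mv_holomorphic_on f S" and S: "open S"
  shows "mv_holomorphic_on (partial_deriv i f) S"
proof -
  interpret f: line_holomorphic f S by (rule line_holomorphicI[OF f S])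
  have "partial_deriv i f = (\<lambda>z. f.D z (axis i 1))" by (simp add: partial_deriv_def f.D_def fun_eq_iff)
  then have "continuous_on S (partial_deriv i f)" using f.continuous_D by simp
  then interpret pf: line_holomorphic "partial_deriv i f" S
    by unfold_locales (auto simp: S intro: field_differentiable_partial_deriv_line[OF f S])
  show ?thesis by (rule pf.holomorphic)
qed

lemma partial_deriv_eq:
  assumes "(f has_derivative (\<lambda>v. \<Sum>i\<in>UNIV. v $ i * D i)) (at z)"
  shows "partial_deriv k f z = D k"
proof -
  have "((\<lambda>ze. \<chi> i. z $ i + ze * axis k 1 $ i) has_derivative (\<lambda>h. \<chi> i. h * axis k 1 $ i)) (at (0::complex))"
    by (intro has_derivative_vec_lambda derivative_eq_intros | simp)+
  then have l: "((\<lambda>ze. z + ze *s axis k 1) has_derivative (\<lambda>h. \<chi> i. h * axis k 1 $ i)) (at 0)"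
    by (simp add: plus_vec_def vector_scalar_mult_def)
  have "((\<lambda>ze. f (z + ze *s axis k 1)) has_derivative (\<lambda>h. \<Sum>i\<in>UNIV. (\<chi> i. h * axis k 1 $ i) $ i * D i)) (at 0)"
    using has_derivative_compose[OF l, of f "\<lambda>v. \<Sum>i\<in>UNIV. v $ i * D i"] assms by simp
  moreover have "(\<lambda>h. \<Sum>i\<in>UNIV. (\<chi> i. h * axis k 1 $ i) $ i * D i) = (*) (D k)"
    by (simp add: fun_eq_iff axis_def if_distrib if_distribR mult.commute cong: if_cong)
  ultimately show ?thesis
    unfolding partial_deriv_def by (auto intro!: DERIV_imp_deriv simp: has_field_derivative_def)
qed

lemma partial_deriv_cong_open:
  assumes "open N" "z \<in> N" "\<And>w. w \<in> N \<Longrightarrow> f w = g w"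
  shows "partial_deriv i f z = partial_deriv i g z"
proof -
  have "\<forall>\<^sub>F t in nhds 0. t \<in> {t. z + t *s axis i 1 \<in> N}"
    by (rule eventually_nhds_in_open) (use assms open_line_vimage in auto)
  then have "\<forall>\<^sub>F t in nhds 0. f (z + t *s axis i 1) = g (z + t *s axis i 1)"
    by eventually_elim (use assms in auto)
  then show ?thesis unfolding partial_deriv_def by (rule deriv_cong_ev) simp
qed

text \<open>Restriction to the complex line through \<open>w\<close> and \<open>z\<close>: convexity
  makes the part of that line inside \<open>S\<close> connected, so the identity theorem of one
  variable applies.\<close>

lemma mv_holomorphic_zero_convex:
  fixes f :: "complex^'m \<Rightarrow> complex"
  assumes f: "mv_holomorphic_on f S" and S: "open S" "convex S"
    and w: "w \<in> S" "r > 0" "\<And>y. y \<in> ball w r \<inter> S \<Longrightarrow> f y = 0" and z: "z \<in> S"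
  shows "f z = 0"
proof -
  let ?v = "z - w"
  let ?T = "{ze. w + ze *s ?v \<in> S}"
  have c: "convex ?T"
  proof (rule convexI)
    fix x y :: complex and u v :: real
    assume a: "x \<in> ?T" "y \<in> ?T" "0 \<le> u" "0 \<le> v" "u + v = 1"
    have "u *\<^sub>R (w + x *s ?v) + v *\<^sub>R (w + y *s ?v) \<in> S" using a convexD[OF S(2)] by blast
    moreover have "u *\<^sub>R (w + x *s ?v) + v *\<^sub>R (w + y *s ?v) = w + (u *\<^sub>R x + v *\<^sub>R y) *s ?v"
    proof -
      have "u *\<^sub>R w $ i + v *\<^sub>R w $ i = w $ i" for i using a by (simp flip: scaleR_add_left)
      then show ?thesis by (simp add: vec_eq_iff algebra_simps)
    qed
    ultimately show "u *\<^sub>R x + v *\<^sub>R y \<in> ?T" by simp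
  qed
  define s where "s = r / (norm ?v + 1)"
  have s: "s > 0" using w by (simp add: s_def add_nonneg_pos)
  have "f (w + 1 *s ?v) = 0"
  proof (rule analytic_continuation_open[where s = "ball 0 s \<inter> ?T" and s' = ?T and g = "\<lambda>_. 0" and f = "\<lambda>ze. f (w + ze *s ?v)"])
    show "(\<lambda>ze. f (w + ze *s ?v)) holomorphic_on ?T" by (rule mv_holomorphic_on_line[OF f])
    fix ze assume ze: "ze \<in> ball 0 s \<inter> ?T"
    have "norm (ze *s ?v) \<le> norm ze * (norm ?v + 1)" unfolding norm_vector_scalar_mult by (intro mult_left_mono) auto
    also have "\<dots> < r" using ze by (simp add: s_def pos_less_divide_eq add_nonneg_pos)
    finally show "f (w + ze *s ?v) = 0" using ze by (intro w) (auto simp: dist_norm norm_minus_commute)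
  next
    show oT: "open ?T" by (rule open_line_vimage[OF S(1)])
    then show "open (ball 0 s \<inter> ?T)" by auto
    have "0 \<in> ball 0 s \<inter> ?T" using s w by auto
    then show "ball 0 s \<inter> ?T \<noteq> {}" by blast
    show "connected ?T" using c by (rule convex_connected)
    show "1 \<in> ?T" using z by simp
  qed auto
  then show ?thesis by simp
qed

text \<open>The set of points near which \<open>f\<close> vanishes is open. It is also closed in
  \<open>S\<close>, since a ball around a limit point contains one of its points and the convex case
  spreads the vanishing over the ball.\<close>

lemma mv_holomorphic_zero_connected:
  fixes f :: "complex^'m \<Rightarrow> complex"
  assumes f: "mv_holomorphic_on f S" and S: "open S" "connected S"
    and w: "w \<in> S" "r > 0" "\<And>y. y \<in> ball w r \<inter> S \<Longrightarrow> f y = 0" and z: "z \<in> S"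
  shows "f z = 0"
proof -
  define A where "A = {x \<in> S. \<exists>r>0. \<forall>y\<in>ball x r \<inter> S. f y = 0}"
  have "A = {} \<or> A = S"
  proof (rule connected_clopen[THEN iffD1, OF S(2), rule_format], rule conjI)
    have "open A"
    proof (rule openI)
      fix x assume "x \<in> A"
      then obtain r where r: "x \<in> S" "r > 0" "\<forall>y\<in>ball x r \<inter> S. f y = 0" by (auto simp: A_def)
      obtain e where e: "e > 0" "ball x e \<subseteq> S" using r S open_contains_ball by blast
      have "ball x (min (r/2) e) \<subseteq> A"
      proof
        fix y assume y: "y \<in> ball x (min (r/2) e)"
        have "ball y (r/2) \<subseteq> ball x r"
        proof
          fix u assume "u \<in> ball y (r/2)"
          then show "u \<in> ball x r" using y dist_triangle[of x u y] by auto
        qed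
        then show "y \<in> A" using y e r by (auto simp: A_def intro!: exI[of _ "r/2"])
      qed
      then show "\<exists>e>0. ball x e \<subseteq> A" using e r by (intro exI[of _ "min (r/2) e"]) auto
    qed
    then show "openin (top_of_set S) A" by (auto simp: openin_open_eq[OF S(1)] A_def)
    show "closedin (top_of_set S) A"
      unfolding closedin_limpt
    proof (intro conjI allI impI)
      show "A \<subseteq> S" by (auto simp: A_def)
      fix x assume x: "x islimpt A \<and> x \<in> S"
      obtain e where e: "e > 0" "ball x e \<subseteq> S" using x S open_contains_ball by blast
      obtain a where a: "a \<in> A" "dist a x < e" using x e islimpt_approachable by metis
      then obtain r where r: "r > 0" "\<forall>y\<in>ball a r \<inter> S. f y = 0" by (auto simp: A_def)
      have "f y = 0" if "y \<in> ball x e" for y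
        by (rule mv_holomorphic_zero_convex[OF mv_holomorphic_on_subset[OF f e(2)] open_ball convex_ball _ r(1) _ that, of a])
           (use a r e in \<open>auto simp: dist_commute subset_iff\<close>)
      then show "x \<in> A" using x e by (auto simp: A_def)
    qed
  qed
  moreover have "w \<in> A" using w by (auto simp: A_def)
  ultimately have "z \<in> A" using z by auto
  then obtain r where "r > 0" "\<forall>y\<in>ball z r \<inter> S. f y = 0" by (auto simp: A_def)
  then show ?thesis using z by auto
qed

section \<open>Taylor coefficients along lines\<close>

text \<open>The homogeneous part of degree \<open>k\<close> of the Taylor series of \<open>g\<close>
  at \<open>z\<close>, evaluated at \<open>v\<close>: the \<open>k\<close>-th derivative along
  \<open>v\<close> divided by \<open>fact k\<close>. The recursion is Euler's identity for this
  part; it permits inductions in which \<open>g\<close> is replaced by its partial derivatives, with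
  no multi-indices.\<close>

primrec taylor_coeff :: "nat \<Rightarrow> (complex^'m \<Rightarrow> complex) \<Rightarrow> complex^'m \<Rightarrow> complex^'m \<Rightarrow> complex" where
  "taylor_coeff 0 g z v = g z"
| "taylor_coeff (Suc k) g z v = (\<Sum>i\<in>UNIV. v $ i * taylor_coeff k (partial_deriv i g) z v) / of_nat (Suc k)"

text \<open>Differentiating the remainder of order \<open>Suc n\<close> along the line gives the
  combination, with coefficients \<open>v $ i\<close>, of the remainders of order \<open>n\<close>
  of the partial derivatives; integrating back from 0 gains one power of \<open>ze\<close>. The
  constant is uniform in \<open>z\<close> and in bounded \<open>v\<close>, as required later when
  \<open>z\<close> runs through a curve.\<close>

lemma taylor_remainder:
  fixes g :: "complex^'m \<Rightarrow> complex"
  assumes "mv_holomorphic_on g S" "open S" "compact K" "K \<subseteq> S"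
  shows "\<exists>C\<ge>0. \<forall>z v (ze::complex). (\<forall>\<xi>. norm \<xi> \<le> norm ze \<longrightarrow> z + \<xi> *s v \<in> K) \<longrightarrow> norm v \<le> b \<longrightarrow>
     norm (g (z + ze *s v) - (\<Sum>k<n. ze^k * taylor_coeff k g z v)) \<le> C * norm ze ^ n"
  using assms(1)
proof (induction n arbitrary: g)
  case 0
  have "compact (g ` K)"
    using assms(3,4) 0 by (intro compact_continuous_image continuous_on_subset[OF mv_holomorphic_on_imp_continuous_on]) auto
  then obtain B where B: "\<And>p. p \<in> g ` K \<Longrightarrow> norm p \<le> B"
    using compact_imp_bounded bounded_iff by meson
  show ?case
  proof (intro exI[of _ "max B 0"] conjI allI impI)
    fix z v and ze :: complex assume "\<forall>\<xi>. norm \<xi> \<le> norm ze \<longrightarrow> z + \<xi> *s v \<in> K"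
    then have "z + ze *s v \<in> K" by blast
    then show "norm (g (z + ze *s v) - (\<Sum>k<0. ze^k * taylor_coeff k g z v)) \<le> max B 0 * norm ze ^ 0"
      using B by (fastforce simp: le_max_iff_disj)
  qed auto
next
  case (Suc n)
  have hp: "mv_holomorphic_on (partial_deriv i g) S" for i
    by (rule mv_holomorphic_on_partial_deriv[OF Suc.prems assms(2)])
  have "\<forall>i. \<exists>C\<ge>0. \<forall>z v (ze::complex). (\<forall>\<xi>. norm \<xi> \<le> norm ze \<longrightarrow> z + \<xi> *s v \<in> K) \<longrightarrow> norm v \<le> b \<longrightarrow>
     norm (partial_deriv i g (z + ze *s v) - (\<Sum>k<n. ze^k * taylor_coeff k (partial_deriv i g) z v)) \<le> C * norm ze ^ n"
    using Suc.IH[OF hp] by blast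
  from choice[OF this] obtain C where C': "\<forall>i. C i \<ge> 0 \<and> (\<forall>z v (ze::complex). (\<forall>\<xi>. norm \<xi> \<le> norm ze \<longrightarrow> z + \<xi> *s v \<in> K) \<longrightarrow> norm v \<le> b \<longrightarrow>
     norm (partial_deriv i g (z + ze *s v) - (\<Sum>k<n. ze^k * taylor_coeff k (partial_deriv i g) z v)) \<le> C i * norm ze ^ n)" ..
  have C: "C i \<ge> 0" "(\<forall>\<xi>. norm \<xi> \<le> norm ze \<longrightarrow> z + \<xi> *s v \<in> K) \<Longrightarrow> norm v \<le> b \<Longrightarrow>
     norm (partial_deriv i g (z + ze *s v) - (\<Sum>k<n. ze^k * taylor_coeff k (partial_deriv i g) z v)) \<le> C i * norm ze ^ n" for i z v and ze :: complex
    using C'[THEN spec, of i] by blast+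
  let ?C = "\<bar>b\<bar> * (\<Sum>i\<in>UNIV. C i)"
  show ?case
  proof (intro exI[of _ ?C] conjI allI impI)
    show "?C \<ge> 0" using C by (simp add: sum_nonneg)
    fix z v and ze :: complex assume K: "\<forall>\<xi>. norm \<xi> \<le> norm ze \<longrightarrow> z + \<xi> *s v \<in> K" and v: "norm v \<le> b"
    let ?R = "\<lambda>\<xi>. g (z + \<xi> *s v) - (\<Sum>k<Suc n. \<xi>^k * taylor_coeff k g z v)"
    let ?R' = "\<lambda>\<xi>. \<Sum>i\<in>UNIV. v $ i * (partial_deriv i g (z + \<xi> *s v) - (\<Sum>k<n. \<xi>^k * taylor_coeff k (partial_deriv i g) z v))"
    have "norm (?R ze - ?R 0) \<le> (?C * norm ze ^ n) * norm (ze - 0)"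
    proof (rule field_differentiable_bound[where S = "cball 0 (norm ze)" and f' = ?R'])
      fix \<xi> :: complex assume \<xi>: "\<xi> \<in> cball 0 (norm ze)"
      then have xs: "z + \<xi> *s v \<in> S" using K assms(4) by auto
      have d1: "((\<lambda>\<xi>. \<Sum>k<Suc n. \<xi>^k * taylor_coeff k g z v) has_field_derivative
          (\<Sum>k<n. \<xi>^k * (\<Sum>i\<in>UNIV. v $ i * taylor_coeff k (partial_deriv i g) z v))) (at \<xi>)"
      proof -
        have e: "(\<Sum>k<Suc n. \<xi>^k * taylor_coeff k g z v) = taylor_coeff 0 g z v + (\<Sum>k<n. \<xi>^(Suc k) * taylor_coeff (Suc k) g z v)" for \<xi>
          by (simp only: sum.lessThan_Suc_shift) simp
        have "((\<lambda>\<xi>. taylor_coeff 0 g z v + (\<Sum>k<n. \<xi>^(Suc k) * taylor_coeff (Suc k) g z v)) has_field_derivative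
          0 + (\<Sum>k<n. of_nat (Suc k) * \<xi>^k * taylor_coeff (Suc k) g z v)) (at \<xi>)"
        proof (intro DERIV_add DERIV_const DERIV_sum DERIV_cmult_right)
          fix k
          show "((\<lambda>x. x ^ Suc k) has_field_derivative of_nat (Suc k) * \<xi> ^ k) (at \<xi>)"
            using DERIV_power[OF DERIV_ident[of "at \<xi>"], where n = "Suc k"] by (simp del: of_nat_Suc)
        qed
        then show ?thesis unfolding e
          by (rule DERIV_cong) (simp del: of_nat_Suc add: mult_ac)
      qed
      have "?R' \<xi> = (\<Sum>i\<in>UNIV. v $ i * partial_deriv i g (z + \<xi> *s v))
         - (\<Sum>k<n. \<xi>^k * (\<Sum>i\<in>UNIV. v $ i * taylor_coeff k (partial_deriv i g) z v))"
      proof -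
        have "(\<Sum>i\<in>UNIV. v $ i * (\<Sum>k<n. \<xi>^k * taylor_coeff k (partial_deriv i g) z v))
          = (\<Sum>k<n. \<xi>^k * (\<Sum>i\<in>UNIV. v $ i * taylor_coeff k (partial_deriv i g) z v))"
          unfolding sum_distrib_left by (subst sum.swap) (simp add: mult_ac)
        then show ?thesis by (simp add: right_diff_distrib sum_subtractf)
      qed
      then show "(?R has_field_derivative ?R' \<xi>) (at \<xi> within cball 0 (norm ze))"
        using DERIV_diff[OF field_differentiable_along_line[OF Suc.prems xs] d1]
        by (simp only: has_field_derivative_at_within)
      have "norm (?R' \<xi>) \<le> (\<Sum>i\<in>UNIV. \<bar>b\<bar> * (C i * norm ze ^ n))"
      proof (rule sum_norm_le)
        fix i
        have "norm (partial_deriv i g (z + \<xi> *s v) - (\<Sum>k<n. \<xi>^k * taylor_coeff k (partial_deriv i g) z v)) \<le> C i * norm \<xi> ^ n"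
          using K \<xi> v by (intro C) auto
        also have "\<dots> \<le> C i * norm ze ^ n" using \<xi> C by (intro mult_left_mono power_mono) auto
        finally show "norm (v $ i * (partial_deriv i g (z + \<xi> *s v) - (\<Sum>k<n. \<xi>^k * taylor_coeff k (partial_deriv i g) z v))) \<le> \<bar>b\<bar> * (C i * norm ze ^ n)"
          using v Finite_Cartesian_Product.norm_nth_le[of v i] unfolding norm_mult by (intro mult_mono) auto
      qed
      also have "\<dots> = ?C * norm ze ^ n" by (simp add: sum_distrib_left sum_distrib_right mult.assoc)
      finally show "norm (?R' \<xi>) \<le> ?C * norm ze ^ n" .
    qed auto
    moreover have "?R 0 = 0" by (simp add: sum.lessThan_Suc_shift del: sum.lessThan_Suc)
    moreover have "(?C * norm ze ^ n) * norm (ze - 0) = ?C * norm ze ^ Suc n" by simp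
    ultimately show "norm (?R ze) \<le> ?C * norm ze ^ Suc n" by (simp only: diff_zero)
  qed
qed

text \<open>Otherwise \<open>\<phi>\<close> has a zero of some exact order \<open>n\<close> at 0,
  contrary to the bound with exponent \<open>Suc n\<close>.\<close>

lemma holomorphic_zero_of_small:
  fixes \<phi> :: "complex \<Rightarrow> complex"
  assumes hol: "\<phi> holomorphic_on ball 0 \<rho>" and \<rho>: "\<rho> > 0"
    and small: "\<And>n. \<exists>C. \<forall>ze\<in>ball 0 \<rho>. norm (\<phi> ze) \<le> C * norm ze ^ n"
    and w: "w \<in> ball 0 \<rho>"
  shows "\<phi> w = 0"
proof (rule ccontr)
  assume nz: "\<phi> w \<noteq> 0"
  have z0: "\<phi> 0 = 0"
  proof -
    obtain C where "\<forall>ze\<in>ball 0 \<rho>. norm (\<phi> ze) \<le> C * norm ze ^ 1" using small[of 1] by blast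
    from bspec[OF this, of 0] \<rho> show ?thesis by simp
  qed
  have nc: "\<not> \<phi> constant_on ball 0 \<rho>"
    using z0 nz w \<rho> unfolding constant_on_def by (metis centre_in_ball)
  have centre: "0 \<in> ball 0 \<rho>" using \<rho> by simp
  show False
  proof (rule holomorphic_factor_zero_nonconstant[OF hol open_ball connected_ball centre z0 nc])
  fix g r and n :: nat
  assume g: "0 < n" "0 < r" "ball (0::complex) r \<subseteq> ball 0 \<rho>" "g holomorphic_on ball 0 r"
    "\<And>w. w \<in> ball 0 r \<Longrightarrow> \<phi> w = (w - 0) ^ n * g w" "\<And>w. w \<in> ball 0 r \<Longrightarrow> g w \<noteq> 0"
  obtain C where C: "\<And>ze. ze \<in> ball 0 \<rho> \<Longrightarrow> norm (\<phi> ze) \<le> C * norm ze ^ Suc n" using small[of "Suc n"] by blast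
  have cg: "isCont g 0"
    using holomorphic_on_imp_continuous_on[OF g(4)] g(2) by (simp add: continuous_on_eq_continuous_at)
  have ev: "\<forall>\<^sub>F ze in at 0. norm (g ze) \<le> C * norm ze"
  proof -
    have "\<forall>\<^sub>F ze in at (0::complex). ze \<in> ball 0 r"
      using g(2) eventually_at_ball[of r "0::complex" UNIV] by simp
    then show ?thesis using eventually_neq_at_within[of "0::complex" "0::complex" UNIV]
    proof eventually_elim
      case (elim ze)
      have "norm ze ^ n * norm (g ze) \<le> norm ze ^ n * (C * norm ze)"
      proof -
        have "ze \<in> ball 0 \<rho>" using elim g(3) by blast
        then have "norm (\<phi> ze) \<le> C * norm ze ^ Suc n" by (rule C)
        then show ?thesis using g(5)[of ze] elim by (simp add: norm_mult norm_power mult_ac)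
      qed
      then show ?case using elim by (simp add: mult_le_cancel_left_pos)
    qed
  qed
  have "norm (g 0) \<le> 0"
  proof (rule tendsto_le[OF _ _ _ ev])
    show "((\<lambda>ze. C * norm ze) \<longlongrightarrow> 0) (at (0::complex))" by (auto intro!: tendsto_eq_intros)
    show "((\<lambda>ze. norm (g ze)) \<longlongrightarrow> norm (g 0)) (at 0)" using cg by (intro tendsto_norm) (simp add: isCont_def)
  qed simp
  then show False using g(2) g(6)[of 0] by simp
  qed
qed

lemma zero_of_taylor_coeff_zero:
  fixes g :: "complex^'m \<Rightarrow> complex"
  assumes g: "mv_holomorphic_on g S" and S: "open S" "connected S" "z \<in> S"
    and T: "\<And>k v. taylor_coeff k g z v = 0" and w: "w \<in> S"
  shows "g w = 0"
proof -
  obtain e where e: "e > 0" "cball z e \<subseteq> S" using S open_contains_cball by blast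
  have "g y = 0" if y: "y \<in> ball z e" for y
  proof -
    define v where "v = y - z"
    define a where "a = norm v"
    \<comment> \<open>The value 1 of the line parameter has to lie inside the disc, so
      \<open>\<rho>\<close> must exceed 1, while \<open>\<rho> * a\<close> must not exceed
      \<open>e\<close>; this formula achieves both, also for \<open>a = 0\<close>.\<close>
    define \<rho> where "\<rho> = 2 * e / (a + e)"
    have a: "a < e" "0 \<le> a" "0 < e" "0 < a + e"
      using y e by (auto simp: a_def v_def dist_norm norm_minus_commute add_nonneg_pos)
    have \<rho>: "\<rho> > 1" using a by (simp add: \<rho>_def)
    have \<rho>e: "\<rho> * norm v \<le> e"
    proof -
      have "2 * e * a \<le> e * (a + e)" using a by (simp add: algebra_simps)
      then show ?thesis using a unfolding a_def[symmetric] \<rho>_def by (simp add: divide_le_eq)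
    qed
    have inK: "z + \<xi> *s v \<in> cball z e" if "norm \<xi> \<le> \<rho>" for \<xi>
    proof -
      have "norm (\<xi> *s v) \<le> \<rho> * norm v" unfolding norm_vector_scalar_mult using that by (intro mult_right_mono) auto
      then show ?thesis using \<rho>e by (simp add: dist_norm)
    qed
    have "(\<lambda>ze. g (z + ze *s v)) 1 = 0"
    proof (rule holomorphic_zero_of_small[where \<rho> = \<rho> and \<phi> = "\<lambda>ze. g (z + ze *s v)"])
      show "(\<lambda>ze. g (z + ze *s v)) holomorphic_on ball 0 \<rho>"
        by (rule holomorphic_on_subset[OF mv_holomorphic_on_line[OF g]]) (use inK e in \<open>auto simp: subset_iff\<close>)
      fix n :: nat
      obtain C where C: "\<forall>z' v' (ze::complex). (\<forall>\<xi>. norm \<xi> \<le> norm ze \<longrightarrow> z' + \<xi> *s v' \<in> cball z e) \<longrightarrow> norm v' \<le> norm v \<longrightarrow>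
        norm (g (z' + ze *s v') - (\<Sum>k<n. ze^k * taylor_coeff k g z' v')) \<le> C * norm ze ^ n"
        using taylor_remainder[OF g S(1) compact_cball e(2), of "norm v" n] by blast
      have "norm (g (z + ze *s v)) \<le> C * norm ze ^ n" if "ze \<in> ball 0 \<rho>" for ze
      proof -
        have "\<forall>\<xi>. norm \<xi> \<le> norm ze \<longrightarrow> z + \<xi> *s v \<in> cball z e" using inK that by auto
        from C[THEN spec, THEN spec, THEN spec, THEN mp, THEN mp, OF this order_refl] show ?thesis by (simp add: T)
      qed
      then show "\<exists>C. \<forall>ze\<in>ball 0 \<rho>. norm (g (z + ze *s v)) \<le> C * norm ze ^ n" by blast
    qed (use \<rho> in auto)
    then show "g y = 0" by (simp add: v_def)
  qed
  then show ?thesis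
    using mv_holomorphic_zero_connected[OF g S(1,2) S(3) e(1) _ w] by auto
qed

lemma holomorphic_taylor_coeff_curve:
  fixes g :: "complex^'m \<Rightarrow> complex" and z v :: "complex \<Rightarrow> complex^'m"
  assumes "mv_holomorphic_on g S" "open S" "open T"
    and "\<And>i. (\<lambda>t. z t $ i) holomorphic_on T" "\<And>i. (\<lambda>t. v t $ i) holomorphic_on T" "\<And>t. t \<in> T \<Longrightarrow> z t \<in> S"
  shows "(\<lambda>t. taylor_coeff k g (z t) (v t)) holomorphic_on T"
  using assms(1)
proof (induction k arbitrary: g)
  case 0
  have "(\<lambda>t. g (z t)) field_differentiable (at t)" if t: "t \<in> T" for t
  proof -
    have "((\<lambda>t. z t $ i) has_field_derivative deriv (\<lambda>t. z t $ i) t) (at t)" for i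
      using holomorphic_derivI[OF assms(4,3) t] by simp
    then show ?thesis
      using mv_holomorphic_on_curve[where H = z and H' = "\<lambda>i. deriv (\<lambda>t. z t $ i) t", OF 0 assms(6)[OF t]]
      unfolding field_differentiable_def by blast
  qed
  then show ?case unfolding holomorphic_on_def using field_differentiable_at_within by auto
next
  case (Suc k)
  have "(\<lambda>t. taylor_coeff k (partial_deriv i g) (z t) (v t)) holomorphic_on T" for i
    by (rule Suc.IH[OF mv_holomorphic_on_partial_deriv[OF Suc.prems assms(2)]])
  then show ?case by (auto intro!: holomorphic_intros assms(5))
qed

lemma continuous_on_taylor_coeff:
  fixes g :: "complex^'m \<Rightarrow> complex" and z v :: "'a::topological_space \<Rightarrow> complex^'m"
  assumes "mv_holomorphic_on g S" "open S"
    and "continuous_on T z" "continuous_on T v" "\<And>t. t \<in> T \<Longrightarrow> z t \<in> S"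
  shows "continuous_on T (\<lambda>t. taylor_coeff k g (z t) (v t))"
  using assms(1)
proof (induction k arbitrary: g)
  case 0
  show ?case using continuous_on_compose2[OF mv_holomorphic_on_imp_continuous_on[OF 0] assms(3)] assms(5) by auto
next
  case (Suc k)
  have "continuous_on T (\<lambda>t. taylor_coeff k (partial_deriv i g) (z t) (v t))" for i
    by (rule Suc.IH[OF mv_holomorphic_on_partial_deriv[OF Suc.prems assms(2)]])
  then have "continuous_on T (\<lambda>t. (\<Sum>i\<in>UNIV. v t $ i * taylor_coeff k (partial_deriv i g) (z t) (v t)) / of_nat (Suc k))"
    by (intro continuous_intros assms(4)) (simp_all del: of_nat_Suc)
  then show ?case by (simp del: of_nat_Suc)
qed

lemma taylor_remainder_leading:
  fixes g :: "complex^'m \<Rightarrow> complex"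
  assumes "mv_holomorphic_on g S" "open S" "compact K" "K \<subseteq> S"
  shows "\<exists>C\<ge>0. \<forall>z v (ze::complex). (\<forall>\<xi>. norm \<xi> \<le> norm ze \<longrightarrow> z + \<xi> *s v \<in> K) \<longrightarrow> norm v \<le> b \<longrightarrow>
     (\<forall>k<n. taylor_coeff k g z v = 0) \<longrightarrow>
     norm (g (z + ze *s v) - ze^n * taylor_coeff n g z v) \<le> C * norm ze ^ Suc n"
proof -
  obtain C where C: "C \<ge> 0" "\<forall>z v (ze::complex). (\<forall>\<xi>. norm \<xi> \<le> norm ze \<longrightarrow> z + \<xi> *s v \<in> K) \<longrightarrow> norm v \<le> b \<longrightarrow>
     norm (g (z + ze *s v) - (\<Sum>k<Suc n. ze^k * taylor_coeff k g z v)) \<le> C * norm ze ^ Suc n"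
    using taylor_remainder[OF assms, of b "Suc n"] by blast
  show ?thesis
  proof (intro exI[of _ C] conjI C(1) allI impI)
    fix z v and ze :: complex
    assume a: "\<forall>\<xi>. norm \<xi> \<le> norm ze \<longrightarrow> z + \<xi> *s v \<in> K" "norm v \<le> b" "\<forall>k<n. taylor_coeff k g z v = 0"
    have "(\<Sum>k<Suc n. ze^k * taylor_coeff k g z v) = ze^n * taylor_coeff n g z v" using a(3) by simp
    then show "norm (g (z + ze *s v) - ze^n * taylor_coeff n g z v) \<le> C * norm ze ^ Suc n"
      using C(2)[THEN spec, THEN spec, THEN spec, THEN mp, THEN mp, OF a(1,2)] by simp
  qed
qed

text \<open>Cauchy's inequality on the disc of radius \<open>\<rho> / (2 * norm v)\<close> in the
  line with direction \<open>v\<close>.\<close>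

lemma directional_derivative_bound:
  fixes f :: "complex^'m \<Rightarrow> complex"
  assumes f: "mv_holomorphic_on f (ball z \<rho>)" and \<rho>: "\<rho> > 0"
    and B: "\<And>w. w \<in> ball z \<rho> \<Longrightarrow> norm (f w) \<le> B"
  shows "norm (\<Sum>i\<in>UNIV. v $ i * partial_deriv i f z) \<le> 2 * B * norm v / \<rho>"
proof (cases "v = 0")
  case True
  have "B \<ge> 0" using B[of z] \<rho> norm_ge_zero order_trans by (metis centre_in_ball)
  then show ?thesis using True \<rho> by simp
next
  case False
  let ?\<phi> = "\<lambda>ze. f (z + ze *s v)"
  define r where "r = \<rho> / (2 * norm v)"
  have r: "r > 0" using False \<rho> by (simp add: r_def)
  have inb: "z + ze *s v \<in> ball z \<rho>" if "norm ze \<le> r" for ze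
  proof -
    have "norm (ze *s v) \<le> r * norm v" unfolding norm_vector_scalar_mult using that by (intro mult_right_mono) auto
    also have "\<dots> = \<rho>/2" using False by (simp add: r_def)
    finally show ?thesis using \<rho> by (simp add: dist_norm)
  qed
  have hol: "?\<phi> holomorphic_on {ze. z + ze *s v \<in> ball z \<rho>}" by (rule mv_holomorphic_on_line[OF f])
  have "norm ((deriv ^^ 1) ?\<phi> 0) \<le> fact 1 * B / r ^ 1"
  proof (rule Cauchy_inequality)
    show "?\<phi> holomorphic_on ball 0 r" by (rule holomorphic_on_subset[OF hol]) (use inb in auto)
    show "continuous_on (cball 0 r) ?\<phi>"
      by (rule holomorphic_on_imp_continuous_on[OF holomorphic_on_subset[OF hol]]) (use inb in auto)
    show "norm (?\<phi> x) \<le> B" if "norm (0 - x) = r" for x using inb[of x] that by (intro B) auto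
  qed (use r in auto)
  moreover have "deriv ?\<phi> 0 = (\<Sum>i\<in>UNIV. v $ i * partial_deriv i f z)"
    using field_differentiable_along_line[OF f, of z 0 v] \<rho> by (simp add: DERIV_imp_deriv)
  ultimately show ?thesis using False \<rho> by (simp add: r_def mult_ac)
qed

lemma mv_holomorphic_lipschitz:
  fixes f :: "complex^'m \<Rightarrow> complex"
  assumes f: "mv_holomorphic_on f S" and \<rho>: "\<rho> > 0"
    and C: "convex C" "x \<in> C" "y \<in> C" "\<And>w. w \<in> C \<Longrightarrow> ball w \<rho> \<subseteq> S"
    and B: "\<And>w. w \<in> S \<Longrightarrow> norm (f w) \<le> B"
  shows "norm (f x - f y) \<le> 2 * B / \<rho> * norm (x - y)"
proof (rule differentiable_bound[OF C(1) _ _ C(2,3)])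
  fix w assume w: "w \<in> C"
  have wS: "w \<in> S" using C(4)[OF w] \<rho> by auto
  show "(f has_derivative (\<lambda>v. \<Sum>i\<in>UNIV. v $ i * partial_deriv i f w)) (at w within C)"
    by (rule has_derivative_at_withinI[OF mv_holomorphic_on_has_derivative[OF f wS]])
  show "onorm (\<lambda>v. \<Sum>i\<in>UNIV. v $ i * partial_deriv i f w) \<le> 2 * B / \<rho>"
  proof (rule onorm_le)
    fix v :: "complex^'m"
    show "norm (\<Sum>i\<in>UNIV. v $ i * partial_deriv i f w) \<le> 2 * B / \<rho> * norm v"
      using directional_derivative_bound[OF mv_holomorphic_on_subset[OF f C(4)[OF w]] \<rho>, of B v] B C(4)[OF w] by (auto simp: subset_iff)
  qed
qed

section \<open>Maps close to the identity\<close>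

text \<open>A divided difference at the largest node removes that node, improves the bound
  \<open>B\<close> by a factor of order \<open>1 / T\<close> and changes the nodal bound
  \<open>e\<close> only by a constant factor. Once the node 0 alone is left, Cauchy's inequality
  supplies the last factor \<open>1 / T\<close>.\<close>

lemma interpolation_derivative_bound:
  "\<exists>C\<ge>0. \<forall>u B e T. u holomorphic_on ball (0::complex) T \<longrightarrow> 4 * (real J + 1) \<le> T \<longrightarrow>
     (\<forall>\<tau>\<in>ball 0 T. norm (u \<tau>) \<le> B) \<longrightarrow> (\<forall>i\<le>J. norm (u (of_nat i) :: complex) \<le> e) \<longrightarrow>
     norm (deriv u 0) \<le> C * (B / T ^ Suc J + e)"
proof (induction J)
  case 0
  show ?case
  proof (intro exI[of _ 2] conjI allI impI)
    fix u :: "complex \<Rightarrow> complex" and B e T :: real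
    assume u: "u holomorphic_on ball 0 T" and T: "4 * (real 0 + 1) \<le> T"
      and B: "\<forall>\<tau>\<in>ball 0 T. norm (u \<tau>) \<le> B" and e: "\<forall>i\<le>0. norm (u (of_nat i)) \<le> e"
    have "norm ((deriv ^^ 1) u 0) \<le> fact 1 * B / (T/2) ^ 1"
    proof (rule Cauchy_inequality)
      show "u holomorphic_on ball 0 (T/2)" using T by (intro holomorphic_on_subset[OF u]) auto
      show "continuous_on (cball 0 (T/2)) u"
        using T by (intro holomorphic_on_imp_continuous_on holomorphic_on_subset[OF u]) auto
      show "norm (u x) \<le> B" if "norm (0 - x) = T/2" for x using that B T by auto
    qed (use T in auto)
    moreover have "0 \<le> e" using e norm_ge_zero order_trans by blast
    ultimately show "norm (deriv u 0) \<le> 2 * (B / T ^ Suc 0 + e)" by (simp add: mult.commute)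
  qed auto
next
  case (Suc J)
  then obtain C where C: "C \<ge> 0" and CI: "\<forall>u B e T. u holomorphic_on ball (0::complex) T \<longrightarrow> 4 * (real J + 1) \<le> T \<longrightarrow>
     (\<forall>\<tau>\<in>ball 0 T. norm (u \<tau>) \<le> B) \<longrightarrow> (\<forall>i\<le>J. norm (u (of_nat i) :: complex) \<le> e) \<longrightarrow>
     norm (deriv u 0) \<le> C * (B / T ^ Suc J + e)" by blast
  let ?C = "2 + (real J + 1) * (8 * C)"
  show ?case
  proof (intro exI[of _ ?C] conjI allI impI)
    show "?C \<ge> 0" using C by simp
    fix u :: "complex \<Rightarrow> complex" and B e T :: real
    assume u: "u holomorphic_on ball 0 T" and T: "4 * (real (Suc J) + 1) \<le> T"
      and B: "\<forall>\<tau>\<in>ball 0 T. norm (u \<tau>) \<le> B" and e: "\<forall>i\<le>Suc J. norm (u (of_nat i)) \<le> e"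
    define a :: complex where "a = of_nat (Suc J)"
    have na: "norm a = real J + 1" unfolding a_def norm_of_nat by simp
    have T0: "T > 0" "norm a \<le> T/4" using T na by auto
    have aT: "a \<in> ball 0 T" using T0 by simp
    have B0: "0 \<le> B" using B aT norm_ge_zero order_trans by blast
    have e0: "0 \<le> e" using e norm_ge_zero order_trans by blast
    define u1 where "u1 = (\<lambda>\<tau>. if \<tau> = a then deriv u a else (u \<tau> - u a) / (\<tau> - a))"
    have hu1: "u1 holomorphic_on ball 0 T" unfolding u1_def
      using pole_lemma_open[OF u open_ball, of a] by simp
    have ub: "ball w (T/4) \<subseteq> ball 0 T" "cball w (T/4) \<subseteq> ball 0 T" if "w \<in> ball a (T/4)" for w
    proof -
      have nw: "norm w < T/2" using that T0 norm_triangle_sub[of w a] by (simp add: dist_norm norm_minus_commute)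
      show "cball w (T/4) \<subseteq> ball 0 T"
      proof
        fix x assume "x \<in> cball w (T/4)"
        then show "x \<in> ball 0 T" using nw T0 norm_triangle_sub[of x w] by (simp add: dist_norm norm_minus_commute)
      qed
      then show "ball w (T/4) \<subseteq> ball 0 T" by auto
    qed
    have du: "norm (deriv u w) \<le> 4 * B / T" if w: "w \<in> ball a (T/4)" for w
    proof -
      have "norm ((deriv ^^ 1) u w) \<le> fact 1 * B / (T/4) ^ 1"
      proof (rule Cauchy_inequality)
        show "u holomorphic_on ball w (T/4)" by (rule holomorphic_on_subset[OF u ub(1)[OF w]])
        show "continuous_on (cball w (T/4)) u"
          by (rule holomorphic_on_imp_continuous_on[OF holomorphic_on_subset[OF u ub(2)[OF w]]])
        show "norm (u x) \<le> B" if "norm (w - x) = T/4" for x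
          using that B ub(2)[OF w] by (auto simp: subset_iff dist_norm)
      qed (use T0 in auto)
      then show ?thesis by (simp add: mult.commute)
    qed
    \<comment> \<open>Near the node the divided difference is controlled by the derivative of
      \<open>u\<close>, elsewhere by the distance \<open>T / 4\<close> from the node.\<close>
    have b1: "norm (u1 \<tau>) \<le> 8 * B / T" if \<tau>: "\<tau> \<in> ball 0 T" for \<tau>
    proof -
      consider "\<tau> = a" | "\<tau> \<noteq> a" "\<tau> \<in> ball a (T/4)" | "\<tau> \<noteq> a" "norm (\<tau> - a) \<ge> T/4"
        by (auto simp: dist_norm norm_minus_commute) force
      then show ?thesis
      proof cases
        case 1
        then have "norm (u1 \<tau>) \<le> 4 * B / T" using du[of a] T0 by (simp add: u1_def)
        also have "\<dots> \<le> 8 * B / T" using B0 T0 by (intro divide_right_mono) auto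
        finally show ?thesis .
      next
        case 2
        have "norm (u \<tau> - u a) \<le> 4 * B / T * norm (\<tau> - a)"
        proof (rule field_differentiable_bound[where S = "ball a (T/4)" and f' = "deriv u"])
          fix w assume w: "w \<in> ball a (T/4)"
          then have "w \<in> ball 0 T" using ub(2)[OF w] T0 centre_in_cball[of w "T/4"] by (meson divide_nonneg_nonneg less_imp_le subsetD zero_le_numeral)
          then show "(u has_field_derivative deriv u w) (at w within ball a (T/4))"
            using holomorphic_derivI[OF u open_ball] has_field_derivative_at_within by blast
        qed (use du 2 T0 in auto)
        then have "norm (u1 \<tau>) \<le> 4 * B / T" using 2 by (simp add: u1_def norm_divide divide_le_eq)
        also have "\<dots> \<le> 8 * B / T" using B0 T0 by (intro divide_right_mono) auto
        finally show ?thesis .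
      next
        case 3
        have "norm (u1 \<tau>) = norm (u \<tau> - u a) / norm (\<tau> - a)" using 3 by (simp add: u1_def norm_divide)
        also have "\<dots> \<le> (2 * B) / (T/4)"
        proof (rule frac_le)
          have "norm (u \<tau> - u a) \<le> norm (u \<tau>) + norm (u a)" by (rule norm_triangle_ineq4)
          moreover have "norm (u \<tau>) \<le> B" "norm (u a) \<le> B" using B \<tau> aT by blast+
          ultimately show "norm (u \<tau> - u a) \<le> 2 * B" by linarith
        qed (use 3 T0 B0 in auto)
        finally show ?thesis by (simp add: mult.commute)
      qed
    qed
    have e1: "norm (u1 (of_nat i)) \<le> 2 * e" if "i \<le> J" for i
    proof -
      have ne: "of_nat i \<noteq> a" unfolding a_def of_nat_eq_iff using that by simp
      have "of_nat i - a = - of_nat (Suc J - i)" using that by (simp add: a_def of_nat_diff)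
      then have "norm (of_nat i - a) = real (Suc J - i)" by (simp only: norm_minus_cancel norm_of_nat)
      then have n1: "norm (of_nat i - a) \<ge> 1" using that by simp
      have "norm (u (of_nat i) - u a) \<le> norm (u (of_nat i)) + norm (u a)" by (rule norm_triangle_ineq4)
      also have "\<dots> \<le> 2 * e" using e[rule_format, of i] e[rule_format, of "Suc J"] that by (simp add: a_def)
      finally have "norm (u (of_nat i) - u a) / norm (of_nat i - a) \<le> 2 * e / 1"
        using n1 e0 by (intro frac_le) auto
      then show ?thesis using ne by (simp add: u1_def norm_divide)
    qed
    have "norm (deriv u1 0) \<le> C * ((8 * B / T) / T ^ Suc J + 2 * e)"
      using T by (intro CI[rule_format, OF hu1]) (auto intro: b1 e1)
    then have d1: "norm (deriv u1 0) \<le> C * (8 * (B / T ^ Suc (Suc J)) + 2 * e)"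
      by (simp add: mult_ac)
    have "u = (\<lambda>\<tau>. u a + (\<tau> - a) * u1 \<tau>)" by (auto simp: fun_eq_iff u1_def)
    moreover have "((\<lambda>\<tau>. u a + (\<tau> - a) * u1 \<tau>) has_field_derivative u1 0 - a * deriv u1 0) (at 0)"
    proof -
      have "(u1 has_field_derivative deriv u1 0) (at 0)" using holomorphic_derivI[OF hu1 open_ball, of 0] T0 by simp
      then show ?thesis by (auto intro!: derivative_eq_intros)
    qed
    ultimately have "deriv u 0 = u1 0 - a * deriv u1 0" using DERIV_imp_deriv by metis
    then have "norm (deriv u 0) \<le> norm (u1 0) + (real J + 1) * norm (deriv u1 0)"
      using norm_triangle_ineq4[of "u1 0" "a * deriv u1 0"] by (simp add: norm_mult na)
    also have "\<dots> \<le> 2 * e + (real J + 1) * (C * (8 * (B / T ^ Suc (Suc J)) + 2 * e))"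
      using e1[of 0] d1 by (intro add_mono mult_left_mono) auto
    also have "\<dots> \<le> ?C * (B / T ^ Suc (Suc J) + e)"
    proof -
      define x where "x = B / T ^ Suc (Suc J)"
      define q where "q = (real J + 1) * C"
      have "x \<ge> 0" "q \<ge> 0" using B0 T0 C by (auto simp: x_def q_def)
      then have "2 * e + q * (8 * x + 2 * e) \<le> (2 + 8 * q) * (x + e)"
        using e0 by (simp add: algebra_simps)
      then show ?thesis unfolding x_def[symmetric] by (simp add: q_def mult_ac)
    qed
    finally show "norm (deriv u 0) \<le> ?C * (B / T ^ Suc (Suc J) + e)" .
  qed
qed

text \<open>Forward differences at time 0 of the orbit \<open>\<lambda>i. (H ^^ i) c\<close>,
  written so that each one is again a map of \<open>c\<close> and can be estimated by Cauchy's
  inequality.\<close>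

primrec forward_difference :: "(complex^'m \<Rightarrow> complex^'m) \<Rightarrow> nat \<Rightarrow> complex^'m \<Rightarrow> complex^'m" where
  "forward_difference H 0 c = c"
| "forward_difference H (Suc j) c = forward_difference H j (H c) - forward_difference H j c"

text \<open>Newton's forward difference formula. With \<open>i\<close> replaced by a complex time it
  becomes the interpolating curve that defines the logarithm.\<close>

lemma funpow_eq_sum_forward_difference:
  "(H ^^ i) c = (\<Sum>j\<le>i. of_nat (i choose j) *s forward_difference H j c)"
proof (induction i arbitrary: c)
  case (Suc i)
  let ?D = "\<lambda>j. forward_difference H j c"
  have "(H ^^ Suc i) c = (H ^^ i) (H c)" by (simp add: funpow_swap1)
  also have "\<dots> = (\<Sum>j\<le>i. of_nat (i choose j) *s (?D j + ?D (Suc j)))"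
    unfolding Suc by (intro sum.cong) auto
  also have "\<dots> = (\<Sum>j\<le>i. of_nat (i choose j) *s ?D j) + (\<Sum>j\<le>i. of_nat (i choose j) *s ?D (Suc j))"
    by (simp only: vector_add_ldistrib sum.distrib)
  also have "(\<Sum>j\<le>i. of_nat (i choose j) *s ?D j) = (\<Sum>j\<le>Suc i. of_nat (i choose j) *s ?D j)" by simp
  also have "\<dots> = ?D 0 + (\<Sum>j\<le>i. of_nat (i choose Suc j) *s ?D (Suc j))"
    by (simp only: sum.atMost_Suc_shift) simp
  also have "\<dots> + (\<Sum>j\<le>i. of_nat (i choose j) *s ?D (Suc j))
     = ?D 0 + (\<Sum>j\<le>i. of_nat (Suc i choose Suc j) *s ?D (Suc j))"
    by (simp add: sum.distrib[symmetric] vector_sadd_rdistrib add_ac del: forward_difference.simps(2))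
  also have "\<dots> = (\<Sum>j\<le>Suc i. of_nat (Suc i choose j) *s ?D j)"
    by (simp only: sum.atMost_Suc_shift[of _ i]) simp
  finally show ?case .
qed simp

lemma norm_le_of_components:
  fixes v :: "complex^'m"
  assumes "\<And>i. norm (v $ i) \<le> b" shows "norm v \<le> real CARD('m) * b"
proof -
  have "norm v \<le> (\<Sum>i\<in>UNIV. norm (v $ i))" by (rule norm_le_sum_components)
  also have "\<dots> \<le> (\<Sum>i\<in>(UNIV :: 'm set). b)" by (intro sum_mono assms)
  finally show ?thesis by simp
qed

text \<open>One more difference compares a small function at two points at distance at most
  \<open>\<eta>\<close>. Cauchy's inequality costs \<open>\<kappa>\<close> of the radius and gives a
  factor of order \<open>\<eta> / \<kappa>\<close>, so every further difference gains one power of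
  \<open>\<eta>\<close>.\<close>

lemma forward_difference_bound:
  fixes H :: "complex^'m \<Rightarrow> complex^'m"
  assumes \<kappa>: "\<kappa> > 0" and \<eta>: "0 < \<eta>" "\<eta> \<le> \<kappa> / 2"
    and H: "\<And>i. mv_holomorphic_on (\<lambda>c. H c $ i) (ball c0 dlt)"
    and near: "\<And>c. c \<in> ball c0 dlt \<Longrightarrow> norm (H c - c) \<le> \<eta>"
  shows "(\<forall>i. mv_holomorphic_on (\<lambda>c. forward_difference H (Suc j) c $ i) (ball c0 (dlt - real j * \<kappa>)))
    \<and> (\<forall>c\<in>ball c0 (dlt - real j * \<kappa>). norm (forward_difference H (Suc j) c) \<le> \<eta> * (real CARD('m) * (4 / \<kappa>) * \<eta>) ^ j)"
proof (induction j)
  case 0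
  show ?case using near by (auto intro!: mv_holomorphic_intros H)
next
  case (Suc j)
  let ?r = "dlt - real j * \<kappa>" and ?r' = "dlt - real (Suc j) * \<kappa>"
  let ?B = "\<eta> * (real CARD('m) * (4 / \<kappa>) * \<eta>) ^ j"
  let ?D = "forward_difference H (Suc j)"
  have B0: "?B \<ge> 0" using \<eta> \<kappa> by simp
  have rr: "?r' = ?r - \<kappa>" by (simp add: algebra_simps)
  have rdlt: "?r \<le> dlt" using \<kappa> by simp
  have r'dlt: "?r' \<le> dlt" using \<kappa> by simp
  have IH: "\<And>i. mv_holomorphic_on (\<lambda>c. ?D c $ i) (ball c0 ?r)" "\<And>c. c \<in> ball c0 ?r \<Longrightarrow> norm (?D c) \<le> ?B"
    using Suc by blast+
  have HC: "H c \<in> ball c0 (?r - \<kappa>/2)" if "c \<in> ball c0 ?r'" for c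
  proof -
    have "c \<in> ball c0 dlt" using that subset_ball[OF r'dlt, of c0] by blast
    then have "norm (H c - c) \<le> \<kappa>/2" using near[of c] \<eta> by simp
    then show ?thesis using that rr dist_triangle[of c0 "H c" c] by (auto simp: dist_norm norm_minus_commute)
  qed
  have sub: "ball w (\<kappa>/2) \<subseteq> ball c0 ?r" if "w \<in> ball c0 (?r - \<kappa>/2)" for w
  proof
    fix x assume "x \<in> ball w (\<kappa>/2)"
    then show "x \<in> ball c0 ?r" using that dist_triangle[of c0 x w] by auto
  qed
  have s1: "ball c0 ?r' \<subseteq> ball c0 (?r - \<kappa>/2)" "ball c0 (?r - \<kappa>/2) \<subseteq> ball c0 ?r" "ball c0 ?r' \<subseteq> ball c0 dlt"
    using \<kappa> rr r'dlt by (intro subset_ball; linarith)+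
  have hol: "mv_holomorphic_on (\<lambda>c. forward_difference H (Suc (Suc j)) c $ i) (ball c0 ?r')" for i
  proof -
    have "mv_holomorphic_on (\<lambda>c. ?D (H c) $ i - ?D c $ i) (ball c0 ?r')"
    proof (intro mv_holomorphic_on_diff)
      show "mv_holomorphic_on (\<lambda>c. ?D (H c) $ i) (ball c0 ?r')"
        by (rule mv_holomorphic_on_compose[OF IH(1)]) (use HC s1 in \<open>blast intro: mv_holomorphic_on_subset[OF H]\<close>)+
      show "mv_holomorphic_on (\<lambda>c. ?D c $ i) (ball c0 ?r')"
        by (rule mv_holomorphic_on_subset[OF IH(1)]) (use s1 in blast)
    qed
    then show ?thesis by simp
  qed
  have "norm (forward_difference H (Suc (Suc j)) c) \<le> \<eta> * (real CARD('m) * (4 / \<kappa>) * \<eta>) ^ Suc j"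
    if c: "c \<in> ball c0 ?r'" for c
  proof -
    have nc: "norm (H c - c) \<le> \<eta>" using near c s1 by blast
    have "norm ((?D (H c) - ?D c) $ i) \<le> 2 * ?B / (\<kappa>/2) * \<eta>" for i
    proof -
      have "norm (?D (H c) $ i - ?D c $ i) \<le> 2 * ?B / (\<kappa>/2) * norm (H c - c)"
      proof (rule mv_holomorphic_lipschitz[OF IH(1), where C = "ball c0 (?r - \<kappa>/2)"])
        show "norm (?D w $ i) \<le> ?B" if "w \<in> ball c0 ?r" for w
          using IH(2)[OF that] Finite_Cartesian_Product.norm_nth_le[of "?D w" i] by linarith
      qed (use \<kappa> HC[OF c] c s1 sub in auto)
      also have "\<dots> \<le> 2 * ?B / (\<kappa>/2) * \<eta>" using nc B0 \<kappa> by (intro mult_left_mono) auto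
      finally show ?thesis by simp
    qed
    then have "norm (?D (H c) - ?D c) \<le> real CARD('m) * (2 * ?B / (\<kappa>/2) * \<eta>)"
      by (rule norm_le_of_components)
    also have "\<dots> = \<eta> * (real CARD('m) * (4 / \<kappa>) * \<eta>) ^ Suc j" by (simp add: mult_ac)
    finally show ?thesis by simp
  qed
  with hol show ?case by blast
qed

lemma norm_gbinomial_le:
  fixes \<tau> :: complex
  assumes "norm \<tau> \<le> T" "j \<le> J"
  shows "norm (\<tau> gchoose j) \<le> (T + real J) ^ j"
proof -
  have "norm (\<tau> gchoose j) = norm (\<Prod>i = 0..<j. \<tau> - of_nat i) / fact j"
    by (simp add: gbinomial_prod_rev norm_divide)
  also have "\<dots> \<le> norm (\<Prod>i = 0..<j. \<tau> - of_nat i) / 1"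
    by (intro divide_left_mono) (auto simp: fact_ge_1)
  also have "\<dots> = (\<Prod>i = 0..<j. norm (\<tau> - of_nat i))" by (simp add: prod_norm)
  also have "\<dots> \<le> (\<Prod>i = 0..<j. T + real J)"
  proof (rule prod_mono)
    fix i assume "i \<in> {0..<j}"
    then have "norm (\<tau> - of_nat i) \<le> T + real i" using assms norm_triangle_ineq4[of \<tau> "of_nat i"] by simp
    also have "\<dots> \<le> T + real J" using \<open>i \<in> {0..<j}\<close> assms by simp
    finally show "0 \<le> norm (\<tau> - of_nat i) \<and> norm (\<tau> - of_nat i) \<le> T + real J" by simp
  qed
  finally show ?thesis by simp
qed

text \<open>The vector \<open>Z\<close> is a truncation of the logarithm of \<open>H\<close>.  A function that is almost invariant
  under \<open>H\<close> is almost annihilated by \<open>Z\<close>: interpolate the orbit \<open>H\<^sup>i c\<^sub>0\<close> by a polynomial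
  curve of a complex time, which stays in the ball for times of order \<open>1 / \<eta>\<close>.\<close>

lemma near_identity_logarithm:
  fixes c0 :: "complex^'m"
  assumes dlt: "dlt > 0"
  shows "\<exists>C \<eta>0. 0 < \<eta>0 \<and> 0 \<le> C \<and> (\<forall>\<eta> H. 0 < \<eta> \<longrightarrow> \<eta> \<le> \<eta>0 \<longrightarrow> (\<forall>i. mv_holomorphic_on (\<lambda>c. H c $ i) (ball c0 dlt)) \<longrightarrow>
    (\<forall>c\<in>ball c0 dlt. norm (H c - c) \<le> \<eta>) \<longrightarrow>
    (\<exists>Z. norm (Z - (H c0 - c0)) \<le> C * \<eta>\<^sup>2 \<and>
      (\<forall>G B e. mv_holomorphic_on G (ball c0 dlt) \<longrightarrow> (\<forall>c\<in>ball c0 dlt. norm (G c) \<le> B) \<longrightarrow>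
         (\<forall>c\<in>ball c0 (dlt/2). norm (G (H c) - G c) \<le> e) \<longrightarrow>
         norm (\<Sum>i\<in>UNIV. Z $ i * partial_deriv i G c0) \<le> C * (B * \<eta> ^ J + e))))"
proof -
  \<comment> \<open>At most \<open>J\<close> losses of \<open>\<kappa>\<close> occur, and they leave
    \<open>c0\<close> inside the domain of every difference that is used.\<close>
  define \<kappa> where "\<kappa> = dlt / (2 * (real J + 1))"
  have \<kappa>: "\<kappa> > 0" using dlt by (simp add: \<kappa>_def)
  define K where "K = max 1 (real CARD('m) * (4 / \<kappa>))"
  have K: "K \<ge> 1" "real CARD('m) * (4 / \<kappa>) \<le> K" by (auto simp: K_def)
  \<comment> \<open>The interpolating curve will differ from \<open>c0\<close> by
    \<open>J + 1\<close> terms, each of norm at most \<open>x0\<close>, and has to stay in the ball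
    of radius \<open>dlt\<close>.\<close>
  define x0 where "x0 = min 1 (dlt / (2 * (real J + 2)))"
  have x0: "x0 > 0" "x0 \<le> 1" "(real J + 1) * x0 < dlt"
  proof -
    show x: "x0 > 0" "x0 \<le> 1" using dlt by (auto simp: x0_def)
    have "(real J + 1) * x0 \<le> (real J + 1) * (dlt / (2 * (real J + 2)))" by (intro mult_left_mono) (auto simp: x0_def)
    also have "\<dots> < dlt" using dlt by (simp add: field_simps add_pos_nonneg add_nonneg_pos)
    finally show "(real J + 1) * x0 < dlt" .
  qed
  \<comment> \<open>\<open>\<kappa>' / \<eta>\<close> becomes the radius of the disc of complex
    times. A time of this size, increased by \<open>Suc J\<close> and multiplied by the difference
    bound \<open>K * \<eta>\<close>, is then at most \<open>2 * K * \<kappa>' = x0\<close>.\<close>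
  define \<kappa>' where "\<kappa>' = x0 / (2 * K)"
  have \<kappa>': "\<kappa>' > 0" "2 * K * \<kappa>' = x0" using x0 K by (auto simp: \<kappa>'_def)
  obtain C1 where C1: "C1 \<ge> 0" "\<forall>u B e T. u holomorphic_on ball (0::complex) T \<longrightarrow> 4 * (real (Suc J) + 1) \<le> T \<longrightarrow>
     (\<forall>\<tau>\<in>ball 0 T. norm (u \<tau>) \<le> B) \<longrightarrow> (\<forall>i\<le>Suc J. norm (u (of_nat i) :: complex) \<le> e) \<longrightarrow>
     norm (deriv u 0) \<le> C1 * (B / T ^ Suc (Suc J) + e)" using interpolation_derivative_bound[of "Suc J"] by blast
  define dj where "dj = (\<lambda>j. deriv (\<lambda>\<tau>::complex. \<tau> gchoose j) 0)"
  have hg: "(\<lambda>\<tau>::complex. \<tau> gchoose j) holomorphic_on UNIV" for j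
    unfolding gbinomial_prod_rev by (intro holomorphic_intros) auto
  have dg: "((\<lambda>\<tau>::complex. \<tau> gchoose j) has_field_derivative dj j) (at 0)" for j
    unfolding dj_def using holomorphic_derivI[OF hg open_UNIV] by blast
  define C2 where "C2 = (\<Sum>j\<le>J. norm (dj (Suc j))) * K ^ Suc J"
  define C3 where "C3 = C1 * max (2 / \<kappa>' ^ Suc (Suc J)) (real (Suc J))"
  define C where "C = max C2 C3"
  define \<eta>0 where "\<eta>0 = Min {1, \<kappa>/2, \<kappa>' / (4 * (real J + 2)), dlt / (2 * (real J + 2))}"
  have C0: "0 \<le> C" unfolding C_def C2_def using K by (simp add: sum_nonneg le_max_iff_disj)
  have \<eta>00: "0 < \<eta>0" unfolding \<eta>0_def using \<kappa> \<kappa>' dlt by (subst Min_gr_iff) auto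
  have main: "\<exists>Z. norm (Z - (H c0 - c0)) \<le> C * \<eta>\<^sup>2 \<and>
      (\<forall>G B e. mv_holomorphic_on G (ball c0 dlt) \<longrightarrow> (\<forall>c\<in>ball c0 dlt. norm (G c) \<le> B) \<longrightarrow>
         (\<forall>c\<in>ball c0 (dlt/2). norm (G (H c) - G c) \<le> e) \<longrightarrow>
         norm (\<Sum>i\<in>UNIV. Z $ i * partial_deriv i G c0) \<le> C * (B * \<eta> ^ J + e))"
    if \<eta>: "0 < \<eta>" "\<eta> \<le> \<eta>0" and H: "\<forall>i. mv_holomorphic_on (\<lambda>c. H c $ i) (ball c0 dlt)"
      and near: "\<forall>c\<in>ball c0 dlt. norm (H c - c) \<le> \<eta>" for \<eta> and H :: "complex^'m \<Rightarrow> complex^'m"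
  proof -
    have \<eta>s: "\<eta> \<le> 1" "\<eta> \<le> \<kappa>/2" "\<eta> \<le> \<kappa>' / (4 * (real J + 2))" "\<eta> \<le> dlt / (2 * (real J + 2))"
      using \<eta>(2) unfolding \<eta>0_def by auto
    let ?D = "\<lambda>j. forward_difference H j c0"
    have Dj: "norm (?D (Suc j)) \<le> (K * \<eta>) ^ Suc j" if "j \<le> J" for j
    proof -
      have "real j * \<kappa> \<le> real J * \<kappa>" using that \<kappa> by (intro mult_right_mono) auto
      also have "\<dots> < dlt" unfolding \<kappa>_def using dlt by (simp add: field_simps add_pos_nonneg add_nonneg_pos)
      finally have "c0 \<in> ball c0 (dlt - real j * \<kappa>)" by simp
      then have "norm (?D (Suc j)) \<le> \<eta> * (real CARD('m) * (4 / \<kappa>) * \<eta>) ^ j"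
        using forward_difference_bound[of \<kappa> \<eta> H c0 dlt j] \<kappa> \<eta>(1) \<eta>s(2) H near by blast
      also have "\<dots> \<le> (K * \<eta>) * (K * \<eta>) ^ j"
      proof (rule mult_mono)
        show "\<eta> \<le> K * \<eta>" using mult_right_mono[OF K(1), of \<eta>] \<eta> by simp
        have "real CARD('m) * (4 / \<kappa>) * \<eta> \<le> K * \<eta>" using K(2) \<eta>(1) by (intro mult_right_mono) auto
        then show "(real CARD('m) * (4 / \<kappa>) * \<eta>) ^ j \<le> (K * \<eta>) ^ j"
          using \<eta> \<kappa> by (intro power_mono) auto
      qed (use \<eta> \<kappa> K in auto)
      finally show ?thesis by simp
    qed
    define P where "P = (\<lambda>\<tau>::complex. \<Sum>j\<le>Suc J. (\<tau> gchoose j) *s ?D j)"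
    \<comment> \<open>The velocity of the interpolating curve at time 0. Since \<open>dj j\<close>
      is the linear coefficient of \<open>\<tau> gchoose j\<close>, this is the logarithmic series
      in the difference operator, cut off after the term of order \<open>Suc J\<close>.\<close>
    define Z where "Z = (\<Sum>j\<le>Suc J. dj j *s ?D j)"
    define T where "T = \<kappa>' / \<eta>"
    have T: "T > 0" "4 * (real (Suc J) + 1) \<le> T"
    proof -
      show "T > 0" using \<kappa>' \<eta> by (simp add: T_def)
      have "\<eta> * (4 * (real J + 2)) \<le> \<kappa>'" using \<eta>s(3) by (simp add: pos_le_divide_eq add_nonneg_pos)
      then show "4 * (real (Suc J) + 1) \<le> T" using \<eta>(1) unfolding T_def by (simp add: pos_le_divide_eq algebra_simps)
    qed
    have x: "(T + real (Suc J)) * (K * \<eta>) \<le> x0"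
    proof -
      have "real (Suc J) \<le> T" using T by simp
      then have "(T + real (Suc J)) * (K * \<eta>) \<le> (2 * T) * (K * \<eta>)" using K \<eta> by (intro mult_right_mono) auto
      also have "\<dots> = x0" using \<eta> \<kappa>'(2) by (simp add: T_def mult_ac)
      finally show ?thesis .
    qed
    have PT: "P \<tau> \<in> ball c0 dlt" if \<tau>: "\<tau> \<in> ball 0 T" for \<tau>
    proof -
      have e: "P \<tau> = c0 + (\<Sum>j\<le>J. (\<tau> gchoose Suc j) *s ?D (Suc j))"
        unfolding P_def by (simp only: sum.atMost_Suc_shift[of _ J]) simp
      have "norm (\<Sum>j\<le>J. (\<tau> gchoose Suc j) *s ?D (Suc j)) \<le> (\<Sum>j\<le>J. x0)"
      proof (rule sum_norm_le)
        fix j assume j: "j \<in> {..J}"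
        have "norm ((\<tau> gchoose Suc j) *s ?D (Suc j)) \<le> (T + real (Suc J)) ^ Suc j * (K * \<eta>) ^ Suc j"
          unfolding norm_vector_scalar_mult using \<tau> j T
          by (intro mult_mono norm_gbinomial_le Dj) (auto intro!: zero_le_power)
        also have "\<dots> = ((T + real (Suc J)) * (K * \<eta>)) ^ Suc j" by (simp add: power_mult_distrib mult_ac)
        also have "\<dots> \<le> x0 ^ Suc j" using x T K \<eta> by (intro power_mono) auto
        also have "\<dots> \<le> x0 ^ 1" using x0 by (intro power_decreasing) auto
        finally show "norm ((\<tau> gchoose Suc j) *s ?D (Suc j)) \<le> x0" by simp
      qed
      also have "\<dots> < dlt" using x0(3) by (simp add: add.commute)
      finally show ?thesis unfolding e by (simp add: dist_norm)
    qed
    have it: "(H ^^ i) c0 \<in> ball c0 (dlt/2)" if "i \<le> Suc J" for i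
    proof -
      have "norm ((H ^^ i) c0 - c0) \<le> real i * \<eta>" using that
      proof (induction i)
        case (Suc i)
        have i\<eta>: "real i * \<eta> < dlt"
        proof -
          have "real i * \<eta> \<le> (real J + 2) * (dlt / (2 * (real J + 2)))" using Suc.prems \<eta>s(4) \<eta>(1) by (intro mult_mono) auto
          also have "\<dots> = dlt/2" by (simp add: field_simps add_nonneg_eq_0_iff)
          finally show ?thesis using dlt by simp
        qed
        have "norm ((H ^^ i) c0 - c0) \<le> real i * \<eta>" using Suc by simp
        then have "(H ^^ i) c0 \<in> ball c0 dlt" using i\<eta> by (simp add: dist_norm norm_minus_commute)
        then have "norm (H ((H ^^ i) c0) - (H ^^ i) c0) \<le> \<eta>" using near by blast
        then have "norm (H ((H ^^ i) c0) - c0) \<le> \<eta> + real i * \<eta>"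
          using Suc norm_triangle_ineq[of "H ((H ^^ i) c0) - (H ^^ i) c0" "(H ^^ i) c0 - c0"] by simp
        then show ?case by (simp add: algebra_simps)
      qed simp
      also have "real i * \<eta> \<le> (real J + 1) * (dlt / (2 * (real J + 2)))" using that \<eta>s(4) \<eta>(1) by (intro mult_mono) auto
      also have "\<dots> < dlt / 2" using dlt by (simp add: field_simps add_pos_nonneg add_nonneg_pos)
      finally show ?thesis by (simp add: dist_norm norm_minus_commute)
    qed
    have Pi: "P (of_nat i) = (H ^^ i) c0" if "i \<le> Suc J" for i
    proof -
      have "P (of_nat i) = (\<Sum>j\<le>Suc J. of_nat (i choose j) *s ?D j)"
        unfolding P_def binomial_gbinomial ..
      also have "\<dots> = (\<Sum>j\<le>i. of_nat (i choose j) *s ?D j)"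
        by (rule sum.mono_neutral_right) (use that in \<open>auto simp: not_le\<close>)
      finally show ?thesis by (simp add: funpow_eq_sum_forward_difference)
    qed
    have Z1: "norm (Z - (H c0 - c0)) \<le> C2 * \<eta>\<^sup>2"
    proof -
      have d0: "dj 0 = 0" "dj (Suc 0) = 1" unfolding dj_def by simp_all
      have "Z = (\<Sum>j\<le>J. dj (Suc j) *s ?D (Suc j))"
        unfolding Z_def by (simp only: sum.atMost_Suc_shift[of _ J] d0) simp
      also have "\<dots> = ?D (Suc 0) + (\<Sum>j\<in>{..J}-{0}. dj (Suc j) *s ?D (Suc j))"
        by (subst sum.remove[of _ 0]) (auto simp: d0)
      finally have "Z - (H c0 - c0) = (\<Sum>j\<in>{..J}-{0}. dj (Suc j) *s ?D (Suc j))" by simp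
      also have "norm \<dots> \<le> (\<Sum>j\<in>{..J}-{0}. norm (dj (Suc j)) * (K ^ Suc J * \<eta>\<^sup>2))"
      proof (rule sum_norm_le)
        fix j assume j: "j \<in> {..J} - {0}"
        have "(K * \<eta>) ^ Suc j = K ^ Suc j * \<eta> ^ Suc j" by (rule power_mult_distrib)
        also have "\<dots> \<le> K ^ Suc J * \<eta>\<^sup>2"
          using j K \<eta> \<eta>s(1) by (intro mult_mono power_increasing power_decreasing) auto
        finally have "norm (?D (Suc j)) \<le> K ^ Suc J * \<eta>\<^sup>2" using Dj[of j] j by auto
        then show "norm (dj (Suc j) *s ?D (Suc j)) \<le> norm (dj (Suc j)) * (K ^ Suc J * \<eta>\<^sup>2)"
          unfolding norm_vector_scalar_mult by (intro mult_left_mono) auto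
      qed
      also have "\<dots> \<le> (\<Sum>j\<le>J. norm (dj (Suc j)) * (K ^ Suc J * \<eta>\<^sup>2))"
        using K \<eta> by (intro sum_mono2) auto
      also have "\<dots> = C2 * \<eta>\<^sup>2" by (simp only: C2_def sum_distrib_right mult.assoc)
      finally show ?thesis .
    qed
    have Z2: "norm (\<Sum>i\<in>UNIV. Z $ i * partial_deriv i G c0) \<le> C3 * (B * \<eta> ^ J + e)"
      if G: "mv_holomorphic_on G (ball c0 dlt)" and B: "\<forall>c\<in>ball c0 dlt. norm (G c) \<le> B"
        and e: "\<forall>c\<in>ball c0 (dlt/2). norm (G (H c) - G c) \<le> e" for G B e
    proof -
      have e0: "0 \<le> e" using e[rule_format, of c0] dlt norm_ge_zero order_trans by (metis centre_in_ball half_gt_zero)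
      have B0: "0 \<le> B" using B[rule_format, of c0] dlt norm_ge_zero order_trans by (metis centre_in_ball)
      \<comment> \<open>Along the interpolating curve \<open>G\<close> is bounded on a disc of
        radius of order \<open>1 / \<eta>\<close> and nearly constant at the integers up to
        \<open>Suc J\<close>, which is the situation of
        \<open>interpolation_derivative_bound\<close>.\<close>
      define u where "u = (\<lambda>\<tau>. G (P \<tau>) - G c0)"
      have dP: "((\<lambda>\<tau>. P \<tau> $ i) has_field_derivative (\<Sum>j\<le>Suc J. deriv (\<lambda>\<tau>. \<tau> gchoose j) \<tau> * ?D j $ i)) (at \<tau>)" for i \<tau>
        unfolding P_def sum_component vector_smult_component
        by (intro DERIV_sum DERIV_cmult_right holomorphic_derivI[OF hg open_UNIV]) auto
      have du: "(u has_field_derivative (\<Sum>i\<in>UNIV. (\<Sum>j\<le>Suc J. deriv (\<lambda>\<tau>. \<tau> gchoose j) \<tau> * ?D j $ i) * partial_deriv i G (P \<tau>))) (at \<tau>)"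
        if "\<tau> \<in> ball 0 T" for \<tau>
        unfolding u_def using DERIV_diff[OF mv_holomorphic_on_curve[where H = P, OF G PT[OF that] dP] DERIV_const] by simp
      have hu: "u holomorphic_on ball 0 T"
        unfolding holomorphic_on_def field_differentiable_def using du has_field_derivative_at_within by blast
      have P0: "P 0 = c0" using Pi[of 0] by simp
      have "deriv u 0 = (\<Sum>i\<in>UNIV. Z $ i * partial_deriv i G c0)"
      proof -
        have z: "(0::complex) \<in> ball 0 T" using T by simp
        show ?thesis using DERIV_imp_deriv[OF du[OF z]]
          by (simp only: P0 Z_def dj_def sum_component vector_smult_component)
      qed
      moreover have "norm (deriv u 0) \<le> C1 * (2 * B / T ^ Suc (Suc J) + real (Suc J) * e)"
      proof (rule C1(2)[rule_format, OF hu T(2)])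
        fix \<tau> :: complex assume "\<tau> \<in> ball 0 T"
        then have "norm (G (P \<tau>)) \<le> B" "norm (G c0) \<le> B" using B PT dlt by auto
        then show "norm (u \<tau>) \<le> 2 * B" using norm_triangle_ineq4[of "G (P \<tau>)" "G c0"] by (simp add: u_def)
      next
        fix i assume i: "i \<le> Suc J"
        have "norm (G ((H ^^ i) c0) - G c0) \<le> real i * e" using i
        proof (induction i)
          case (Suc i)
          have "norm (G (H ((H ^^ i) c0)) - G ((H ^^ i) c0)) \<le> e" using e it[of i] Suc by auto
          then have "norm (G (H ((H ^^ i) c0)) - G c0) \<le> e + real i * e"
            using Suc norm_triangle_ineq[of "G (H ((H ^^ i) c0)) - G ((H ^^ i) c0)" "G ((H ^^ i) c0) - G c0"] by simp
          then show ?case by (simp add: algebra_simps)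
        qed simp
        also have "\<dots> \<le> real (Suc J) * e" using i e0 by (intro mult_right_mono) auto
        finally show "norm (u (of_nat i)) \<le> real (Suc J) * e" using Pi[OF i] by (simp add: u_def)
      qed
      moreover have "\<dots> \<le> C3 * (B * \<eta> ^ J + e)"
      proof -
        define M where "M = max (2 / \<kappa>' ^ Suc (Suc J)) (real (Suc J))"
        \<comment> \<open>The nodes \<open>0, ..., Suc J\<close> provide two more powers of
          \<open>\<eta>\<close> than are kept.\<close>
        have "2 * B / T ^ Suc (Suc J) = 2 / \<kappa>' ^ Suc (Suc J) * (B * \<eta> ^ Suc (Suc J))"
          unfolding T_def power_divide by simp
        also have "\<dots> \<le> M * (B * \<eta> ^ J)"
        proof (rule mult_mono)
          show "B * \<eta> ^ Suc (Suc J) \<le> B * \<eta> ^ J"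
            using B0 \<eta> \<eta>s(1) by (intro mult_left_mono power_decreasing) auto
        qed (use \<kappa>' B0 \<eta> in \<open>auto simp: M_def le_max_iff_disj\<close>)
        finally have "2 * B / T ^ Suc (Suc J) \<le> M * (B * \<eta> ^ J)" .
        moreover have "real (Suc J) * e \<le> M * e" using e0 by (intro mult_right_mono) (auto simp: M_def)
        ultimately have "2 * B / T ^ Suc (Suc J) + real (Suc J) * e \<le> M * (B * \<eta> ^ J + e)"
          unfolding distrib_left by linarith
        then have "C1 * (2 * B / T ^ Suc (Suc J) + real (Suc J) * e) \<le> C1 * (M * (B * \<eta> ^ J + e))"
          using C1(1) by (rule mult_left_mono)
        then show ?thesis by (simp add: C3_def M_def mult.assoc)
      qed
      ultimately show ?thesis by (metis order_trans)
    qed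
    show ?thesis
    proof (intro exI[of _ Z] conjI allI impI)
      have "C2 * \<eta>\<^sup>2 \<le> C * \<eta>\<^sup>2" by (intro mult_right_mono) (auto simp: C_def)
      then show "norm (Z - (H c0 - c0)) \<le> C * \<eta>\<^sup>2" using Z1 by linarith
      fix G B e
      assume G: "mv_holomorphic_on G (ball c0 dlt)" and B: "\<forall>c\<in>ball c0 dlt. norm (G c) \<le> B"
        and e: "\<forall>c\<in>ball c0 (dlt/2). norm (G (H c) - G c) \<le> e"
      have "0 \<le> e" using e[rule_format, of c0] dlt norm_ge_zero order_trans by (metis centre_in_ball half_gt_zero)
      moreover have "0 \<le> B" using B[rule_format, of c0] dlt norm_ge_zero order_trans by (metis centre_in_ball)
      ultimately have "C3 * (B * \<eta> ^ J + e) \<le> C * (B * \<eta> ^ J + e)"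
        using \<eta> by (intro mult_right_mono) (auto simp: C_def)
      then show "norm (\<Sum>i\<in>UNIV. Z $ i * partial_deriv i G c0) \<le> C * (B * \<eta> ^ J + e)"
        using Z2[OF G B e] by linarith
    qed
  qed
  show ?thesis
  proof (rule exI[of _ C], rule exI[of _ \<eta>0], intro conjI allI impI \<eta>00 C0)
    fix \<eta> and H :: "complex^'m \<Rightarrow> complex^'m"
    assume "0 < \<eta>" "\<eta> \<le> \<eta>0" "\<forall>i. mv_holomorphic_on (\<lambda>c. H c $ i) (ball c0 dlt)" "\<forall>c\<in>ball c0 dlt. norm (H c - c) \<le> \<eta>"
    from main[OF this] show "\<exists>Z. norm (Z - (H c0 - c0)) \<le> C * \<eta>\<^sup>2 \<and>
      (\<forall>G B e. mv_holomorphic_on G (ball c0 dlt) \<longrightarrow> (\<forall>c\<in>ball c0 dlt. norm (G c) \<le> B) \<longrightarrow>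
         (\<forall>c\<in>ball c0 (dlt/2). norm (G (H c) - G c) \<le> e) \<longrightarrow>
         norm (\<Sum>i\<in>UNIV. Z $ i * partial_deriv i G c0) \<le> C * (B * \<eta> ^ J + e))" .
  qed
qed

section \<open>Transport along segments\<close>

text \<open>Osgood's criterion: on lines the integral is differentiated under the integral sign by
  Leibniz' rule.\<close>

lemma mv_holomorphic_on_integral:
  fixes q :: "real \<Rightarrow> complex^'m \<Rightarrow> complex"
  assumes S: "open S" and hol: "\<And>x. x \<in> {0..1} \<Longrightarrow> mv_holomorphic_on (q x) S"
    and cont: "continuous_on (S \<times> {0..1}) (\<lambda>(c,x). q x c)"
  shows "mv_holomorphic_on (\<lambda>c. integral {0..1} (\<lambda>x. q x c)) S"
proof -
  have cb: "cbox 0 1 = {0..1::real}" by simp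
  interpret line_holomorphic "\<lambda>c. integral {0..1} (\<lambda>x. q x c)" S
  proof
    show "open S" by (rule S)
    show "continuous_on S (\<lambda>c. integral {0..1} (\<lambda>x. q x c))"
      using integral_continuous_on_param[of S 0 1 "\<lambda>c x. q x c"] cont by simp
    fix z v assume z: "z \<in> S"
    obtain \<rho> where \<rho>: "\<rho> > 0" "ball 0 \<rho> \<subseteq> {ze. z + ze *s v \<in> S}"
      using open_contains_ball[THEN iffD1, OF open_line_vimage[OF S, of z v], rule_format, of 0] z by auto
    let ?U = "ball 0 \<rho> :: complex set"
    have inS: "z + ze *s v \<in> S" if "ze \<in> ?U" for ze using that \<rho> by blast
    have hol1: "(\<lambda>ze. q x (z + ze *s v)) holomorphic_on ?U" if "x \<in> {0..1}" for x
      by (rule holomorphic_on_subset[OF mv_holomorphic_on_line[OF hol[OF that]]]) (use inS in auto)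
    have c1: "continuous_on ({0..1} \<times> ?U) (\<lambda>(x,ze). q x (z + ze *s v))"
    proof -
      have "continuous_on ({0..1} \<times> ?U) (\<lambda>p. (\<lambda>(c,x). q x c) (z + snd p *s v, fst p))"
        by (rule continuous_on_compose2[OF cont]) (use inS in \<open>auto intro!: continuous_intros\<close>)
      then show ?thesis by (simp add: case_prod_unfold)
    qed
    have c2: "continuous_on ({0..1} \<times> ?U) (\<lambda>(x,ze). deriv (\<lambda>ze. q x (z + ze *s v)) ze)"
      by (rule continuous_on_deriv_parametric[OF open_ball hol1 c1])
    have c3: "continuous_on (?U \<times> {0..1}) (\<lambda>(ze,x). deriv (\<lambda>ze. q x (z + ze *s v)) ze)"
    proof -
      have "continuous_on (?U \<times> {0..1}) (\<lambda>p. (\<lambda>(x,ze). deriv (\<lambda>ze. q x (z + ze *s v)) ze) (snd p, fst p))"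
        by (rule continuous_on_compose2[OF c2]) (auto intro!: continuous_intros)
      then show ?thesis by (simp add: case_prod_unfold)
    qed
    have "(\<lambda>ze. integral (cbox 0 1) (\<lambda>x. q x (z + ze *s v))) holomorphic_on ?U"
    proof (rule leibniz_rule_holomorphic)
      show "((\<lambda>ze. q x (z + ze *s v)) has_field_derivative deriv (\<lambda>ze. q x (z + ze *s v)) ze) (at ze within ?U)"
        if "ze \<in> ?U" "x \<in> cbox 0 1" for ze x
        using holomorphic_derivI[OF hol1 open_ball that(1), of x] that(2) has_field_derivative_at_within by auto
      show "(\<lambda>x. q x (z + ze *s v)) integrable_on cbox 0 1" if "ze \<in> ?U" for ze
      proof (rule integrable_continuous)
        have "continuous_on (cbox 0 1) (\<lambda>x. (\<lambda>(x,ze). q x (z + ze *s v)) (x, ze))"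
          by (rule continuous_on_compose2[OF c1]) (use that in \<open>auto intro!: continuous_intros\<close>)
        then show "continuous_on (cbox 0 1) (\<lambda>x. q x (z + ze *s v))" by simp
      qed
    qed (use c3 in auto)
    then show "(\<lambda>ze. integral {0..1} (\<lambda>x. q x (z + ze *s v))) field_differentiable at 0"
      using \<rho> by (simp add: holomorphic_on_imp_differentiable_at)
  qed
  show ?thesis by (rule holomorphic)
qed

text \<open>The Picard iterates use integrals over a fixed interval, so that dependence on
  parameters is covered by the lemmas above; this lemma restores the integral up to
  \<open>s\<close>, which can be differentiated in \<open>s\<close>.\<close>

lemma integral_rescale:
  fixes g :: "real \<Rightarrow> complex"
  assumes "continuous_on {0..1} g" "0 \<le> s" "s \<le> 1"
  shows "integral {0..s} g = of_real s * integral {0..1} (\<lambda>x. g (s * x))"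
proof -
  have "((\<lambda>x. s *\<^sub>R g (s * x)) has_integral (integral {s * 0..s * 1} g)) {0..1}"
  proof (rule has_integral_substitution[where c = 0 and d = 1])
    show "(\<lambda>x. s * x) ` {0..1} \<subseteq> {0..1}" using assms by (auto intro: mult_le_one)
    show "((\<lambda>x. s * x) has_field_derivative s) (at x within {0..1})" for x
      by (auto intro!: derivative_eq_intros)
  qed (use assms in auto)
  from integral_unique[OF this] show ?thesis by (simp add: scaleR_conv_of_real)
qed

lemma has_vector_derivative_vec:
  fixes f :: "real \<Rightarrow> complex^'m"
  assumes "\<And>k. ((\<lambda>s. f s $ k) has_vector_derivative D $ k) F"
  shows "(f has_vector_derivative D) F"
proof -
  have "((\<lambda>s. \<chi> k. f s $ k) has_derivative (\<lambda>h. \<chi> k. h *\<^sub>R D $ k)) F"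
    using assms by (intro has_derivative_vec_lambda) (simp add: has_vector_derivative_def)
  moreover have "(\<lambda>h. \<chi> k. h *\<^sub>R D $ k) = (\<lambda>h. h *\<^sub>R D)" by (simp add: fun_eq_iff vec_eq_iff)
  ultimately show ?thesis by (simp add: has_vector_derivative_def)
qed

lemma norm_integral_le:
  fixes f :: "real \<Rightarrow> complex"
  assumes "continuous_on {0..1} f" "0 \<le> s" "s \<le> 1" "\<And>x. x \<in> {0..s} \<Longrightarrow> norm (f x) \<le> B"
  shows "norm (integral {0..s} f) \<le> B"
proof -
  have "B \<ge> 0" using assms(4)[of 0] assms(2) norm_ge_zero order_trans by (metis atLeastAtMost_iff order_refl)
  have "norm (integral (cbox 0 s) f) \<le> B * measure lborel (cbox 0 s)"
  proof (rule integrable_bound[OF \<open>B \<ge> 0\<close>])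
    show "f integrable_on cbox 0 s"
      using assms by (intro integrable_continuous continuous_on_subset[OF assms(1)]) auto
  qed (use assms in auto)
  also have "\<dots> \<le> B * 1" using assms \<open>B \<ge> 0\<close> by (intro mult_left_mono) auto
  finally show ?thesis by simp
qed

lemma onorm_scaleR_le:
  fixes D :: "'b::real_normed_vector"
  assumes "norm D \<le> b" shows "onorm (\<lambda>h::real. h *\<^sub>R D) \<le> b"
proof (rule onorm_le)
  show "norm (h *\<^sub>R D) \<le> b * norm h" for h :: real
    using mult_left_mono[OF assms, of "\<bar>h\<bar>"] by (simp add: mult.commute)
qed

text \<open>The system with velocity \<open>eps ^ r\<close> times \<open>Y\<close> in the variables
  \<open>c\<close> of variation of constants, its limit field \<open>Y0\<close>, and a set
  \<open>S\<close> of complex times. \<open>G_derivative\<close> combines two facts: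
  \<open>G i eps\<close> is jointly differentiable in time and space, and its derivative vanishes in
  the direction of the flow. The bound \<open>B / eps ^ l\<close> may blow up because first
  integrals can have poles along the unperturbed curve.\<close>

locale slow_system =
  fixes r l :: nat and dlt B :: real and c0 :: "complex^'m"
    and Y :: "real \<Rightarrow> complex \<Rightarrow> complex^'m \<Rightarrow> complex^'m" and Y0 :: "complex \<Rightarrow> complex^'m \<Rightarrow> complex^'m"
    and G :: "'i \<Rightarrow> real \<Rightarrow> complex \<Rightarrow> complex^'m \<Rightarrow> complex" and S :: "complex set"
  assumes r: "1 \<le> r" and dlt: "0 < dlt" "dlt \<le> 1" and B: "0 \<le> B"
    and Y_holomorphic: "\<And>eps t k. 0 < eps \<Longrightarrow> eps < dlt \<Longrightarrow> t \<in> S \<Longrightarrow> mv_holomorphic_on (\<lambda>c. Y eps t c $ k) (ball c0 dlt)"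
    and Y_continuous: "\<And>eps. 0 < eps \<Longrightarrow> eps < dlt \<Longrightarrow> continuous_on (S \<times> ball c0 dlt) (\<lambda>(t,c). Y eps t c)"
    and Y_bound: "\<And>eps t c. 0 < eps \<Longrightarrow> eps < dlt \<Longrightarrow> t \<in> S \<Longrightarrow> c \<in> ball c0 dlt \<Longrightarrow> norm (Y eps t c) \<le> B"
    and Y0_continuous: "continuous_on (S \<times> ball c0 dlt) (\<lambda>(t,c). Y0 t c)"
    and Y_Y0: "\<And>eps t c. 0 < eps \<Longrightarrow> eps < dlt \<Longrightarrow> t \<in> S \<Longrightarrow> c \<in> ball c0 dlt \<Longrightarrow> norm (Y eps t c - Y0 t c) \<le> B * eps"
    and G_derivative: "\<And>i eps t c. 0 < eps \<Longrightarrow> eps < dlt \<Longrightarrow> t \<in> S \<Longrightarrow> c \<in> ball c0 dlt \<Longrightarrow>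
      ((\<lambda>(t,c). G i eps t c) has_derivative
        (\<lambda>(\<tau>,v). \<Sum>k\<in>UNIV. (v - (\<tau> * of_real (eps ^ r)) *s Y eps t c) $ k * partial_deriv k (G i eps t) c)) (at (t,c))"
    and G_bound: "\<And>i eps t c. 0 < eps \<Longrightarrow> eps < dlt \<Longrightarrow> t \<in> S \<Longrightarrow> c \<in> ball c0 dlt \<Longrightarrow> norm (G i eps t c) \<le> B / eps ^ l"
begin

lemma G_holomorphic:
  assumes "0 < eps" "eps < dlt" "t \<in> S"
  shows "mv_holomorphic_on (G i eps t) (ball c0 dlt)"
proof (rule mv_holomorphic_onI[where D = "\<lambda>c k. partial_deriv k (G i eps t) c"])
  fix c assume c: "c \<in> ball c0 dlt"
  have "((\<lambda>c. (t, c)) has_derivative (\<lambda>v. (0, v))) (at c)" by (auto intro!: derivative_eq_intros)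
  from has_derivative_compose[OF this G_derivative[OF assms c]]
  show "(G i eps t has_derivative (\<lambda>v. \<Sum>k\<in>UNIV. v $ k * partial_deriv k (G i eps t) c)) (at c)" by simp
qed

definition regular_displacement :: "(complex^'m \<Rightarrow> complex^'m) \<Rightarrow> bool" where
  "regular_displacement k \<longleftrightarrow> (\<exists>L\<ge>0. \<forall>c\<in>ball c0 (dlt/2). norm (k c) \<le> L \<and>
     (\<forall>c'\<in>ball c0 (dlt/2). norm (k c - k c') \<le> L * norm (c - c')))"

text \<open>The map \<open>H\<close> may depend on the order \<open>M\<close>, since it is a
  truncated solution and not the flow; only its first-order displacement \<open>k\<close> is common
  to all orders. Regularity of \<open>k\<close> belongs to the notion because composition needs a
  Lipschitz constant.\<close>

definition transport :: "complex \<Rightarrow> complex \<Rightarrow> (complex^'m \<Rightarrow> complex^'m) \<Rightarrow> bool" where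
  "transport a b k \<longleftrightarrow> regular_displacement k \<and> (\<forall>M. \<exists>H C d. 0 < d \<and> d \<le> dlt/4 \<and> 0 \<le> C \<and>
     (\<forall>eps. 0 < eps \<longrightarrow> eps < d \<longrightarrow> (\<forall>j. mv_holomorphic_on (\<lambda>c. H eps c $ j) (ball c0 d)) \<and>
        (\<forall>c\<in>ball c0 d. norm (H eps c - c - of_real (eps ^ r) *s k c) \<le> C * eps ^ Suc r \<and>
           (\<forall>i. norm (G i eps b (H eps c) - G i eps a c) \<le> C * eps ^ M))))"

lemma power_r_le: "0 < eps \<Longrightarrow> eps < dlt \<Longrightarrow> eps ^ r \<le> eps"
  using power_decreasing[of 1 r eps] r dlt by simp

text \<open>At order \<open>eps ^ r\<close> the displacements add: evaluating \<open>k2\<close> at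
  the image point instead of \<open>c\<close> costs a multiple of \<open>eps\<close> by its
  Lipschitz constant, hence a multiple of \<open>eps ^ Suc r\<close> in the position.\<close>

lemma transport_compose:
  assumes "transport a b k1" "transport b e k2"
  shows "transport a e (\<lambda>c. k1 c + k2 c)"
proof -
  obtain L1 where L1: "L1 \<ge> 0" "\<And>c. c \<in> ball c0 (dlt/2) \<Longrightarrow> norm (k1 c) \<le> L1"
    "\<And>c c'. c \<in> ball c0 (dlt/2) \<Longrightarrow> c' \<in> ball c0 (dlt/2) \<Longrightarrow> norm (k1 c - k1 c') \<le> L1 * norm (c - c')"
    using assms(1) unfolding transport_def regular_displacement_def by blast
  obtain L2 where L2: "L2 \<ge> 0" "\<And>c. c \<in> ball c0 (dlt/2) \<Longrightarrow> norm (k2 c) \<le> L2"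
    "\<And>c c'. c \<in> ball c0 (dlt/2) \<Longrightarrow> c' \<in> ball c0 (dlt/2) \<Longrightarrow> norm (k2 c - k2 c') \<le> L2 * norm (c - c')"
    using assms(2) unfolding transport_def regular_displacement_def by blast
  have "regular_displacement (\<lambda>c. k1 c + k2 c)"
    unfolding regular_displacement_def
  proof (intro exI[of _ "L1 + L2"] conjI ballI)
    fix c c' assume c: "c \<in> ball c0 (dlt/2)"
    show "norm (k1 c + k2 c) \<le> L1 + L2" using L1(2)[OF c] L2(2)[OF c] norm_triangle_ineq[of "k1 c" "k2 c"] by linarith
    assume c': "c' \<in> ball c0 (dlt/2)"
    have "norm ((k1 c + k2 c) - (k1 c' + k2 c')) \<le> norm (k1 c - k1 c') + norm (k2 c - k2 c')"
      using norm_triangle_ineq[of "k1 c - k1 c'" "k2 c - k2 c'"] by (simp add: algebra_simps)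
    also have "\<dots> \<le> (L1 + L2) * norm (c - c')" using L1(3)[OF c c'] L2(3)[OF c c'] by (simp add: distrib_right)
    finally show "norm ((k1 c + k2 c) - (k1 c' + k2 c')) \<le> (L1 + L2) * norm (c - c')" .
  qed (use L1 L2 in auto)
  moreover have "\<exists>H C d. 0 < d \<and> d \<le> dlt/4 \<and> 0 \<le> C \<and>
     (\<forall>eps. 0 < eps \<longrightarrow> eps < d \<longrightarrow> (\<forall>j. mv_holomorphic_on (\<lambda>c. H eps c $ j) (ball c0 d)) \<and>
        (\<forall>c\<in>ball c0 d. norm (H eps c - c - of_real (eps ^ r) *s (k1 c + k2 c)) \<le> C * eps ^ Suc r \<and>
           (\<forall>i. norm (G i eps e (H eps c) - G i eps a c) \<le> C * eps ^ M)))" for M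
  proof -
    obtain H1 C1 d1 where H1: "0 < d1" "d1 \<le> dlt/4" "0 \<le> C1"
      "\<And>eps j. 0 < eps \<Longrightarrow> eps < d1 \<Longrightarrow> mv_holomorphic_on (\<lambda>c. H1 eps c $ j) (ball c0 d1)"
      "\<And>eps c. 0 < eps \<Longrightarrow> eps < d1 \<Longrightarrow> c \<in> ball c0 d1 \<Longrightarrow> norm (H1 eps c - c - of_real (eps ^ r) *s k1 c) \<le> C1 * eps ^ Suc r"
      "\<And>eps c i. 0 < eps \<Longrightarrow> eps < d1 \<Longrightarrow> c \<in> ball c0 d1 \<Longrightarrow> norm (G i eps b (H1 eps c) - G i eps a c) \<le> C1 * eps ^ M"
      using assms(1)[unfolded transport_def, THEN conjunct2, THEN spec, of M] by (elim exE conjE) blast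
    obtain H2 C2 d2 where H2: "0 < d2" "d2 \<le> dlt/4" "0 \<le> C2"
      "\<And>eps j. 0 < eps \<Longrightarrow> eps < d2 \<Longrightarrow> mv_holomorphic_on (\<lambda>c. H2 eps c $ j) (ball c0 d2)"
      "\<And>eps c. 0 < eps \<Longrightarrow> eps < d2 \<Longrightarrow> c \<in> ball c0 d2 \<Longrightarrow> norm (H2 eps c - c - of_real (eps ^ r) *s k2 c) \<le> C2 * eps ^ Suc r"
      "\<And>eps c i. 0 < eps \<Longrightarrow> eps < d2 \<Longrightarrow> c \<in> ball c0 d2 \<Longrightarrow> norm (G i eps e (H2 eps c) - G i eps b c) \<le> C2 * eps ^ M"
      using assms(2)[unfolded transport_def, THEN conjunct2, THEN spec, of M] by (elim exE conjE) blast
    \<comment> \<open>\<open>A * eps\<close> bounds the distance moved by the first map; the radius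
      \<open>d\<close> below leaves room for it inside the domain of the second.\<close>
    define A where "A = L1 + C1 + 1"
    have A: "A > 0" using L1 H1 by (simp add: A_def)
    define d where "d = min (min d1 (d2/2)) (d2 / (2 * A))"
    have d: "0 < d" "d \<le> d1" "d \<le> d2/2" "A * d \<le> d2/2"
    proof -
      have "d \<le> d2 / (2 * A)" by (simp add: d_def)
      then show "A * d \<le> d2/2" using A by (simp add: field_simps)
    qed (use H1 H2 A in \<open>auto simp: d_def\<close>)
    let ?C = "C2 + C1 + L2 * A"
    show ?thesis
    proof (rule exI[of _ "\<lambda>eps c. H2 eps (H1 eps c)"], rule exI[of _ ?C], rule exI[of _ d], intro conjI allI impI ballI)
      show "0 < d" "d \<le> dlt/4" "0 \<le> ?C" using d H1 H2 L2 A by auto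
      fix eps :: real assume eps: "0 < eps" "eps < d"
      have eps1: "eps < d1" "eps < d2" "eps < dlt" using eps d H1 H2 dlt by auto
      have step: "norm (H1 eps c - c) \<le> A * eps" if "c \<in> ball c0 d" for c
      proof -
        have c: "c \<in> ball c0 d1" "c \<in> ball c0 (dlt/2)" using that d H1 dlt by auto
        have "norm (H1 eps c - c) \<le> norm (H1 eps c - c - of_real (eps ^ r) *s k1 c) + norm (of_real (eps ^ r) *s k1 c)"
          by (rule norm_triangle_sub[of "H1 eps c - c" "of_real (eps ^ r) *s k1 c", unfolded add.commute[of "norm (of_real (eps ^ r) *s k1 c)"]])
        also have "\<dots> \<le> C1 * eps ^ Suc r + eps ^ r * L1"
          using H1(5)[OF eps(1) eps1(1) c(1)] L1(2)[OF c(2)] eps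
          by (intro add_mono) (auto simp: norm_vector_scalar_mult norm_power intro!: mult_left_mono)
        also have "\<dots> \<le> C1 * eps + eps * L1"
        proof (intro add_mono mult_left_mono mult_right_mono)
          show "eps ^ Suc r \<le> eps" using power_decreasing[of 1 "Suc r" eps] eps eps1 dlt by simp
        qed (use L1 H1 power_r_le[OF eps(1) eps1(3)] in auto)
        also have "\<dots> \<le> A * eps" using eps by (simp add: A_def algebra_simps)
        finally show ?thesis .
      qed
      have in2: "H1 eps c \<in> ball c0 d2" if "c \<in> ball c0 d" for c
      proof -
        have "A * eps \<le> A * d" using eps A by (intro mult_left_mono) auto
        then have "norm (H1 eps c - c) \<le> d2/2" using step[OF that] d by linarith
        then show ?thesis using that d dist_triangle[of c0 "H1 eps c" c] by (auto simp: dist_norm norm_minus_commute)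
      qed
      show "mv_holomorphic_on (\<lambda>c. H2 eps (H1 eps c) $ j) (ball c0 d)" for j
      proof (rule mv_holomorphic_on_compose[OF H2(4)[OF eps(1) eps1(2)]])
        show "mv_holomorphic_on (\<lambda>z. H1 eps z $ i) (ball c0 d)" for i
          by (rule mv_holomorphic_on_subset[OF H1(4)[OF eps(1) eps1(1)]]) (use d in auto)
      qed (use in2 in auto)
      fix c assume c: "c \<in> ball c0 d"
      have c1: "c \<in> ball c0 d1" using c d by auto
      have c2: "c \<in> ball c0 (dlt/2)" "H1 eps c \<in> ball c0 (dlt/2)" using c1 H1(2) H2(2) in2[OF c] dlt by auto
      have "H2 eps (H1 eps c) - c - of_real (eps ^ r) *s (k1 c + k2 c)
         = (H2 eps (H1 eps c) - H1 eps c - of_real (eps ^ r) *s k2 (H1 eps c)) + (H1 eps c - c - of_real (eps ^ r) *s k1 c)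
          + of_real (eps ^ r) *s (k2 (H1 eps c) - k2 c)"
        by (simp add: vec_eq_iff algebra_simps)
      also have "norm \<dots> \<le> C2 * eps ^ Suc r + C1 * eps ^ Suc r + eps ^ r * (L2 * (A * eps))"
      proof (intro order_trans[OF norm_triangle_ineq] add_mono)
        show "norm (H2 eps (H1 eps c) - H1 eps c - of_real (eps ^ r) *s k2 (H1 eps c)) \<le> C2 * eps ^ Suc r"
          by (rule H2(5)[OF eps(1) eps1(2) in2[OF c]])
        show "norm (H1 eps c - c - of_real (eps ^ r) *s k1 c) \<le> C1 * eps ^ Suc r"
          by (rule H1(5)[OF eps(1) eps1(1) c1])
        have "norm (k2 (H1 eps c) - k2 c) \<le> L2 * (A * eps)"
          using L2(3)[OF c2(2,1)] mult_left_mono[OF step[OF c] L2(1)] by linarith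
        then show "norm (of_real (eps ^ r) *s (k2 (H1 eps c) - k2 c)) \<le> eps ^ r * (L2 * (A * eps))"
          unfolding norm_vector_scalar_mult using eps by (simp add: norm_power mult_left_mono)
      qed
      also have "\<dots> = ?C * eps ^ Suc r" by (simp add: algebra_simps)
      finally show "norm (H2 eps (H1 eps c) - c - of_real (eps ^ r) *s (k1 c + k2 c)) \<le> ?C * eps ^ Suc r" .
      fix i
      have "norm (G i eps e (H2 eps (H1 eps c)) - G i eps a c)
        \<le> norm (G i eps e (H2 eps (H1 eps c)) - G i eps b (H1 eps c)) + norm (G i eps b (H1 eps c) - G i eps a c)"
        using norm_triangle_ineq[of "G i eps e (H2 eps (H1 eps c)) - G i eps b (H1 eps c)" "G i eps b (H1 eps c) - G i eps a c"] by simp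
      also have "\<dots> \<le> C2 * eps ^ M + C1 * eps ^ M"
        by (intro add_mono H2(6)[OF eps(1) eps1(2) in2[OF c]] H1(6)[OF eps(1) eps1(1) c1])
      also have "\<dots> \<le> ?C * eps ^ M" using L2 A eps by (simp add: distrib_right)
      finally show "norm (G i eps e (H2 eps (H1 eps c)) - G i eps a c) \<le> ?C * eps ^ M" .
    qed
  qed
  ultimately show ?thesis unfolding transport_def by blast
qed

text \<open>One constant that dominates the size of \<open>Y\<close>, its Lipschitz constant from
  Cauchy's inequality and the dimension factors on a segment with direction \<open>w\<close>, so
  that each Picard step contributes a factor \<open>eps ^ r * seg_const w\<close>. The summand 1
  keeps it positive for \<open>w = 0\<close>.\<close>

definition seg_const :: "complex \<Rightarrow> real" where
  "seg_const w = real CARD('m) * norm w * (4 * B / dlt * (1 + real CARD('m)) + B) + 1"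

text \<open>Picard iterates for the equation \<open>c' = eps\<^sup>r Y eps t c\<close> along the segment from \<open>a\<close> to \<open>a + w\<close>.\<close>

primrec picard :: "real \<Rightarrow> complex \<Rightarrow> complex \<Rightarrow> nat \<Rightarrow> real \<Rightarrow> complex^'m \<Rightarrow> complex^'m" where
  "picard eps a w 0 s c = c"
| "picard eps a w (Suc i) s c = (\<chi> k. c $ k + of_real (eps ^ r) * w *
      (of_real s * integral {0..1} (\<lambda>x. Y eps (a + of_real (s * x) * w) (picard eps a w i (s * x) c) $ k)))"

declare picard.simps(2) [simp del]

context
  fixes eps :: real and a w :: complex
  assumes eps: "0 < eps" "eps < dlt" and seg: "\<And>s. 0 \<le> s \<Longrightarrow> s \<le> 1 \<Longrightarrow> a + of_real s * w \<in> S"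
    and small: "eps ^ r * seg_const w \<le> dlt / 4"
begin

abbreviation (input) "P i s c \<equiv> picard eps a w i s c"
abbreviation (input) "tt s \<equiv> a + of_real s * w"
abbreviation (input) "\<mu> \<equiv> eps ^ r"

lemma seg_const_pos: "1 \<le> seg_const w"
  unfolding seg_const_def using B dlt by simp

lemma \<mu>_pos: "0 < \<mu>" using eps by simp

lemma scaled_norm_le: "norm z \<le> b \<Longrightarrow> norm (of_real \<mu> * w * z) \<le> \<mu> * norm w * b"
  using \<mu>_pos unfolding norm_mult norm_of_real by (simp add: mult_left_mono)

lemma A_bounds:
  "real CARD('m) * norm w * B \<le> seg_const w"
  "real CARD('m) * norm w * (4 * B / dlt) \<le> seg_const w"
  "real CARD('m) * norm w * (real CARD('m) * (4 * B / dlt)) \<le> seg_const w"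
proof -
  have nn: "0 \<le> real CARD('m) * norm w" by simp
  have aux: "B \<le> q * (1 + n) + B" "q \<le> q * (1 + n) + B" "n * q \<le> q * (1 + n) + B" if "0 \<le> q" "0 \<le> n" for q n :: real
    using that B mult_nonneg_nonneg[OF that] by (simp_all add: distrib_left mult.commute)
  have "B \<le> 4 * B / dlt * (1 + real CARD('m)) + B" "4 * B / dlt \<le> 4 * B / dlt * (1 + real CARD('m)) + B"
    "real CARD('m) * (4 * B / dlt) \<le> 4 * B / dlt * (1 + real CARD('m)) + B"
    using B dlt by (intro aux; simp)+
  from this[THEN mult_left_mono, OF nn]
  show "real CARD('m) * norm w * B \<le> seg_const w"
    "real CARD('m) * norm w * (4 * B / dlt) \<le> seg_const w"
    "real CARD('m) * norm w * (real CARD('m) * (4 * B / dlt)) \<le> seg_const w"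
    unfolding seg_const_def by linarith+
qed

lemma Y_lipschitz:
  assumes "t \<in> S" "c \<in> ball c0 (dlt/2)" "c' \<in> ball c0 (dlt/2)"
  shows "norm (Y eps t c $ k - Y eps t c' $ k) \<le> 4 * B / dlt * norm (c - c')"
proof -
  have "norm (Y eps t c $ k - Y eps t c' $ k) \<le> 2 * B / (dlt/2) * norm (c - c')"
  proof (rule mv_holomorphic_lipschitz[OF Y_holomorphic[OF eps assms(1)], where C = "ball c0 (dlt/2)"])
    show "ball x (dlt/2) \<subseteq> ball c0 dlt" if "x \<in> ball c0 (dlt/2)" for x
    proof
      fix y assume "y \<in> ball x (dlt/2)"
      then show "y \<in> ball c0 dlt" using that dist_triangle[of c0 y x] by auto
    qed
    show "norm (Y eps t x $ k) \<le> B" if "x \<in> ball c0 dlt" for x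
      using Y_bound[OF eps assms(1) that] Finite_Cartesian_Product.norm_nth_le[of "Y eps t x" k] by linarith
  qed (use assms dlt in auto)
  then show ?thesis by simp
qed

text \<open>Continuity, smallness and holomorphy have to be proved together: an iterate can be
  inserted into \<open>Y\<close> only if it stays in the domain, and the parameter integral asks for
  joint continuity in time and initial value.\<close>

lemma picard_props:
  "continuous_on ({0..1} \<times> ball c0 (dlt/4)) (\<lambda>(s,c). P i s c) \<and>
   (\<forall>s\<in>{0..1}. \<forall>c\<in>ball c0 (dlt/4). norm (P i s c - c) \<le> \<mu> * seg_const w) \<and>
   (\<forall>s\<in>{0..1}. \<forall>k. mv_holomorphic_on (\<lambda>c. P i s c $ k) (ball c0 (dlt/4)))"
proof (induction i)
  case 0
  have "continuous_on ({0..1} \<times> ball c0 (dlt/4)) (\<lambda>(s,c). c)" unfolding case_prod_unfold by (intro continuous_intros)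
  then show ?case using \<mu>_pos seg_const_pos by (auto intro!: mv_holomorphic_intros)
next
  case (Suc i)
  let ?D = "ball c0 (dlt/4)"
  have cP: "continuous_on ({0..1} \<times> ?D) (\<lambda>(s,c). P i s c)"
    and hP: "\<And>s k. s \<in> {0..1} \<Longrightarrow> mv_holomorphic_on (\<lambda>c. P i s c $ k) ?D"
    using Suc by blast+
  have inb: "P i s c \<in> ball c0 (dlt/2)" "P i s c \<in> ball c0 dlt" if "s \<in> {0..1}" "c \<in> ?D" for s c
  proof -
    have "norm (P i s c - c) \<le> dlt/4" using Suc that small by force
    then show "P i s c \<in> ball c0 (dlt/2)"
      using that dist_triangle[of c0 "P i s c" c] by (auto simp: dist_norm norm_minus_commute)
    then show "P i s c \<in> ball c0 dlt" using dlt by auto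
  qed
  let ?q = "\<lambda>k s c x. Y eps (tt (s * x)) (P i (s * x) c) $ k"
  have sx: "s * x \<in> {0..1}" if "s \<in> {0..1}" "x \<in> {0..1}" for s x :: real using that by (auto intro: mult_le_one)
  have cq: "continuous_on (({0..1} \<times> ?D) \<times> {0..1}) (\<lambda>(p,x). ?q k (fst p) (snd p) x)" for k
  proof -
    have c1: "continuous_on (({0..1} \<times> ?D) \<times> {0..1}) (\<lambda>u. (\<lambda>(s,c). P i s c) (fst (fst u) * snd u, snd (fst u)))"
      by (rule continuous_on_compose2[OF cP]) (use sx in \<open>auto intro!: continuous_intros intro: mult_le_one\<close>)
    have "continuous_on (({0..1} \<times> ?D) \<times> {0..1})
       (\<lambda>u. (\<lambda>(t,c). Y eps t c) (tt (fst (fst u) * snd u), P i (fst (fst u) * snd u) (snd (fst u))))"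
    proof (rule continuous_on_compose2[OF Y_continuous[OF eps]])
      show "continuous_on (({0..1} \<times> ?D) \<times> {0..1}) (\<lambda>u. (tt (fst (fst u) * snd u), P i (fst (fst u) * snd u) (snd (fst u))))"
        using c1 by (intro continuous_intros) auto
      show "(\<lambda>u. (tt (fst (fst u) * snd u), P i (fst (fst u) * snd u) (snd (fst u)))) ` (({0..1} \<times> ?D) \<times> {0..1}) \<subseteq> S \<times> ball c0 dlt"
      proof (rule image_subsetI)
        fix u :: "(real \<times> (complex^'m)) \<times> real" assume "u \<in> ({0..1} \<times> ?D) \<times> {0..1}"
        then have u: "fst (fst u) \<in> {0..1}" "snd (fst u) \<in> ?D" "snd u \<in> {0..1}" by auto
        show "(tt (fst (fst u) * snd u), P i (fst (fst u) * snd u) (snd (fst u))) \<in> S \<times> ball c0 dlt"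
          using seg[of "fst (fst u) * snd u"] inb(2)[OF sx[OF u(1,3)] u(2)] sx[OF u(1,3)] by auto
      qed
    qed
    then have "continuous_on (({0..1} \<times> ?D) \<times> {0..1}) (\<lambda>u. Y eps (tt (fst (fst u) * snd u)) (P i (fst (fst u) * snd u) (snd (fst u))) $ k)"
      by (intro continuous_intros) (simp add: case_prod_unfold)
    then show ?thesis by (simp add: case_prod_unfold)
  qed
  have cI: "continuous_on ({0..1} \<times> ?D) (\<lambda>p. integral {0..1} (\<lambda>x. ?q k (fst p) (snd p) x))" for k
    using integral_continuous_on_param[of "{0..1} \<times> ?D" 0 1 "\<lambda>p x. ?q k (fst p) (snd p) x"] cq[of k] by simp
  have "continuous_on ({0..1} \<times> ?D) (\<lambda>p. P (Suc i) (fst p) (snd p))"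
    using cI by (simp only: picard.simps) (intro continuous_intros; simp)
  then have 1: "continuous_on ({0..1} \<times> ?D) (\<lambda>(s,c). P (Suc i) s c)" by (simp add: case_prod_unfold)
  have cqs: "continuous_on (?D \<times> {0..1}) (\<lambda>(c,x). ?q k s c x)" if "s \<in> {0..1}" for s k
  proof -
    have "continuous_on (?D \<times> {0..1}) (\<lambda>u. (\<lambda>(p,x). ?q k (fst p) (snd p) x) ((s, fst u), snd u))"
      by (rule continuous_on_compose2[OF cq]) (use that in \<open>auto intro!: continuous_intros\<close>)
    then show ?thesis by (simp add: case_prod_unfold)
  qed
  have 2: "norm (P (Suc i) s c - c) \<le> \<mu> * seg_const w" if s: "s \<in> {0..1}" and c: "c \<in> ?D" for s c
  proof -
    have "norm ((P (Suc i) s c - c) $ k) \<le> \<mu> * norm w * B" for k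
    proof -
      have cc: "continuous_on {0..1} (\<lambda>x. ?q k s c x)"
      proof -
        have "continuous_on {0..1} (\<lambda>x. (\<lambda>(c,x). ?q k s c x) (c, x))"
          by (rule continuous_on_compose2[OF cqs[OF s]]) (use c in \<open>auto intro!: continuous_intros\<close>)
        then show ?thesis by simp
      qed
      have "norm (integral {0..1} (\<lambda>x. ?q k s c x)) \<le> B"
      proof (rule norm_integral_le[OF cc])
        fix x :: real assume x: "x \<in> {0..1}"
        have "norm (?q k s c x) \<le> norm (Y eps (tt (s * x)) (P i (s * x) c))" by (rule Finite_Cartesian_Product.norm_nth_le)
        also have "\<dots> \<le> B" using seg[of "s * x"] sx[OF s x] inb(2)[OF sx[OF s x] c] by (intro Y_bound[OF eps]) auto
        finally show "norm (?q k s c x) \<le> B" .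
      qed auto
      then have "norm (of_real s * integral {0..1} (\<lambda>x. ?q k s c x)) \<le> 1 * B"
        unfolding norm_mult using s by (intro mult_mono) auto
      from scaled_norm_le[OF this] show ?thesis by (simp add: picard.simps(2))
    qed
    then have "norm (P (Suc i) s c - c) \<le> real CARD('m) * (\<mu> * norm w * B)" by (rule norm_le_of_components)
    also have "\<dots> = \<mu> * (real CARD('m) * norm w * B)" by simp
    also have "\<dots> \<le> \<mu> * seg_const w" using A_bounds \<mu>_pos by (intro mult_left_mono) auto
    finally show ?thesis .
  qed
  have 3: "mv_holomorphic_on (\<lambda>c. P (Suc i) s c $ k) ?D" if s: "s \<in> {0..1}" for s k
  proof -
    have "mv_holomorphic_on (\<lambda>c. integral {0..1} (\<lambda>x. ?q k s c x)) ?D"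
    proof (rule mv_holomorphic_on_integral[OF open_ball _ cqs[OF s]])
      fix x :: real assume x: "x \<in> {0..1}"
      show "mv_holomorphic_on (\<lambda>c. ?q k s c x) ?D"
        by (rule mv_holomorphic_on_compose[OF Y_holomorphic[OF eps] hP[OF sx[OF s x]]])
           (use seg[of "s * x"] sx[OF s x] inb(2) in auto)
    qed
    then have "mv_holomorphic_on (\<lambda>c. c $ k + of_real \<mu> * w * (of_real s * integral {0..1} (\<lambda>x. ?q k s c x))) ?D"
      by (intro mv_holomorphic_intros)
    then show ?thesis by (simp add: picard.simps(2))
  qed
  show ?case using 1 2 3 by blast
qed

lemma picard_in_ball:
  assumes "s \<in> {0..1}" "c \<in> ball c0 (dlt/4)"
  shows "P i s c \<in> ball c0 (dlt/2)" "P i s c \<in> ball c0 dlt"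
proof -
  have "norm (P i s c - c) \<le> \<mu> * seg_const w" using picard_props[of i] assms by blast
  then have "norm (P i s c - c) \<le> dlt/4" using small by linarith
  then show "P i s c \<in> ball c0 (dlt/2)"
    using assms dist_triangle[of c0 "P i s c" c] by (auto simp: dist_norm norm_minus_commute)
  then show "P i s c \<in> ball c0 dlt" using dlt by auto
qed

lemma continuous_Y_picard:
  assumes c: "c \<in> ball c0 (dlt/4)"
  shows "continuous_on {0..1} (\<lambda>x. Y eps (tt x) (P i x c))"
proof -
  have cP: "continuous_on ({0..1} \<times> ball c0 (dlt/4)) (\<lambda>(s,c). P i s c)" using picard_props by blast
  have "continuous_on {0..1} (\<lambda>x. (\<lambda>(s,c). P i s c) (x, c))"
    by (rule continuous_on_compose2[OF cP]) (use c in \<open>auto intro!: continuous_intros\<close>)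
  then have c1: "continuous_on {0..1} (\<lambda>x. P i x c)" by simp
  have "continuous_on {0..1} (\<lambda>x. (\<lambda>(t,c). Y eps t c) (tt x, P i x c))"
    by (rule continuous_on_compose2[OF Y_continuous[OF eps]])
       (use seg picard_in_ball(2)[OF _ c] in \<open>auto intro!: continuous_intros c1\<close>)
  then show ?thesis by simp
qed

lemma picard_Suc_eq:
  assumes "s \<in> {0..1}" and c: "c \<in> ball c0 (dlt/4)"
  shows "P (Suc i) s c $ k = c $ k + of_real \<mu> * w * integral {0..s} (\<lambda>x. Y eps (tt x) (P i x c) $ k)"
proof -
  have "continuous_on {0..1} (\<lambda>x. Y eps (tt x) (P i x c) $ k)"
    by (intro continuous_intros continuous_Y_picard c)
  from integral_rescale[OF this, of s] assms(1) show ?thesis by (simp add: picard.simps(2))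
qed

lemma picard_has_vector_derivative:
  assumes s: "s \<in> {0..1}" and c: "c \<in> ball c0 (dlt/4)"
  shows "((\<lambda>s. P (Suc i) s c) has_vector_derivative (of_real \<mu> * w) *s Y eps (tt s) (P i s c)) (at s within {0..1})"
proof (rule has_vector_derivative_vec)
  fix k
  have cont: "continuous_on {0..1} (\<lambda>x. Y eps (tt x) (P i x c) $ k)"
    by (intro continuous_intros continuous_Y_picard c)
  have "((\<lambda>s. integral {0..s} (\<lambda>x. Y eps (tt x) (P i x c) $ k)) has_vector_derivative Y eps (tt s) (P i s c) $ k) (at s within {0..1})"
    by (rule integral_has_vector_derivative[OF cont s])
  then have "((\<lambda>s. c $ k + of_real \<mu> * w * integral {0..s} (\<lambda>x. Y eps (tt x) (P i x c) $ k)) has_vector_derivative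
     of_real \<mu> * w * Y eps (tt s) (P i s c) $ k) (at s within {0..1})"
    by (auto intro!: derivative_eq_intros)
  then have "((\<lambda>s. P (Suc i) s c $ k) has_vector_derivative
     of_real \<mu> * w * Y eps (tt s) (P i s c) $ k) (at s within {0..1})"
    by (rule has_vector_derivative_transform[rotated 2]) (use s picard_Suc_eq[OF _ c] in auto)
  then show "((\<lambda>s. P (Suc i) s c $ k) has_vector_derivative
     ((of_real \<mu> * w) *s Y eps (tt s) (P i s c)) $ k) (at s within {0..1})" by simp
qed

text \<open>The usual contraction count: the Lipschitz estimate for \<open>Y\<close> multiplies the
  previous difference by at most \<open>eps ^ r * seg_const w\<close>.\<close>

lemma picard_diff:
  assumes "s \<in> {0..1}" and c: "c \<in> ball c0 (dlt/4)"
  shows "norm (P (Suc i) s c - P i s c) \<le> (\<mu> * seg_const w) ^ Suc i"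
  using assms(1)
proof (induction i arbitrary: s)
  case 0
  have "norm (P (Suc 0) s c - c) \<le> \<mu> * seg_const w" using picard_props[of "Suc 0"] 0 c by blast
  then show ?case by simp
next
  case (Suc i)
  let ?q = "(\<mu> * seg_const w) ^ Suc i"
  have q0: "0 \<le> ?q" using \<mu>_pos seg_const_pos by simp
  have "norm ((P (Suc (Suc i)) s c - P (Suc i) s c) $ k) \<le> \<mu> * norm w * (4 * B / dlt * ?q)" for k
  proof -
    let ?f = "\<lambda>i x. Y eps (tt x) (P i x c) $ k"
    have cont: "continuous_on {0..1} (?f i)" for i by (intro continuous_intros continuous_Y_picard c)
    have int: "?f i integrable_on {0..s}" for i
      using continuous_on_subset[OF cont, of "{0..s}"] Suc.prems by (intro integrable_continuous_interval) auto
    have eq: "(P (Suc (Suc i)) s c - P (Suc i) s c) $ k = of_real \<mu> * w * integral {0..s} (\<lambda>x. ?f (Suc i) x - ?f i x)"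
      unfolding vector_minus_component picard_Suc_eq[OF Suc.prems c] integral_diff[OF int int] by (simp add: algebra_simps)
    have bd: "norm (integral {0..s} (\<lambda>x. ?f (Suc i) x - ?f i x)) \<le> 4 * B / dlt * ?q"
    proof (rule norm_integral_le)
      show "continuous_on {0..1} (\<lambda>x. ?f (Suc i) x - ?f i x)" by (intro continuous_on_diff cont)
      fix x assume x: "x \<in> {0..s}"
      then have x1: "x \<in> {0..1}" using Suc.prems by auto
      have "norm (?f (Suc i) x - ?f i x) \<le> 4 * B / dlt * norm (P (Suc i) x c - P i x c)"
        using x1 by (intro Y_lipschitz seg picard_in_ball c) auto
      also have "\<dots> \<le> 4 * B / dlt * ?q" using Suc.IH[OF x1] B dlt by (intro mult_left_mono) auto
      finally show "norm (?f (Suc i) x - ?f i x) \<le> 4 * B / dlt * ?q" .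
    qed (use Suc.prems in auto)
    show ?thesis unfolding eq by (rule scaled_norm_le[OF bd])
  qed
  then have "norm (P (Suc (Suc i)) s c - P (Suc i) s c) \<le> real CARD('m) * (\<mu> * norm w * (4 * B / dlt * ?q))"
    by (rule norm_le_of_components)
  also have "\<dots> = \<mu> * (real CARD('m) * norm w * (4 * B / dlt)) * ?q" by simp
  also have "\<dots> \<le> \<mu> * seg_const w * ?q" using A_bounds \<mu>_pos q0 by (intro mult_right_mono mult_left_mono) auto
  finally show ?case by simp
qed

text \<open>The iterate of index \<open>Suc I\<close> moves with the velocity prescribed at the
  iterate of index \<open>I\<close>. As the derivative of \<open>G\<close> vanishes in the direction
  of the flow, only the mismatch of the two values of \<open>Y\<close> contributes. By
  \<open>picard_diff\<close> it has high order in \<open>eps ^ r\<close>, while Cauchy's inequality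
  for \<open>G\<close> costs the fixed factor \<open>1 / eps ^ l\<close>.\<close>

lemma picard_almost_invariant:
  assumes c: "c \<in> ball c0 (dlt/4)"
  shows "norm (G i eps (a + w) (P (Suc I) 1 c) - G i eps a c) \<le> 4 * B / dlt / eps ^ l * (\<mu> * seg_const w) ^ Suc (Suc I)"
proof -
  let ?\<phi> = "\<lambda>s. G i eps (tt s) (P (Suc I) s c)"
  let ?v = "\<lambda>s. (w * of_real \<mu>) *s (Y eps (tt s) (P I s c) - Y eps (tt s) (P (Suc I) s c))"
  let ?D = "\<lambda>s. \<Sum>k\<in>UNIV. ?v s $ k * partial_deriv k (G i eps (tt s)) (P (Suc I) s c)"
  have d: "(?\<phi> has_derivative (\<lambda>h. h *\<^sub>R ?D s)) (at s within {0..1})" if s: "s \<in> {0..1}" for s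
  proof -
    let ?p = "\<lambda>s. (tt s, P (Suc I) s c)"
    have "((\<lambda>s. P (Suc I) s c) has_derivative (\<lambda>h. h *\<^sub>R ((of_real \<mu> * w) *s Y eps (tt s) (P I s c)))) (at s within {0..1})"
      using picard_has_vector_derivative[OF s c] by (simp add: has_vector_derivative_def)
    then have dp: "(?p has_derivative (\<lambda>h. (of_real h * w, h *\<^sub>R ((of_real \<mu> * w) *s Y eps (tt s) (P I s c))))) (at s within {0..1})"
      by (intro has_derivative_Pair) (auto intro!: derivative_eq_intros)
    have inS: "tt s \<in> S" "P (Suc I) s c \<in> ball c0 dlt" using seg s picard_in_ball(2)[OF s c] by auto
    have "((\<lambda>s. (\<lambda>(t,c). G i eps t c) (?p s)) has_derivative
      (\<lambda>h. (\<lambda>(\<tau>,v). \<Sum>k\<in>UNIV. (v - (\<tau> * of_real (eps ^ r)) *s Y eps (tt s) (P (Suc I) s c)) $ k * partial_deriv k (G i eps (tt s)) (P (Suc I) s c))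
        (of_real h * w, h *\<^sub>R ((of_real \<mu> * w) *s Y eps (tt s) (P I s c))))) (at s within {0..1})"
      by (rule has_derivative_compose[OF dp G_derivative[OF eps inS]])
    note D = this[unfolded prod.case]
    have pt: "(h *\<^sub>R ((of_real \<mu> * w) *s y) - (of_real h * w * of_real \<mu>) *s y') $ k = h *\<^sub>R ((w * of_real \<mu>) *s (y - y')) $ k"
      for h :: real and y y' :: "complex^'m" and k
      unfolding vector_minus_component vector_scaleR_component vector_smult_component
      by (simp add: scaleR_conv_of_real algebra_simps)
    show ?thesis
      by (rule has_derivative_eq_rhs[OF D]) (simp only: pt scaleR_sum_right mult_scaleR_left)
  qed
  have b: "norm (?D s) \<le> 4 * B / dlt / eps ^ l * (\<mu> * seg_const w) ^ Suc (Suc I)" if s: "s \<in> {0..1}" for s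
  proof -
    let ?x = "P (Suc I) s c"
    have sub: "ball ?x (dlt/2) \<subseteq> ball c0 dlt"
    proof
      fix y assume "y \<in> ball ?x (dlt/2)"
      then show "y \<in> ball c0 dlt" using picard_in_ball(1)[OF s c, of "Suc I"] dist_triangle[of c0 y ?x] by auto
    qed
    have tS: "tt s \<in> S" using seg s by auto
    have "norm (?D s) \<le> 2 * (B / eps ^ l) * norm (?v s) / (dlt/2)"
      by (rule directional_derivative_bound[OF mv_holomorphic_on_subset[OF G_holomorphic[OF eps tS] sub]])
         (use dlt sub in \<open>auto intro!: G_bound[OF eps tS]\<close>)
    also have "\<dots> = 4 * B / dlt / eps ^ l * norm (?v s)" using dlt eps by (simp add: field_simps)
    also have "\<dots> \<le> 4 * B / dlt / eps ^ l * (\<mu> * seg_const w) ^ Suc (Suc I)"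
    proof (rule mult_left_mono)
      let ?q = "(\<mu> * seg_const w) ^ Suc I"
      have q0: "0 \<le> ?q" using \<mu>_pos seg_const_pos by simp
      have "norm ((Y eps (tt s) (P I s c) - Y eps (tt s) ?x) $ k) \<le> 4 * B / dlt * ?q" for k
      proof -
        have "norm (Y eps (tt s) (P I s c) $ k - Y eps (tt s) ?x $ k) \<le> 4 * B / dlt * norm (P I s c - ?x)"
          by (intro Y_lipschitz tS picard_in_ball s c)
        also have "\<dots> \<le> 4 * B / dlt * ?q" using picard_diff[OF s c, of I] B dlt
          by (intro mult_left_mono) (auto simp: norm_minus_commute)
        finally show ?thesis by simp
      qed
      then have "norm (Y eps (tt s) (P I s c) - Y eps (tt s) ?x) \<le> real CARD('m) * (4 * B / dlt * ?q)"
        by (rule norm_le_of_components)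
      then have "norm w * \<mu> * norm (Y eps (tt s) (P I s c) - Y eps (tt s) ?x) \<le> norm w * \<mu> * (real CARD('m) * (4 * B / dlt * ?q))"
        by (rule mult_left_mono) (use \<mu>_pos in simp)
      then have "norm (?v s) \<le> norm w * \<mu> * (real CARD('m) * (4 * B / dlt * ?q))"
        by (simp only: norm_vector_scalar_mult norm_mult norm_of_real abs_of_pos[OF \<mu>_pos])
      also have "\<dots> = \<mu> * (real CARD('m) * norm w * (4 * B / dlt)) * ?q" by simp
      also have "\<dots> \<le> \<mu> * seg_const w * ?q" using A_bounds \<mu>_pos q0 by (intro mult_right_mono mult_left_mono) auto
      finally show "norm (?v s) \<le> (\<mu> * seg_const w) ^ Suc (Suc I)" by simp
    qed (use B dlt eps in auto)
    finally show ?thesis .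
  qed
  have "norm (?\<phi> 1 - ?\<phi> 0) \<le> 4 * B / dlt / eps ^ l * (\<mu> * seg_const w) ^ Suc (Suc I) * norm (1 - 0 :: real)"
  proof (rule differentiable_bound[where S = "{0..1}" and f' = "\<lambda>s h. h *\<^sub>R ?D s"])
    show "onorm (\<lambda>h. h *\<^sub>R ?D s) \<le> 4 * B / dlt / eps ^ l * (\<mu> * seg_const w) ^ Suc (Suc I)" if "s \<in> {0..1}" for s
      by (rule onorm_scaleR_le[OF b[OF that]])
  qed (use d in auto)
  moreover have "P (Suc I) 0 c = c" by (simp add: picard.simps(2) vec_eq_iff)
  ultimately show ?thesis by simp
qed

text \<open>At leading order the iterate may be replaced by \<open>c\<close>, with an error of order
  \<open>eps ^ r\<close>, and \<open>Y\<close> by \<open>Y0\<close>, with an error of order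
  \<open>eps\<close>; both are at most of order \<open>eps\<close> because
  \<open>1 \<le> r\<close>.\<close>

lemma picard_displacement:
  assumes c: "c \<in> ball c0 (dlt/4)"
  shows "norm (P (Suc I) 1 c - c - of_real \<mu> *s (\<chi> k. w * integral {0..1} (\<lambda>x. Y0 (tt x) c $ k)))
    \<le> (seg_const w * seg_const w + seg_const w) * eps ^ Suc r"
proof -
  have cdlt: "c \<in> ball c0 dlt" "c \<in> ball c0 (dlt/2)" using c dlt by auto
  have cY0: "continuous_on {0..1} (\<lambda>x. Y0 (tt x) c)"
  proof -
    have "continuous_on {0..1} (\<lambda>x. (\<lambda>(t,c). Y0 t c) (tt x, c))"
      by (rule continuous_on_compose2[OF Y0_continuous]) (use seg cdlt in \<open>auto intro!: continuous_intros\<close>)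
    then show ?thesis by simp
  qed
  define E where "E = 4 * B / dlt * (\<mu> * seg_const w) + B * eps"
  have E0: "0 \<le> E" unfolding E_def using B dlt eps seg_const_pos by simp
  have "norm ((P (Suc I) 1 c - c - of_real \<mu> *s (\<chi> k. w * integral {0..1} (\<lambda>x. Y0 (tt x) c $ k))) $ k) \<le> \<mu> * norm w * E" for k
  proof -
    have c1: "continuous_on {0..1} (\<lambda>x. Y eps (tt x) (P I x c) $ k)" "continuous_on {0..1} (\<lambda>x. Y0 (tt x) c $ k)"
      by (intro continuous_intros continuous_Y_picard c cY0)+
    have eq: "(P (Suc I) 1 c - c - of_real \<mu> *s (\<chi> k. w * integral {0..1} (\<lambda>x. Y0 (tt x) c $ k))) $ k
      = of_real \<mu> * w * integral {0..1} (\<lambda>x. Y eps (tt x) (P I x c) $ k - Y0 (tt x) c $ k)"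
      unfolding integral_diff[OF integrable_continuous_interval[OF c1(1)] integrable_continuous_interval[OF c1(2)]]
      unfolding vector_minus_component vector_smult_component picard_Suc_eq[OF _ c, of 1, simplified]
      by (simp add: algebra_simps)
    have bd: "norm (integral {0..1} (\<lambda>x. Y eps (tt x) (P I x c) $ k - Y0 (tt x) c $ k)) \<le> E"
    proof (rule norm_integral_le)
      show "continuous_on {0..1} (\<lambda>x. Y eps (tt x) (P I x c) $ k - Y0 (tt x) c $ k)" by (intro continuous_on_diff c1)
      fix x :: real assume x: "x \<in> {0..1}"
      have tS: "tt x \<in> S" using seg x by auto
      have "norm (Y eps (tt x) (P I x c) $ k - Y eps (tt x) c $ k) \<le> 4 * B / dlt * norm (P I x c - c)"
        by (intro Y_lipschitz tS picard_in_ball x c cdlt)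
      also have "\<dots> \<le> 4 * B / dlt * (\<mu> * seg_const w)" using picard_props[of I] x c B dlt by (intro mult_left_mono) auto
      finally have "norm (Y eps (tt x) (P I x c) $ k - Y eps (tt x) c $ k) \<le> 4 * B / dlt * (\<mu> * seg_const w)" .
      moreover have "norm (Y eps (tt x) c $ k - Y0 (tt x) c $ k) \<le> B * eps"
        using Y_Y0[OF eps tS cdlt(1)] Finite_Cartesian_Product.norm_nth_le[of "Y eps (tt x) c - Y0 (tt x) c" k] by simp
      ultimately show "norm (Y eps (tt x) (P I x c) $ k - Y0 (tt x) c $ k) \<le> E"
        unfolding E_def using norm_triangle_ineq[of "Y eps (tt x) (P I x c) $ k - Y eps (tt x) c $ k" "Y eps (tt x) c $ k - Y0 (tt x) c $ k"]
        by simp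
    qed auto
    show ?thesis unfolding eq by (rule scaled_norm_le[OF bd])
  qed
  then have "norm (P (Suc I) 1 c - c - of_real \<mu> *s (\<chi> k. w * integral {0..1} (\<lambda>x. Y0 (tt x) c $ k))) \<le> real CARD('m) * (\<mu> * norm w * E)"
    by (rule norm_le_of_components)
  also have "\<dots> = \<mu> * ((real CARD('m) * norm w * (4 * B / dlt)) * (\<mu> * seg_const w) + (real CARD('m) * norm w * B) * eps)"
    by (simp add: E_def algebra_simps)
  also have "\<dots> \<le> \<mu> * (seg_const w * (\<mu> * seg_const w) + seg_const w * eps)"
    using A_bounds \<mu>_pos eps seg_const_pos by (intro mult_left_mono add_mono mult_right_mono) auto
  also have "\<dots> \<le> \<mu> * (seg_const w * (eps * seg_const w) + seg_const w * eps)"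
    using power_r_le[OF eps] \<mu>_pos seg_const_pos by (intro mult_left_mono add_mono mult_right_mono) auto
  also have "\<dots> = (seg_const w * seg_const w + seg_const w) * eps ^ Suc r" by (simp add: algebra_simps)
  finally show ?thesis .
qed

end

text \<open>\<open>Y0\<close> is only given as a continuous field; its size and its Lipschitz
  constant are inherited from \<open>Y\<close> through the comparison \<open>Y_Y0\<close>.\<close>

lemma Y0_bounds:
  assumes t: "t \<in> S"
  shows "c \<in> ball c0 dlt \<Longrightarrow> norm (Y0 t c) \<le> 2 * B"
    and "c \<in> ball c0 (dlt/2) \<Longrightarrow> c' \<in> ball c0 (dlt/2) \<Longrightarrow> norm (Y0 t c $ k - Y0 t c' $ k) \<le> 4 * B / dlt * norm (c - c')"
proof -
  show "norm (Y0 t c) \<le> 2 * B" if c: "c \<in> ball c0 dlt"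
  proof -
    have eps: "0 < dlt/2" "dlt/2 < dlt" using dlt by auto
    have "norm (Y0 t c) \<le> norm (Y (dlt/2) t c) + norm (Y (dlt/2) t c - Y0 t c)"
      using norm_triangle_sub[of "Y0 t c" "Y (dlt/2) t c"] by (simp add: norm_minus_commute)
    also have "\<dots> \<le> B + B * (dlt/2)" by (intro add_mono Y_bound Y_Y0 eps t c)
    also have "\<dots> \<le> B + B * 1" using dlt B by (intro add_mono mult_left_mono) auto
    finally show ?thesis by simp
  qed
  show "norm (Y0 t c $ k - Y0 t c' $ k) \<le> 4 * B / dlt * norm (c - c')"
    if c: "c \<in> ball c0 (dlt/2)" "c' \<in> ball c0 (dlt/2)"
  proof (rule field_le_epsilon)
    fix e :: real assume e: "e > 0"
    have cdlt: "c \<in> ball c0 dlt" "c' \<in> ball c0 dlt" using c dlt by auto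
    define eps where "eps = min (dlt/4) (e / (2 * B + 1))"
    have eps: "0 < eps" "eps < dlt" using dlt e B by (auto simp: eps_def)
    have "eps * (2 * B) \<le> e / (2 * B + 1) * (2 * B)" using B by (intro mult_right_mono) (auto simp: eps_def)
    also have "\<dots> \<le> e" using B e by (simp add: field_simps)
    finally have epse: "eps * (2 * B) \<le> e" .
    \<comment> \<open>The Lipschitz estimate was proved along a segment; the degenerate segment with
      direction 0 makes it available at a single time, where the smallness condition reduces to
      \<open>eps ^ r \<le> dlt / 4\<close>.\<close>
    have sc0: "seg_const 0 = 1" by (simp add: seg_const_def)
    have "eps ^ r \<le> eps" by (rule power_r_le[OF eps])
    then have sm: "eps ^ r * seg_const 0 \<le> dlt/4" by (simp add: sc0 eps_def)
    have L: "norm (Y eps t c $ k - Y eps t c' $ k) \<le> 4 * B / dlt * norm (c - c')"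
      by (rule Y_lipschitz[OF eps _ sm t c, of t]) (use t in simp)
    have "norm ((Y eps t x - Y0 t x) $ k) \<le> B * eps" if "x \<in> ball c0 dlt" for x
      using Y_Y0[OF eps t that] Finite_Cartesian_Product.norm_nth_le[of "Y eps t x - Y0 t x" k] by linarith
    from this[OF cdlt(1)] this[OF cdlt(2)]
    have "norm (Y eps t c $ k - Y0 t c $ k) \<le> B * eps" "norm (Y eps t c' $ k - Y0 t c' $ k) \<le> B * eps" by simp_all
    moreover have "Y0 t c $ k - Y0 t c' $ k = (Y eps t c $ k - Y eps t c' $ k) - (Y eps t c $ k - Y0 t c $ k) + (Y eps t c' $ k - Y0 t c' $ k)" by simp
    then have "norm (Y0 t c $ k - Y0 t c' $ k) \<le> norm (Y eps t c $ k - Y eps t c' $ k) + norm (Y eps t c $ k - Y0 t c $ k) + norm (Y eps t c' $ k - Y0 t c' $ k)"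
      by (metis (no_types, lifting) add_right_mono norm_triangle_ineq norm_triangle_ineq4 order_trans)
    ultimately show "norm (Y0 t c $ k - Y0 t c' $ k) \<le> 4 * B / dlt * norm (c - c') + e"
      using L epse unfolding mult.commute[of B eps] by linarith
  qed
qed

lemma transport_segment:
  assumes seg: "closed_segment a b \<subseteq> S"
  shows "transport a b (\<lambda>c. \<chi> k. contour_integral (linepath a b) (\<lambda>t. Y0 t c $ k))"
proof -
  define w where "w = b - a"
  have inS: "a + of_real s * w \<in> S" if "0 \<le> s" "s \<le> 1" for s
  proof -
    have "a + of_real s * w = (1 - s) *\<^sub>R a + s *\<^sub>R b" by (simp add: w_def scaleR_conv_of_real algebra_simps)
    then have "a + of_real s * w \<in> closed_segment a b" using that by (auto simp: closed_segment_def)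
    then show ?thesis using seg by blast
  qed
  have ab: "a + w = b" by (simp add: w_def)
  define k where "k = (\<lambda>c. \<chi> k. w * integral {0..1} (\<lambda>x. Y0 (a + of_real x * w) c $ k))"
  have ck: "(\<lambda>c. \<chi> k. contour_integral (linepath a b) (\<lambda>t. Y0 t c $ k)) = k"
  proof -
    have "linepath a b x = a + of_real x * w" for x
      by (simp add: linepath_def w_def scaleR_conv_of_real algebra_simps)
    then show ?thesis
      by (simp add: k_def fun_eq_iff vec_eq_iff contour_integral_integral vector_derivative_linepath_at w_def mult.commute)
  qed
  have c1: "continuous_on {0..1} (\<lambda>x. Y0 (a + of_real x * w) c $ k)" if "c \<in> ball c0 dlt" for c k
  proof -
    have "continuous_on {0..1} (\<lambda>x. (\<lambda>(t,c). Y0 t c) (a + of_real x * w, c))"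
      by (rule continuous_on_compose2[OF Y0_continuous]) (use inS that in \<open>auto intro!: continuous_intros\<close>)
    then have "continuous_on {0..1} (\<lambda>x. Y0 (a + of_real x * w) c)" by simp
    then show ?thesis by (intro continuous_intros)
  qed
  have kb: "norm (k c) \<le> real CARD('m) * (norm w * (2 * B))" if c: "c \<in> ball c0 (dlt/2)" for c
  proof (rule norm_le_of_components)
    fix j
    have cdlt: "c \<in> ball c0 dlt" using c dlt by auto
    have "norm (integral {0..1} (\<lambda>x. Y0 (a + of_real x * w) c $ j)) \<le> 2 * B"
    proof (rule norm_integral_le[OF c1[OF cdlt]])
      fix x :: real assume "x \<in> {0..1}"
      then have "norm (Y0 (a + of_real x * w) c) \<le> 2 * B" using inS cdlt by (intro Y0_bounds) auto
      then show "norm (Y0 (a + of_real x * w) c $ j) \<le> 2 * B"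
        using Finite_Cartesian_Product.norm_nth_le[of "Y0 (a + of_real x * w) c" j] by linarith
    qed auto
    then show "norm (k c $ j) \<le> norm w * (2 * B)" unfolding k_def by (simp add: norm_mult mult_left_mono)
  qed
  have kl: "norm (k c - k c') \<le> real CARD('m) * (norm w * (4 * B / dlt * norm (c - c')))"
    if c: "c \<in> ball c0 (dlt/2)" "c' \<in> ball c0 (dlt/2)" for c c'
  proof (rule norm_le_of_components)
    fix j
    have cdlt: "c \<in> ball c0 dlt" "c' \<in> ball c0 dlt" using c dlt by auto
    have "norm (integral {0..1} (\<lambda>x. Y0 (a + of_real x * w) c $ j - Y0 (a + of_real x * w) c' $ j)) \<le> 4 * B / dlt * norm (c - c')"
    proof (rule norm_integral_le)
      fix x :: real assume "x \<in> {0..1}"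
      then show "norm (Y0 (a + of_real x * w) c $ j - Y0 (a + of_real x * w) c' $ j) \<le> 4 * B / dlt * norm (c - c')"
        using inS by (intro Y0_bounds(2) c) auto
    qed (auto intro!: continuous_on_diff c1 cdlt)
    moreover have "(k c - k c') $ j = w * integral {0..1} (\<lambda>x. Y0 (a + of_real x * w) c $ j - Y0 (a + of_real x * w) c' $ j)"
      unfolding integral_diff[OF integrable_continuous_interval[OF c1[OF cdlt(1)]] integrable_continuous_interval[OF c1[OF cdlt(2)]]]
      by (simp add: k_def right_diff_distrib)
    ultimately show "norm ((k c - k c') $ j) \<le> norm w * (4 * B / dlt * norm (c - c'))"
      by (simp only: norm_mult) (rule mult_left_mono, auto)
  qed
  have reg: "regular_displacement k"
    unfolding regular_displacement_def
  proof (intro exI[of _ "real CARD('m) * (norm w * (2 * B)) + real CARD('m) * (norm w * (4 * B / dlt))"] conjI ballI)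
    let ?L1 = "real CARD('m) * (norm w * (2 * B))" and ?L2 = "real CARD('m) * (norm w * (4 * B / dlt))"
    have L: "0 \<le> ?L1" "0 \<le> ?L2" using B dlt by auto
    show "0 \<le> ?L1 + ?L2" using L by linarith
    fix c assume c: "c \<in> ball c0 (dlt/2)"
    show "norm (k c) \<le> ?L1 + ?L2" using kb[OF c] L by linarith
    fix c' assume c': "c' \<in> ball c0 (dlt/2)"
    have "norm (k c - k c') \<le> ?L2 * norm (c - c')" using kl[OF c c'] by (simp add: mult.assoc)
    also have "\<dots> \<le> (?L1 + ?L2) * norm (c - c')" using L by (intro mult_right_mono) auto
    finally show "norm (k c - k c') \<le> (?L1 + ?L2) * norm (c - c')" .
  qed
  have "\<exists>H C d. 0 < d \<and> d \<le> dlt/4 \<and> 0 \<le> C \<and>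
     (\<forall>eps. 0 < eps \<longrightarrow> eps < d \<longrightarrow> (\<forall>j. mv_holomorphic_on (\<lambda>c. H eps c $ j) (ball c0 d)) \<and>
        (\<forall>c\<in>ball c0 d. norm (H eps c - c - of_real (eps ^ r) *s k c) \<le> C * eps ^ Suc r \<and>
           (\<forall>i. norm (G i eps b (H eps c) - G i eps a c) \<le> C * eps ^ M)))" for M
  proof -
    \<comment> \<open>The iterate of index \<open>Suc I\<close> is invariant up to order
      \<open>r * (I + 2) - l\<close> in \<open>eps\<close>; this index makes the order at least
      \<open>M\<close>.\<close>
    define I where "I = M + l"
    define sc where "sc = seg_const w"
    have sc1: "1 \<le> sc" unfolding sc_def seg_const_def using B dlt by simp
    define d where "d = dlt / (4 * sc)"
    have d: "0 < d" "d \<le> dlt/4"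
    proof -
      show "0 < d" using dlt sc1 by (simp add: d_def)
      show "d \<le> dlt/4" unfolding d_def using dlt sc1 by (intro divide_left_mono) auto
    qed
    define C where "C = sc * sc + sc + 4 * B / dlt * sc ^ Suc (Suc I)"
    have C: "0 \<le> C" "sc * sc + sc \<le> C" "4 * B / dlt * sc ^ Suc (Suc I) \<le> C"
      using sc1 B dlt by (auto simp: C_def)
    show ?thesis
    proof (rule exI[of _ "\<lambda>eps c. picard eps a w (Suc I) 1 c"], rule exI[of _ C], rule exI[of _ d], intro conjI allI impI ballI)
      fix eps :: real assume eps0: "0 < eps" "eps < d"
      have eps: "0 < eps" "eps < dlt" using eps0 d dlt by auto
      have "eps ^ r * sc \<le> d * sc" using power_r_le[OF eps] eps0 sc1 by (intro mult_right_mono) auto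
      also have "\<dots> = dlt/4" using sc1 by (simp add: d_def)
      finally have small: "eps ^ r * seg_const w \<le> dlt/4" by (simp add: sc_def)
      have sub: "ball c0 d \<subseteq> ball c0 (dlt/4)" using d by auto
      show "mv_holomorphic_on (\<lambda>c. picard eps a w (Suc I) 1 c $ j) (ball c0 d)" for j
        using picard_props[OF eps inS small, of "Suc I"] mv_holomorphic_on_subset[OF _ sub] by (metis atLeastAtMost_iff order_refl zero_le_one)
      fix c assume "c \<in> ball c0 d"
      then have c: "c \<in> ball c0 (dlt/4)" using sub by blast
      have "norm (picard eps a w (Suc I) 1 c - c - of_real (eps ^ r) *s k c) \<le> (sc * sc + sc) * eps ^ Suc r"
        unfolding k_def sc_def by (rule picard_displacement[OF eps inS small c])
      also have "\<dots> \<le> C * eps ^ Suc r" using C eps by (intro mult_right_mono) auto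
      finally show "norm (picard eps a w (Suc I) 1 c - c - of_real (eps ^ r) *s k c) \<le> C * eps ^ Suc r" .
      fix i
      have "norm (G i eps b (picard eps a w (Suc I) 1 c) - G i eps a c) \<le> 4 * B / dlt / eps ^ l * (eps ^ r * sc) ^ Suc (Suc I)"
        using picard_almost_invariant[OF eps inS small c, of i I] by (simp only: ab sc_def)
      also have "\<dots> = 4 * B / dlt * sc ^ Suc (Suc I) * ((eps ^ r) ^ Suc (Suc I) / eps ^ l)"
        by (simp only: power_mult_distrib) simp
      also have "\<dots> \<le> C * eps ^ M"
      proof (rule mult_mono)
        have "(eps ^ r) ^ Suc (Suc I) \<le> eps ^ Suc (Suc I)" using power_r_le[OF eps] eps by (intro power_mono) auto
        also have "\<dots> \<le> eps ^ (M + l)" using eps dlt by (intro power_decreasing) (auto simp: I_def)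
        finally show "(eps ^ r) ^ Suc (Suc I) / eps ^ l \<le> eps ^ M"
          using eps by (simp add: pos_divide_le_eq power_add del: power_Suc)
      qed (use C eps in auto)
      finally show "norm (G i eps b (picard eps a w (Suc I) 1 c) - G i eps a c) \<le> C * eps ^ M" .
    qed (use d C in auto)
  qed
  then show ?thesis unfolding ck transport_def using reg by blast
qed

text \<open>A closed transport moves points by a multiple of \<open>eps ^ r\<close>, so its
  truncated logarithm exists and agrees with \<open>eps ^ r\<close> times the displacement up to an
  error of order \<open>eps ^ (2 * r)\<close>, which is absorbed in
  \<open>eps ^ Suc r\<close>.\<close>

lemma transport_logarithm:
  assumes tr: "transport t t k" and t: "t \<in> S"
  shows "\<exists>C d. 0 < d \<and> (\<forall>eps. 0 < eps \<longrightarrow> eps < d \<longrightarrow> (\<exists>Z. norm (Z - of_real (eps ^ r) *s k c0) \<le> C * eps ^ Suc r \<and>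
      (\<forall>i. norm (\<Sum>j\<in>UNIV. Z $ j * partial_deriv j (G i eps t) c0) \<le> C * eps ^ M)))"
proof -
  obtain L where L: "L \<ge> 0" "\<forall>c\<in>ball c0 (dlt/2). norm (k c) \<le> L"
    using tr unfolding transport_def regular_displacement_def by blast
  obtain H C1 d1 where d1: "0 < d1" "d1 \<le> dlt/4" "0 \<le> C1" and
    H: "\<forall>eps. 0 < eps \<longrightarrow> eps < d1 \<longrightarrow> (\<forall>j. mv_holomorphic_on (\<lambda>c. H eps c $ j) (ball c0 d1)) \<and>
        (\<forall>c\<in>ball c0 d1. norm (H eps c - c - of_real (eps ^ r) *s k c) \<le> C1 * eps ^ Suc r \<and>
           (\<forall>i. norm (G i eps t (H eps c) - G i eps t c) \<le> C1 * eps ^ M))"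
    using tr[unfolded transport_def, THEN conjunct2, THEN spec, of M] by (elim exE conjE) blast
  \<comment> \<open>The summand \<open>l\<close> in the interpolation order \<open>M + l\<close>
    compensates for the size \<open>B / eps ^ l\<close> of the integrals.\<close>
  obtain C2 \<eta>0 where \<eta>0: "0 < \<eta>0" "0 \<le> C2" and near: "\<forall>\<eta> H. 0 < \<eta> \<longrightarrow> \<eta> \<le> \<eta>0 \<longrightarrow> (\<forall>i. mv_holomorphic_on (\<lambda>c. H c $ i) (ball c0 d1)) \<longrightarrow>
    (\<forall>c\<in>ball c0 d1. norm (H c - c) \<le> \<eta>) \<longrightarrow>
    (\<exists>Z. norm (Z - (H c0 - c0)) \<le> C2 * \<eta>\<^sup>2 \<and>
      (\<forall>G B e. mv_holomorphic_on G (ball c0 d1) \<longrightarrow> (\<forall>c\<in>ball c0 d1. norm (G c) \<le> B) \<longrightarrow>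
         (\<forall>c\<in>ball c0 (d1/2). norm (G (H c) - G c) \<le> e) \<longrightarrow>
         norm (\<Sum>i\<in>UNIV. Z $ i * partial_deriv i G c0) \<le> C2 * (B * \<eta> ^ (M + l) + e)))"
    using near_identity_logarithm[OF d1(1), of c0 "M + l"] by (elim exE conjE) blast
  define A where "A = L + C1 + 1"
  have A: "1 \<le> A" using L d1 by (simp add: A_def)
  define d where "d = min d1 (\<eta>0 / A)"
  define C where "C = max (C1 + C2 * A\<^sup>2) (C2 * (B * A ^ (M + l) + C1))"
  have d: "0 < d" "d \<le> d1" "A * d \<le> \<eta>0"
  proof -
    show "0 < d" "d \<le> d1" using d1 \<eta>0 A by (auto simp: d_def)
    have "A * d \<le> A * (\<eta>0 / A)" using A by (intro mult_left_mono) (auto simp: d_def)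
    then show "A * d \<le> \<eta>0" using A by simp
  qed
  have main: "\<exists>Z. norm (Z - of_real (eps ^ r) *s k c0) \<le> C * eps ^ Suc r \<and>
      (\<forall>i. norm (\<Sum>j\<in>UNIV. Z $ j * partial_deriv j (G i eps t) c0) \<le> C * eps ^ M)" if eps0: "0 < eps" "eps < d" for eps
  proof -
    have eps: "0 < eps" "eps < dlt" "eps < d1" "eps \<le> 1" using eps0 d d1 dlt by auto
    note HH = H[rule_format, OF eps(1,3)]
    \<comment> \<open>Bound for the whole movement of the closed map: \<open>L\<close> for its
      first-order part, \<open>C1\<close> for the error, and 1 to keep \<open>\<eta>\<close>
      positive.\<close>
    define \<eta> where "\<eta> = A * eps ^ r"
    have \<eta>e: "\<eta> \<le> A * eps" using power_r_le[OF eps(1,2)] A by (simp add: \<eta>_def)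
    moreover have "A * eps \<le> A * d" using eps0 A by (intro mult_left_mono) auto
    ultimately have \<eta>: "0 < \<eta>" "\<eta> \<le> \<eta>0" using eps A d(3) by (simp add: \<eta>_def, linarith)
    have hol: "\<forall>i. mv_holomorphic_on (\<lambda>c. H eps c $ i) (ball c0 d1)" using HH by blast
    have Hn: "\<forall>c\<in>ball c0 d1. norm (H eps c - c) \<le> \<eta>"
    proof
      fix c assume c: "c \<in> ball c0 d1"
      then have c': "c \<in> ball c0 (dlt/2)" using d1 dlt by auto
      have "norm (H eps c - c) \<le> norm (of_real (eps ^ r) *s k c) + norm (H eps c - c - of_real (eps ^ r) *s k c)"
        by (rule norm_triangle_sub)
      also have "\<dots> \<le> eps ^ r * L + C1 * eps ^ Suc r"
      proof (rule add_mono)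
        have "norm (of_real (eps ^ r) *s k c) = eps ^ r * norm (k c)"
          unfolding norm_vector_scalar_mult norm_of_real using eps by simp
        also have "\<dots> \<le> eps ^ r * L" using L c' eps by (intro mult_left_mono) auto
        finally show "norm (of_real (eps ^ r) *s k c) \<le> eps ^ r * L" .
      qed (use HH c in blast)
      also have "\<dots> \<le> eps ^ r * L + C1 * eps ^ r"
        using d1 eps by (intro add_left_mono mult_left_mono power_decreasing) auto
      also have "\<dots> \<le> \<eta>" using eps by (simp add: \<eta>_def A_def algebra_simps)
      finally show "norm (H eps c - c) \<le> \<eta>" .
    qed
    obtain Z where Z1: "norm (Z - (H eps c0 - c0)) \<le> C2 * \<eta>\<^sup>2" and
      Z2: "\<forall>G B e. mv_holomorphic_on G (ball c0 d1) \<longrightarrow> (\<forall>c\<in>ball c0 d1. norm (G c) \<le> B) \<longrightarrow>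
         (\<forall>c\<in>ball c0 (d1/2). norm (G (H eps c) - G c) \<le> e) \<longrightarrow>
         norm (\<Sum>i\<in>UNIV. Z $ i * partial_deriv i G c0) \<le> C2 * (B * \<eta> ^ (M + l) + e)"
      using near[THEN spec, THEN spec, THEN mp, THEN mp, THEN mp, THEN mp, OF \<eta> hol Hn] by (elim exE conjE)
    have c0d: "c0 \<in> ball c0 d1" using d1 by simp
    have "norm (Z - of_real (eps ^ r) *s k c0) \<le> norm (H eps c0 - c0 - of_real (eps ^ r) *s k c0) + norm (Z - (H eps c0 - c0))"
      using norm_triangle_ineq[of "H eps c0 - c0 - of_real (eps ^ r) *s k c0" "Z - (H eps c0 - c0)"] by simp
    also have "\<dots> \<le> C1 * eps ^ Suc r + C2 * \<eta>\<^sup>2" using HH c0d Z1 by (intro add_mono) auto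
    also have "\<dots> \<le> C1 * eps ^ Suc r + C2 * (A\<^sup>2 * eps ^ Suc r)"
    proof -
      have "\<eta>\<^sup>2 = A\<^sup>2 * (eps ^ r * eps ^ r)" by (simp add: \<eta>_def power2_eq_square mult_ac)
      also have "\<dots> \<le> A\<^sup>2 * (eps * eps ^ r)" using power_r_le[OF eps(1,2)] eps by (intro mult_left_mono mult_right_mono) auto
      finally show ?thesis using \<eta>0 by (intro add_left_mono mult_left_mono) auto
    qed
    also have "\<dots> = (C1 + C2 * A\<^sup>2) * eps ^ Suc r" by (simp add: algebra_simps)
    also have "\<dots> \<le> C * eps ^ Suc r" using eps by (intro mult_right_mono) (auto simp: C_def)
    finally have 1: "norm (Z - of_real (eps ^ r) *s k c0) \<le> C * eps ^ Suc r" .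
    have 2: "norm (\<Sum>j\<in>UNIV. Z $ j * partial_deriv j (G i eps t) c0) \<le> C * eps ^ M" for i
    proof -
      have sub: "ball c0 d1 \<subseteq> ball c0 dlt" using d1 dlt by auto
      have "norm (\<Sum>j\<in>UNIV. Z $ j * partial_deriv j (G i eps t) c0) \<le> C2 * (B / eps ^ l * \<eta> ^ (M + l) + C1 * eps ^ M)"
      proof (rule Z2[THEN spec, THEN spec, THEN spec, THEN mp, THEN mp, THEN mp])
        show "mv_holomorphic_on (G i eps t) (ball c0 d1)"
          by (rule mv_holomorphic_on_subset[OF G_holomorphic[OF eps(1,2) t] sub])
        show "\<forall>c\<in>ball c0 d1. norm (G i eps t c) \<le> B / eps ^ l" using G_bound[OF eps(1,2) t] sub by blast
        show "\<forall>c\<in>ball c0 (d1/2). norm (G i eps t (H eps c) - G i eps t c) \<le> C1 * eps ^ M" using HH d1 by auto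
      qed
      also have "\<dots> \<le> C2 * (B * A ^ (M + l) * eps ^ M + C1 * eps ^ M)"
      proof (intro mult_left_mono add_right_mono)
        have "\<eta> ^ (M + l) \<le> (A * eps) ^ (M + l)" using \<eta>e \<eta> by (intro power_mono) auto
        also have "\<dots> = A ^ (M + l) * eps ^ M * eps ^ l" by (simp add: power_mult_distrib power_add)
        finally have "B * \<eta> ^ (M + l) \<le> B * (A ^ (M + l) * eps ^ M * eps ^ l)" using B by (rule mult_left_mono)
        then show "B / eps ^ l * \<eta> ^ (M + l) \<le> B * A ^ (M + l) * eps ^ M"
          using eps by (simp add: pos_divide_le_eq mult_ac)
      qed (use \<eta>0 in auto)
      also have "\<dots> = (C2 * (B * A ^ (M + l) + C1)) * eps ^ M" by (simp add: algebra_simps)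
      also have "\<dots> \<le> C * eps ^ M" using eps by (intro mult_right_mono) (auto simp: C_def)
      finally show ?thesis .
    qed
    from 1 2 show ?thesis by blast
  qed
  show ?thesis by (rule exI[of _ C], rule exI[of _ d]) (use d main in blast)
qed

end

section \<open>Generic lower bounds\<close>

text \<open>Holomorphic functions on a connected open set have no zero divisors: on a ball where the
  product of the previous factors has no zero, the next factor cannot vanish identically.\<close>

lemma mv_holomorphic_prod_nonzero:
  fixes f :: "'i \<Rightarrow> complex^'m \<Rightarrow> complex"
  assumes S: "open S" "connected S" "S \<noteq> {}" and I: "finite I"
    and f: "\<And>i. i \<in> I \<Longrightarrow> mv_holomorphic_on (f i) S" "\<And>i. i \<in> I \<Longrightarrow> \<exists>z\<in>S. f i z \<noteq> 0"
  shows "\<exists>z\<in>S. (\<Prod>i\<in>I. f i z) \<noteq> 0"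
  using I f
proof (induction I rule: finite_induct)
  case empty
  then show ?case using S by auto
next
  case (insert j I)
  then obtain z where z: "z \<in> S" "(\<Prod>i\<in>I. f i z) \<noteq> 0" by blast
  have c: "continuous_on S (\<lambda>z. \<Prod>i\<in>I. f i z)"
    by (intro mv_holomorphic_on_imp_continuous_on mv_holomorphic_on_prod insert) auto
  have "open {w \<in> S. (\<Prod>i\<in>I. f i w) \<in> - {0}}"
    using continuous_open_preimage[OF c S(1), of "-{0}"] by (simp add: vimage_def Int_def open_Compl)
  then obtain r where r: "r > 0" "ball z r \<subseteq> {w \<in> S. (\<Prod>i\<in>I. f i w) \<in> - {0}}"
    using z open_contains_ball[of "{w \<in> S. (\<Prod>i\<in>I. f i w) \<in> - {0}}"] by blast
  have "\<exists>y\<in>ball z r \<inter> S. f j y \<noteq> 0"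
  proof (rule ccontr)
    assume "\<not> (\<exists>y\<in>ball z r \<inter> S. f j y \<noteq> 0)"
    then have "f j w = 0" if "w \<in> S" for w
      using mv_holomorphic_zero_connected[OF _ S(1,2) z(1) r(1) _ that, of "f j"] insert.prems(1)[of j] by blast
    then show False using insert.prems(2)[of j] by blast
  qed
  then obtain y where y: "y \<in> ball z r" "f j y \<noteq> 0" "y \<in> S" by blast
  moreover have "(\<Prod>i\<in>I. f i y) \<noteq> 0" using r y by auto
  ultimately show ?case using insert by (intro bexI[of _ y]) auto
qed

text \<open>Generic points are those outside the zero set of one entire function that is not
  identically zero. The notion is stable under finite intersections, by taking products, and generic
  points are dense by the identity theorem.\<close>

definition generic_on :: "(complex^'m \<Rightarrow> complex) \<Rightarrow> bool" where
  "generic_on p \<longleftrightarrow> mv_holomorphic_on p UNIV \<and> (\<exists>c. p c \<noteq> 0)"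

lemma generic_on_dense:
  assumes "generic_on p" "r > 0" shows "\<exists>c\<in>ball a r. p c \<noteq> 0"
proof (rule ccontr)
  assume "\<not> ?thesis"
  then have "p c = 0" for c
    using mv_holomorphic_zero_connected[of p UNIV a r c] assms unfolding generic_on_def by auto
  then show False using assms unfolding generic_on_def by blast
qed

text \<open>The entire functions belonging to a finite subcover are multiplied, and the finite
  exceptional sets are united.\<close>

lemma generic_finite_on_compact:
  fixes P :: "complex \<Rightarrow> complex^'m \<Rightarrow> bool"
  assumes K: "compact K" and loc: "\<And>t0. t0 \<in> K \<Longrightarrow> \<exists>dlt>0. \<exists>p. generic_on p \<and> (\<forall>c. p c \<noteq> 0 \<longrightarrow> finite {t \<in> ball t0 dlt. \<not> P t c})"
  shows "\<exists>p. generic_on p \<and> (\<forall>c. p c \<noteq> 0 \<longrightarrow> finite {t \<in> K. \<not> P t c})"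
proof -
  obtain dlt p where dlt: "\<And>t0. t0 \<in> K \<Longrightarrow> dlt t0 > 0" "\<And>t0. t0 \<in> K \<Longrightarrow> generic_on (p t0)"
    "\<And>t0 c. t0 \<in> K \<Longrightarrow> p t0 c \<noteq> 0 \<Longrightarrow> finite {t \<in> ball t0 (dlt t0). \<not> P t c}"
    using loc by metis
  have "K \<subseteq> (\<Union>t0\<in>K. ball t0 (dlt t0))" using dlt(1) by auto
  then obtain T where T: "T \<subseteq> K" "finite T" "K \<subseteq> (\<Union>t0\<in>T. ball t0 (dlt t0))"
    using compactE_image[OF K, of K "\<lambda>t0. ball t0 (dlt t0)"] by auto
  show ?thesis
  proof (intro exI[of _ "\<lambda>c. \<Prod>t0\<in>T. p t0 c"] conjI allI impI)
    have "\<exists>z\<in>UNIV. (\<Prod>i\<in>T. p i z) \<noteq> 0"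
      using dlt(2) T unfolding generic_on_def by (intro mv_holomorphic_prod_nonzero) auto
    then show "generic_on (\<lambda>c. \<Prod>t0\<in>T. p t0 c)"
      using dlt(2) T unfolding generic_on_def by (auto intro!: mv_holomorphic_on_prod)
    fix c assume "(\<Prod>t0\<in>T. p t0 c) \<noteq> 0"
    then have "finite (\<Union>t0\<in>T. {t \<in> ball t0 (dlt t0). \<not> P t c})"
      using T dlt(3) by (intro finite_UN_I) auto
    moreover have "{t \<in> K. \<not> P t c} \<subseteq> (\<Union>t0\<in>T. {t \<in> ball t0 (dlt t0). \<not> P t c})"
    proof
      fix t assume t: "t \<in> {t \<in> K. \<not> P t c}"
      then obtain t0 where "t0 \<in> T" "t \<in> ball t0 (dlt t0)" using T(3) by blast
      then show "t \<in> (\<Union>t0\<in>T. {t \<in> ball t0 (dlt t0). \<not> P t c})" using t by blast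
    qed
    ultimately show "finite {t \<in> K. \<not> P t c}" by (rule finite_subset[rotated])
  qed
qed

lemma mv_holomorphic_taylor_coeff: "mv_holomorphic_on (taylor_coeff k g z) UNIV"
proof (induction k arbitrary: g)
  case 0
  have "taylor_coeff 0 g z = (\<lambda>v. g z)" by (simp add: fun_eq_iff)
  then show ?case by (simp add: mv_holomorphic_on_const)
next
  case (Suc k)
  have "mv_holomorphic_on (\<lambda>v. (\<Sum>i\<in>UNIV. v $ i * taylor_coeff k (partial_deriv i g) z v) / of_nat (Suc k)) UNIV"
    by (intro mv_holomorphic_on_divide mv_holomorphic_on_sum mv_holomorphic_on_mult mv_holomorphic_on_component
        mv_holomorphic_on_const Suc) (simp del: of_nat_Suc)
  moreover have "taylor_coeff (Suc k) g z = (\<lambda>v. (\<Sum>i\<in>UNIV. v $ i * taylor_coeff k (partial_deriv i g) z v) / of_nat (Suc k))"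
    by (simp add: fun_eq_iff)
  ultimately show ?case by simp
qed

lemma mv_holomorphic_on_matrix_vector_mult: "mv_holomorphic_on (\<lambda>c. ((A :: complex^'m^'k) *v c) $ i) S"
  unfolding matrix_vector_mult_def by (simp add: mv_holomorphic_intros)

lemma matrix_vector_mult_scale: "(A :: complex^'m^'k) *v (a *s c) = a *s (A *v c)"
  by (simp add: matrix_vector_mult_def vec_eq_iff sum_distrib_left mult_ac)

text \<open>In the application \<open>Lm\<close> is a fundamental matrix of the unperturbed linear
  system, \<open>curve\<close> its solution with initial value \<open>b0\<close>, and
  \<open>nearby t eps c\<close> the solution whose initial value is shifted by \<open>eps\<close>
  times \<open>c\<close>. Letting \<open>c\<close> vary with time is variation of constants.\<close>

locale linear_flow =
  fixes Lm :: "complex \<Rightarrow> complex^'m^'m" and b0 :: "complex^'m"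
  assumes Lm_holomorphic: "\<And>i j. (\<lambda>t. Lm t $ i $ j) holomorphic_on UNIV"
    and Lm_invertible: "\<And>t. invertible (Lm t)"
begin

definition curve :: "complex \<Rightarrow> complex^'m" where "curve t = Lm t *v b0"

definition nearby :: "complex \<Rightarrow> real \<Rightarrow> complex^'m \<Rightarrow> complex^'m" where
  "nearby t eps c = Lm t *v (b0 + of_real eps *s c)"

lemma nearby_eq: "nearby t eps c = curve t + of_real eps *s (Lm t *v c)"
  by (simp add: nearby_def curve_def matrix_vector_right_distrib matrix_vector_mult_scale)

lemma holomorphic_Lm_mult: "(\<lambda>t. (Lm t *v c) $ i) holomorphic_on T"
  unfolding matrix_vector_mult_def using holomorphic_on_subset[OF Lm_holomorphic]
  by (auto intro!: holomorphic_intros)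

lemma continuous_Lm_mult [continuous_intros]:
  assumes "continuous_on T t" "continuous_on T c"
  shows "continuous_on T (\<lambda>x. Lm (t x) *v c x)"
proof -
  have c: "continuous_on T (\<lambda>x. Lm (t x) $ i $ j)" for i j
    by (rule continuous_on_compose2[OF holomorphic_on_imp_continuous_on[OF Lm_holomorphic] assms(1)]) auto
  then show ?thesis unfolding matrix_vector_mult_def
    by (intro continuous_on_vec_lambda continuous_on_sum continuous_on_mult c continuous_on_component assms(2))
qed

lemma continuous_curve [continuous_intros]: "continuous_on T t \<Longrightarrow> continuous_on T (\<lambda>x. curve (t x))"
  unfolding curve_def by (intro continuous_intros)

text \<open>The exponent \<open>l\<close> is uniform for times and initial values near
  \<open>t\<close> and \<open>c\<close>. Such a power bound replaces nonvanishing on the curve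
  itself, where \<open>h\<close> may be zero.\<close>

definition lower_bounded :: "(complex^'m \<Rightarrow> complex) \<Rightarrow> (complex^'m) set \<Rightarrow> complex \<Rightarrow> complex^'m \<Rightarrow> bool" where
  "lower_bounded h N t c \<longleftrightarrow> (\<exists>d>0. \<exists>l. \<forall>t'\<in>ball t d. \<forall>c'\<in>ball c d. \<forall>eps. 0 < eps \<longrightarrow> eps < d \<longrightarrow>
     nearby t' eps c' \<in> N \<and> eps ^ l \<le> norm (h (nearby t' eps c')))"

lemma lower_bounded_leading:
  assumes h: "mv_holomorphic_on h N" and N: "open N" "curve t \<in> N"
    and dlt: "dlt > 0" "\<And>t'. t' \<in> ball t dlt \<Longrightarrow> curve t' \<in> N"
    and zero: "\<And>t' v k. t' \<in> ball t dlt \<Longrightarrow> k < l \<Longrightarrow> taylor_coeff k h (curve t') v = 0"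
    and nz: "taylor_coeff l h (curve t) (Lm t *v c) \<noteq> 0"
  shows "lower_bounded h N t c"
proof -
  let ?T = "\<lambda>t c. taylor_coeff l h (curve t) (Lm t *v c)"
  obtain \<rho> where \<rho>: "\<rho> > 0" "cball (curve t) (2*\<rho>) \<subseteq> N"
  proof -
    obtain e where "e > 0" "cball (curve t) e \<subseteq> N" using N open_contains_cball by blast
    then show thesis using that[of "e/2"] by auto
  qed
  have cc: "isCont curve t"
    using continuous_curve[of UNIV "\<lambda>x. x"] by (simp add: continuous_on_eq_continuous_at)
  obtain d1 where d1: "d1 > 0" "\<And>t'. dist t' t < d1 \<Longrightarrow> dist (curve t') (curve t) < \<rho>"
    using cc[unfolded continuous_at_eps_delta, rule_format, of \<rho>] \<rho>(1) by blast
  have cT: "continuous_on (ball t dlt \<times> UNIV) (\<lambda>p. ?T (fst p) (snd p))"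
    by (rule continuous_on_taylor_coeff[OF h N(1)]) (use dlt(2) in \<open>auto intro!: continuous_intros\<close>)
  have op: "open (ball t dlt \<times> (UNIV :: (complex^'m) set))" by (intro open_Times) auto
  define \<mu> where "\<mu> = norm (?T t c) / 2"
  have \<mu>: "\<mu> > 0" using nz by (simp add: \<mu>_def)
  have "isCont (\<lambda>p. ?T (fst p) (snd p)) (t, c)" using cT op dlt(1) by (simp add: continuous_on_eq_continuous_at)
  from this[unfolded continuous_at_eps_delta, rule_format, OF \<mu>] obtain d2 where d2: "d2 > 0"
    "\<forall>p. dist p (t,c) < d2 \<longrightarrow> dist (?T (fst p) (snd p)) (?T (fst (t,c)) (snd (t,c))) < \<mu>" by (elim exE conjE)
  have cL: "compact ((\<lambda>p. Lm (fst p) *v snd p) ` (cball t 1 \<times> cball c 1))"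
    by (intro compact_continuous_image compact_Times continuous_intros) auto
  then obtain b where b0: "\<And>y. y \<in> (\<lambda>p. Lm (fst p) *v snd p) ` (cball t 1 \<times> cball c 1) \<Longrightarrow> norm y \<le> b"
    using compact_imp_bounded bounded_iff by meson
  have b: "norm (Lm t' *v c') \<le> b" if "dist t' t \<le> 1" "dist c' c \<le> 1" for t' c'
    using b0[of "Lm t' *v c'"] that by (force simp: dist_commute)
  have bpos: "b \<ge> 0" using b[of t c] norm_ge_zero order_trans by (metis dist_self zero_le_one)
  obtain C where C: "C \<ge> 0" "\<forall>z v ze. (\<forall>\<xi>. norm \<xi> \<le> norm ze \<longrightarrow> z + \<xi> *s v \<in> cball (curve t) (2*\<rho>)) \<longrightarrow> norm v \<le> b \<longrightarrow>
     (\<forall>k<l. taylor_coeff k h z v = 0) \<longrightarrow>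
     norm (h (z + ze *s v) - ze^l * taylor_coeff l h z v) \<le> C * norm ze ^ Suc l"
    using taylor_remainder_leading[OF h N(1) compact_cball \<rho>(2), of b l] by blast
  \<comment> \<open>The entry with \<open>C + 1\<close> makes the remainder at most half of the
    leading term, and \<open>\<mu> / 2\<close> lets the remaining constant be absorbed by one more
    power of \<open>eps\<close>; this explains the final exponent \<open>Suc l\<close>.\<close>
  define d where "d = Min {1, dlt, d1, d2/2, \<rho> / (b+1), \<mu> / (2 * (C+1)), \<mu>/2}"
  have dpos: "d > 0" unfolding d_def using dlt d1 d2 \<rho> bpos \<mu> C by (subst Min_gr_iff) auto
  have ds: "d \<le> 1" "d \<le> dlt" "d \<le> d1" "d \<le> d2/2" "d \<le> \<rho> / (b+1)" "d \<le> \<mu> / (2 * (C+1))" "d \<le> \<mu>/2"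
    unfolding d_def by (rule Min_le; simp)+
  show ?thesis unfolding lower_bounded_def
  proof (rule exI[of _ d], intro conjI dpos, rule exI[of _ "Suc l"], intro ballI allI impI conjI)
    fix t' c' and eps :: real assume t': "t' \<in> ball t d" and c': "c' \<in> ball c d" and eps: "0 < eps" "eps < d"
    let ?v = "Lm t' *v c'"
    have tb: "dist t' t < d" "dist c' c < d" using t' c' by (auto simp: dist_commute)
    have "dist t' t \<le> 1" "dist c' c \<le> 1" using tb ds(1) by linarith+
    then have v: "norm ?v \<le> b" by (rule b)
    have epss: "eps \<le> \<rho> / (b+1)" "eps \<le> \<mu> / (2 * (C+1))" "eps \<le> \<mu>/2" using eps(2) ds(5,6,7) by linarith+
    have inK: "curve t' + \<xi> *s ?v \<in> cball (curve t) (2*\<rho>)" if "norm \<xi> \<le> norm (of_real eps :: complex)" for \<xi>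
    proof -
      have "norm (\<xi> *s ?v) \<le> eps * b" unfolding norm_vector_scalar_mult using that v eps(1) by (intro mult_mono) simp_all
      also have "\<dots> \<le> \<rho> / (b+1) * (b+1)" using epss(1) bpos \<rho>(1) by (intro mult_mono) simp_all
      also have "\<dots> = \<rho>" using bpos by simp
      finally have "norm (\<xi> *s ?v) \<le> \<rho>" .
      moreover have "dist (curve t) (curve t') \<le> \<rho>" using d1(2)[of t'] tb(1) ds(3) by (simp add: dist_commute)
      moreover have "dist (curve t) (curve t' + \<xi> *s ?v) \<le> dist (curve t) (curve t') + norm (\<xi> *s ?v)"
        using dist_triangle[of "curve t" "curve t' + \<xi> *s ?v" "curve t'"] by (simp add: dist_norm)
      ultimately show ?thesis by simp
    qed
    have tdlt: "t' \<in> ball t dlt" using t' ds(2) by simp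
    have rem: "norm (h (nearby t' eps c') - of_real eps ^ l * ?T t' c') \<le> C * norm (of_real eps :: complex) ^ Suc l"
      unfolding nearby_eq
      by (rule C(2)[THEN spec, THEN spec, THEN spec, THEN mp, THEN mp, THEN mp]) (use inK v zero[OF tdlt] in auto)
    have "dist (t',c') (t,c) \<le> dist t' t + dist c' c" by (simp add: dist_Pair_Pair sqrt_sum_squares_le_sum)
    then have "dist (t',c') (t,c) < d2" using tb ds(4) by linarith
    then have "norm (?T t' c' - ?T t c) < \<mu>" using d2(2)[THEN spec, of "(t',c')"] by (simp add: dist_norm)
    then have "norm (?T t' c') \<ge> \<mu>" using norm_triangle_sub[of "?T t c" "?T t' c'"] \<mu>_def by (simp add: norm_minus_commute)
    then have "eps ^ l * \<mu> \<le> norm (of_real eps ^ l * ?T t' c')" using eps by (simp add: norm_mult norm_power)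
    moreover have "norm (of_real eps ^ l * ?T t' c') \<le> norm (h (nearby t' eps c')) + C * eps ^ Suc l"
      using rem norm_triangle_sub[of "of_real eps ^ l * ?T t' c'" "h (nearby t' eps c')"] eps by (simp add: norm_minus_commute)
    moreover have "C * eps ^ Suc l \<le> eps ^ l * (\<mu>/2)"
    proof -
      have "C * eps \<le> (C+1) * (\<mu> / (2 * (C+1)))" using C(1) eps(1) epss(2) by (intro mult_mono) simp_all
      also have "\<dots> = \<mu>/2"
      proof -
        have "C + 1 \<noteq> 0" using C(1) by linarith
        then show ?thesis by (simp add: field_simps)
      qed
      finally have "eps ^ l * (C * eps) \<le> eps ^ l * (\<mu>/2)" using eps by (intro mult_left_mono) auto
      then show ?thesis by (simp add: mult_ac)
    qed
    moreover have "eps ^ Suc l \<le> eps ^ l * (\<mu>/2)"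
    proof -
      have "eps ^ l * eps \<le> eps ^ l * (\<mu>/2)" using eps(1) epss(3) by (intro mult_left_mono) simp_all
      then show ?thesis by (simp add: mult.commute)
    qed
    ultimately show "eps ^ Suc l \<le> norm (h (nearby t' eps c'))" by linarith
    show "nearby t' eps c' \<in> N" unfolding nearby_eq using inK[of "of_real eps"] \<rho>(2) by auto
  qed
qed

text \<open>The relevant degree is the order of vanishing of \<open>h\<close> along the curve at
  generic times. For \<open>c\<close> outside a hypersurface the leading coefficient is a
  holomorphic function of \<open>t\<close> that is not identically zero, so only finitely many times
  in a smaller disc are exceptional.\<close>

lemma generic_lower_bounded:
  assumes h: "mv_holomorphic_on h N" and N: "open N" "connected N" "curve t0 \<in> N"
    and nz: "\<exists>z\<in>N. h z \<noteq> 0"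
  shows "\<exists>dlt>0. \<exists>p. generic_on p \<and> (\<forall>c. p c \<noteq> 0 \<longrightarrow> finite {t \<in> ball t0 dlt. \<not> lower_bounded h N t c})"
proof -
  have "open {t. curve t \<in> N}"
    using open_vimage[OF N(1), of curve] continuous_curve[of UNIV "\<lambda>x. x"] by (simp add: vimage_def)
  then obtain dlt1 where dlt1: "dlt1 > 0" "ball t0 dlt1 \<subseteq> {t. curve t \<in> N}"
    using N(3) open_contains_ball[of "{t. curve t \<in> N}"] by blast
  have inN: "curve t \<in> N" if "t \<in> ball t0 dlt1" for t using that dlt1 by blast
  have ex: "\<exists>k v. taylor_coeff k h (curve t0) v \<noteq> 0"
    using zero_of_taylor_coeff_zero[OF h N] nz by blast
  \<comment> \<open>The least degree with a nonzero coefficient somewhere on the disc, so that all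
    lower ones vanish on the entire disc; at \<open>t0\<close> itself the order of vanishing may be
    larger.\<close>
  define l where "l = (LEAST k. \<exists>t\<in>ball t0 dlt1. \<exists>v. taylor_coeff k h (curve t) v \<noteq> 0)"
  have exk: "\<exists>k. \<exists>t\<in>ball t0 dlt1. \<exists>v. taylor_coeff k h (curve t) v \<noteq> 0" using ex dlt1 by (metis centre_in_ball)
  have "\<exists>t\<in>ball t0 dlt1. \<exists>v. taylor_coeff l h (curve t) v \<noteq> 0"
    unfolding l_def by (rule LeastI_ex[OF exk])
  then obtain t1 v1 where t1: "t1 \<in> ball t0 dlt1" "taylor_coeff l h (curve t1) v1 \<noteq> 0" by blast
  have zero: "taylor_coeff k h (curve t) v = 0" if "t \<in> ball t0 dlt1" "k < l" for k t v
    using not_less_Least[of k "\<lambda>k. \<exists>t\<in>ball t0 dlt1. \<exists>v. taylor_coeff k h (curve t) v \<noteq> 0"] that unfolding l_def by blast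
  let ?T = "\<lambda>t c. taylor_coeff l h (curve t) (Lm t *v c)"
  obtain Li where Li: "Lm t1 ** Li = mat 1" using Lm_invertible[of t1] unfolding invertible_def by blast
  show ?thesis
  proof (intro exI[of _ "dlt1/2"] conjI exI[of _ "?T t1"] allI impI)
    show "dlt1/2 > 0" using dlt1 by simp
    have "Lm t1 *v (Li *v v1) = v1" by (simp add: matrix_vector_mul_assoc Li)
    then have "?T t1 (Li *v v1) \<noteq> 0" using t1 by simp
    moreover have "mv_holomorphic_on (?T t1) UNIV"
      by (rule mv_holomorphic_on_compose[OF mv_holomorphic_taylor_coeff mv_holomorphic_on_matrix_vector_mult]) simp
    ultimately show "generic_on (?T t1)" unfolding generic_on_def by blast
    fix c assume c: "?T t1 c \<noteq> 0"
    have hol: "(\<lambda>t. ?T t c) holomorphic_on ball t0 dlt1"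
      by (rule holomorphic_taylor_coeff_curve[OF h N(1) open_ball])
         (use inN in \<open>auto simp: curve_def intro!: holomorphic_Lm_mult\<close>)
    have "finite {t \<in> cball t0 (dlt1/2). ?T t c = 0}"
    proof (cases "(\<lambda>t. ?T t c) constant_on ball t0 dlt1")
      case True
      then obtain a where a: "\<And>t. t \<in> ball t0 dlt1 \<Longrightarrow> ?T t c = a" unfolding constant_on_def by blast
      then have "a \<noteq> 0" using c t1 by auto
      then have e: "{t \<in> cball t0 (dlt1/2). ?T t c = 0} = {}" using a dlt1 by auto
      show ?thesis unfolding e by simp
    next
      case False
      show ?thesis
        by (rule holomorphic_compact_finite_zeros[OF hol open_ball connected_ball compact_cball _ False])
           (use dlt1 in auto)
    qed
    moreover have "{t \<in> ball t0 (dlt1/2). \<not> lower_bounded h N t c} \<subseteq> {t \<in> cball t0 (dlt1/2). ?T t c = 0}"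
    proof
      fix t assume t: "t \<in> {t \<in> ball t0 (dlt1/2). \<not> lower_bounded h N t c}"
      have sub: "ball t (dlt1/2) \<subseteq> ball t0 dlt1"
      proof
        fix x assume "x \<in> ball t (dlt1/2)"
        then show "x \<in> ball t0 dlt1" using t dist_triangle[of t0 x t] by auto
      qed
      have "t \<in> ball t0 dlt1" using t dlt1 by auto
      then have "?T t c \<noteq> 0 \<Longrightarrow> lower_bounded h N t c"
        by (intro lower_bounded_leading[OF h N(1) inN, where dlt = "dlt1/2"]) (use sub dlt1 inN zero in auto)
      then show "t \<in> {t \<in> cball t0 (dlt1/2). ?T t c = 0}" using t by auto
    qed
    ultimately show "finite {t \<in> ball t0 (dlt1/2). \<not> lower_bounded h N t c}" by (rule finite_subset[rotated])
  qed
qed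

end

section \<open>Functions in involution\<close>

definition symplectic_form :: "complex^('n::finite + 'n) \<Rightarrow> complex^('n + 'n) \<Rightarrow> complex" where
  "symplectic_form u v = (\<Sum>j\<in>UNIV. u $ Inl j * v $ Inr j - u $ Inr j * v $ Inl j)"

text \<open>Turns a differential into the corresponding Hamiltonian vector, so that pairing a second
  differential with it gives the Poisson bracket.\<close>

definition symplectic_dual :: "complex^('n::finite + 'n) \<Rightarrow> complex^('n + 'n)" where
  "symplectic_dual a = (\<chi> m. case m of Inl j \<Rightarrow> a $ Inr j | Inr j \<Rightarrow> - a $ Inl j)"

lemma sum_UNIV_Plus: "(\<Sum>m\<in>(UNIV :: ('n::finite + 'n) set). f m) = (\<Sum>j\<in>UNIV. f (Inl j)) + (\<Sum>j\<in>UNIV. f (Inr j))"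
  by (subst UNIV_Plus_UNIV[symmetric], subst sum.Plus) auto

lemma symplectic_dual_pairing: "(\<Sum>m\<in>UNIV. a $ m * symplectic_dual b $ m) = symplectic_form a b"
  by (simp add: sum_UNIV_Plus symplectic_dual_def symplectic_form_def sum_subtractf sum_negf)

lemma symplectic_form_dual: "symplectic_form u (symplectic_dual a) = - (\<Sum>m\<in>UNIV. a $ m * u $ m)"
  by (simp add: sum_UNIV_Plus symplectic_dual_def symplectic_form_def sum_subtractf sum_negf mult.commute)

lemma symplectic_form_diff_left: "symplectic_form (u - u') v = symplectic_form u v - symplectic_form u' v"
  by (simp add: symplectic_form_def sum_subtractf[symmetric] algebra_simps)

lemma symplectic_form_diff_right: "symplectic_form u (v - v') = symplectic_form u v - symplectic_form u v'"
  by (simp add: symplectic_form_def sum_subtractf[symmetric] algebra_simps)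

lemma symplectic_form_scale: "symplectic_form (a *s u) (b *s v) = a * b * symplectic_form u v"
  by (simp add: symplectic_form_def sum_distrib_left algebra_simps)

lemma symplectic_form_sum_right: "symplectic_form u (\<Sum>i\<in>I. f i) = (\<Sum>i\<in>I. symplectic_form u (f i))"
  by (simp add: symplectic_form_def sum_distrib_left sum_subtractf sum.swap[of _ UNIV I])

lemma norm_symplectic_form: "norm (symplectic_form (u :: complex^('n::finite + 'n)) v) \<le> 2 * real CARD('n) * norm u * norm v"
proof -
  have "norm (symplectic_form u v) \<le> (\<Sum>j\<in>(UNIV :: 'n set). 2 * (norm u * norm v))"
    unfolding symplectic_form_def
  proof (rule sum_norm_le)
    fix j :: 'n
    have "norm (u $ Inl j * v $ Inr j - u $ Inr j * v $ Inl j) \<le> norm (u $ Inl j) * norm (v $ Inr j) + norm (u $ Inr j) * norm (v $ Inl j)"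
      using norm_triangle_ineq4[of "u $ Inl j * v $ Inr j" "u $ Inr j * v $ Inl j"] by (simp add: norm_mult)
    also have "\<dots> \<le> norm u * norm v + norm u * norm v"
      by (intro add_mono mult_mono Finite_Cartesian_Product.norm_nth_le) auto
    finally show "norm (u $ Inl j * v $ Inr j - u $ Inr j * v $ Inl j) \<le> 2 * (norm u * norm v)" by simp
  qed
  then show ?thesis by simp
qed

text \<open>The \<open>n\<close> rows of \<open>A\<close> are independent because
  \<open>A ** V\<close> is invertible, and they span an isotropic, hence Lagrangian, space of
  differentials. Its annihilator is spanned by the duals of the rows, on which the form vanishes.
  The columns of \<open>V\<close> provide a complement that makes the dimension count
  explicit.\<close>

lemma isotropic_annihilator:
  fixes A :: "complex^('n::finite + 'n)^'n" and V :: "complex^'n^('n + 'n)"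
  assumes iso: "\<And>i j. symplectic_form (A $ i) (A $ j) = 0" and inv: "invertible (A ** V)"
    and u: "A *v u = 0" and v: "A *v v = 0"
  shows "symplectic_form u v = 0"
proof -
  define J where "J = (\<lambda>x :: complex^'n. \<Sum>i\<in>UNIV. x $ i *s symplectic_dual (A $ i))"
  have AJ: "A *v J x = 0" for x
  proof -
    have "(A *v J x) $ i = (\<Sum>j\<in>UNIV. x $ j * (\<Sum>m\<in>UNIV. A $ i $ m * symplectic_dual (A $ j) $ m))" for i
      unfolding J_def matrix_vector_mult_def by (simp add: sum_distrib_left mult_ac sum.swap[of _ "UNIV :: ('n+'n) set"])
    then show ?thesis by (simp add: vec_eq_iff symplectic_dual_pairing iso)
  qed
  \<comment> \<open>A combination of duals of rows and columns of \<open>V\<close>, between spaces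
    of equal dimension: injectivity gives surjectivity, and a vector annihilated by \<open>A\<close>
    can have no component along \<open>V\<close>.\<close>
  define f where "f = (\<lambda>x :: complex^('n+'n). J (\<chi> i. x $ Inl i) + V *v (\<chi> i. x $ Inr i))"
  have lin: "Vector_Spaces.linear (*s) (*s) f"
    by unfold_locales (simp_all add: f_def J_def vec_eq_iff matrix_vector_mult_def sum.distrib algebra_simps sum_distrib_left)
  have "inj f"
  proof (rule injI)
    fix x y assume fxy: "f x = f y"
    define z where "z = x - y"
    have "f (x - y) = f x - f y"
      by (simp add: f_def J_def vec_eq_iff matrix_vector_mult_def sum_subtractf algebra_simps)
    then have "f z = 0" using fxy by (simp add: z_def)
    then have 0: "J (\<chi> i. z $ Inl i) + V *v (\<chi> i. z $ Inr i) = 0" by (simp add: f_def)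
    then have "A *v (J (\<chi> i. z $ Inl i) + V *v (\<chi> i. z $ Inr i)) = 0" by simp
    then have AV: "(A ** V) *v (\<chi> i. z $ Inr i) = 0" by (simp add: matrix_vector_right_distrib AJ matrix_vector_mul_assoc)
    obtain Bi where "Bi ** (A ** V) = mat 1" using inv unfolding invertible_def by blast
    then have r0: "(\<chi> i. z $ Inr i) = 0" using AV by (metis matrix_vector_mul_assoc matrix_vector_mul_lid matrix_vector_mult_0_right)
    then have J0: "J (\<chi> i. z $ Inl i) = 0" using 0 by (simp add: r0)
    have S0: "(\<Sum>i\<in>UNIV. z $ Inl i * A $ i $ m) = 0" for m
    proof (cases m)
      case (Inl j)
      have "J (\<chi> i. z $ Inl i) $ Inr j = 0" using J0 by simp
      then show ?thesis unfolding Inl by (simp add: J_def symplectic_dual_def sum_negf)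
    next
      case (Inr j)
      have "J (\<chi> i. z $ Inl i) $ Inl j = 0" using J0 by simp
      then show ?thesis unfolding Inr by (simp add: J_def symplectic_dual_def)
    qed
    define p where "p = (\<chi> i. z $ Inl i)"
    have "p v* (A ** V) = 0"
    proof -
      have "p v* A = 0" using S0 by (simp add: vec_eq_iff vector_matrix_mult_def p_def mult.commute)
      moreover have "p v* (A ** V) = (p v* A) v* V" by (simp add: vector_matrix_mul_assoc)
      ultimately show ?thesis by (simp add: vector_matrix_mult_def vec_eq_iff)
    qed
    moreover obtain Br where "(A ** V) ** Br = mat 1" using inv unfolding invertible_def by blast
    ultimately have "p = 0"
      by (metis (no_types) vector_matrix_mul_assoc vector_matrix_mul_rid vector_matrix_mult_0)
    then have "z $ m = 0" for m
      using r0 by (cases m) (auto simp: p_def vec_eq_iff)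
    then have "z = 0" by (simp add: vec_eq_iff)
    then show "x = y" by (simp add: z_def)
  qed
  then have "surj f" by (rule vec.linear_injective_imp_surjective[OF lin]) (rule refl)
  then obtain x where x: "v = f x" unfolding surj_def by blast
  have "(A ** V) *v (\<chi> i. x $ Inr i) = 0"
    using v unfolding x f_def by (simp add: matrix_vector_right_distrib AJ matrix_vector_mul_assoc)
  moreover obtain Bi where "Bi ** (A ** V) = mat 1" using inv unfolding invertible_def by blast
  ultimately have "(\<chi> i. x $ Inr i) = 0" by (metis matrix_vector_mul_assoc matrix_vector_mul_lid matrix_vector_mult_0_right)
  then have vJ: "v = J (\<chi> i. x $ Inl i)" unfolding x f_def by simp
  have "symplectic_form u (c *s w) = c * symplectic_form u w" for c w
    using symplectic_form_scale[of 1 u c w] by simp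
  moreover have "(\<Sum>m\<in>UNIV. A $ i $ m * u $ m) = 0" for i using u by (simp add: vec_eq_iff matrix_vector_mult_def)
  ultimately show ?thesis unfolding vJ J_def by (simp add: symplectic_form_sum_right symplectic_form_dual)
qed

lemma norm_det_le:
  fixes M :: "complex^'n^'n"
  assumes "\<And>i j. norm (M $ i $ j) \<le> b"
  shows "norm (det M) \<le> fact CARD('n) * b ^ CARD('n)"
proof -
  have "norm (det M) \<le> (\<Sum>p\<in>{p. p permutes (UNIV :: 'n set)}. b ^ CARD('n))"
    unfolding det_def
  proof (rule sum_norm_le)
    fix p :: "'n \<Rightarrow> 'n"
    have "norm (of_int (sign p) * (\<Prod>i\<in>UNIV. M $ i $ p i)) = (\<Prod>i\<in>UNIV. norm (M $ i $ p i))"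
      by (simp add: norm_mult prod_norm sign_def)
    also have "\<dots> \<le> (\<Prod>i\<in>(UNIV :: 'n set). b)" using assms by (intro prod_mono) auto
    finally show "norm (of_int (sign p) * (\<Prod>i\<in>UNIV. M $ i $ p i)) \<le> b ^ CARD('n)" by simp
  qed
  also have "\<dots> = fact CARD('n) * b ^ CARD('n)" by (simp add: card_permutations)
  finally show ?thesis .
qed

text \<open>Cramer's rule, with the numerator determinants bounded by the number of permutations
  times the largest product of entries.\<close>

lemma approximate_preimage:
  fixes M :: "complex^'n^'n" and b :: "complex^'n"
  assumes M: "\<And>i j. norm (M $ i $ j) \<le> \<alpha>" "1 \<le> \<alpha>" and D: "0 < D" "D \<le> norm (det M)"
    and e: "0 < e" "\<And>i. norm (b $ i) \<le> e"
  shows "\<exists>x. M *v x = b \<and> (\<forall>k. norm (x $ k) \<le> e * (fact CARD('n) * \<alpha> ^ CARD('n)) / D)"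
proof -
  have d0: "det M \<noteq> 0" using D by auto
  \<comment> \<open>Scaled to entries of norm at most 1, so that the column inserted by Cramer's
    rule also obeys the bound \<open>\<alpha>\<close>.\<close>
  define b' where "b' = of_real (1 / e) *s b"
  have b': "norm (b' $ i) \<le> 1" for i
    using e unfolding b'_def vector_smult_component norm_mult norm_of_real by (simp add: divide_le_eq)
  define x where "x = (\<chi> k. det (\<chi> i j. if j = k then b' $ i else M $ i $ j) / det M)"
  have Mx: "M *v x = b'" using cramer[OF d0, of x b'] by (simp add: x_def)
  have xk: "norm (x $ k) \<le> fact CARD('n) * \<alpha> ^ CARD('n) / D" for k
  proof -
    have "norm (det (\<chi> i j. if j = k then b' $ i else M $ i $ j)) \<le> fact CARD('n) * \<alpha> ^ CARD('n)"
    proof (rule norm_det_le)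
      fix i j
      show "norm ((\<chi> i j. if j = k then b' $ i else M $ i $ j) $ i $ j) \<le> \<alpha>"
        using M(1)[of i j] b'[of i] M(2) by auto
    qed
    then have "norm (det (\<chi> i j. if j = k then b' $ i else M $ i $ j)) / norm (det M) \<le> fact CARD('n) * \<alpha> ^ CARD('n) / D"
      using D M(2) by (intro frac_le) auto
    then show ?thesis by (simp add: x_def norm_divide)
  qed
  show ?thesis
  proof (intro exI[of _ "of_real e *s x"] conjI allI)
    have "M *v (of_real e *s x) = of_real e *s b'" by (simp add: matrix_vector_mult_scale Mx)
    also have "\<dots> = b"
    proof -
      have "complex_of_real e * complex_of_real (1 / e) = 1" using e by (simp flip: of_real_mult)
      then show ?thesis unfolding b'_def vector_smult_assoc by simp
    qed
    finally show "M *v (of_real e *s x) = b" .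
    fix k
    show "norm ((of_real e *s x) $ k) \<le> e * (fact CARD('n) * \<alpha> ^ CARD('n)) / D"
      using mult_left_mono[OF xk[of k], of e] e unfolding vector_smult_component norm_mult norm_of_real by simp
  qed
qed

text \<open>Both vectors are corrected by elements of the range of \<open>V\<close> so that
  \<open>A\<close> annihilates them exactly; by Cramer's rule the corrections have size at most
  \<open>\<tau> * e\<close>. The factor 6 collects three correction terms, each with the factor 2 of
  \<open>norm_symplectic_form\<close>.\<close>

lemma approximately_isotropic_annihilator:
  fixes A :: "complex^('n::finite + 'n)^'n" and V :: "complex^'n^('n + 'n)"
  assumes iso: "\<And>i j. symplectic_form (A $ i) (A $ j) = 0"
    and AV: "\<And>i j. norm ((A ** V) $ i $ j) \<le> \<alpha>" "1 \<le> \<alpha>" and D: "0 < D" "D \<le> norm (det (A ** V))"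
    and V: "\<And>i j. norm (V $ i $ j) \<le> \<nu>"
    and e: "0 < e" "\<And>i. norm ((A *v u) $ i) \<le> e" "\<And>i. norm ((A *v v) $ i) \<le> e"
    and uv: "norm u \<le> 1" "norm v \<le> 1"
    and \<tau>: "\<tau> = real CARD('n + 'n) * (real CARD('n) * (\<nu> * (fact CARD('n) * \<alpha> ^ CARD('n) / D)))" "\<tau> * e \<le> 1"
  shows "norm (symplectic_form u v) \<le> 6 * real CARD('n) * (\<tau> * e)"
proof -
  have corr: "\<exists>dlt. A *v (w - dlt) = 0 \<and> norm dlt \<le> \<tau> * e" if w: "\<And>i. norm ((A *v w) $ i) \<le> e" for w
  proof -
    obtain x where x: "(A ** V) *v x = A *v w" "\<forall>k. norm (x $ k) \<le> e * (fact CARD('n) * \<alpha> ^ CARD('n)) / D"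
      using approximate_preimage[OF AV D e(1) w] by blast
    show ?thesis
    proof (intro exI[of _ "V *v x"] conjI)
      show "A *v (w - V *v x) = 0" using x by (simp add: matrix_vector_mult_diff_distrib matrix_vector_mul_assoc)
      have "norm (V *v x) \<le> real CARD('n + 'n) * (real CARD('n) * (\<nu> * (e * (fact CARD('n) * \<alpha> ^ CARD('n)) / D)))"
      proof (rule norm_le_of_components)
        fix i
        have "norm ((V *v x) $ i) \<le> (\<Sum>j\<in>(UNIV :: 'n set). \<nu> * (e * (fact CARD('n) * \<alpha> ^ CARD('n)) / D))"
          unfolding matrix_vector_mult_def vec_lambda_beta
        proof (rule sum_norm_le)
          fix j
          have "0 \<le> \<nu>" using V[of i j] norm_ge_zero order_trans by blast
          then show "norm (V $ i $ j * x $ j) \<le> \<nu> * (e * (fact CARD('n) * \<alpha> ^ CARD('n)) / D)"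
            unfolding norm_mult using V x(2) by (intro mult_mono) auto
        qed
        then show "norm ((V *v x) $ i) \<le> real CARD('n) * (\<nu> * (e * (fact CARD('n) * \<alpha> ^ CARD('n)) / D))" by simp
      qed
      then show "norm (V *v x) \<le> \<tau> * e" unfolding \<tau>(1) by (simp add: mult_ac)
    qed
  qed
  obtain dlt where dlt: "A *v (u - dlt) = 0" "norm dlt \<le> \<tau> * e" using corr[OF e(2)] by blast
  obtain dlt' where dlt': "A *v (v - dlt') = 0" "norm dlt' \<le> \<tau> * e" using corr[OF e(3)] by blast
  have "invertible (A ** V)" using D by (auto simp: invertible_det_nz)
  then have "symplectic_form (u - dlt) (v - dlt') = 0"
    by (rule isotropic_annihilator[OF iso _ dlt(1) dlt'(1)])
  then have "symplectic_form u v = symplectic_form u dlt' + symplectic_form dlt v - symplectic_form dlt dlt'"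
    by (simp add: symplectic_form_diff_left symplectic_form_diff_right algebra_simps)
  also have "norm \<dots> \<le> norm (symplectic_form u dlt') + norm (symplectic_form dlt v) + norm (symplectic_form dlt dlt')"
    by (meson norm_triangle_ineq norm_triangle_ineq4 add_right_mono order_trans)
  also have "\<dots> \<le> 2 * real CARD('n) * (\<tau> * e) + 2 * real CARD('n) * (\<tau> * e) + 2 * real CARD('n) * (\<tau> * e)"
  proof (intro add_mono)
    have \<tau>e: "0 \<le> \<tau> * e" using dlt(2) norm_ge_zero order_trans by blast
    have 1: "norm x * norm y \<le> \<tau> * e" if "norm x \<le> 1" "norm y \<le> \<tau> * e" for x y :: "complex^('n+'n)"
      using mult_mono[OF that] by simp
    have b: "norm (symplectic_form x y) \<le> 2 * real CARD('n) * (\<tau> * e)" if "norm x * norm y \<le> \<tau> * e" for x y :: "complex^('n+'n)"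
    proof -
      have "2 * real CARD('n) * (norm x * norm y) \<le> 2 * real CARD('n) * (\<tau> * e)" using that by (intro mult_left_mono) auto
      then show ?thesis using norm_symplectic_form[of x y] unfolding mult.assoc by linarith
    qed
    show "norm (symplectic_form u dlt') \<le> 2 * real CARD('n) * (\<tau> * e)" by (rule b[OF 1[OF uv(1) dlt'(2)]])
    show "norm (symplectic_form dlt v) \<le> 2 * real CARD('n) * (\<tau> * e)"
      using 1[OF uv(2) dlt(2)] by (intro b) (simp add: mult.commute)
    show "norm (symplectic_form dlt dlt') \<le> 2 * real CARD('n) * (\<tau> * e)"
      using dlt(2) \<tau>(2) by (intro b 1 dlt'(2)) linarith
  qed
  finally show ?thesis by (simp add: mult_ac)
qed

lemma poisson_bracket_eq_symplectic_form: "poisson_bracket F G z = symplectic_form (grad F z) (grad G z)"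
  by (simp add: poisson_bracket_def symplectic_form_def grad_def)

section \<open>First integrals near a curve\<close>

lemma mv_holomorphic_on_cong:
  assumes "mv_holomorphic_on f S" "open S" "\<And>z. z \<in> S \<Longrightarrow> f z = g z"
  shows "mv_holomorphic_on g S"
  unfolding mv_holomorphic_on_def
proof
  fix z assume z: "z \<in> S"
  then obtain f' where f': "(f has_derivative f') (at z)" "\<forall>c v. f' (c *s v) = c * f' v"
    using assms(1) unfolding mv_holomorphic_on_def by blast
  have "(g has_derivative f') (at z)"
    by (rule has_derivative_transform_within_open[OF f'(1) assms(2) z assms(3)])
  then show "\<exists>f'. (g has_derivative f') (at z) \<and> (\<forall>c v. f' (c *s v) = c * f' v)" using f'(2) by blast
qed

lemma partial_deriv_divide:
  assumes g: "mv_holomorphic_on g S" and h: "mv_holomorphic_on h S" and z: "z \<in> S" "h z \<noteq> 0"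
  shows "partial_deriv m (\<lambda>z. g z / h z) z = (partial_deriv m g z * h z - g z * partial_deriv m h z) / (h z * h z)"
proof (rule partial_deriv_eq)
  have "((\<lambda>z. g z / h z) has_derivative (\<lambda>v. ((\<Sum>i\<in>UNIV. v $ i * partial_deriv i g z) * h z - g z * (\<Sum>i\<in>UNIV. v $ i * partial_deriv i h z)) / (h z * h z))) (at z)"
    by (rule has_derivative_divide'[OF mv_holomorphic_on_has_derivative[OF g z(1)] mv_holomorphic_on_has_derivative[OF h z(1)] z(2)])
  then show "((\<lambda>z. g z / h z) has_derivative (\<lambda>v. \<Sum>i\<in>UNIV. v $ i * ((partial_deriv i g z * h z - g z * partial_deriv i h z) / (h z * h z)))) (at z)"
    by (rule has_derivative_eq_rhs)
       (simp add: fun_eq_iff sum_distrib_left sum_distrib_right sum_subtractf[symmetric] sum_divide_distrib algebra_simps)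
qed

lemma mv_holomorphic_on_det:
  fixes M :: "complex^'k \<Rightarrow> complex^'n^'n"
  assumes "\<And>i j. mv_holomorphic_on (\<lambda>z. M z $ i $ j) S"
  shows "mv_holomorphic_on (\<lambda>z. det (M z)) S"
  unfolding det_def by (intro mv_holomorphic_intros assms)

locale integrable_flow = linear_flow Lm b0
  for Lm :: "complex \<Rightarrow> complex^('n::finite + 'n)^('n + 'n)" and b0 :: "complex^('n + 'n)" +
  fixes W :: "(complex^('n + 'n)) set" and F :: "'n \<Rightarrow> complex^('n + 'n) \<Rightarrow> complex"
  assumes open_W: "open W" and meromorphic: "\<And>i. mv_meromorphic_on (F i) W"
    and independent: "functionally_independent W F"
begin

definition jacobian :: "complex^('n + 'n) \<Rightarrow> complex^('n + 'n)^'n" where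
  "jacobian z = (\<chi> i m. partial_deriv m (F i) z)"

text \<open>A quantitative substitute, uniform near \<open>t\<close> and \<open>c\<close>, for
  regularity and independence of the integrals: growth at most polynomial in \<open>1 / eps\<close>,
  and one constant matrix \<open>V\<close> for which the determinant of the Jacobian times
  \<open>V\<close> decays at most polynomially.\<close>

definition good :: "complex \<Rightarrow> complex^('n + 'n) \<Rightarrow> bool" where
  "good t c \<longleftrightarrow> (\<exists>d>0. \<exists>l V. \<forall>t'\<in>ball t d. \<forall>c'\<in>ball c d. \<forall>eps. 0 < eps \<longrightarrow> eps < d \<longrightarrow>
     (\<forall>i. nearby t' eps c' \<in> regular_points (F i) W \<and> norm (F i (nearby t' eps c')) \<le> 1 / eps ^ l) \<and>
     eps ^ l \<le> norm (det (jacobian (nearby t' eps c') ** V)))"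

text \<open>Each integral brings its own connected neighbourhood. On a common ball the denominators
  are still not identically zero, by the identity theorem on those larger sets. The doubled radius
  leaves a compact ball on which numerators and denominators are bounded.\<close>

lemma local_quotients:
  assumes z0: "z0 \<in> W"
  obtains \<rho> g h where "\<rho> > 0" "cball z0 \<rho> \<subseteq> W"
    "\<And>i. mv_holomorphic_on (g i) (ball z0 (2*\<rho>))" "\<And>i. mv_holomorphic_on (h i) (ball z0 (2*\<rho>))" "ball z0 (2*\<rho>) \<subseteq> W"
    "\<And>i. \<exists>z\<in>ball z0 \<rho>. h i z \<noteq> 0" "\<And>i z. z \<in> ball z0 (2*\<rho>) \<Longrightarrow> h i z \<noteq> 0 \<Longrightarrow> F i z = g i z / h i z"
proof -
  define Q where "Q = (\<lambda>i N g h. open N \<and> connected N \<and> z0 \<in> N \<and> N \<subseteq> W \<and>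
        mv_holomorphic_on g N \<and> mv_holomorphic_on h N \<and> (\<exists>z\<in>N. h z \<noteq> 0) \<and>
        (\<forall>z\<in>N. h z \<noteq> 0 \<longrightarrow> F i z = g z / h z))"
  have ex: "\<exists>N g h. Q i N g h" for i
    using meromorphic[of i, unfolded mv_meromorphic_on_def, THEN bspec, OF z0] unfolding Q_def .
  define N where "N i = (SOME N. \<exists>g h. Q i N g h)" for i
  define g where "g i = (SOME g. \<exists>h. Q i (N i) g h)" for i
  define h where "h i = (SOME h. Q i (N i) (g i) h)" for i
  have "\<exists>g h. Q i (N i) g h" for i unfolding N_def by (rule someI_ex[OF ex])
  then have "\<exists>h. Q i (N i) (g i) h" for i unfolding g_def by (rule someI_ex)
  then have Q: "Q i (N i) (g i) (h i)" for i unfolding h_def by (rule someI_ex)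
  have Q': "open (N i)" "connected (N i)" "z0 \<in> N i" "N i \<subseteq> W" "mv_holomorphic_on (g i) (N i)"
    "mv_holomorphic_on (h i) (N i)" "\<exists>z\<in>N i. h i z \<noteq> 0" "\<forall>z\<in>N i. h i z \<noteq> 0 \<longrightarrow> F i z = g i z / h i z" for i
    using Q[of i] unfolding Q_def by simp_all
  have "open (\<Inter>i. N i)" using Q'(1) by (intro open_INT) auto
  moreover have "z0 \<in> (\<Inter>i. N i)" using Q'(3) by simp
  ultimately have "\<exists>e>0. cball z0 e \<subseteq> (\<Inter>i. N i)" by (rule open_contains_cball[THEN iffD1, THEN bspec])
  then obtain e where e: "e > 0" "cball z0 e \<subseteq> (\<Inter>i. N i)" by blast
  define \<rho> where "\<rho> = e / 2"
  have \<rho>: "\<rho> > 0" "ball z0 (2*\<rho>) \<subseteq> (\<Inter>i. N i)" "cball z0 \<rho> \<subseteq> (\<Inter>i. N i)"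
  proof -
    show "\<rho> > 0" using e by (simp add: \<rho>_def)
    have "ball z0 (2*\<rho>) \<subseteq> cball z0 e" by (simp add: \<rho>_def ball_subset_cball)
    then show "ball z0 (2*\<rho>) \<subseteq> (\<Inter>i. N i)" using e(2) by (rule order_trans)
    have "cball z0 \<rho> \<subseteq> cball z0 e" using e(1) by (intro subset_cball) (simp add: \<rho>_def)
    then show "cball z0 \<rho> \<subseteq> (\<Inter>i. N i)" using e(2) by (rule order_trans)
  qed
  have sub: "ball z0 (2*\<rho>) \<subseteq> N i" for i using \<rho>(2) INT_lower[of i UNIV N] by (simp add: subset_trans)
  have nz: "\<exists>z\<in>ball z0 \<rho>. h i z \<noteq> 0" for i
  proof (rule ccontr)
    assume "\<not> ?thesis"
    then have 0: "\<And>y. y \<in> ball z0 \<rho> \<inter> N i \<Longrightarrow> h i y = 0" by simp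
    have "h i z = 0" if "z \<in> N i" for z
      by (rule mv_holomorphic_zero_connected[OF Q'(6) Q'(1) Q'(2) Q'(3) \<rho>(1) _ that]) (rule 0)
    then show False using Q'(7)[of i] by simp
  qed
  show thesis
  proof (rule that[of \<rho> g h, OF \<rho>(1)])
    show "cball z0 \<rho> \<subseteq> W" using subset_trans[OF \<rho>(3) INT_lower[of undefined UNIV N]] Q'(4)[of undefined] by simp
    show "ball z0 (2*\<rho>) \<subseteq> W" using subset_trans[OF sub Q'(4)] .
    show "mv_holomorphic_on (g i) (ball z0 (2*\<rho>))" "mv_holomorphic_on (h i) (ball z0 (2*\<rho>))" for i
      by (rule mv_holomorphic_on_subset[OF Q'(5) sub], rule mv_holomorphic_on_subset[OF Q'(6) sub])
    show "\<exists>z\<in>ball z0 \<rho>. h i z \<noteq> 0" for i by (rule nz)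
    show "F i z = g i z / h i z" if "z \<in> ball z0 (2*\<rho>)" "h i z \<noteq> 0" for i z
      using Q'(8)[of i, THEN bspec, of z] sub[of i] that by (simp add: subset_iff)
  qed
qed

text \<open>All denominators and the Jacobian determinant, cleared of denominators, are multiplied
  into one holomorphic function \<open>hh\<close>. A lower bound for the product together with upper
  bounds for its factors yields lower bounds for the factors, so a single application of
  \<open>generic_lower_bounded\<close> suffices.\<close>

lemma local_generic_good:
  assumes z0: "curve t0 \<in> W"
  shows "\<exists>dlt>0. \<exists>p. generic_on p \<and> (\<forall>c. p c \<noteq> 0 \<longrightarrow> finite {t \<in> ball t0 dlt. \<not> good t c})"
proof -
  let ?z = "curve t0"
  obtain \<rho> g h where \<rho>: "\<rho> > 0" "cball ?z \<rho> \<subseteq> W"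
    and g: "\<And>i. mv_holomorphic_on (g i) (ball ?z (2*\<rho>))" and h: "\<And>i. mv_holomorphic_on (h i) (ball ?z (2*\<rho>))"
    and BW: "ball ?z (2*\<rho>) \<subseteq> W" and hnz: "\<And>i. \<exists>z\<in>ball ?z \<rho>. h i z \<noteq> 0"
    and Fq: "\<And>i z. z \<in> ball ?z (2*\<rho>) \<Longrightarrow> h i z \<noteq> 0 \<Longrightarrow> F i z = g i z / h i z"
    using local_quotients[OF z0] by blast
  let ?B = "ball ?z \<rho>" and ?B2 = "ball ?z (2*\<rho>)"
  have sub: "?B \<subseteq> ?B2" "cball ?z \<rho> \<subseteq> ?B2" using \<rho> by auto
  have hB: "mv_holomorphic_on (h i) ?B" for i using h sub mv_holomorphic_on_subset by blast
  define H where "H = (\<lambda>z. \<Prod>i\<in>UNIV. h i z)"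
  have holH: "mv_holomorphic_on H ?B" "mv_holomorphic_on H ?B2" unfolding H_def by (intro mv_holomorphic_on_prod hB h)+
  have "\<exists>z\<in>?B. H z \<noteq> 0" unfolding H_def
    by (rule mv_holomorphic_prod_nonzero[OF open_ball connected_ball]) (use \<rho> hB hnz in auto)
  then obtain z' where z': "z' \<in> ?B" "H z' \<noteq> 0" by blast
  have "open {z \<in> ?B. H z \<in> - {0}}"
    using continuous_open_preimage[OF mv_holomorphic_on_imp_continuous_on[OF holH(1)] open_ball, of "-{0}"]
    by (simp add: vimage_def Int_def open_Compl)
  then obtain r where r: "r > 0" "ball z' r \<subseteq> {z \<in> ?B. H z \<in> - {0}}"
    using z' open_contains_ball[of "{z \<in> ?B. H z \<in> - {0}}"] by blast
  obtain D where D: "open D" "D \<subseteq> W" "W \<subseteq> closure D"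
    "\<And>z c. z \<in> D \<Longrightarrow> (\<Sum>i\<in>UNIV. c i *s grad (F i) z) = 0 \<Longrightarrow> \<forall>i. c i = 0"
    using independent unfolding functionally_independent_def by blast
  have "z' \<in> closure D" using z' D(3) BW sub by blast
  then obtain z1 where z1: "z1 \<in> D" "dist z1 z' < r" using r(1) closure_approachable by blast
  have z1B: "z1 \<in> ?B" "H z1 \<noteq> 0" using r z1 by (auto simp: dist_commute subset_iff)
  have reg: "z \<in> regular_points (F i) W" and pd: "partial_deriv m (F i) z = (partial_deriv m (g i) z * h i z - g i z * partial_deriv m (h i) z) / (h i z * h i z)"
    if z: "z \<in> ?B" and hz: "h i z \<noteq> 0" for i m z
  proof -
    have o: "open {z \<in> ?B. h i z \<in> - {0}}"
      using continuous_open_preimage[OF mv_holomorphic_on_imp_continuous_on[OF hB] open_ball, of "-{0}"]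
      by (simp add: vimage_def Int_def open_Compl)
    let ?N = "{z \<in> ?B. h i z \<in> - {0}}"
    have q: "mv_holomorphic_on (\<lambda>z. g i z / h i z) ?N"
      by (intro mv_holomorphic_on_divide mv_holomorphic_on_subset[OF g] mv_holomorphic_on_subset[OF h]) (use sub in auto)
    have e: "g i z / h i z = F i z" if "z \<in> ?N" for z using Fq[of z i] that sub by auto
    have "mv_holomorphic_on (F i) ?N" by (rule mv_holomorphic_on_cong[OF q o e])
    moreover have "?N \<subseteq> W" using BW sub by auto
    ultimately show "z \<in> regular_points (F i) W" unfolding regular_points_def using o z hz by blast
    have "partial_deriv m (F i) z = partial_deriv m (\<lambda>z. g i z / h i z) z"
      by (rule partial_deriv_cong_open[OF o]) (use z hz e in auto)
    also have "\<dots> = (partial_deriv m (g i) z * h i z - g i z * partial_deriv m (h i) z) / (h i z * h i z)"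
      by (rule partial_deriv_divide[OF g h]) (use z sub hz in auto)
    finally show "partial_deriv m (F i) z = (partial_deriv m (g i) z * h i z - g i z * partial_deriv m (h i) z) / (h i z * h i z)" .
  qed
  \<comment> \<open>Independence of the differentials at \<open>z1\<close> gives a right inverse of
    the Jacobian there; with this constant matrix the determinant is not identically zero.\<close>
  have "(\<exists>V. jacobian z1 ** V = mat 1)"
    unfolding matrix_right_invertible_independent_rows
  proof (intro allI impI)
    fix c i assume "(\<Sum>i\<in>UNIV. c i *s row i (jacobian z1)) = 0"
    moreover have "row i (jacobian z1) = grad (F i) z1" for i by (simp add: row_def jacobian_def grad_def vec_eq_iff)
    ultimately show "c i = 0" using D(4)[OF z1(1), of c] by simp
  qed
  then obtain V where V: "jacobian z1 ** V = mat 1" by blast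
  \<comment> \<open>The rows are multiplied by the squares of the denominators, which makes the
    determinant holomorphic also where the integrals are singular.\<close>
  define Jn where "Jn = (\<lambda>z. det ((\<chi> i m. partial_deriv m (g i) z * h i z - g i z * partial_deriv m (h i) z) ** V))"
  have holJn: "mv_holomorphic_on Jn ?B2"
    unfolding Jn_def matrix_matrix_mult_def
    by (intro mv_holomorphic_on_det) (simp add: mv_holomorphic_intros g h mv_holomorphic_on_partial_deriv)
  have Jn: "Jn z = (\<Prod>i\<in>UNIV. h i z * h i z) * det (jacobian z ** V)" if z: "z \<in> ?B" "H z \<noteq> 0" for z
  proof -
    have hz: "h i z \<noteq> 0" for i using z(2) by (simp add: H_def)
    have "(\<chi> i m. partial_deriv m (g i) z * h i z - g i z * partial_deriv m (h i) z) = (\<chi> i. (h i z * h i z) *s jacobian z $ i)"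
      using hz by (simp add: vec_eq_iff jacobian_def pd[OF z(1) hz])
    moreover have "(\<chi> i. (h i z * h i z) *s jacobian z $ i) ** V = (\<chi> i. (h i z * h i z) *s (jacobian z ** V) $ i)"
      by (simp add: vec_eq_iff matrix_matrix_mult_def sum_distrib_left mult_ac)
    ultimately have "Jn z = det (\<chi> i. (h i z * h i z) *s (jacobian z ** V) $ i)" unfolding Jn_def by simp
    also have "\<dots> = (\<Prod>i\<in>UNIV. h i z * h i z) * det (\<chi> i. (jacobian z ** V) $ i)" by (rule det_rows_mul)
    finally show ?thesis by simp
  qed
  define hh where "hh = (\<lambda>z. Jn z * H z)"
  have holhh: "mv_holomorphic_on hh ?B" unfolding hh_def
    using holJn holH sub by (intro mv_holomorphic_on_mult mv_holomorphic_on_subset[OF holJn]) auto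
  have "Jn z1 \<noteq> 0" using Jn[OF z1B] z1B by (simp add: V H_def)
  then have nz: "\<exists>z\<in>?B. hh z \<noteq> 0" using z1B by (auto simp: hh_def)
  have cB: "curve t0 \<in> ?B" using \<rho> by simp
  from generic_lower_bounded[OF holhh open_ball connected_ball cB nz]
  obtain dlt p where dlt: "dlt > 0" "generic_on p" "\<And>c. p c \<noteq> 0 \<Longrightarrow> finite {t \<in> ball t0 dlt. \<not> lower_bounded hh ?B t c}" by blast
  have bdd: "\<exists>Q. \<forall>z\<in>?B. norm (f z) \<le> Q" if "mv_holomorphic_on f ?B2" for f
  proof -
    have "compact (f ` cball ?z \<rho>)"
      by (intro compact_continuous_image continuous_on_subset[OF mv_holomorphic_on_imp_continuous_on[OF that]] sub) auto
    then obtain Q where "\<And>p. p \<in> f ` cball ?z \<rho> \<Longrightarrow> norm p \<le> Q" using compact_imp_bounded bounded_iff by meson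
    then show ?thesis by (intro exI[of _ Q]) auto
  qed
  obtain Qg where Qg: "\<And>i z. z \<in> ?B \<Longrightarrow> norm (g i z) \<le> Qg i" using bdd[OF g] by metis
  obtain Qh where Qh: "\<And>i z. z \<in> ?B \<Longrightarrow> norm (h i z) \<le> Qh i" using bdd[OF h] by metis
  obtain QJ where QJ: "\<And>z. z \<in> ?B \<Longrightarrow> norm (Jn z) \<le> QJ" using bdd[OF holJn] by metis
  define Q where "Q = Max (insert 1 (insert QJ (range Qg \<union> range Qh)))"
  have Q1: "1 \<le> Q" unfolding Q_def by (intro Max_ge) auto
  have Qg': "norm (g i z) \<le> Q" if "z \<in> ?B" for i z
    unfolding Q_def by (rule order_trans[OF Qg[OF that]], rule Max_ge, simp, blast)
  have Qh': "norm (h i z) \<le> Q" if "z \<in> ?B" for i z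
    unfolding Q_def by (rule order_trans[OF Qh[OF that]], rule Max_ge, simp, blast)
  have QJ': "norm (Jn z) \<le> Q" if "z \<in> ?B" for z
    unfolding Q_def by (rule order_trans[OF QJ[OF that]], rule Max_ge, simp, blast)
  define n where "n = CARD('n)"
  have Hle: "norm (H z) \<le> Q ^ n" if "z \<in> ?B" for z
  proof -
    have "(\<Prod>i\<in>(UNIV :: 'n set). norm (h i z)) \<le> (\<Prod>i\<in>(UNIV :: 'n set). Q)" using Qh'[OF that] by (intro prod_mono) auto
    then show ?thesis by (simp add: H_def prod_norm[symmetric] n_def)
  qed
  have "lower_bounded hh ?B t c \<Longrightarrow> good t c" for t c
  proof -
    assume "lower_bounded hh ?B t c"
    then obtain d l where d: "d > 0" and lb: "\<And>t' c' eps. t' \<in> ball t d \<Longrightarrow> c' \<in> ball c d \<Longrightarrow> 0 < eps \<Longrightarrow> eps < d \<Longrightarrow>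
       nearby t' eps c' \<in> ?B \<and> eps ^ l \<le> norm (hh (nearby t' eps c'))" unfolding lower_bounded_def by blast
    \<comment> \<open>\<open>q\<close> exceeds every constant that arises: \<open>Q ^ Suc n\<close>
      from the bounds on the integrals and \<open>Q ^ (n * 3)\<close> from the determinant. For
      \<open>eps < 1 / q\<close> it is absorbed by one additional power of
      \<open>eps\<close>.\<close>
    define q where "q = Q ^ (3 * n + 2)"
    have q: "1 \<le> q" unfolding q_def by (rule one_le_power[OF Q1])
    have Qq: "Q ^ k \<le> q" if "k \<le> 3 * n + 2" for k unfolding q_def using Q1 that by (intro power_increasing) auto
    show "good t c" unfolding good_def
    proof (rule exI[of _ "min d (1/q)"], intro conjI, simp add: d, use q in simp, rule exI[of _ "Suc l"], rule exI[of _ V], intro ballI allI impI)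
      fix t' c' and eps :: real
      assume a: "t' \<in> ball t (min d (1/q))" "c' \<in> ball c (min d (1/q))" "0 < eps" "eps < min d (1/q)"
      define z where "z = nearby t' eps c'"
      have z: "z \<in> ?B" "eps ^ l \<le> norm (hh z)" unfolding z_def using lb a by auto
      have el: "0 < eps ^ l" using a by simp
      have eq: "q * eps ^ Suc l \<le> eps ^ l"
      proof -
        have "q * eps \<le> 1" using a(4) q by (simp add: pos_less_divide_eq mult.commute)
        then have "(q * eps) * eps ^ l \<le> 1 * eps ^ l" using el by (intro mult_right_mono) auto
        then show ?thesis by (simp add: mult_ac)
      qed
      have Hz: "H z \<noteq> 0" using z(2) el by (auto simp: hh_def)
      have hz: "h i z \<noteq> 0" for i using Hz by (simp add: H_def)
      \<comment> \<open>The lower bound for \<open>hh\<close> passes to a single denominator because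
        the other factors together are at most \<open>Q ^ n\<close>.\<close>
      have hi: "eps ^ l \<le> norm (h i z) * Q ^ n" for i
      proof -
        have "H z = h i z * (\<Prod>j\<in>UNIV-{i}. h j z)" unfolding H_def by (subst prod.remove[of _ i]) auto
        then have e1: "norm (hh z) = norm (h i z) * (norm (Jn z) * norm (\<Prod>j\<in>UNIV-{i}. h j z))"
          by (simp add: hh_def norm_mult)
        have "norm (Jn z) * norm (\<Prod>j\<in>UNIV-{i}. h j z) \<le> Q * Q ^ (n - 1)"
        proof (rule mult_mono[OF QJ'[OF z(1)]])
          have "(\<Prod>j\<in>UNIV-{i}. norm (h j z)) \<le> (\<Prod>j\<in>UNIV-{i}. Q)" using Qh'[OF z(1)] by (intro prod_mono) auto
          then show "norm (\<Prod>j\<in>UNIV-{i}. h j z) \<le> Q ^ (n - 1)" by (simp add: prod_norm[symmetric] n_def)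
        qed (use Q1 in auto)
        moreover have "Q * Q ^ (n - 1) = Q ^ n" unfolding n_def by (simp add: power_eq_if)
        ultimately have "norm (Jn z) * norm (\<Prod>j\<in>UNIV-{i}. h j z) \<le> Q ^ n" by simp
        from mult_left_mono[OF this norm_ge_zero, of "h i z"] show ?thesis using z(2) e1 by linarith
      qed
      have F: "norm (F i z) \<le> 1 / eps ^ Suc l" for i
      proof -
        have "norm (F i z) = norm (g i z) / norm (h i z)" using Fq[OF _ hz] z(1) sub by (auto simp: norm_divide)
        moreover have "norm (g i z) * eps ^ Suc l \<le> norm (h i z)"
        proof -
          have "norm (g i z) * Q ^ n * eps ^ Suc l \<le> Q * Q ^ n * eps ^ Suc l"
            using Qg'[OF z(1)] Q1 a by (intro mult_right_mono) auto
          also have "\<dots> \<le> q * eps ^ Suc l" using Qq[of "Suc n"] a by (intro mult_right_mono) auto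
          also have "\<dots> \<le> norm (h i z) * Q ^ n" using eq hi[of i] by linarith
          finally have "norm (g i z) * eps ^ Suc l * Q ^ n \<le> norm (h i z) * Q ^ n" by (simp add: mult_ac)
          then show ?thesis using Q1 by (simp add: mult_le_cancel_right)
        qed
        ultimately show ?thesis using hz[of i] a(3) by (simp add: divide_le_eq pos_le_divide_eq)
      qed
      \<comment> \<open>Three factors \<open>H z\<close> occur: two from clearing the rows of the
        Jacobian, one from the definition of \<open>hh\<close>.\<close>
      have dt: "eps ^ Suc l \<le> norm (det (jacobian z ** V))"
      proof -
        have "(\<Prod>i\<in>UNIV. h i z * h i z) = H z * H z" by (simp add: H_def prod.distrib)
        then have "hh z = H z * H z * det (jacobian z ** V) * H z" by (simp add: hh_def Jn[OF z(1) Hz])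
        then have "norm (hh z) = norm (det (jacobian z ** V)) * (norm (H z)) ^ 3"
          by (simp add: norm_mult power3_eq_cube mult_ac)
        also have "\<dots> \<le> norm (det (jacobian z ** V)) * (Q ^ n) ^ 3"
          using Hle[OF z(1)] by (intro mult_left_mono power_mono) auto
        also have "\<dots> \<le> norm (det (jacobian z ** V)) * q"
          using Qq[of "n * 3"] by (intro mult_left_mono) (auto simp: power_mult[symmetric])
        finally have "q * eps ^ Suc l \<le> q * norm (det (jacobian z ** V))" using eq z(2) by (simp add: mult.commute)
        then show ?thesis using q by (simp add: mult_le_cancel_left)
      qed
      show "(\<forall>i. nearby t' eps c' \<in> regular_points (F i) W \<and> norm (F i (nearby t' eps c')) \<le> 1 / eps ^ Suc l) \<and>
         eps ^ Suc l \<le> norm (det (jacobian (nearby t' eps c') ** V))"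
        using F dt reg[OF z(1) hz] unfolding z_def[symmetric] by blast
    qed
  qed
  then have "{t \<in> ball t0 dlt. \<not> good t c} \<subseteq> {t \<in> ball t0 dlt. \<not> lower_bounded hh ?B t c}" for c by blast
  then show ?thesis using dlt by (intro exI[of _ dlt] conjI exI[of _ p]) (auto intro: finite_subset)
qed

lemma generic_good:
  assumes "compact K" "\<And>t. t \<in> K \<Longrightarrow> curve t \<in> W"
  shows "\<exists>p. generic_on p \<and> (\<forall>c. p c \<noteq> 0 \<longrightarrow> finite {t \<in> K. \<not> good t c})"
  by (rule generic_finite_on_compact[OF assms(1) local_generic_good[OF assms(2)]])

end

section \<open>Variation of constants for first integrals\<close>

context linear_flow
begin

definition dLm :: "complex \<Rightarrow> complex^'m^'m" where "dLm t = (\<chi> i j. deriv (\<lambda>t. Lm t $ i $ j) t)"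

lemma has_derivative_nearby:
  "((\<lambda>(t,c). nearby t eps c) has_derivative
     (\<lambda>(\<tau>,v). \<tau> *s (dLm t *v (b0 + of_real eps *s c)) + of_real eps *s (Lm t *v v))) (at (t,c))"
proof -
  have L: "((\<lambda>t. Lm t $ i $ j) has_derivative (\<lambda>\<tau>. dLm t $ i $ j * \<tau>)) (at t)" for i j
    using holomorphic_derivI[OF Lm_holomorphic[of i j] open_UNIV, of t]
    by (simp add: dLm_def has_field_derivative_def)
  have f: "(fst has_derivative fst) (at (t,c))" by (rule bounded_linear_imp_has_derivative[OF bounded_linear_fst])
  have L': "((\<lambda>p. Lm (fst p) $ i $ j) has_derivative (\<lambda>q. dLm t $ i $ j * fst q)) (at (t,c))" for i j
    using has_derivative_compose[OF f, of "\<lambda>t. Lm t $ i $ j" "\<lambda>\<tau>. dLm t $ i $ j * \<tau>"] L by simp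
  have s: "((\<lambda>p. snd p $ j) has_derivative (\<lambda>q. snd q $ j)) (at (t,c))" for j
    by (rule bounded_linear_imp_has_derivative)
       (rule bounded_linear_compose[OF bounded_linear_vec_nth bounded_linear_snd])
  have e: "((\<lambda>p. Lm (fst p) $ i $ j * (b0 $ j + of_real eps * snd p $ j)) has_derivative
     (\<lambda>q. Lm t $ i $ j * (of_real eps * snd q $ j) + dLm t $ i $ j * fst q * (b0 $ j + of_real eps * c $ j))) (at (t,c))" for i j
    using has_derivative_mult[OF L' has_derivative_add[OF has_derivative_const[of "b0 $ j"] has_derivative_mult_right[OF s, of "of_real eps"]], of i j j]
    by simp
  have "((\<lambda>p. \<chi> i. \<Sum>j\<in>UNIV. Lm (fst p) $ i $ j * (b0 $ j + of_real eps * snd p $ j)) has_derivative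
     (\<lambda>q. \<chi> i. \<Sum>j\<in>UNIV. Lm t $ i $ j * (of_real eps * snd q $ j) + dLm t $ i $ j * fst q * (b0 $ j + of_real eps * c $ j))) (at (t,c))"
    by (intro has_derivative_vec_lambda has_derivative_sum e)
  moreover have "(\<lambda>p. \<chi> i. \<Sum>j\<in>UNIV. Lm (fst p) $ i $ j * (b0 $ j + of_real eps * snd p $ j)) = (\<lambda>(t,c). nearby t eps c)"
    by (simp add: fun_eq_iff nearby_def matrix_vector_mult_def)
  moreover have "(\<lambda>q. \<chi> i. \<Sum>j\<in>UNIV. Lm t $ i $ j * (of_real eps * snd q $ j) + dLm t $ i $ j * fst q * (b0 $ j + of_real eps * c $ j))
     = (\<lambda>(\<tau>,v). \<tau> *s (dLm t *v (b0 + of_real eps *s c)) + of_real eps *s (Lm t *v v))"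
    by (simp add: fun_eq_iff vec_eq_iff matrix_vector_mult_def sum.distrib sum_distrib_left algebra_simps)
  ultimately show ?thesis by simp
qed

lemma
  assumes "nearby t eps c \<in> regular_points f W"
  shows has_derivative_along_flow: "((\<lambda>(t,c). f (nearby t eps c)) has_derivative
     (\<lambda>(\<tau>,v). \<Sum>m\<in>UNIV. (\<tau> *s (dLm t *v (b0 + of_real eps *s c)) + of_real eps *s (Lm t *v v)) $ m * partial_deriv m f (nearby t eps c))) (at (t,c))"
    and sum_partial_deriv_nearby: "(\<Sum>k\<in>UNIV. v $ k * partial_deriv k (\<lambda>c. f (nearby t eps c)) c) =
       of_real eps * (\<Sum>m\<in>UNIV. (Lm t *v v) $ m * partial_deriv m f (nearby t eps c))"
    and has_derivative_nearby_initial: "((\<lambda>c. f (nearby t eps c)) has_derivative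
       (\<lambda>v. \<Sum>k\<in>UNIV. v $ k * partial_deriv k (\<lambda>c. f (nearby t eps c)) c)) (at c)"
proof -
  obtain N where N: "nearby t eps c \<in> N" "mv_holomorphic_on f N" using assms unfolding regular_points_def by blast
  have F: "(f has_derivative (\<lambda>u. \<Sum>m\<in>UNIV. u $ m * partial_deriv m f (nearby t eps c))) (at ((\<lambda>(t,c). nearby t eps c) (t,c)))"
    using mv_holomorphic_on_has_derivative[OF N(2,1)] by simp
  show 1: "((\<lambda>(t,c). f (nearby t eps c)) has_derivative
     (\<lambda>(\<tau>,v). \<Sum>m\<in>UNIV. (\<tau> *s (dLm t *v (b0 + of_real eps *s c)) + of_real eps *s (Lm t *v v)) $ m * partial_deriv m f (nearby t eps c))) (at (t,c))"
    using has_derivative_compose[OF has_derivative_nearby F] by (simp add: case_prod_unfold)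
  have p: "((\<lambda>c. (t, c)) has_derivative (\<lambda>v. (0, v))) (at c)" by (auto intro!: derivative_eq_intros)
  have 2: "((\<lambda>c. f (nearby t eps c)) has_derivative (\<lambda>v. of_real eps * (\<Sum>m\<in>UNIV. (Lm t *v v) $ m * partial_deriv m f (nearby t eps c)))) (at c)"
    using has_derivative_compose[OF p 1] by (simp add: sum_distrib_left mult_ac)
  have 3: "(\<lambda>v. of_real eps * (\<Sum>m\<in>UNIV. (Lm t *v v) $ m * partial_deriv m f (nearby t eps c)))
     = (\<lambda>v. \<Sum>k\<in>UNIV. v $ k * (of_real eps * (\<Sum>m\<in>UNIV. Lm t $ m $ k * partial_deriv m f (nearby t eps c))))"
    unfolding matrix_vector_mult_def vec_lambda_beta sum_distrib_left sum_distrib_right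
    by (subst sum.swap) (simp add: mult_ac)
  have 4: "partial_deriv k (\<lambda>c. f (nearby t eps c)) c = of_real eps * (\<Sum>m\<in>UNIV. Lm t $ m $ k * partial_deriv m f (nearby t eps c))" for k
    by (rule partial_deriv_eq[OF 2[unfolded 3]])
  show "(\<Sum>k\<in>UNIV. v $ k * partial_deriv k (\<lambda>c. f (nearby t eps c)) c) =
       of_real eps * (\<Sum>m\<in>UNIV. (Lm t *v v) $ m * partial_deriv m f (nearby t eps c))"
    unfolding 4 fun_cong[OF 3] ..
  show "((\<lambda>c. f (nearby t eps c)) has_derivative
       (\<lambda>v. \<Sum>k\<in>UNIV. v $ k * partial_deriv k (\<lambda>c. f (nearby t eps c)) c)) (at c)"
    unfolding 4 by (rule 2[unfolded 3])
qed

text \<open>For a solution written as \<open>nearby t eps c\<close> with moving \<open>c\<close>,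
  the term with \<open>dLm\<close> is the explicit time derivative, and the remaining part
  \<open>eps ^ Suc r\<close> of the field must come from the motion of \<open>c\<close>. As
  \<open>c\<close> enters with the factor \<open>eps\<close>, its velocity has order
  \<open>eps ^ r\<close>.\<close>

lemma slow_derivative:
  assumes reg: "nearby t eps c \<in> regular_points f W"
    and X: "(\<Sum>m\<in>UNIV. (dLm t *v (b0 + of_real eps *s c) + of_real (eps ^ Suc r) *s (Lm t *v y)) $ m * partial_deriv m f (nearby t eps c)) = 0"
  shows "((\<lambda>(t,c). f (nearby t eps c)) has_derivative
        (\<lambda>(\<tau>,v). \<Sum>k\<in>UNIV. (v - (\<tau> * of_real (eps ^ r)) *s y) $ k * partial_deriv k (\<lambda>c. f (nearby t eps c)) c)) (at (t,c))"
proof (rule has_derivative_eq_rhs[OF has_derivative_along_flow[OF reg]], rule ext, clarify)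
  fix \<tau> :: complex and v :: "complex^'m"
  let ?D = "\<lambda>m. partial_deriv m f (nearby t eps c)"
  have "(\<Sum>k\<in>UNIV. (v - (\<tau> * of_real (eps ^ r)) *s y) $ k * partial_deriv k (\<lambda>c. f (nearby t eps c)) c)
     = of_real eps * (\<Sum>m\<in>UNIV. (Lm t *v (v - (\<tau> * of_real (eps ^ r)) *s y)) $ m * ?D m)"
    by (rule sum_partial_deriv_nearby[OF reg])
  also have "\<dots> = of_real eps * (\<Sum>m\<in>UNIV. (Lm t *v v) $ m * ?D m) - \<tau> * (\<Sum>m\<in>UNIV. of_real (eps ^ Suc r) * (Lm t *v y) $ m * ?D m)"
    by (simp add: matrix_vector_mult_diff_distrib matrix_vector_mult_scale sum_subtractf sum_distrib_left algebra_simps)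
  also have "(\<Sum>m\<in>UNIV. of_real (eps ^ Suc r) * (Lm t *v y) $ m * ?D m) = - (\<Sum>m\<in>UNIV. (dLm t *v (b0 + of_real eps *s c)) $ m * ?D m)"
    using X by (simp add: algebra_simps sum.distrib eq_neg_iff_add_eq_0 del: of_real_power power_Suc of_real_mult)
  finally show "(\<Sum>m\<in>UNIV. (\<tau> *s (dLm t *v (b0 + of_real eps *s c)) + of_real eps *s (Lm t *v v)) $ m * ?D m) =
     (\<Sum>k\<in>UNIV. (v - (\<tau> * of_real (eps ^ r)) *s y) $ k * partial_deriv k (\<lambda>c. f (nearby t eps c)) c)"
    by (simp add: sum.distrib sum_distrib_left algebra_simps)
qed

end

context integrable_flow
begin

text \<open>A finite subcover of \<open>S\<close> makes the radii and the exponents independent of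
  the time.\<close>

lemma uniform_good:
  assumes S: "compact S" and good: "\<And>t. t \<in> S \<Longrightarrow> good t c0"
  shows "\<exists>d>0. \<exists>l. \<forall>t\<in>S. \<forall>c\<in>ball c0 d. \<forall>eps. 0 < eps \<longrightarrow> eps < d \<longrightarrow>
     (\<forall>i. nearby t eps c \<in> regular_points (F i) W \<and> norm (F i (nearby t eps c)) \<le> 1 / eps ^ l)"
proof -
  have "\<exists>d>0. \<exists>l. \<forall>t'\<in>ball t d. \<forall>c\<in>ball c0 d. \<forall>eps. 0 < eps \<longrightarrow> eps < d \<longrightarrow>
     (\<forall>i. nearby t' eps c \<in> regular_points (F i) W \<and> norm (F i (nearby t' eps c)) \<le> 1 / eps ^ l)" if "t \<in> S" for t
    using good[OF that] unfolding good_def by fast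
  then obtain d l where dl: "\<And>t. t \<in> S \<Longrightarrow> d t > 0" "\<And>t. t \<in> S \<Longrightarrow> \<forall>t'\<in>ball t (d t). \<forall>c\<in>ball c0 (d t). \<forall>eps. 0 < eps \<longrightarrow> eps < d t \<longrightarrow>
     (\<forall>i. nearby t' eps c \<in> regular_points (F i) W \<and> norm (F i (nearby t' eps c)) \<le> 1 / eps ^ l t)" by metis
  have "S \<subseteq> (\<Union>t\<in>S. ball t (d t))" using dl(1) by auto
  then obtain T where T: "T \<subseteq> S" "finite T" "S \<subseteq> (\<Union>t\<in>T. ball t (d t))"
    using compactE_image[OF S, of S "\<lambda>t. ball t (d t)"] by auto
  define D where "D = Min (insert 1 (d ` T))"
  define L where "L = Max (insert 0 (l ` T))"
  have D: "D > 0" "D \<le> 1" "\<And>t. t \<in> T \<Longrightarrow> D \<le> d t" using T dl(1) by (auto simp: D_def)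
  have L: "\<And>t. t \<in> T \<Longrightarrow> l t \<le> L" using T by (auto simp: L_def)
  show ?thesis
  proof (rule exI[of _ D], rule conjI[OF D(1)], rule exI[of _ L], intro ballI allI impI)
    fix t c and eps :: real and i assume a: "t \<in> S" "c \<in> ball c0 D" "0 < eps" "eps < D"
    obtain t1 where t1: "t1 \<in> T" "t \<in> ball t1 (d t1)" using a(1) T(3) by blast
    have c: "c \<in> ball c0 (d t1)" "eps < d t1" using a D(3)[OF t1(1)] by auto
    have t1S: "t1 \<in> S" using t1 T by blast
    have 1: "nearby t eps c \<in> regular_points (F i) W" "norm (F i (nearby t eps c)) \<le> 1 / eps ^ l t1"
      using dl(2)[OF t1S, THEN bspec, OF t1(2), THEN bspec, OF c(1), THEN spec, THEN mp, OF a(3), THEN mp, OF c(2)] by simp_all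
    have "eps ^ L \<le> eps ^ l t1" using L[OF t1(1)] a D by (intro power_decreasing) auto
    then have "1 / eps ^ l t1 \<le> 1 / eps ^ L" using a by (intro divide_left_mono mult_pos_pos) auto
    then show "nearby t eps c \<in> regular_points (F i) W \<and> norm (F i (nearby t eps c)) \<le> 1 / eps ^ L" using 1 by linarith
  qed
qed

end

locale integrable_slow_system = integrable_flow Lm b0 W F +
    slow_system r l dlt B c0 Y Y0 "\<lambda>i eps t c. F i (linear_flow.nearby Lm b0 t eps c)" S
  for Lm :: "complex \<Rightarrow> complex^('n::finite + 'n)^('n + 'n)" and b0 :: "complex^('n + 'n)"
    and W :: "(complex^('n + 'n)) set" and F :: "'n \<Rightarrow> complex^('n + 'n) \<Rightarrow> complex"
    and r l dlt B c0 Y Y0 S +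
  assumes involution: "\<And>i j z. z \<in> regular_points (F i) W \<Longrightarrow> z \<in> regular_points (F j) W \<Longrightarrow> poisson_bracket (F i) (F j) z = 0"
begin

text \<open>The truncated logarithms of the two closed transports are almost annihilated by the
  differentials of the integrals, whose span is isotropic by involution. The quantitative
  annihilator lemma bounds their symplectic product. This product is also
  \<open>eps ^ (2 * r)\<close> times that of the displacements, up to smaller terms, so letting
  \<open>eps\<close> tend to 0 gives the claim.\<close>

lemma isotropic_displacements:
  assumes k: "transport t t k" "transport t t k'" and t: "t \<in> S" and good: "good t c0"
  shows "symplectic_form (Lm t *v k c0) (Lm t *v k' c0) = 0"
proof -
  obtain d g V where d: "d > 0" and good0: "\<forall>t'\<in>ball t d. \<forall>c'\<in>ball c0 d. \<forall>eps. 0 < eps \<longrightarrow> eps < d \<longrightarrow>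
     (\<forall>i. nearby t' eps c' \<in> regular_points (F i) W \<and> norm (F i (nearby t' eps c')) \<le> 1 / eps ^ g) \<and>
     eps ^ g \<le> norm (det (jacobian (nearby t' eps c') ** V))"
    using good unfolding good_def by (elim exE conjE) (rule that)
  note good' = good0[THEN bspec, THEN bspec, THEN spec, THEN mp, THEN mp]
  have reg: "nearby t eps c' \<in> regular_points (F i) W" and Fb: "norm (F i (nearby t eps c')) \<le> 1 / eps ^ g"
    if "c' \<in> ball c0 d" "0 < eps" "eps < d" for c' eps i
    using good'[of t c' eps] that d by auto
  have detb: "eps ^ g \<le> norm (det (jacobian (nearby t eps c0) ** V))" if "0 < eps" "eps < d" for eps
    using good'[of t c0 eps] that d by auto
  define \<Lambda> where "\<Lambda> = Lm t"
  obtain \<Lambda>i where \<Lambda>i: "\<Lambda> ** \<Lambda>i = mat 1" using Lm_invertible[of t] unfolding \<Lambda>_def invertible_def by blast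
  obtain \<kappa> where \<kappa>: "\<kappa> > 0" "\<And>x. norm (\<Lambda> *v x) \<le> norm x * \<kappa>"
    using bounded_linear.pos_bounded[OF matrix_vector_mul_bounded_linear[of \<Lambda>]] by auto
  define n where "n = CARD('n)"
  \<comment> \<open>The budget of exponents: \<open>n * Suc g + g\<close> is lost in Cramer's rule,
    one power in the chain rule for \<open>nearby\<close>, and \<open>2 * r\<close> in the division
    by the leading order; one positive power remains.\<close>
  define M where "M = n * Suc g + g + 2 * r + 2"
  obtain C1 d1 where d1: "d1 > 0" and Z1': "\<forall>eps. 0 < eps \<longrightarrow> eps < d1 \<longrightarrow> (\<exists>Z. norm (Z - of_real (eps ^ r) *s k c0) \<le> C1 * eps ^ Suc r \<and>
      (\<forall>i. norm (\<Sum>j\<in>UNIV. Z $ j * partial_deriv j (\<lambda>c. F i (nearby t eps c)) c0) \<le> C1 * eps ^ M))"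
    using transport_logarithm[OF k(1) t, of M] by (elim exE conjE) (rule that)
  note Z1 = Z1'[THEN spec, THEN mp, THEN mp]
  obtain C2 d2 where d2: "d2 > 0" and Z2': "\<forall>eps. 0 < eps \<longrightarrow> eps < d2 \<longrightarrow> (\<exists>Z. norm (Z - of_real (eps ^ r) *s k' c0) \<le> C2 * eps ^ Suc r \<and>
      (\<forall>i. norm (\<Sum>j\<in>UNIV. Z $ j * partial_deriv j (\<lambda>c. F i (nearby t eps c)) c0) \<le> C2 * eps ^ M))"
    using transport_logarithm[OF k(2) t, of M] by (elim exE conjE) (rule that)
  note Z2 = Z2'[THEN spec, THEN mp, THEN mp]
  define C where "C = Max {1, C1, C2}"
  have C: "1 \<le> C" "C1 \<le> C" "C2 \<le> C" unfolding C_def by simp_all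
  \<comment> \<open>Cauchy's inequality in the initial values will bound the entries of
    \<open>A ** V\<close> by \<open>K / eps ^ Suc g\<close>; for this the columns of
    \<open>V\<close> are pulled back by \<open>\<Lambda>i\<close> to directions of initial
    values.\<close>
  define K where "K = 1 + (\<Sum>j\<in>UNIV. 2 * norm (\<Lambda>i *v column j V) / d)"
  have K: "1 \<le> K" "2 * norm (\<Lambda>i *v column j V) / d \<le> K" for j
  proof -
    have "2 * norm (\<Lambda>i *v column j V) / d \<le> (\<Sum>j\<in>UNIV. 2 * norm (\<Lambda>i *v column j V) / d)"
      using d by (intro member_le_sum) auto
    then show "2 * norm (\<Lambda>i *v column j V) / d \<le> K" by (simp add: K_def)
    have "0 \<le> (\<Sum>j\<in>UNIV. 2 * norm (\<Lambda>i *v column j V) / d)" using d by (intro sum_nonneg) auto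
    then show "1 \<le> K" by (simp add: K_def)
  qed
  define Q where "Q = real CARD('n + 'n) * (real n * (norm V * (fact n * K ^ n))) * C"
  have Q: "0 \<le> Q" unfolding Q_def using K C by (intro mult_nonneg_nonneg) auto
  define N where "N = norm (k c0) + norm (k' c0) + C"
  have N: "norm (k c0) + C \<le> N" "norm (k' c0) + C \<le> N" "1 \<le> N"
    using C norm_ge_zero[of "k c0"] norm_ge_zero[of "k' c0"] unfolding N_def by linarith+
  define eps0 where "eps0 = Min {1, d, d1, d2, dlt, 1 / (Q + 1), 1 / (\<kappa> * N)}"
  have pos: "0 < eps0" unfolding eps0_def using d d1 d2 dlt Q \<kappa> N by simp
  have le: "eps0 \<le> 1" "eps0 \<le> d" "eps0 \<le> d1" "eps0 \<le> d2" "eps0 \<le> dlt" "eps0 \<le> 1 / (Q + 1)" "eps0 \<le> 1 / (\<kappa> * N)"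
    unfolding eps0_def by (rule Min_le; simp)+
  define X X' where "X = \<Lambda> *v k c0" and "X' = \<Lambda> *v k' c0"
  define P where "P = 6 * real n * Q + 2 * real n * (2 * (\<kappa> * N) * (\<kappa> * N))"
  have main: "norm (symplectic_form X X') \<le> P * eps" if eps: "0 < eps" "eps < eps0" for eps
  proof -
    have e1: "eps < 1" "eps < d" "eps < d1" "eps < d2" "eps < dlt" "eps < 1 / (Q + 1)" "eps < 1 / (\<kappa> * N)"
      using le eps by linarith+
    define A where "A = jacobian (nearby t eps c0)"
    have c0d: "c0 \<in> ball c0 d" using d by simp
    note reg0 = reg[OF c0d eps(1) e1(2)]
    have A: "A $ i $ m = partial_deriv m (F i) (nearby t eps c0)" for i m by (simp add: A_def jacobian_def)
    have iso: "symplectic_form (A $ i) (A $ j) = 0" for i j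
    proof -
      have "A $ i = grad (F i) (nearby t eps c0)" for i by (simp add: A vec_eq_iff grad_def)
      then show ?thesis using involution[OF reg0 reg0] by (simp add: poisson_bracket_eq_symplectic_form)
    qed
    have A\<Lambda>: "(\<Sum>j\<in>UNIV. Z $ j * partial_deriv j (\<lambda>c. F i (nearby t eps c)) c0) = of_real eps * (A *v (\<Lambda> *v Z)) $ i" for Z i
      using sum_partial_deriv_nearby[OF reg0[of i], of Z] unfolding \<Lambda>_def
      by (simp add: matrix_vector_mult_def[of A] A mult.commute)
    have AV: "norm ((A ** V) $ i $ j) \<le> K / eps ^ Suc g" for i j
    proof -
      let ?w = "\<Lambda>i *v column j V"
      have "\<Lambda> *v ?w = column j V" by (simp add: matrix_vector_mul_assoc \<Lambda>i)
      moreover have "(A ** V) $ i $ j = (A *v column j V) $ i"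
        by (simp add: matrix_matrix_mult_def matrix_vector_mult_def column_def)
      ultimately have 1: "of_real eps * (A ** V) $ i $ j = (\<Sum>m\<in>UNIV. ?w $ m * partial_deriv m (\<lambda>c. F i (nearby t eps c)) c0)"
        by (simp add: A\<Lambda>)
      have hol: "mv_holomorphic_on (\<lambda>c. F i (nearby t eps c)) (ball c0 d)"
        by (rule mv_holomorphic_onI[OF has_derivative_nearby_initial[OF reg[OF _ eps(1) e1(2)]]])
      have "norm (of_real eps * (A ** V) $ i $ j) \<le> 2 * (1 / eps ^ g) * norm ?w / d"
        unfolding 1 by (rule directional_derivative_bound[OF hol d Fb[OF _ eps(1) e1(2)]])
      also have "\<dots> = (2 * norm ?w / d) * (1 / eps ^ g)" by simp
      also have "\<dots> \<le> K * (1 / eps ^ g)" using eps K(2)[of j] by (intro mult_right_mono) auto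
      finally show ?thesis using eps by (simp add: norm_mult field_simps)
    qed
    have K1: "1 \<le> K / eps ^ Suc g"
    proof -
      have "eps ^ Suc g \<le> 1" using eps e1 by (intro power_le_one) auto
      then have "eps ^ Suc g \<le> K" using K(1) by linarith
      then show ?thesis using eps by (simp add: pos_le_divide_eq del: power_Suc)
    qed
    obtain Z where Z: "norm (Z - of_real (eps ^ r) *s k c0) \<le> C1 * eps ^ Suc r"
      "\<And>i. norm (\<Sum>j\<in>UNIV. Z $ j * partial_deriv j (\<lambda>c. F i (nearby t eps c)) c0) \<le> C1 * eps ^ M"
      using Z1[OF eps(1) e1(3)] by (elim exE conjE) (rule that, auto)
    obtain Z' where Z': "norm (Z' - of_real (eps ^ r) *s k' c0) \<le> C2 * eps ^ Suc r"
      "\<And>i. norm (\<Sum>j\<in>UNIV. Z' $ j * partial_deriv j (\<lambda>c. F i (nearby t eps c)) c0) \<le> C2 * eps ^ M"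
      using Z2[OF eps(1) e1(4)] by (elim exE conjE) (rule that, auto)
    define u v where "u = \<Lambda> *v Z" and "v = \<Lambda> *v Z'"
    have Au: "norm ((A *v (\<Lambda> *v Z)) $ i) \<le> C * eps ^ (M - 1)"
      if "norm (\<Sum>j\<in>UNIV. Z $ j * partial_deriv j (\<lambda>c. F i (nearby t eps c)) c0) \<le> C' * eps ^ M" "C' \<le> C" for Z C' i
    proof -
      have "eps * norm ((A *v (\<Lambda> *v Z)) $ i) \<le> C' * eps ^ M" using that(1) eps(1) unfolding A\<Lambda> by (simp add: norm_mult)
      also have "\<dots> \<le> C * eps ^ M" using that(2) eps(1) by (intro mult_right_mono) auto
      also have "\<dots> = eps * (C * eps ^ (M - 1))" by (simp add: M_def)
      finally show ?thesis using eps(1) by simp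
    qed
    have near: "norm (\<Lambda> *v Z - of_real (eps ^ r) *s (\<Lambda> *v q)) \<le> \<kappa> * N * eps ^ Suc r \<and> norm (\<Lambda> *v Z) \<le> \<kappa> * N * eps ^ r \<and>
         norm (of_real (eps ^ r) *s (\<Lambda> *v q)) \<le> \<kappa> * N * eps ^ r"
      if "norm (Z - of_real (eps ^ r) *s q) \<le> C' * eps ^ Suc r" "C' \<le> C" "norm q + C \<le> N" for Z q C'
    proof -
      have p: "0 \<le> eps ^ r" "0 \<le> eps ^ Suc r" "eps ^ Suc r \<le> eps ^ r"
        using eps e1 by (auto intro: mult_left_le_one_le)
      have "C' * eps ^ Suc r \<le> C * eps ^ Suc r" by (intro mult_right_mono p that)
      then have z1: "norm (Z - of_real (eps ^ r) *s q) \<le> C * eps ^ Suc r" using that(1) by linarith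
      have "C * eps ^ Suc r \<le> N * eps ^ Suc r" using that(3) norm_ge_zero[of q] by (intro mult_right_mono p) linarith
      then have z2: "norm (Z - of_real (eps ^ r) *s q) \<le> N * eps ^ Suc r" using z1 by linarith
      have q: "norm (of_real (eps ^ r) *s q) = norm q * eps ^ r"
        unfolding norm_vector_scalar_mult norm_of_real using p(1) by simp
      have "C * eps ^ Suc r \<le> C * eps ^ r" using C(1) by (intro mult_left_mono p) auto
      then have "norm Z \<le> norm q * eps ^ r + C * eps ^ r"
        using z1 norm_triangle_ineq2[of Z "of_real (eps ^ r) *s q"] unfolding q by linarith
      also have "\<dots> = (norm q + C) * eps ^ r" by (simp add: algebra_simps)
      also have "\<dots> \<le> N * eps ^ r" by (intro mult_right_mono p that)
      finally have z3: "norm Z \<le> N * eps ^ r" .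
      have z4: "norm (of_real (eps ^ r) *s q) \<le> N * eps ^ r" unfolding q using that(3) C(1) by (intro mult_right_mono p) auto
      have lin: "\<Lambda> *v Z - of_real (eps ^ r) *s (\<Lambda> *v q) = \<Lambda> *v (Z - of_real (eps ^ r) *s q)"
        by (simp add: matrix_vector_mult_diff_distrib matrix_vector_mult_scale)
      have lin': "of_real (eps ^ r) *s (\<Lambda> *v q) = \<Lambda> *v (of_real (eps ^ r) *s q)" by (simp add: matrix_vector_mult_scale)
      have b: "norm (\<Lambda> *v y) \<le> \<kappa> * N * b" if "norm y \<le> N * b" for y b
      proof -
        have "norm y * \<kappa> \<le> N * b * \<kappa>" using that \<kappa>(1) by (intro mult_right_mono) auto
        then show ?thesis using \<kappa>(2)[of y] by (simp add: mult_ac)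
      qed
      show ?thesis using b[OF z2] b[OF z3] b[OF z4] unfolding lin[symmetric] lin'[symmetric] by blast
    qed
    have nu: "norm (u - of_real (eps ^ r) *s X) \<le> \<kappa> * N * eps ^ Suc r" "norm u \<le> \<kappa> * N * eps ^ r" "norm (of_real (eps ^ r) *s X) \<le> \<kappa> * N * eps ^ r"
      using near[OF Z(1) C(2) N(1)] unfolding u_def X_def by blast+
    have nv: "norm (v - of_real (eps ^ r) *s X') \<le> \<kappa> * N * eps ^ Suc r" "norm v \<le> \<kappa> * N * eps ^ r"
      using near[OF Z'(1) C(3) N(2)] unfolding v_def X'_def by blast+
    have \<kappa>N: "0 < \<kappa> * N" using \<kappa> N by simp
    have small: "\<kappa> * N * eps ^ r \<le> 1"
    proof -
      have "\<kappa> * N * eps ^ r \<le> \<kappa> * N * eps" using power_r_le[OF eps(1) e1(5)] \<kappa>N by (intro mult_left_mono) auto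
      also have "\<dots> \<le> 1" using e1(7) \<kappa>N by (simp add: pos_less_divide_eq mult.commute)
      finally show ?thesis .
    qed
    define \<tau> where "\<tau> = real CARD('n + 'n) * (real CARD('n) * (norm V * (fact CARD('n) * (K / eps ^ Suc g) ^ CARD('n) / eps ^ g)))"
    have \<tau>e: "\<tau> * (C * eps ^ (M - 1)) = Q * eps ^ (2 * r + 1)"
    proof -
      have "eps ^ (M - 1) = (eps ^ Suc g) ^ n * eps ^ g * eps ^ (2 * r + 1)"
        unfolding power_mult[symmetric] power_add[symmetric] by (simp add: M_def algebra_simps)
      then show ?thesis using eps(1) unfolding \<tau>_def Q_def n_def by (simp add: power_divide field_simps del: power_Suc)
    qed
    have p21: "eps ^ (2 * r + 1) \<le> eps" using power_decreasing[of 1 "2*r+1" eps] eps e1 by simp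
    have "Q * eps ^ (2 * r + 1) \<le> Q * eps" using p21 Q by (rule mult_left_mono)
    also have "Q * eps \<le> (Q + 1) * eps" using eps by simp
    also have "\<dots> \<le> 1" using e1(6) Q by (simp add: pos_less_divide_eq mult.commute)
    finally have \<tau>e1: "\<tau> * (C * eps ^ (M - 1)) \<le> 1" unfolding \<tau>e .
    have uv: "norm (symplectic_form u v) \<le> 6 * real CARD('n) * (\<tau> * (C * eps ^ (M - 1)))"
    proof (rule approximately_isotropic_annihilator[OF iso AV K1 _ _ _ _ _ _ _ _ \<tau>_def \<tau>e1])
      show "0 < eps ^ g" "0 < C * eps ^ (M - 1)" using eps C by auto
      show "eps ^ g \<le> norm (det (A ** V))" unfolding A_def by (rule detb[OF eps(1) e1(2)])
      show "norm (V $ i $ j) \<le> norm V" for i j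
        using Finite_Cartesian_Product.norm_nth_le[of V i] Finite_Cartesian_Product.norm_nth_le[of "V $ i" j] by linarith
      show "norm ((A *v u) $ i) \<le> C * eps ^ (M - 1)" for i unfolding u_def by (rule Au[OF Z(2) C(2)])
      show "norm ((A *v v) $ i) \<le> C * eps ^ (M - 1)" for i unfolding v_def by (rule Au[OF Z'(2) C(3)])
      show "norm u \<le> 1" "norm v \<le> 1" using nu(2) nv(2) small by linarith+
    qed
    have pw: "eps ^ (2 * r) = eps ^ r * eps ^ r" by (simp only: mult_2 power_add)
    let ?X = "of_real (eps ^ r) *s X" and ?X' = "of_real (eps ^ r) *s X'"
    have "symplectic_form ?X ?X' = symplectic_form u v - symplectic_form (u - ?X) v - symplectic_form ?X (v - ?X')"
      by (simp add: symplectic_form_diff_left symplectic_form_diff_right)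
    also have "norm \<dots> \<le> norm (symplectic_form u v) + norm (symplectic_form (u - ?X) v) + norm (symplectic_form ?X (v - ?X'))"
      by (meson norm_triangle_ineq4 add_right_mono order_trans)
    also have "\<dots> \<le> 6 * real n * (Q * eps ^ (2 * r + 1)) + 2 * real n * ((\<kappa> * N) * (\<kappa> * N) * eps ^ (2 * r + 1)) + 2 * real n * ((\<kappa> * N) * (\<kappa> * N) * eps ^ (2 * r + 1))"
    proof (intro add_mono)
      show "norm (symplectic_form u v) \<le> 6 * real n * (Q * eps ^ (2 * r + 1))" using uv unfolding \<tau>e n_def .
      have s: "norm (symplectic_form x y) \<le> 2 * real n * (a * b)" if "norm x \<le> a" "norm y \<le> b" for x y :: "complex^('n+'n)" and a b
      proof -
        have "norm x * norm y \<le> a * b" using that order_trans[OF norm_ge_zero that(1)] by (intro mult_mono) auto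
        then have "2 * real n * (norm x * norm y) \<le> 2 * real n * (a * b)" by (intro mult_left_mono) auto
        then show ?thesis using norm_symplectic_form[of x y] unfolding n_def mult.assoc by linarith
      qed
      have e: "(\<kappa> * N * eps ^ Suc r) * (\<kappa> * N * eps ^ r) = (\<kappa> * N) * (\<kappa> * N) * eps ^ (2 * r + 1)"
        by (simp add: pw pw[unfolded mult.commute[of 2]] mult_ac)
      show "norm (symplectic_form (u - ?X) v) \<le> 2 * real n * ((\<kappa> * N) * (\<kappa> * N) * eps ^ (2 * r + 1))"
        using s[OF nu(1) nv(2)] unfolding e .
      show "norm (symplectic_form ?X (v - ?X')) \<le> 2 * real n * ((\<kappa> * N) * (\<kappa> * N) * eps ^ (2 * r + 1))"
        using s[OF nu(3) nv(1)] unfolding e[symmetric] by (simp add: mult_ac)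
    qed
    also have "\<dots> = P * eps * eps ^ (2 * r)" unfolding P_def by (simp add: algebra_simps)
    finally have "norm (symplectic_form ?X ?X') \<le> P * eps * eps ^ (2 * r)" .
    moreover have "norm (symplectic_form ?X ?X') = eps ^ (2 * r) * norm (symplectic_form X X')"
      unfolding symplectic_form_scale using eps(1) by (simp add: norm_mult norm_power pw)
    ultimately have "norm (symplectic_form X X') * eps ^ (2 * r) \<le> P * eps * eps ^ (2 * r)" by (simp add: mult.commute)
    then show ?thesis using eps(1) by simp
  qed
  show ?thesis
  proof (rule ccontr)
    assume nz: "\<not> ?thesis"
    define s where "s = norm (symplectic_form X X')"
    have s: "s > 0" using nz by (simp add: s_def X_def X'_def \<Lambda>_def)
    have P: "0 \<le> P" unfolding P_def using Q \<kappa> N by (intro add_nonneg_nonneg mult_nonneg_nonneg) auto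
    define eps where "eps = min (eps0 / 2) (s / (2 * (P + 1)))"
    have "0 < s / (2 * (P + 1))" using s P by (intro divide_pos_pos) auto
    then have "0 < eps" using pos by (simp add: eps_def)
    moreover have "eps \<le> eps0 / 2" unfolding eps_def by (rule min.cobounded1)
    then have "eps < eps0" using pos by linarith
    ultimately have "s \<le> P * eps" using main unfolding s_def by blast
    also have "\<dots> \<le> P * (s / (2 * (P + 1)))" using P by (intro mult_left_mono) (auto simp: eps_def)
    also have "\<dots> < s"
    proof -
      have "0 \<le> P * s" using s P by simp
      then have "P * s < s * (2 * (P + 1))" using s unfolding distrib_left mult.left_commute[of s 2] mult.commute[of s P] by linarith
      then show ?thesis using P by (simp add: pos_divide_less_eq)
    qed
    finally show False by simp
  qed
qed

end

section \<open>The flow near a straight-line solution\<close>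

lemma sum_orthogonal:
  fixes P :: "complex^'n^'n"
  assumes "transpose P ** P = mat 1"
  shows "(\<Sum>i\<in>UNIV. (P *v x) $ i * (P *v y) $ i) = (\<Sum>j\<in>UNIV. x $ j * y $ j)"
proof -
  have e: "(\<Sum>i\<in>UNIV. P $ i $ j * P $ i $ k) = (if j = k then 1 else 0)" for j k
    using arg_cong[OF assms, of "\<lambda>M. M $ j $ k"] by (simp add: matrix_matrix_mult_def transpose_def mat_def)
  have "(\<Sum>i\<in>UNIV. (P *v x) $ i * (P *v y) $ i) = (\<Sum>i\<in>UNIV. \<Sum>j\<in>UNIV. \<Sum>k\<in>UNIV. x $ j * y $ k * (P $ i $ j * P $ i $ k))"
    by (simp add: matrix_vector_mult_def sum_product mult_ac)
  also have "\<dots> = (\<Sum>j\<in>UNIV. \<Sum>k\<in>UNIV. x $ j * y $ k * (\<Sum>i\<in>UNIV. P $ i $ j * P $ i $ k))"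
    by (subst sum.swap, rule sum.cong[OF refl], subst sum.swap) (simp add: sum_distrib_left)
  also have "\<dots> = (\<Sum>j\<in>UNIV. x $ j * y $ j)" by (simp add: e if_distrib cong: if_cong)
  finally show ?thesis .
qed

lemma partial_deriv_homogeneous:
  fixes V :: "complex^'n \<Rightarrow> complex"
  assumes V: "mv_holomorphic_on V U" "open U" and cone: "\<And>q s. q \<in> U \<Longrightarrow> s \<noteq> 0 \<Longrightarrow> s *s q \<in> U"
    and hom: "\<And>q s. q \<in> U \<Longrightarrow> s \<noteq> 0 \<Longrightarrow> V (s *s q) = s ^ Suc k * V q" and q: "q \<in> U" and s: "s \<noteq> 0"
  shows "partial_deriv i V (s *s q) = s ^ k * partial_deriv i V q"
proof -
  have d: "((\<lambda>q. s *s q) has_derivative (\<lambda>v. s *s v)) (at q)"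
    by (rule bounded_linear_imp_has_derivative, rule bounded_linear_intro[where K = "norm s"])
       (simp_all add: norm_vector_scalar_mult vec_eq_iff algebra_simps)
  have "((\<lambda>q. V (s *s q)) has_derivative (\<lambda>v. \<Sum>i\<in>UNIV. v $ i * (s * partial_deriv i V (s *s q)))) (at q)"
    using has_derivative_compose[OF d mv_holomorphic_on_has_derivative[OF V(1) cone[OF q s]]] by (simp add: mult_ac)
  then have "partial_deriv i (\<lambda>q. V (s *s q)) q = s * partial_deriv i V (s *s q)" by (rule partial_deriv_eq)
  moreover have "((\<lambda>q. s ^ Suc k * V q) has_derivative (\<lambda>v. \<Sum>i\<in>UNIV. v $ i * (s ^ Suc k * partial_deriv i V q))) (at q)"
    using has_derivative_mult_right[OF mv_holomorphic_on_has_derivative[OF V(1) q], of "s ^ Suc k"]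
    by (simp add: sum_distrib_left mult_ac)
  then have "partial_deriv i (\<lambda>q. s ^ Suc k * V q) q = s ^ Suc k * partial_deriv i V q" by (rule partial_deriv_eq)
  moreover have "partial_deriv i (\<lambda>q. V (s *s q)) q = partial_deriv i (\<lambda>q. s ^ Suc k * V q) q"
    by (rule partial_deriv_cong_open[OF V(2) q]) (rule hom[OF _ s])
  ultimately show ?thesis using s by simp
qed

text \<open>The intended coordinates are \<open>u\<close> with \<open>q = P *v u\<close>, where
  \<open>P\<close> is an orthonormal eigenbasis and the Darboux point is \<open>dlt0\<close> times
  the axis \<open>a\<close>. The frequency \<open>w a\<close> is normalised to 1. The constant
  \<open>\<sigma>\<close> with \<open>\<sigma> ^ 2 = - \<gamma>\<close> rescales time so that the
  unperturbed motion is made of \<open>exp (w j * t)\<close> and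
  \<open>exp (- (w j * t))\<close>.\<close>

locale eigencoordinates =
  fixes U :: "(complex^'n::finite) set" and V :: "complex^'n \<Rightarrow> complex" and P :: "complex^'n^'n"
    and \<gamma> \<sigma> dlt0 :: complex and w :: "'n \<Rightarrow> complex" and a :: 'n
  assumes open_U: "open U" and cone: "\<And>q s. q \<in> U \<Longrightarrow> s \<noteq> 0 \<Longrightarrow> s *s q \<in> U"
    and V_holomorphic: "mv_holomorphic_on V U"
    and V_homogeneous: "\<And>q s. q \<in> U \<Longrightarrow> s \<noteq> 0 \<Longrightarrow> V (s *s q) = s ^ 2 * V q"
    and P: "transpose P ** P = mat 1" and w: "\<And>j. w j \<noteq> 0" "w a = 1"
    and \<gamma>: "\<gamma> \<noteq> 0" "\<sigma> ^ 2 = - \<gamma>" and base_in: "P *v axis a dlt0 \<in> U" and dlt0: "dlt0 \<noteq> 0"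
begin

lemma P': "P ** transpose P = mat 1" using P matrix_left_right_inverse by blast

abbreviation base :: "complex^'n" where "base \<equiv> axis a dlt0"

definition dom :: "(complex^'n) set" where "dom = {u. P *v u \<in> U}"

text \<open>The gradient of the potential in eigencoordinates minus its expected linear part; the
  theorem amounts to its vanishing.\<close>

definition pert :: "'n \<Rightarrow> complex^'n \<Rightarrow> complex" where
  "pert j u = (\<Sum>i\<in>UNIV. P $ i $ j * partial_deriv i V (P *v u)) - \<gamma> * (w j)\<^sup>2 * u $ j"

definition wave :: "complex \<Rightarrow> complex^('n + 'n) \<Rightarrow> complex^'n" where
  "wave t c = (\<chi> j. c $ Inl j * exp (w j * t) + c $ Inr j * exp (- (w j * t)))"

definition \<phi> :: "complex \<Rightarrow> complex" where "\<phi> t = exp t - exp (- t)"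

text \<open>The columns are the phase-space images of the two exponential solutions of each mode;
  momenta are \<open>\<sigma>\<close> times the derivatives of positions in the rescaled
  time.\<close>

definition L :: "complex \<Rightarrow> complex^('n + 'n)^('n + 'n)" where
  "L t = (\<chi> m k. case m of
     Inl i \<Rightarrow> (case k of Inl j \<Rightarrow> P $ i $ j * exp (w j * t) | Inr j \<Rightarrow> P $ i $ j * exp (- (w j * t)))
   | Inr i \<Rightarrow> (case k of Inl j \<Rightarrow> P $ i $ j * (\<sigma> * w j * exp (w j * t)) | Inr j \<Rightarrow> P $ i $ j * (- (\<sigma> * w j * exp (- (w j * t))))))"

definition initial :: "complex^('n + 'n)" where
  "initial = (\<chi> m. case m of Inl j \<Rightarrow> if j = a then dlt0 else 0 | Inr j \<Rightarrow> if j = a then - dlt0 else 0)"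

lemma \<sigma>: "\<sigma> \<noteq> 0" using \<gamma> by auto

lemma open_dom: "open dom"
proof -
  have "dom = (\<lambda>u. P *v u) -` U" by (auto simp: dom_def)
  moreover have "continuous_on UNIV (\<lambda>u. P *v u)"
    using matrix_vector_mul_bounded_linear[of P] linear_continuous_on by blast
  ultimately show ?thesis using open_U by (simp add: continuous_on_eq_continuous_at open_vimage)
qed

lemma base_dom: "base \<in> dom" using base_in by (simp add: dom_def)

lemma dom_scale: "u \<in> dom \<Longrightarrow> s \<noteq> 0 \<Longrightarrow> s *s u \<in> dom"
  by (simp add: dom_def matrix_vector_mult_scale cone)

lemma pert_holomorphic: "mv_holomorphic_on (pert j) dom"
  unfolding pert_def
proof (intro mv_holomorphic_on_diff mv_holomorphic_on_sum mv_holomorphic_on_mult mv_holomorphic_on_const mv_holomorphic_on_component)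
  show "mv_holomorphic_on (\<lambda>u. partial_deriv i V (P *v u)) dom" for i
    by (rule mv_holomorphic_on_compose[OF mv_holomorphic_on_partial_deriv[OF V_holomorphic open_U] mv_holomorphic_on_matrix_vector_mult])
       (simp add: dom_def)
qed

lemma pert_scale: "u \<in> dom \<Longrightarrow> s \<noteq> 0 \<Longrightarrow> pert j (s *s u) = s * pert j u"
  using partial_deriv_homogeneous[OF V_holomorphic open_U cone, of 1 "P *v u" s] V_homogeneous
  by (simp add: dom_def pert_def matrix_vector_mult_scale sum_distrib_left algebra_simps power2_eq_square)

lemma grad_eq: "grad V (P *v u) = P *v (\<chi> j. \<gamma> * (w j)\<^sup>2 * u $ j + pert j u)"
proof -
  have "(\<chi> j. \<gamma> * (w j)\<^sup>2 * u $ j + pert j u) = transpose P *v grad V (P *v u)"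
    by (simp add: vec_eq_iff pert_def matrix_vector_mult_def transpose_def grad_def)
  then show ?thesis by (simp only: matrix_vector_mul_assoc P' matrix_vector_mul_lid)
qed

lemma position_L: "position (L t *v c) = P *v wave t c"
  by (simp add: vec_eq_iff position_def L_def wave_def matrix_vector_mult_def sum_UNIV_Plus sum.distrib[symmetric] algebra_simps)

lemma momentum_L: "momentum (L t *v c) = P *v (\<chi> j. \<sigma> * w j * (c $ Inl j * exp (w j * t) - c $ Inr j * exp (- (w j * t))))"
  by (simp add: vec_eq_iff momentum_def L_def matrix_vector_mult_def sum_UNIV_Plus sum.distrib[symmetric] algebra_simps)

lemma phase_point_position_momentum: "z = phase_point (position z) (momentum z)"
  by (simp add: vec_eq_iff phase_point_def position_def momentum_def split: sum.split)

lemma symplectic_form_position_momentum: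
  "symplectic_form u v = (\<Sum>i\<in>UNIV. position u $ i * momentum v $ i) - (\<Sum>i\<in>UNIV. momentum u $ i * position v $ i)"
  by (simp add: symplectic_form_def position_def momentum_def sum_subtractf)

text \<open>The products of \<open>exp (w j * t)\<close> and \<open>exp (- (w j * t))\<close> are
  constant, so in the variables \<open>c\<close> the form does not depend on time: the two
  amplitudes of a mode are conjugate, with a weight proportional to \<open>w j\<close>.\<close>

lemma symplectic_form_L: "symplectic_form (L t *v u) (L t *v v) =
   - 2 * \<sigma> * (\<Sum>j\<in>UNIV. w j * (u $ Inl j * v $ Inr j - u $ Inr j * v $ Inl j))"
proof -
  have e: "exp (w j * t) * exp (- (w j * t)) = 1" for j by (simp add: exp_minus)
  have 1: "(x * E + y * E') * (s * (x' * E - y' * E')) - s * (x * E - y * E') * (x' * E + y' * E')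
      = - 2 * s * (x * y' - y * x') * (E * E')" for x y x' y' s E E' :: complex by (simp add: algebra_simps)
  show ?thesis
    unfolding symplectic_form_position_momentum position_L momentum_L sum_orthogonal[OF P] sum_subtractf[symmetric]
      wave_def vec_lambda_beta 1 e sum_distrib_left by (simp add: mult_ac)
qed

lemma L_inverse: "invertible (L t)"
proof -
  \<comment> \<open>Inverse built from the orthogonality of \<open>P\<close>: position and momentum
    of a mode, the latter divided by \<open>\<sigma> * w j\<close>, are the sum and the difference
    of its two exponentials.\<close>
  define R where "R = (\<chi> k m. case k of
     Inl j \<Rightarrow> (case m of Inl i \<Rightarrow> P $ i $ j * (exp (- (w j * t)) / 2) | Inr i \<Rightarrow> P $ i $ j * (exp (- (w j * t)) / (2 * \<sigma> * w j)))
   | Inr j \<Rightarrow> (case m of Inl i \<Rightarrow> P $ i $ j * (exp (w j * t) / 2) | Inr i \<Rightarrow> P $ i $ j * (- (exp (w j * t) / (2 * \<sigma> * w j)))))"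
  have PP: "(\<Sum>j\<in>UNIV. P $ i $ j * P $ k $ j) = (if i = k then 1 else 0)" for i k
    using arg_cong[OF P', of "\<lambda>M. M $ i $ k"] by (simp add: matrix_matrix_mult_def transpose_def mat_def)
  have e: "exp (w j * t) * exp (- (w j * t)) = 1" for j by (simp add: exp_minus)
  have "(L t ** R) $ m $ k = mat 1 $ m $ k" for m k
  proof (cases m; cases k)
    fix i i' assume m: "m = Inl i" "k = Inl i'"
    have "(L t ** R) $ m $ k = (\<Sum>j\<in>UNIV. P $ i $ j * P $ i' $ j * (exp (w j * t) * exp (- (w j * t))))"
      unfolding m matrix_matrix_mult_def vec_lambda_beta sum_UNIV_Plus sum.distrib[symmetric]
      by (rule sum.cong[OF refl]) (simp add: L_def R_def field_simps)
    then show ?thesis by (simp add: e PP m mat_def)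
  next
    fix i i' assume m: "m = Inl i" "k = Inr i'"
    have "(L t ** R) $ m $ k = 0"
      unfolding m matrix_matrix_mult_def vec_lambda_beta sum_UNIV_Plus sum.distrib[symmetric]
      by (rule sum.neutral, rule ballI) (simp add: L_def R_def field_simps)
    then show ?thesis by (simp add: m mat_def)
  next
    fix i i' assume m: "m = Inr i" "k = Inl i'"
    have "(L t ** R) $ m $ k = 0"
      unfolding m matrix_matrix_mult_def vec_lambda_beta sum_UNIV_Plus sum.distrib[symmetric]
      by (rule sum.neutral, rule ballI) (simp add: L_def R_def field_simps)
    then show ?thesis by (simp add: m mat_def)
  next
    fix i i' assume m: "m = Inr i" "k = Inr i'"
    have "(L t ** R) $ m $ k = (\<Sum>j\<in>UNIV. P $ i $ j * P $ i' $ j * (exp (w j * t) * exp (- (w j * t))))"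
      unfolding m matrix_matrix_mult_def vec_lambda_beta sum_UNIV_Plus sum.distrib[symmetric]
      by (rule sum.cong[OF refl]) (simp add: L_def R_def field_simps w \<sigma>)
    then show ?thesis by (simp add: e PP m mat_def)
  qed
  then have "L t ** R = mat 1" by (simp add: vec_eq_iff)
  then show ?thesis using matrix_left_right_inverse unfolding invertible_def by blast
qed

lemma L_holomorphic: "(\<lambda>t. L t $ i $ j) holomorphic_on UNIV"
  by (cases i; cases j) (auto simp: L_def intro!: holomorphic_intros)

sublocale linear_flow L initial
  by unfold_locales (simp_all add: L_holomorphic L_inverse)

lemma wave_initial: "wave t (initial + of_real eps *s c) = \<phi> t *s base + of_real eps *s wave t c"
  by (simp add: wave_def initial_def \<phi>_def vec_eq_iff axis_def w algebra_simps)

lemma position_nearby: "position (nearby t eps c) = P *v (\<phi> t *s base + of_real eps *s wave t c)"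
  unfolding nearby_def position_L wave_initial ..

lemma curve_in: "\<phi> t \<noteq> 0 \<Longrightarrow> curve t \<in> phase_space U"
  using position_nearby[of t 0 0] base_dom dom_scale[OF base_dom, of "\<phi> t"]
  by (simp add: nearby_eq phase_space_def dom_def)

text \<open>The preimage under \<open>L t\<close> of the phase vector with position 0 and momentum
  \<open>\<sigma> / \<gamma>\<close> times the image of \<open>h\<close> under \<open>P\<close>: the
  forcing term of variation of constants.\<close>

definition kick :: "complex \<Rightarrow> ('n \<Rightarrow> complex) \<Rightarrow> complex^('n + 'n)" where
  "kick t h = (\<chi> m. case m of Inl j \<Rightarrow> h j * exp (- (w j * t)) / (2 * \<gamma> * w j) | Inr j \<Rightarrow> - (h j * exp (w j * t) / (2 * \<gamma> * w j)))"

lemma dLm_eq: "dLm t = (\<chi> m k. case m of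
     Inl i \<Rightarrow> (case k of Inl j \<Rightarrow> P $ i $ j * (w j * exp (w j * t)) | Inr j \<Rightarrow> P $ i $ j * (- (w j * exp (- (w j * t)))))
   | Inr i \<Rightarrow> (case k of Inl j \<Rightarrow> P $ i $ j * (\<sigma> * (w j)\<^sup>2 * exp (w j * t)) | Inr j \<Rightarrow> P $ i $ j * (\<sigma> * (w j)\<^sup>2 * exp (- (w j * t)))))"
proof -
  have "dLm t $ m $ k = (case m of
     Inl i \<Rightarrow> (case k of Inl j \<Rightarrow> P $ i $ j * (w j * exp (w j * t)) | Inr j \<Rightarrow> P $ i $ j * (- (w j * exp (- (w j * t)))))
   | Inr i \<Rightarrow> (case k of Inl j \<Rightarrow> P $ i $ j * (\<sigma> * (w j)\<^sup>2 * exp (w j * t)) | Inr j \<Rightarrow> P $ i $ j * (\<sigma> * (w j)\<^sup>2 * exp (- (w j * t)))))" for m k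
    unfolding dLm_def vec_lambda_beta
    by (rule DERIV_imp_deriv, cases m; cases k)
       (auto simp: L_def power2_eq_square intro!: derivative_eq_intros)
  then show ?thesis by (simp add: vec_eq_iff)
qed

text \<open>In the positions the kick contributes nothing; in the momenta
  \<open>\<sigma> ^ 2 = - \<gamma>\<close> turns the linear part and the kick into minus the
  gradient of the potential.\<close>

lemma flow_equation:
  "\<sigma> *s (dLm t *v c + L t *v kick t (\<lambda>j. pert j (wave t c))) = hamilton_field (hamiltonian V) (L t *v c)"
proof -
  let ?z = "dLm t *v c + L t *v kick t (\<lambda>j. pert j (wave t c))" and ?k = "kick t (\<lambda>j. pert j (wave t c))"
  have k: "?k $ Inl j * exp (w j * t) = pert j (wave t c) / (2 * \<gamma> * w j)"
    "?k $ Inr j * exp (- (w j * t)) = - (pert j (wave t c) / (2 * \<gamma> * w j))" for j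
    by (simp_all add: kick_def exp_minus)
  have "wave t ?k = 0" by (simp add: vec_eq_iff wave_def[of t ?k] k)
  then have p: "position ?z = P *v (\<chi> j. w j * (c $ Inl j * exp (w j * t) - c $ Inr j * exp (- (w j * t))))"
    using position_L[of t ?k]
    by (simp add: position_def vec_eq_iff dLm_eq matrix_vector_mult_def sum_UNIV_Plus sum.distrib[symmetric] algebra_simps)
  have "momentum (L t *v ?k) = P *v (\<chi> j. \<sigma> * pert j (wave t c) / \<gamma>)"
    unfolding momentum_L k using w by (simp add: field_simps)
  moreover have "momentum (dLm t *v c) = P *v (\<chi> j. \<sigma> * (w j)\<^sup>2 * wave t c $ j)"
    by (simp add: momentum_def vec_eq_iff dLm_eq wave_def matrix_vector_mult_def sum_UNIV_Plus sum.distrib[symmetric] algebra_simps)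
  moreover have "momentum ?z = momentum (dLm t *v c) + momentum (L t *v ?k)" by (simp add: momentum_def vec_eq_iff)
  ultimately have m: "momentum ?z = P *v (\<chi> j. \<sigma> * (w j)\<^sup>2 * wave t c $ j + \<sigma> * pert j (wave t c) / \<gamma>)"
    by (simp add: vec_eq_iff matrix_vector_mult_def sum.distrib[symmetric] distrib_left)
  have "position (\<sigma> *s ?z) = \<sigma> *s position ?z" "momentum (\<sigma> *s ?z) = \<sigma> *s momentum ?z"
    by (simp_all add: position_def momentum_def vec_eq_iff distrib_left)
  then have 1: "position (\<sigma> *s ?z) = momentum (L t *v c)" "momentum (\<sigma> *s ?z) = - grad V (position (L t *v c))"
  proof -
    show "position (\<sigma> *s ?z) = momentum (L t *v c)" if "position (\<sigma> *s ?z) = \<sigma> *s position ?z"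
      unfolding that p momentum_L matrix_vector_mult_scale[symmetric] by (rule arg_cong[of _ _ "\<lambda>x. P *v x"]) (simp add: vec_eq_iff mult_ac)
    have s: "\<sigma> * (\<sigma> * x) = - (\<gamma> * x)" for x using \<gamma>(2) by (simp add: power2_eq_square mult.assoc[symmetric])
    have s2: "\<sigma> * (\<sigma> * b * x + \<sigma> * y / \<gamma>) = - (\<gamma> * b * x + y)" for b x y
    proof -
      have "\<sigma> * (\<sigma> * b * x + \<sigma> * y / \<gamma>) = \<sigma> * (\<sigma> * (b * x)) + \<sigma> * (\<sigma> * (y / \<gamma>))" by (simp add: algebra_simps)
      then show ?thesis using \<gamma>(1) by (simp add: s)
    qed
    have n: "- (P *v x) = P *v (- x)" for x by (simp add: vec_eq_iff matrix_vector_mult_def sum_negf)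
    show "momentum (\<sigma> *s ?z) = - grad V (position (L t *v c))" if "momentum (\<sigma> *s ?z) = \<sigma> *s momentum ?z"
      unfolding that m position_L grad_eq n matrix_vector_mult_scale[symmetric]
      by (intro arg_cong[of _ _ "\<lambda>x. P *v x"]) (simp only: vec_eq_iff vector_smult_component vec_lambda_beta vector_uminus_component s2 simp_thms)
  qed
  show ?thesis
    unfolding hamilton_field_hamiltonian
    by (subst phase_point_position_momentum) (simp only: 1)
qed

lemma kick_scale: "s *s kick t h = kick t (\<lambda>j. s * h j)"
  by (simp add: kick_def vec_eq_iff split: sum.split)

lemma kick_diff: "kick t h - kick t h' = kick t (\<lambda>j. h j - h' j)"
  by (simp add: kick_def vec_eq_iff left_diff_distrib diff_divide_distrib split: sum.split)

lemma continuous_wave [continuous_intros]: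
  "continuous_on T f \<Longrightarrow> continuous_on T g \<Longrightarrow> continuous_on T (\<lambda>x. wave (f x) (g x))"
  unfolding wave_def by (intro continuous_intros)

lemma continuous_\<phi> [continuous_intros]: "continuous_on T f \<Longrightarrow> continuous_on T (\<lambda>x. \<phi> (f x))"
  unfolding \<phi>_def by (intro continuous_intros)

lemma continuous_kick:
  assumes "continuous_on T f" "\<And>j. continuous_on T (\<lambda>x. h x j)"
  shows "continuous_on T (\<lambda>x. kick (f x) (h x))"
  unfolding kick_def
proof (rule continuous_on_vec_lambda)
  fix m :: "'n + 'n"
  show "continuous_on T (\<lambda>x. case m of Inl j \<Rightarrow> h x j * exp (- (w j * f x)) / (2 * \<gamma> * w j) | Inr j \<Rightarrow> - (h x j * exp (w j * f x) / (2 * \<gamma> * w j)))"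
    using \<gamma> w by (cases m) (auto intro!: continuous_intros assms)
qed

lemma norm_kick:
  "norm (kick t h) \<le> (\<Sum>j\<in>UNIV. norm (exp (- (w j * t)) / (2 * \<gamma> * w j)) + norm (exp (w j * t) / (2 * \<gamma> * w j))) * (\<Sum>j\<in>UNIV. norm (h j))"
proof -
  let ?E = "\<lambda>j. norm (exp (- (w j * t)) / (2 * \<gamma> * w j)) + norm (exp (w j * t) / (2 * \<gamma> * w j))"
  have "norm (kick t h) \<le> (\<Sum>m\<in>UNIV. norm (kick t h $ m))" by (rule norm_le_sum_components)
  also have "\<dots> = (\<Sum>j\<in>UNIV. ?E j * norm (h j))"
    unfolding sum_UNIV_Plus sum.distrib[symmetric]
    by (rule sum.cong[OF refl]) (simp add: kick_def norm_mult norm_divide algebra_simps add_divide_distrib)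
  also have "\<dots> \<le> (\<Sum>j\<in>UNIV. (\<Sum>j\<in>UNIV. ?E j) * norm (h j))"
    by (intro sum_mono mult_right_mono member_le_sum) auto
  finally show ?thesis by (simp add: sum_distrib_left)
qed

end

lemma compact_norm_bound:
  fixes f :: "'a::topological_space \<Rightarrow> 'b::real_normed_vector"
  assumes "compact S" "continuous_on S f"
  shows "\<exists>B\<ge>0. \<forall>x\<in>S. norm (f x) \<le> B"
proof -
  have "bounded (f ` S)" using compact_continuous_image[OF assms(2,1)] by (rule compact_imp_bounded)
  then obtain B where "\<forall>y\<in>f ` S. norm y \<le> B" unfolding bounded_iff by blast
  then have "\<forall>x\<in>S. norm (f x) \<le> max B 0" by (auto simp: le_max_iff_disj)
  then show ?thesis by (intro exI[of _ "max B 0"]) simp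
qed

text \<open>\<open>r\<close> is an order up to which the perturbation is already known to vanish at
  the Darboux point; the concluding induction enters this setting once for each degree.\<close>

locale integrable_eigencoordinates = eigencoordinates U V P \<gamma> \<sigma> dlt0 w a
  for U :: "(complex^'n::finite) set" and V P \<gamma> \<sigma> dlt0 w a +
  fixes F :: "'n \<Rightarrow> complex^('n + 'n) \<Rightarrow> complex" and r :: nat
  assumes r: "1 \<le> r" and vanish: "\<And>j k v. k \<le> r \<Longrightarrow> taylor_coeff k (pert j) base v = 0"
    and first_integral: "\<And>i. meromorphic_first_integral (hamilton_field (hamiltonian V)) (phase_space U) (F i)"
    and independent: "functionally_independent (phase_space U) F"
    and involution: "\<And>i j z. z \<in> regular_points (F i) (phase_space U) \<Longrightarrow> z \<in> regular_points (F j) (phase_space U) \<Longrightarrow>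
        poisson_bracket (F i) (F j) z = 0"
begin

sublocale integrable_flow L initial "phase_space U" F
proof
  have "phase_space U = position -` U" by (auto simp: phase_space_def)
  moreover have "continuous_on UNIV position" unfolding position_def by (intro continuous_intros)
  ultimately show "open (phase_space U)" using open_vimage[OF open_U] by simp
  show "mv_meromorphic_on (F i) (phase_space U)" for i using first_integral[of i] unfolding meromorphic_first_integral_def by blast
qed (rule independent)

definition T :: "'n \<Rightarrow> complex^'n \<Rightarrow> complex" where "T j = taylor_coeff (Suc r) (pert j) base"

definition Y :: "real \<Rightarrow> complex \<Rightarrow> complex^('n + 'n) \<Rightarrow> complex^('n + 'n)" where
  "Y eps t c = kick t (\<lambda>j. pert j (\<phi> t *s base + of_real eps *s wave t c) / of_real (eps ^ Suc r))"

text \<open>By homogeneity the perturbation at distance \<open>eps\<close> from the curve equals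
  \<open>\<phi> t\<close> times its value at distance \<open>eps / \<phi> t\<close> from
  \<open>base\<close>. Its leading term thus carries \<open>eps ^ Suc r / \<phi> t ^ r\<close>,
  which is the origin of the denominator and of all poles.\<close>

definition Y0 :: "complex \<Rightarrow> complex^('n + 'n) \<Rightarrow> complex^('n + 'n)" where
  "Y0 t c = kick t (\<lambda>j. T j (wave t c) / \<phi> t ^ r)"

lemma continuous_T: "continuous_on A f \<Longrightarrow> continuous_on A (\<lambda>x. T j (f x))"
  using continuous_on_compose2[OF mv_holomorphic_on_imp_continuous_on[OF mv_holomorphic_taylor_coeff]] unfolding T_def by blast

lemma continuous_Y0:
  assumes "continuous_on A f" "continuous_on A g" "\<And>x. x \<in> A \<Longrightarrow> \<phi> (f x) \<noteq> 0"
  shows "continuous_on A (\<lambda>x. Y0 (f x) (g x))"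
  unfolding Y0_def using assms(3) by (intro continuous_kick continuous_on_divide continuous_T continuous_intros assms(1,2)) auto

lemma integral_derivative:
  assumes "nearby t eps c \<in> regular_points (F i) (phase_space U)" "eps \<noteq> 0"
  shows "((\<lambda>(t,c). F i (nearby t eps c)) has_derivative
        (\<lambda>(\<tau>,v). \<Sum>k\<in>UNIV. (v - (\<tau> * of_real (eps ^ r)) *s Y eps t c) $ k * partial_deriv k (\<lambda>c. F i (nearby t eps c)) c)) (at (t,c))"
proof (rule slow_derivative[OF assms(1)])
  let ?c = "initial + of_real eps *s c"
  have "of_real (eps ^ Suc r) *s Y eps t c = kick t (\<lambda>j. pert j (wave t ?c))"
    using assms(2) unfolding Y_def kick_scale wave_initial by simp
  then have "of_real (eps ^ Suc r) *s (L t *v Y eps t c) = L t *v kick t (\<lambda>j. pert j (wave t ?c))"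
    by (simp only: matrix_vector_mult_scale[symmetric])
  then have "\<sigma> *s (dLm t *v ?c + of_real (eps ^ Suc r) *s (L t *v Y eps t c)) = hamilton_field (hamiltonian V) (nearby t eps c)"
    using flow_equation[of t ?c] by (simp only: nearby_def)
  then have e: "\<sigma> * (dLm t *v ?c + of_real (eps ^ Suc r) *s (L t *v Y eps t c)) $ m = hamilton_field (hamiltonian V) (nearby t eps c) $ m" for m
    by (metis vector_smult_component)
  have "(\<Sum>m\<in>UNIV. partial_deriv m (F i) (nearby t eps c) * hamilton_field (hamiltonian V) (nearby t eps c) $ m) = 0"
    using first_integral[of i] assms(1) unfolding meromorphic_first_integral_def by blast
  then have "\<sigma> * (\<Sum>m\<in>UNIV. (dLm t *v ?c + of_real (eps ^ Suc r) *s (L t *v Y eps t c)) $ m * partial_deriv m (F i) (nearby t eps c)) = 0"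
    unfolding e[symmetric] sum_distrib_left by (simp only: mult_ac)
  then show "(\<Sum>m\<in>UNIV. (dLm t *v ?c + of_real (eps ^ Suc r) *s (L t *v Y eps t c)) $ m * partial_deriv m (F i) (nearby t eps c)) = 0"
    using \<sigma> by simp
qed

text \<open>All estimates are made near \<open>base\<close> with the small parameter
  \<open>ze = eps / \<phi> t\<close>, where \<open>\<phi>\<close> is bounded away from zero on the
  compact set \<open>S\<close>; homogeneity of \<open>pert\<close> carries them back to the
  curve.\<close>

lemma slow_system:
  assumes S: "compact S" "\<And>t. t \<in> S \<Longrightarrow> \<phi> t \<noteq> 0" and good: "\<And>t. t \<in> S \<Longrightarrow> good t c0"
  shows "\<exists>l dlt B. slow_system r l dlt B c0 Y Y0 (\<lambda>i eps t c. F i (nearby t eps c)) S"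
proof -
  have "\<exists>d>0. \<exists>l. \<forall>t\<in>S. \<forall>c\<in>ball c0 d. \<forall>eps. 0 < eps \<longrightarrow> eps < d \<longrightarrow>
     (\<forall>i. nearby t eps c \<in> regular_points (F i) (phase_space U) \<and> norm (F i (nearby t eps c)) \<le> 1 / eps ^ l)"
    by (rule uniform_good[OF S(1)]) (rule good)
  then obtain d l where d: "d > 0" and dl: "\<forall>t\<in>S. \<forall>c\<in>ball c0 d. \<forall>eps. 0 < eps \<longrightarrow> eps < d \<longrightarrow>
     (\<forall>i. nearby t eps c \<in> regular_points (F i) (phase_space U) \<and> norm (F i (nearby t eps c)) \<le> 1 / eps ^ l)"
    by (elim exE conjE) (rule that)
  obtain \<rho> where \<rho>: "\<rho> > 0" "cball base \<rho> \<subseteq> dom"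
    using open_dom base_dom open_contains_cball by blast
  have cSc: "compact (S \<times> cball c0 1)" using S by (intro compact_Times) auto
  have "\<exists>b\<ge>0. \<forall>x\<in>S \<times> cball c0 1. norm (wave (fst x) (snd x)) \<le> b"
    by (intro compact_norm_bound[OF cSc]) (auto intro!: continuous_intros)
  then obtain b where b: "b \<ge> 0" "\<forall>x\<in>S \<times> cball c0 1. norm (wave (fst x) (snd x)) \<le> b" by blast
  have "\<exists>B0\<ge>0. \<forall>x\<in>S \<times> cball c0 1. norm (Y0 (fst x) (snd x)) \<le> B0"
    using S(2) by (intro compact_norm_bound[OF cSc]) (auto intro!: continuous_intros continuous_Y0)
  then obtain B0 where B0: "B0 \<ge> 0" "\<forall>x\<in>S \<times> cball c0 1. norm (Y0 (fst x) (snd x)) \<le> B0" by blast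
  have "\<exists>q\<ge>0. \<forall>t\<in>S. norm (1 / \<phi> t) \<le> q"
    using S(2) by (intro compact_norm_bound[OF S(1)]) (auto intro!: continuous_intros)
  then obtain q where q: "q \<ge> 0" "\<forall>t\<in>S. norm (1 / \<phi> t) \<le> q" by blast
  have "\<exists>q'\<ge>0. \<forall>t\<in>S. norm (\<phi> t) \<le> q'"
    by (intro compact_norm_bound[OF S(1)]) (auto intro!: continuous_intros)
  then obtain q' where q': "q' \<ge> 0" "\<forall>t\<in>S. norm (\<phi> t) \<le> q'" by blast
  let ?E = "\<lambda>t. \<Sum>j\<in>UNIV. norm (exp (- (w j * t)) / (2 * \<gamma> * w j)) + norm (exp (w j * t) / (2 * \<gamma> * w j))"
  have "\<exists>E\<ge>0. \<forall>t\<in>S. norm (?E t) \<le> E"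
    using \<gamma> w by (intro compact_norm_bound[OF S(1)]) (auto intro!: continuous_intros)
  then obtain E where E: "E \<ge> 0" "\<forall>t\<in>S. norm (?E t) \<le> E" by blast
  have "\<exists>C\<ge>0. \<forall>z v (ze::complex). (\<forall>\<xi>::complex. norm \<xi> \<le> norm ze \<longrightarrow> z + \<xi> *s v \<in> cball base \<rho>) \<longrightarrow> norm v \<le> b \<longrightarrow>
     (\<forall>k<Suc r. taylor_coeff k (pert j) z v = 0) \<longrightarrow>
     norm (pert j (z + ze *s v) - ze ^ Suc r * taylor_coeff (Suc r) (pert j) z v) \<le> C * norm ze ^ Suc (Suc r)" for j
    by (rule taylor_remainder_leading[OF pert_holomorphic open_dom compact_cball \<rho>(2)])
  then obtain C where C': "\<forall>j. C j \<ge> 0 \<and> (\<forall>z v (ze::complex). (\<forall>\<xi>::complex. norm \<xi> \<le> norm ze \<longrightarrow> z + \<xi> *s v \<in> cball base \<rho>) \<longrightarrow> norm v \<le> b \<longrightarrow>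
     (\<forall>k<Suc r. taylor_coeff k (pert j) z v = 0) \<longrightarrow>
     norm (pert j (z + ze *s v) - ze ^ Suc r * taylor_coeff (Suc r) (pert j) z v) \<le> C j * norm ze ^ Suc (Suc r))"
    by (rule exE[OF choice[OF allI]])
  note C = C'[THEN spec, THEN conjunct1] C'[THEN spec, THEN conjunct2]
  define B1 where "B1 = E * (\<Sum>j\<in>UNIV. C j * (q' * q ^ Suc (Suc r)))"
  \<comment> \<open>The last entry keeps \<open>base + \<xi> *s wave t c\<close> in the ball of
    radius \<open>\<rho>\<close> when \<open>norm \<xi>\<close> is at most
    \<open>eps * q\<close>.\<close>
  define dlt where "dlt = min 1 (min d (\<rho> / (q * b + 1)))"
  have qb: "0 \<le> q * b" using q b by simp
  then have "0 < \<rho> / (q * b + 1)" using \<rho>(1) by (intro divide_pos_pos) auto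
  then have dlt: "0 < dlt" "dlt \<le> 1" "dlt \<le> d" "dlt \<le> \<rho> / (q * b + 1)" using d by (auto simp: dlt_def)
  have B1: "0 \<le> B1" unfolding B1_def using E q q' C by (intro mult_nonneg_nonneg sum_nonneg) auto
  have point: "\<exists>ze. of_real eps = \<phi> t * ze \<and> norm ze \<le> eps * q \<and> norm (wave t c) \<le> b \<and> (\<forall>\<xi>::complex. norm \<xi> \<le> norm ze \<longrightarrow> base + \<xi> *s wave t c \<in> cball base \<rho>)"
    if a: "0 < eps" "eps < dlt" "t \<in> S" "c \<in> ball c0 dlt" for eps t c
  proof (rule exI[of _ "of_real eps / \<phi> t"], intro conjI allI impI)
    show "of_real eps = \<phi> t * (of_real eps / \<phi> t)" using S(2) a by simp
    have "norm (of_real eps / \<phi> t) = eps * norm (1 / \<phi> t)" using a by (simp add: norm_divide)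
    also have "\<dots> \<le> eps * q" using q a by (intro mult_left_mono) auto
    finally show 1: "norm (of_real eps / \<phi> t) \<le> eps * q" .
    have "c \<in> cball c0 1" using a dlt by auto
    then show 2: "norm (wave t c) \<le> b" using b(2) a by auto
    fix \<xi> :: complex assume "norm \<xi> \<le> norm (of_real eps / \<phi> t)"
    then have "norm (\<xi> *s wave t c) \<le> (eps * q) * b"
      using 1 2 b q a unfolding norm_vector_scalar_mult by (intro mult_mono) auto
    also have "\<dots> \<le> eps * (q * b + 1)" using a by (simp add: algebra_simps)
    also have "\<dots> \<le> \<rho>" using a dlt(4) qb by (simp add: pos_le_divide_eq) (smt (verit) mult_right_mono)
    finally show "base + \<xi> *s wave t c \<in> cball base \<rho>" by (simp add: dist_norm)
  qed
  have in_dom: "\<phi> t *s base + of_real eps *s wave t c \<in> dom" if a: "0 < eps" "eps < dlt" "t \<in> S" "c \<in> ball c0 dlt" for eps t c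
  proof -
    obtain ze where ze: "of_real eps = \<phi> t * ze" "\<forall>\<xi>::complex. norm \<xi> \<le> norm ze \<longrightarrow> base + \<xi> *s wave t c \<in> cball base \<rho>"
      using point[OF a] by blast
    have "\<phi> t *s base + of_real eps *s wave t c = \<phi> t *s (base + ze *s wave t c)"
      by (simp add: ze(1) vec_eq_iff algebra_simps)
    moreover have "base + ze *s wave t c \<in> dom" using ze(2) \<rho>(2) by blast
    ultimately show ?thesis by (simp only: dom_scale[OF _ S(2)[OF a(3)]])
  qed
  have diff: "norm (Y eps t c - Y0 t c) \<le> B1 * eps" if a: "0 < eps" "eps < dlt" "t \<in> S" "c \<in> ball c0 dlt" for eps t c
  proof -
    obtain ze where ze: "of_real eps = \<phi> t * ze" "norm ze \<le> eps * q" "norm (wave t c) \<le> b" "\<forall>\<xi>::complex. norm \<xi> \<le> norm ze \<longrightarrow> base + \<xi> *s wave t c \<in> cball base \<rho>"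
      using point[OF a] by blast
    let ?h = "\<lambda>j. pert j (\<phi> t *s base + of_real eps *s wave t c) / of_real (eps ^ Suc r) - T j (wave t c) / \<phi> t ^ r"
    have h: "norm (?h j) \<le> C j * (q' * q ^ Suc (Suc r)) * eps" for j
    proof -
      have z: "\<phi> t \<noteq> 0" "ze \<noteq> 0" using S(2) a ze(1) by auto
      have dz: "base + ze *s wave t c \<in> dom" using ze(4) \<rho>(2) by blast
      have "\<phi> t *s base + of_real eps *s wave t c = \<phi> t *s (base + ze *s wave t c)"
        by (simp add: ze(1) vec_eq_iff algebra_simps)
      then have "?h j = \<phi> t * pert j (base + ze *s wave t c) / (\<phi> t * ze) ^ Suc r - T j (wave t c) / \<phi> t ^ r"
        using pert_scale[OF dz z(1), of j] by (simp add: ze(1))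
      also have "\<dots> = \<phi> t * (pert j (base + ze *s wave t c) - ze ^ Suc r * T j (wave t c)) / (of_real eps) ^ Suc r"
        unfolding ze(1) using z by (simp add: power_mult_distrib field_simps)
      finally have "norm (?h j) = norm (\<phi> t) * norm (pert j (base + ze *s wave t c) - ze ^ Suc r * T j (wave t c)) / eps ^ Suc r"
        using a(1) by (simp add: norm_mult norm_divide norm_power del: power_Suc)
      also have "\<dots> \<le> q' * (C j * (eps * q) ^ Suc (Suc r)) / eps ^ Suc r"
      proof (intro divide_right_mono mult_mono)
        have "norm (pert j (base + ze *s wave t c) - ze ^ Suc r * T j (wave t c)) \<le> C j * norm ze ^ Suc (Suc r)"
          unfolding T_def using C(2)[of j, rule_format, OF ze(4)[rule_format] ze(3) vanish] by simp
        also have "\<dots> \<le> C j * (eps * q) ^ Suc (Suc r)" using C(1) ze(2) by (intro mult_left_mono power_mono) auto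
        finally show "norm (pert j (base + ze *s wave t c) - ze ^ Suc r * T j (wave t c)) \<le> C j * (eps * q) ^ Suc (Suc r)" .
      qed (use q' a in auto)
      also have "\<dots> = C j * (q' * q ^ Suc (Suc r)) * eps" using a(1) by (simp add: power_mult_distrib field_simps)
      finally show ?thesis .
    qed
    have "norm (Y eps t c - Y0 t c) \<le> ?E t * (\<Sum>j\<in>UNIV. norm (?h j))" unfolding Y_def Y0_def kick_diff by (rule norm_kick)
    also have "\<dots> \<le> E * (\<Sum>j\<in>UNIV. C j * (q' * q ^ Suc (Suc r)) * eps)"
    proof (rule mult_mono)
      show "?E t \<le> E" using E(2)[rule_format, OF a(3)] by (simp only: real_norm_def)
      show "(\<Sum>j\<in>UNIV. norm (?h j)) \<le> (\<Sum>j\<in>UNIV. C j * (q' * q ^ Suc (Suc r)) * eps)" by (intro sum_mono h)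
    qed (use E in \<open>auto intro: sum_nonneg\<close>)
    also have "\<dots> = B1 * eps" unfolding B1_def sum_distrib_right[symmetric] mult.assoc ..
    finally show ?thesis .
  qed
  have cY0: "continuous_on (S \<times> ball c0 dlt) (\<lambda>(t,c). Y0 t c)"
    unfolding case_prod_unfold using S(2) by (intro continuous_Y0 continuous_intros) auto
  have "slow_system r l dlt (B0 + B1 + 1) c0 Y Y0 (\<lambda>i eps t c. F i (nearby t eps c)) S"
  proof
    show "1 \<le> r" by (rule r)
    show "0 < dlt" "dlt \<le> 1" "0 \<le> B0 + B1 + 1" using dlt B0 B1 by auto
    show "continuous_on (S \<times> ball c0 dlt) (\<lambda>(t,c). Y0 t c)" by (rule cY0)
    fix eps :: real assume eps: "0 < eps" "eps < dlt"
    have hol: "mv_holomorphic_on (\<lambda>c. pert j (\<phi> t *s base + of_real eps *s wave t c) / of_real (eps ^ Suc r)) (ball c0 dlt)" if "t \<in> S" for t j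
    proof (intro mv_holomorphic_on_divide mv_holomorphic_on_const)
      show "mv_holomorphic_on (\<lambda>c. pert j (\<phi> t *s base + of_real eps *s wave t c)) (ball c0 dlt)"
        by (rule mv_holomorphic_on_compose[OF pert_holomorphic _ in_dom[OF eps that]])
           (auto simp: wave_def intro!: mv_holomorphic_intros)
    qed (use eps in auto)
    show "mv_holomorphic_on (\<lambda>c. Y eps t c $ k) (ball c0 dlt)" if "t \<in> S" for t k
      unfolding Y_def kick_def vec_lambda_beta
    proof (cases k)
      case (Inl j)
      show "mv_holomorphic_on (\<lambda>c. case k of Inl j \<Rightarrow> pert j (\<phi> t *s base + of_real eps *s wave t c) / of_real (eps ^ Suc r) * exp (- (w j * t)) / (2 * \<gamma> * w j)
          | Inr j \<Rightarrow> - (pert j (\<phi> t *s base + of_real eps *s wave t c) / of_real (eps ^ Suc r) * exp (w j * t) / (2 * \<gamma> * w j))) (ball c0 dlt)"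
        unfolding Inl sum.case using w \<gamma> by (intro mv_holomorphic_on_divide[OF mv_holomorphic_on_mult[OF hol[OF that]]] mv_holomorphic_on_const) auto
    next
      case (Inr j)
      have e: "- (x * y / z) = x * (- (y / z))" for x y z :: complex by simp
      show "mv_holomorphic_on (\<lambda>c. case k of Inl j \<Rightarrow> pert j (\<phi> t *s base + of_real eps *s wave t c) / of_real (eps ^ Suc r) * exp (- (w j * t)) / (2 * \<gamma> * w j)
          | Inr j \<Rightarrow> - (pert j (\<phi> t *s base + of_real eps *s wave t c) / of_real (eps ^ Suc r) * exp (w j * t) / (2 * \<gamma> * w j))) (ball c0 dlt)"
        unfolding Inr sum.case e by (intro mv_holomorphic_on_mult[OF hol[OF that]] mv_holomorphic_on_const)
    qed
    show "continuous_on (S \<times> ball c0 dlt) (\<lambda>(t,c). Y eps t c)"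
      unfolding case_prod_unfold Y_def using eps in_dom[OF eps]
      by (intro continuous_kick continuous_on_divide continuous_on_compose2[OF mv_holomorphic_on_imp_continuous_on[OF pert_holomorphic]] continuous_intros) auto
    fix t c assume a: "t \<in> S" "c \<in> ball c0 dlt"
    show "norm (Y eps t c - Y0 t c) \<le> (B0 + B1 + 1) * eps"
      using diff[OF eps a] mult_right_mono[of B1 "B0 + B1 + 1" eps] B0 eps by linarith
    have "c \<in> cball c0 1" using a dlt by auto
    then have "norm (Y0 t c) \<le> B0" using B0(2) a by auto
    moreover have "B1 * eps \<le> B1" using B1 eps dlt by (intro mult_left_le) auto
    ultimately show "norm (Y eps t c) \<le> B0 + B1 + 1" using diff[OF eps a] norm_triangle_sub[of "Y eps t c" "Y0 t c"] by linarith
    fix i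
    have ad: "c \<in> ball c0 d" "eps < d" using a dlt eps by auto
    have g: "nearby t eps c \<in> regular_points (F i) (phase_space U)" "norm (F i (nearby t eps c)) \<le> 1 / eps ^ l"
      using dl[THEN bspec, OF a(1), THEN bspec, OF ad(1), THEN spec, THEN mp, OF eps(1), THEN mp, OF ad(2)] by simp_all
    show "((\<lambda>(t,c). F i (nearby t eps c)) has_derivative
        (\<lambda>(\<tau>,v). \<Sum>k\<in>UNIV. (v - (\<tau> * of_real (eps ^ r)) *s Y eps t c) $ k * partial_deriv k (\<lambda>c. F i (nearby t eps c)) c)) (at (t,c))"
      by (rule integral_derivative[OF g(1)]) (use eps in simp)
    have "1 / eps ^ l \<le> (B0 + B1 + 1) / eps ^ l" using B0 B1 eps by (intro divide_right_mono) auto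
    then show "norm (F i (nearby t eps c)) \<le> (B0 + B1 + 1) / eps ^ l" using g(2) by linarith
  qed
  then show ?thesis by blast
qed

end

section \<open>Exponential sums\<close>

text \<open>The polynomial \<open>p\<close> vanishes at all values of \<open>E\<close> other than
  \<open>e\<close>; applied to the power sums it leaves the terms with value \<open>e\<close>.
  Several indices may share a value, so the conclusion concerns the sum over a fibre of
  \<open>E\<close>.\<close>

lemma exponential_independence:
  fixes g E :: "'x \<Rightarrow> complex"
  assumes X: "finite X" and zero: "\<And>l. (\<Sum>x\<in>X. g x * E x ^ l) = 0"
  shows "(\<Sum>x | x \<in> X \<and> E x = e. g x) = 0"
proof -
  define p where "p = (\<Prod>e'\<in>E ` X - {e}. [:- e', 1:])"
  have p: "poly p z = (\<Prod>e'\<in>E ` X - {e}. z - e')" for z by (simp add: p_def poly_prod)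
  have "(\<Sum>x\<in>X. g x * poly p (E x)) = (\<Sum>x\<in>X. \<Sum>i\<le>degree p. coeff p i * (g x * E x ^ i))"
    by (simp add: poly_altdef sum_distrib_left mult_ac)
  also have "\<dots> = (\<Sum>i\<le>degree p. coeff p i * (\<Sum>x\<in>X. g x * E x ^ i))"
    by (subst sum.swap) (simp add: sum_distrib_left)
  finally have 0: "(\<Sum>x\<in>X. g x * poly p (E x)) = 0" using zero by simp
  have "poly p (E x) = 0" if "x \<in> X" "E x \<noteq> e" for x
    unfolding p using that X by (intro prod_zero) auto
  then have "(\<Sum>x\<in>X. g x * poly p (E x)) = (\<Sum>x | x \<in> X \<and> E x = e. g x * poly p (E x))"
    using X by (intro sum.mono_neutral_right) auto
  also have "\<dots> = (\<Sum>x | x \<in> X \<and> E x = e. g x) * poly p e" by (simp add: sum_distrib_right)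
  finally have "(\<Sum>x | x \<in> X \<and> E x = e. g x) * poly p e = 0" using 0 by simp
  moreover have "poly p e \<noteq> 0" unfolding p using X by simp
  ultimately show ?thesis by simp
qed

lemma sum_lists_Suc:
  fixes f :: "'k::finite list \<Rightarrow> complex"
  shows "(\<Sum>ks | length ks = Suc n. f ks) = (\<Sum>k\<in>UNIV. \<Sum>ks | length ks = n. f (k # ks))"
proof -
  have e: "{ks. length ks = Suc n} = (\<lambda>(k, ks). k # ks) ` (UNIV \<times> {ks :: 'k list. length ks = n})"
    by (auto simp: length_Suc_conv)
  have "(\<Sum>ks | length ks = Suc n. f ks) = (\<Sum>(k, ks)\<in>UNIV \<times> {ks. length ks = n}. f (k # ks))"
    unfolding e by (subst sum.reindex) (auto simp: inj_on_def case_prod_unfold)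
  then show ?thesis by (simp add: sum.cartesian_product)
qed

lemma finite_lists_length: "finite {ks :: 'k::finite list. length ks = n}"
  using finite_lists_length_eq[of "UNIV :: 'k set" n] by simp

text \<open>The iterated partial derivative along the list, divided by the factorial of its length:
  a Taylor coefficient of an ordered monomial, before orderings are collected.\<close>

primrec taylor_index :: "'m list \<Rightarrow> (complex^'m \<Rightarrow> complex) \<Rightarrow> complex^'m \<Rightarrow> complex" where
  "taylor_index [] g z = g z"
| "taylor_index (i # is) g z = taylor_index is (partial_deriv i g) z / of_nat (Suc (length is))"

text \<open>The components of \<open>v\<close> may themselves be sums over the fibres of
  \<open>pr\<close>. This form is made for waves, in which every component is a sum of two
  exponentials.\<close>

lemma taylor_coeff_expand:
  fixes e :: "'k::finite \<Rightarrow> complex" and pr :: "'k \<Rightarrow> 'm::finite"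
  assumes v: "\<And>i. v $ i = (\<Sum>k | pr k = i. e k)"
  shows "taylor_coeff n g z v = (\<Sum>ks | length ks = n. taylor_index (map pr ks) g z * prod_list (map e ks))"
proof (induction n arbitrary: g)
  case 0
  then show ?case by simp
next
  case (Suc n)
  have "taylor_coeff (Suc n) g z v = (\<Sum>i\<in>UNIV. \<Sum>k | k \<in> UNIV \<and> pr k = i. e k * taylor_coeff n (partial_deriv (pr k) g) z v) / of_nat (Suc n)"
    by (simp add: v sum_distrib_right)
  also have "(\<Sum>i\<in>UNIV. \<Sum>k | k \<in> UNIV \<and> pr k = i. e k * taylor_coeff n (partial_deriv (pr k) g) z v)
     = (\<Sum>k\<in>UNIV. e k * taylor_coeff n (partial_deriv (pr k) g) z v)"
    by (rule sum.group) auto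
  also have "\<dots> / of_nat (Suc n) = (\<Sum>k\<in>UNIV. \<Sum>ks | length ks = n. taylor_index (map pr (k # ks)) g z * prod_list (map e (k # ks)))"
    unfolding Suc sum_divide_distrib sum_distrib_left by (intro sum.cong refl) (simp add: mult_ac)
  finally show ?case by (simp only: sum_lists_Suc)
qed

section \<open>Residue integrals\<close>

definition box_path :: "real \<Rightarrow> real \<Rightarrow> nat \<Rightarrow> real \<Rightarrow> complex" where
  "box_path x0 y0 l = rectpath (Complex (- x0) (- y0)) (Complex x0 (pi * l + y0))"

lemma exp_diff_zero_iff: "exp t - exp (- t) = 0 \<longleftrightarrow> (\<exists>n::int. t = of_real (pi * n) * \<i>)"
proof -
  have "exp t - exp (- t) = 0 \<longleftrightarrow> exp t = exp (- t)" by simp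
  also have "\<dots> \<longleftrightarrow> (\<exists>n::int. t = - t + of_int (2 * n) * of_real pi * \<i>)" unfolding exp_eq by (simp add: mult.assoc)
  also have "\<dots> \<longleftrightarrow> (\<exists>n::int. t = of_real (pi * n) * \<i>)"
  proof (intro iff_exI)
    fix n :: int
    have "t = - t + of_int (2 * n) * of_real pi * \<i> \<longleftrightarrow> t + t = of_real (pi * n) * \<i> + of_real (pi * n) * \<i>"
      by (auto simp: algebra_simps)
    also have "\<dots> \<longleftrightarrow> t = of_real (pi * n) * \<i>" by (metis mult_2 mult_cancel_left zero_neq_numeral)
    finally show "t = - t + of_int (2 * n) * of_real pi * \<i> \<longleftrightarrow> t = of_real (pi * n) * \<i>" .
  qed
  finally show ?thesis .
qed

lemma exp_diff_has_derivative: "((\<lambda>t::complex. exp t - exp (- t)) has_field_derivative exp t + exp (- t)) (at t)"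
  by (auto intro!: derivative_eq_intros)

lemma exp_pi_multiple:
  "exp (of_real (pi * real m) * \<i>) = (-1) ^ m" "exp (- (of_real (pi * real m) * \<i>)) = (-1) ^ m"
proof -
  have e: "of_real (pi * real m) * \<i> = of_nat m * (of_real pi * \<i>)" by simp
  show "exp (of_real (pi * real m) * \<i>) = (-1) ^ m" unfolding e exp_of_nat_mult exp_pi_i ..
  then show "exp (- (of_real (pi * real m) * \<i>)) = (-1) ^ m" unfolding exp_minus by (simp only: minus_one_power_iff) simp
qed

text \<open>The margin 3 is smaller than \<pi>, so widening the interval from 0 to
  \<open>pi * l\<close> by it adds no further multiple of \<pi>.\<close>

lemma pi_multiple_bounds:
  fixes n :: int
  assumes "- 3 < pi * n" "pi * n < pi * real l + 3"
  shows "0 \<le> n" "n \<le> int l"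
proof -
  have p: "pi > 3" by (rule pi_gt3)
  show "0 \<le> n"
  proof (rule ccontr)
    assume "\<not> 0 \<le> n"
    then have "real_of_int n \<le> -1" by linarith
    then have "pi * n \<le> pi * (-1)" by (intro mult_left_mono) auto
    then show False using assms p by linarith
  qed
  show "n \<le> int l"
  proof (rule ccontr)
    assume "\<not> n \<le> int l"
    then have "real l + 1 \<le> real_of_int n" by linarith
    then have "pi * (real l + 1) \<le> pi * n" by (intro mult_left_mono) auto
    then show False using assms p by (simp add: distrib_left)
  qed
qed

text \<open>The freedom between 1 and 2 is used later to move the rectangle off finitely many
  exceptional times; for all these values it encloses exactly the poles with index at most
  \<open>l\<close>.\<close>

locale residue_box =
  fixes x0 y0 :: real and l :: nat
  assumes x0: "1 < x0" "x0 < 2" and y0: "1 < y0" "y0 < 2"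
begin

definition S where "S = {t. - 3 < Im t \<and> Im t < pi * l + 3}"

lemma S: "open S" "convex S"
proof -
  have e: "S = {t. - 3 < Im t} \<inter> {t. Im t < pi * l + 3}" by (auto simp: S_def)
  show "open S" unfolding e by (intro open_Int open_halfspace_Im_gt open_halfspace_Im_lt)
  show "convex S" unfolding e by (intro convex_Int convex_halfspace_Im_gt convex_halfspace_Im_lt)
qed

lemma corners: "Re (Complex (- x0) (- y0)) \<le> Re (Complex x0 (pi * l + y0))" "Im (Complex (- x0) (- y0)) \<le> Im (Complex x0 (pi * l + y0))"
  using x0 y0 by (simp_all add: add_nonneg_nonneg)

lemma box_path_image: "path_image (box_path x0 y0 l) =
   {z. (Re z = - x0 \<or> Re z = x0) \<and> - y0 \<le> Im z \<and> Im z \<le> pi * l + y0} \<union> {z. (Im z = - y0 \<or> Im z = pi * l + y0) \<and> - x0 \<le> Re z \<and> Re z \<le> x0}"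
  unfolding box_path_def path_image_rectpath[OF corners] complex.sel
  by (simp only: insert_iff empty_iff atLeastAtMost_iff simp_thms)

lemma box_valid [simp]: "valid_path (box_path x0 y0 l)" "pathfinish (box_path x0 y0 l) = pathstart (box_path x0 y0 l)"
  by (simp_all add: box_path_def)

lemma nonzero_on_path: assumes "t \<in> path_image (box_path x0 y0 l)" shows "exp t - exp (- t) \<noteq> 0" "t \<in> S"
proof -
  have im: "- y0 \<le> Im t" "Im t \<le> pi * l + y0" using assms x0 y0 unfolding box_path_image by (auto simp: add_nonneg_nonneg)
  then show "t \<in> S" using y0 by (simp add: S_def)
  show "exp t - exp (- t) \<noteq> 0"
  proof
    assume "exp t - exp (- t) = 0"
    then obtain n :: int where n: "t = of_real (pi * n) * \<i>" unfolding exp_diff_zero_iff by blast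
    then have r: "Re t = 0" "Im t = pi * n" by simp_all
    have "0 \<le> n" "n \<le> int l" using pi_multiple_bounds[of n l] im y0 r by auto
    then have "0 \<le> real_of_int n" "real_of_int n \<le> real l" by linarith+
    then have "0 \<le> pi * n" "pi * n \<le> pi * l" by (auto intro: mult_left_mono)
    then show False using assms r x0 y0 unfolding box_path_image Un_iff mem_Collect_eq by (elim disjE conjE; linarith)
  qed
qed

text \<open>All poles are simple: the denominator has derivative \<open>2 * (-1) ^ m\<close> at the
  one with index \<open>m\<close>.\<close>

lemma residue_sum:
  assumes f: "f holomorphic_on UNIV" and nz: "\<And>m. f (of_real (pi * real m) * \<i>) \<noteq> 0"
  shows "contour_integral (box_path x0 y0 l) (\<lambda>t. f t / (exp t - exp (- t))) =
     2 * pi * \<i> * (\<Sum>m\<le>l. f (of_real (pi * real m) * \<i>) / (2 * (-1) ^ m))"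
proof -
  let ?p = "\<lambda>m::nat. of_real (pi * real m) * \<i>"
  have inj: "inj_on ?p {..l}" by (auto simp: inj_on_def)
  have "contour_integral (box_path x0 y0 l) (\<lambda>t. f t / (exp t - exp (- t))) =
     2 * pi * \<i> * (\<Sum>p\<in>?p ` {..l}. winding_number (box_path x0 y0 l) p * residue (\<lambda>t. f t / (exp t - exp (- t))) p)"
  proof (rule Residue_theorem[OF S(1) convex_connected[OF S(2)]])
    show "(\<lambda>t. f t / (exp t - exp (- t))) holomorphic_on S - ?p ` {..l}"
    proof (intro holomorphic_intros holomorphic_on_subset[OF f])
      fix t assume t: "t \<in> S - ?p ` {..l}"
      show "exp t - exp (- t) \<noteq> 0"
      proof
        assume "exp t - exp (- t) = 0"
        then obtain n :: int where n: "t = of_real (pi * n) * \<i>" unfolding exp_diff_zero_iff by blast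
        then have "0 \<le> n" "n \<le> int l" using pi_multiple_bounds[of n l] t by (auto simp: S_def)
        then have "t = ?p (nat n)" "nat n \<in> {..l}" using n by auto
        then show False using t by blast
      qed
    qed auto
    show "path_image (box_path x0 y0 l) \<subseteq> S - ?p ` {..l}"
    proof
      fix t assume t: "t \<in> path_image (box_path x0 y0 l)"
      have "exp t - exp (- t) = 0" if "t = ?p m" for m unfolding exp_diff_zero_iff that by (rule exI[of _ "int m"]) simp
      then show "t \<in> S - ?p ` {..l}" using nonzero_on_path[OF t] by auto
    qed
    show "\<forall>z. z \<notin> S \<longrightarrow> winding_number (box_path x0 y0 l) z = 0"
    proof (intro allI impI)
      fix z assume "z \<notin> S"
      then have "z \<notin> cbox (Complex (- x0) (- y0)) (Complex x0 (pi * l + y0))" using y0 by (auto simp: S_def in_cbox_complex_iff)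
      then show "winding_number (box_path x0 y0 l) z = 0"
        unfolding box_path_def by (rule winding_number_rectpath_outside[OF corners])
    qed
  qed auto
  also have "(\<Sum>p\<in>?p ` {..l}. winding_number (box_path x0 y0 l) p * residue (\<lambda>t. f t / (exp t - exp (- t))) p)
     = (\<Sum>m\<le>l. f (?p m) / (2 * (-1) ^ m))"
    unfolding sum.reindex[OF inj] o_def
  proof (rule sum.cong[OF refl])
    fix m assume m: "m \<in> {..l}"
    have "pi * real m \<le> pi * real l" using m by (intro mult_left_mono) auto
    then have m1: "pi * real m < pi * l + y0" using y0 by linarith
    have m2: "- y0 < pi * real m"
    proof -
      have "0 \<le> pi * real m" by simp
      then show ?thesis using y0 by linarith
    qed
    have re: "Re (?p m) = 0" "Im (?p m) = pi * real m" by simp_all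
    have "?p m \<in> box (Complex (- x0) (- y0)) (Complex x0 (pi * l + y0))"
      unfolding in_box_complex_iff re complex.sel greaterThanLessThan_iff using x0 m1 m2 by linarith
    then have 1: "winding_number (box_path x0 y0 l) (?p m) = 1" unfolding box_path_def by (rule winding_number_rectpath)
    note em = exp_pi_multiple[of m]
    have d: "((\<lambda>t. exp t - exp (- t)) has_field_derivative 2 * (-1) ^ m) (at (?p m))"
      using exp_diff_has_derivative[of "?p m"] unfolding em mult_2[symmetric] .
   have "residue (\<lambda>t. f t / (exp t - exp (- t))) (?p m) = f (?p m) / (2 * (-1) ^ m)"
    proof (rule residue_simple_pole_deriv[OF f _ open_UNIV connected_UNIV UNIV_I d nz])
      show "(\<lambda>t. exp t - exp (- t)) holomorphic_on UNIV" by (auto intro!: holomorphic_intros)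
      show "exp (?p m) - exp (- ?p m) = 0" unfolding em by simp
    qed simp
    then show "winding_number (box_path x0 y0 l) (?p m) * residue (\<lambda>t. f t / (exp t - exp (- t))) (?p m) = f (?p m) / (2 * (-1) ^ m)"
      using 1 by simp
  qed
  finally show ?thesis .
qed

lemma loop_integral_derivative:
  assumes "\<And>t. exp t - exp (- t) \<noteq> 0 \<Longrightarrow> (f has_field_derivative f' t) (at t)"
  shows "(f' has_contour_integral 0) (box_path x0 y0 l)"
proof (rule Cauchy_theorem_primitive[OF _ box_valid(1) order_refl box_valid(2)])
  fix t assume "t \<in> path_image (box_path x0 y0 l)"
  then show "(f has_field_derivative f' t) (at t within path_image (box_path x0 y0 l))"
    by (rule has_field_derivative_at_within[OF assms[OF nonzero_on_path(1)]])
qed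

end

text \<open>The residue at 0 of \<open>exp (\<Omega> * t) / (exp t - exp (- t)) ^ r\<close>. The
  recursion in steps of two comes from integration by parts around the pole.\<close>

fun \<rho> :: "nat \<Rightarrow> complex \<Rightarrow> complex" where
  "\<rho> 0 \<Omega> = 0"
| "\<rho> (Suc 0) \<Omega> = 1/2"
| "\<rho> (Suc (Suc 0)) \<Omega> = \<Omega> / 4"
| "\<rho> (Suc (Suc (Suc n))) \<Omega> = (\<Omega>\<^sup>2 - of_nat (Suc n) ^ 2) * \<rho> (Suc n) \<Omega> / (4 * of_nat (Suc n) * of_nat (Suc (Suc n)))"

text \<open>Besides the initial values \<open>1/2\<close> and \<open>\<Omega> / 4\<close>, the
  recursion only brings in nonzero constants and factors \<open>\<Omega>\<^sup>2 - k\<^sup>2\<close>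
  with an integer \<open>k\<close>, which do not vanish off the integers.\<close>

lemma \<rho>_nonzero: "r \<ge> 1 \<Longrightarrow> \<Omega> \<notin> \<int> \<Longrightarrow> \<rho> r \<Omega> \<noteq> 0"
proof (induction r \<Omega> rule: \<rho>.induct)
  case (4 n \<Omega>)
  have "\<Omega> \<noteq> of_nat (Suc n)" "\<Omega> \<noteq> - of_nat (Suc n)" using 4(3) Ints_of_nat Ints_minus by blast+
  then have "\<Omega>\<^sup>2 - of_nat (Suc n) ^ 2 \<noteq> 0" by (simp only: right_minus_eq power2_eq_iff) blast
  moreover have "(of_nat (Suc n) :: complex) \<noteq> 0" "(of_nat (Suc (Suc n)) :: complex) \<noteq> 0" by (simp_all only: of_nat_eq_0_iff nat.distinct not_False_eq_True)
  ultimately show ?case using 4 by (simp only: \<rho>.simps mult_eq_0_iff divide_eq_0_iff) auto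
qed auto

text \<open>With \<open>s\<close> and \<open>c\<close> the difference and the sum of
  \<open>exp t\<close> and \<open>exp (- t)\<close>, and \<open>e = exp (\<Omega> * t)\<close>, this
  simplifies the derivative of \<open>e / s ^ k\<close>; the companion lemma treats
  \<open>e * c / s ^ Suc k\<close>, where \<open>c\<^sup>2 = s\<^sup>2 + 4\<close> enters.\<close>

lemma quotient_derivative:
  fixes s :: complex
  assumes "s \<noteq> 0"
  shows "(\<Omega> * e * s ^ k - e * (of_nat k * (c * s ^ (k - Suc 0)))) / (s ^ k * s ^ k) = \<Omega> * (e / s ^ k) - of_nat k * (e * c / s ^ Suc k)"
proof (cases k)
  case (Suc n)
  have "e * (of_nat k * (c * p)) / ((s * p) * (s * p)) = of_nat k * (e * c / (s * (s * p)))" if "p \<noteq> 0" for p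
    using assms that by simp
  from this[of "s ^ n"] have "e * (of_nat k * (c * s ^ (k - Suc 0))) / (s ^ k * s ^ k) = of_nat k * (e * c / s ^ Suc k)"
    using assms unfolding Suc by simp
  moreover have "\<Omega> * e * s ^ k / (s ^ k * s ^ k) = \<Omega> * (e / s ^ k)" using assms by simp
  ultimately show ?thesis unfolding diff_divide_distrib by simp
qed simp

lemma quotient_derivative':
  fixes s :: complex
  assumes "s \<noteq> 0" "c * c = s * s + 4"
  shows "((e * s + \<Omega> * e * c) * s ^ Suc k - e * c * (of_nat (Suc k) * (c * s ^ (Suc k - Suc 0)))) / (s ^ Suc k * s ^ Suc k)
     = \<Omega> * (e * c / s ^ Suc k) - of_nat k * (e / s ^ k) - 4 * of_nat (Suc k) * (e / s ^ Suc (Suc k))"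
proof -
  have "e * c * (of_nat (Suc k) * (c * s ^ (Suc k - Suc 0))) = of_nat (Suc k) * e * s ^ k * (c * c)" by (simp add: mult_ac)
  also have "\<dots> = of_nat (Suc k) * e * s ^ k * (s * s + 4)" using assms(2) by simp
  finally have "((e * s + \<Omega> * e * c) * s ^ Suc k - e * c * (of_nat (Suc k) * (c * s ^ (Suc k - Suc 0)))) / (s ^ Suc k * s ^ Suc k)
     = s ^ k * ((e * s + \<Omega> * e * c) * s - of_nat (Suc k) * e * (s * s + 4)) / (s ^ k * (s ^ k * s * s))"
    by (simp add: algebra_simps)
  also have "\<dots> = ((e * s + \<Omega> * e * c) * s - of_nat (Suc k) * e * (s * s + 4)) / (s ^ k * s * s)" using assms(1) by simp
  also have "\<dots> = \<Omega> * (e * c / s ^ Suc k) - of_nat k * (e / s ^ k) - 4 * of_nat (Suc k) * (e / s ^ Suc (Suc k))"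
  proof -
    have "(e * s + \<Omega> * e * c) * s - of_nat (Suc k) * e * (s * s + 4) = \<Omega> * e * c * s - of_nat k * e * (s * s) - 4 * of_nat (Suc k) * e"
      by (simp add: algebra_simps)
    then show ?thesis using assms(1) by (simp add: diff_divide_distrib mult_ac del: of_nat_Suc)
  qed
  finally show ?thesis .
qed

context residue_box
begin

text \<open>Derivatives integrate to 0 over the loop. The relations from
  \<open>exp (\<Omega> * t) / s ^ k\<close> and \<open>exp (\<Omega> * t) * c / s ^ Suc k\<close>,
  with \<open>s\<close> and \<open>c\<close> as in \<open>quotient_derivative\<close>, lower the
  power of the denominator by two once the integrals \<open>J\<close> are eliminated, down to the
  simple poles of \<open>I 1\<close> and \<open>J 1\<close>. The sign \<open>(-1) ^ r\<close> arises
  because \<open>s\<close> changes sign under a shift by half its period.\<close>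

lemma exp_power_integral:
  assumes "r \<ge> 1"
  shows "((\<lambda>t. exp (\<Omega> * t) / (exp t - exp (- t)) ^ r) has_contour_integral
     2 * pi * \<i> * \<rho> r \<Omega> * (\<Sum>m\<le>l. ((-1) ^ r * exp (pi * \<i> * \<Omega>)) ^ m)) (box_path x0 y0 l)"
proof -
  let ?s = "\<lambda>t::complex. exp t - exp (- t)" and ?c = "\<lambda>t::complex. exp t + exp (- t)" and ?g = "box_path x0 y0 l"
  let ?e = "\<lambda>t::complex. exp (\<Omega> * t)"
  define I where "I = (\<lambda>k. contour_integral ?g (\<lambda>t. ?e t / ?s t ^ k))"
  define J where "J = (\<lambda>k. contour_integral ?g (\<lambda>t. ?e t * ?c t / ?s t ^ k))"
  have op: "open {t. ?s t \<noteq> 0}"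
  proof -
    have "{t. ?s t \<noteq> 0} = - {t. ?s t = 0}" by auto
    moreover have "closed {t. ?s t = 0}"
      by (rule closed_Collect_eq[OF holomorphic_on_imp_continuous_on[of _ UNIV] continuous_on_const]) (intro holomorphic_intros)
    ultimately show ?thesis by (simp add: open_Compl)
  qed
  have sub: "path_image ?g \<subseteq> {t. ?s t \<noteq> 0}" using nonzero_on_path(1) by auto
  have Ii: "(\<lambda>t. ?e t / ?s t ^ k) contour_integrable_on ?g" for k
    by (rule contour_integrable_holomorphic_simple[OF _ op _ sub]) (auto intro!: holomorphic_intros)
  have Ji: "(\<lambda>t. ?e t * ?c t / ?s t ^ k) contour_integrable_on ?g" for k
    by (rule contour_integrable_holomorphic_simple[OF _ op _ sub]) (auto intro!: holomorphic_intros)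
  have I: "((\<lambda>t. ?e t / ?s t ^ k) has_contour_integral I k) ?g" for k unfolding I_def by (rule has_contour_integral_integral[OF Ii])
  have J: "((\<lambda>t. ?e t * ?c t / ?s t ^ k) has_contour_integral J k) ?g" for k unfolding J_def by (rule has_contour_integral_integral[OF Ji])
  have de: "(?e has_field_derivative \<Omega> * ?e t) (at t)" for t by (auto intro!: derivative_eq_intros)
  have ds: "(?s has_field_derivative ?c t) (at t)" for t by (rule exp_diff_has_derivative)
  have dc: "(?c has_field_derivative ?s t) (at t)" for t by (auto intro!: derivative_eq_intros)
  have J1: "\<Omega> * I k = of_nat k * J (Suc k)" for k
  proof -
    have "((\<lambda>t. \<Omega> * (?e t / ?s t ^ k) - of_nat k * (?e t * ?c t / ?s t ^ Suc k)) has_contour_integral 0) ?g"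
    proof (rule loop_integral_derivative[where f = "\<lambda>t. ?e t / ?s t ^ k"])
      fix t assume nz: "?s t \<noteq> 0"
      show "((\<lambda>t. ?e t / ?s t ^ k) has_field_derivative \<Omega> * (?e t / ?s t ^ k) - of_nat k * (?e t * ?c t / ?s t ^ Suc k)) (at t)"
        by (rule DERIV_cong[OF DERIV_divide[OF de DERIV_power[OF ds]]]) (use nz in \<open>simp del: right_minus_eq\<close>, rule quotient_derivative[OF nz])
    qed
    moreover have "((\<lambda>t. \<Omega> * (?e t / ?s t ^ k) - of_nat k * (?e t * ?c t / ?s t ^ Suc k)) has_contour_integral (\<Omega> * I k - of_nat k * J (Suc k))) ?g"
      by (intro has_contour_integral_diff has_contour_integral_lmul I J)
    ultimately have "\<Omega> * I k - of_nat k * J (Suc k) = 0" using has_contour_integral_unique by blast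
    then show ?thesis by simp
  qed
  have J2: "\<Omega> * J (Suc k) = of_nat k * I k + 4 * of_nat (Suc k) * I (Suc (Suc k))" for k
  proof -
    let ?f' = "\<lambda>t. \<Omega> * (?e t * ?c t / ?s t ^ Suc k) - of_nat k * (?e t / ?s t ^ k) - 4 * of_nat (Suc k) * (?e t / ?s t ^ Suc (Suc k))"
    have "(?f' has_contour_integral 0) ?g"
    proof (rule loop_integral_derivative[where f = "\<lambda>t. ?e t * ?c t / ?s t ^ Suc k"])
      fix t assume nz: "?s t \<noteq> 0"
      have cs: "?c t * ?c t = ?s t * ?s t + 4" by (simp add: exp_minus field_simps)
      show "((\<lambda>t. ?e t * ?c t / ?s t ^ Suc k) has_field_derivative ?f' t) (at t)"
        by (rule DERIV_cong[OF DERIV_divide[OF DERIV_mult'[OF de dc] DERIV_power[OF ds]] quotient_derivative'[OF nz cs]])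
          (use nz in \<open>simp del: right_minus_eq\<close>)
    qed
    moreover have "(?f' has_contour_integral (\<Omega> * J (Suc k) - of_nat k * I k - 4 * of_nat (Suc k) * I (Suc (Suc k)))) ?g"
      by (intro has_contour_integral_diff has_contour_integral_lmul I J)
    ultimately have "\<Omega> * J (Suc k) - of_nat k * I k - 4 * of_nat (Suc k) * I (Suc (Suc k)) = 0" using has_contour_integral_unique by blast
    then show ?thesis by (simp add: algebra_simps)
  qed
  define q where "q = exp (pi * \<i> * \<Omega>)"
  have em: "exp (\<Omega> * (of_real (pi * real m) * \<i>)) = q ^ m" for m
  proof -
    have "\<Omega> * (of_real (pi * real m) * \<i>) = of_nat m * (pi * \<i> * \<Omega>)" by simp
    then show ?thesis unfolding q_def by (simp only: exp_of_nat_mult)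
  qed
  have ec: "exp (of_real (pi * real m) * \<i>) + exp (- (of_real (pi * real m) * \<i>)) = 2 * (-1) ^ m" for m
    unfolding exp_pi_multiple by simp
  have "I 1 = 2 * pi * \<i> * (\<Sum>m\<le>l. exp (\<Omega> * (of_real (pi * real m) * \<i>)) / (2 * (-1) ^ m))"
    unfolding I_def using residue_sum[of ?e] by (simp add: holomorphic_intros)
  also have "\<dots> = 2 * pi * \<i> * (1/2 * (\<Sum>m\<le>l. ((-1) * q) ^ m))"

  proof -
    have "q ^ m / (2 * (-1) ^ m) = 1/2 * ((-1) * q) ^ m" for m
      unfolding power_mult_distrib by (simp add: minus_one_power_iff)
    then show ?thesis unfolding em by (simp only: sum_distrib_left)
  qed
  finally have I1: "I 1 = 2 * pi * \<i> * (1/2 * (\<Sum>m\<le>l. ((-1) * q) ^ m))" .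
  have "J 1 = 2 * pi * \<i> * (\<Sum>m\<le>l. exp (\<Omega> * (of_real (pi * real m) * \<i>)) * (2 * (-1) ^ m) / (2 * (-1) ^ m))"
    unfolding J_def using residue_sum[of "\<lambda>t. ?e t * ?c t"] ec by (simp add: holomorphic_intros)
  then have J1': "J 1 = 2 * pi * \<i> * (\<Sum>m\<le>l. q ^ m)" unfolding em by simp
  have "I r = 2 * pi * \<i> * \<rho> r \<Omega> * (\<Sum>m\<le>l. ((-1) ^ r * q) ^ m)"
    using assms
  proof (induction r rule: less_induct)
    case (less r)
    consider "r = 1" | "r = 2" | n where "r = Suc (Suc (Suc n))" using less(2)
    proof (cases r)
      case (Suc p)
      then show thesis using that by (cases p; cases "p - 1") auto
    qed (use less(2) in simp)
    then show ?case
    proof cases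
      case 1
      then show ?thesis using I1 by simp
    next
      case 2
      have i2: "I 2 = \<Omega> * J 1 / 4" using J2[of 0] by (simp add: numeral_2_eq_2)
      have r2: "\<rho> 2 \<Omega> = \<Omega> / 4" by (simp add: numeral_2_eq_2)
      show ?thesis unfolding 2 i2 r2 J1' by simp
    next
      case (3 n)
      define k where "k = Suc n"
      have IH: "I k = 2 * pi * \<i> * \<rho> k \<Omega> * (\<Sum>m\<le>l. ((-1) ^ k * q) ^ m)" using less(1)[of k] 3 by (simp add: k_def)
      have k0: "(of_nat k :: complex) \<noteq> 0" "(of_nat (Suc k) :: complex) \<noteq> 0" by (simp_all add: k_def del: of_nat_Suc)
      have "\<Omega>\<^sup>2 * I k = of_nat k * (\<Omega> * J (Suc k))" using J1[of k] by (simp add: power2_eq_square)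
      then have "(\<Omega>\<^sup>2 - of_nat k ^ 2) * I k = 4 * of_nat k * of_nat (Suc k) * I (Suc (Suc k))"
        unfolding J2 by (simp add: algebra_simps power2_eq_square)
      then have "I (Suc (Suc k)) = (\<Omega>\<^sup>2 - of_nat k ^ 2) * I k / (4 * of_nat k * of_nat (Suc k))"
        using k0 by (simp add: field_simps del: of_nat_Suc)
      moreover have "\<rho> (Suc (Suc k)) \<Omega> = (\<Omega>\<^sup>2 - of_nat k ^ 2) * \<rho> k \<Omega> / (4 * of_nat k * of_nat (Suc k))" by (simp only: k_def \<rho>.simps)
      moreover have "(-1 :: complex) ^ Suc (Suc k) = (-1) ^ k" by simp
      moreover have "r = Suc (Suc k)" using 3 by (simp add: k_def)
      ultimately show ?thesis unfolding IH by (simp only: times_divide_eq_left times_divide_eq_right mult_ac)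
    qed
  qed
  then show ?thesis using I[of r] by (simp add: q_def)
qed

end

lemma euler_homogeneous:
  fixes f :: "complex^'m \<Rightarrow> complex"
  assumes f: "mv_holomorphic_on f U" and q: "q \<in> U" and hom: "\<And>s. s \<noteq> 0 \<Longrightarrow> f (s *s q) = s ^ k * f q"
  shows "(\<Sum>i\<in>UNIV. q $ i * partial_deriv i f q) = of_nat k * f q"
proof -
  have A: "((\<lambda>ze. f (q + ze *s q)) has_field_derivative (\<Sum>i\<in>UNIV. q $ i * partial_deriv i f q)) (at 0)"
    using field_differentiable_along_line[OF f, of q 0 q] q by simp
  have B: "((\<lambda>ze. (1 + ze) ^ k * f q) has_field_derivative of_nat k * f q) (at 0)" by (auto intro!: derivative_eq_intros)
  have "((\<lambda>ze. f (q + ze *s q)) has_field_derivative of_nat k * f q) (at 0)"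
  proof (rule has_field_derivative_transform_within_open[OF B])
    show "open (- {-1 :: complex})" "0 \<in> - {-1 :: complex}" by auto
    fix ze :: complex assume "ze \<in> - {-1}"
    then have nz: "1 + ze \<noteq> 0" by (auto simp: add_eq_0_iff)
    have e: "q + ze *s q = (1 + ze) *s q" by (simp add: vec_eq_iff algebra_simps)
    show "(1 + ze) ^ k * f q = f (q + ze *s q)" unfolding e by (rule hom[OF nz, symmetric])
  qed
  then show ?thesis using A DERIV_unique by blast
qed

context eigencoordinates
begin

text \<open>The non-quadratic part of the potential. Its gradient is \<open>pert\<close>, which
  makes Euler's relation available for the perturbation.\<close>

definition rest :: "complex^'n \<Rightarrow> complex" where
  "rest u = V (P *v u) - \<gamma> / 2 * (\<Sum>j\<in>UNIV. (w j)\<^sup>2 * (u $ j * u $ j))"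

lemma sum_pert: "(\<Sum>j\<in>UNIV. v $ j * pert j u) =
   (\<Sum>i\<in>UNIV. (P *v v) $ i * partial_deriv i V (P *v u)) - \<gamma> * (\<Sum>j\<in>UNIV. (w j)\<^sup>2 * (v $ j * u $ j))"
proof -
  have "(\<Sum>i\<in>UNIV. (P *v v) $ i * partial_deriv i V (P *v u)) = (\<Sum>j\<in>UNIV. v $ j * (\<Sum>i\<in>UNIV. P $ i $ j * partial_deriv i V (P *v u)))"
    unfolding matrix_vector_mult_def vec_lambda_beta sum_distrib_right sum_distrib_left
    by (subst sum.swap) (simp add: mult_ac)
  then show ?thesis by (simp add: pert_def sum_subtractf sum_distrib_left algebra_simps)
qed

lemma rest_derivative:
  assumes u: "u \<in> dom"
  shows "(rest has_derivative (\<lambda>v. \<Sum>j\<in>UNIV. v $ j * pert j u)) (at u)"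
proof -
  have d1: "((\<lambda>u. P *v u) has_derivative (\<lambda>v. P *v v)) (at u)"
    by (rule bounded_linear_imp_has_derivative[OF matrix_vector_mul_bounded_linear])
  have pu: "P *v u \<in> U" using u by (simp add: dom_def)
  have d2: "((\<lambda>u. V (P *v u)) has_derivative (\<lambda>v. \<Sum>i\<in>UNIV. (P *v v) $ i * partial_deriv i V (P *v u))) (at u)"
    by (rule has_derivative_compose[OF d1 mv_holomorphic_on_has_derivative[OF V_holomorphic pu]])
  have c: "((\<lambda>u. u $ j) has_derivative (\<lambda>v. v $ j)) (at u)" for j
    by (rule bounded_linear_imp_has_derivative[OF bounded_linear_vec_nth])
  have d3: "((\<lambda>u. \<gamma> / 2 * (\<Sum>j\<in>UNIV. (w j)\<^sup>2 * (u $ j * u $ j))) has_derivative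
      (\<lambda>v. \<gamma> / 2 * (\<Sum>j\<in>UNIV. (w j)\<^sup>2 * (u $ j * v $ j + v $ j * u $ j)))) (at u)"
    by (intro has_derivative_mult_right has_derivative_sum has_derivative_mult c)
  show ?thesis unfolding rest_def
    by (rule has_derivative_eq_rhs[OF has_derivative_diff[OF d2 d3]])
       (simp add: fun_eq_iff sum_pert sum_distrib_left algebra_simps)
qed

lemma rest_euler: "u \<in> dom \<Longrightarrow> 2 * rest u = (\<Sum>j\<in>UNIV. u $ j * pert j u)"
  using euler_homogeneous[OF V_holomorphic, of "P *v u" 2] V_homogeneous by (simp add: sum_pert rest_def dom_def algebra_simps)

end

lemma contour_integral_rectpath:
  assumes "f contour_integrable_on rectpath a1 a3"
  shows "contour_integral (rectpath a1 a3) f =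
     contour_integral (linepath a1 (Complex (Re a3) (Im a1))) f + (contour_integral (linepath (Complex (Re a3) (Im a1)) a3) f +
     (contour_integral (linepath a3 (Complex (Re a1) (Im a3))) f + contour_integral (linepath (Complex (Re a1) (Im a3)) a1) f))"
  using assms by (simp add: rectpath_def Let_def)

lemma rectpath_segments:
  "closed_segment u (Complex (Re v) (Im u)) \<subseteq> path_image (rectpath u v)"
  "closed_segment (Complex (Re v) (Im u)) v \<subseteq> path_image (rectpath u v)"
  "closed_segment v (Complex (Re u) (Im v)) \<subseteq> path_image (rectpath u v)"
  "closed_segment (Complex (Re u) (Im v)) u \<subseteq> path_image (rectpath u v)"
  by (auto simp: rectpath_def Let_def path_image_join)

section \<open>The leading term of the perturbation\<close>

context integrable_eigencoordinates
begin

lemma pert_bound: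
  "\<exists>d>0. \<exists>C\<ge>0. \<forall>ze. norm ze < d \<longrightarrow> base + ze *s v \<in> dom \<and>
     (\<forall>j. norm (pert j (base + ze *s v) - ze ^ Suc r * T j v) \<le> C * norm ze ^ Suc (Suc r))"
proof -
  obtain \<rho> where \<rho>: "\<rho> > 0" "cball base \<rho> \<subseteq> dom" using open_dom base_dom open_contains_cball by blast
  have "\<exists>C\<ge>0. \<forall>z u (ze::complex). (\<forall>\<xi>. norm \<xi> \<le> norm ze \<longrightarrow> z + \<xi> *s u \<in> cball base \<rho>) \<longrightarrow> norm u \<le> norm v \<longrightarrow>
     (\<forall>k<Suc r. taylor_coeff k (pert j) z u = 0) \<longrightarrow>
     norm (pert j (z + ze *s u) - ze ^ Suc r * taylor_coeff (Suc r) (pert j) z u) \<le> C * norm ze ^ Suc (Suc r)" for j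
    by (rule taylor_remainder_leading[OF pert_holomorphic open_dom compact_cball \<rho>(2)])
  then have "\<exists>C\<ge>0. \<forall>ze::complex. (\<forall>\<xi>. norm \<xi> \<le> norm ze \<longrightarrow> base + \<xi> *s v \<in> cball base \<rho>) \<longrightarrow>
     norm (pert j (base + ze *s v) - ze ^ Suc r * T j v) \<le> C * norm ze ^ Suc (Suc r)" for j
    using vanish unfolding T_def by (metis less_Suc_eq_le order_refl)
  then obtain C where C: "\<And>j. 0 \<le> C j" "\<And>j ze. (\<And>\<xi>. norm \<xi> \<le> norm ze \<Longrightarrow> base + \<xi> *s v \<in> cball base \<rho>) \<Longrightarrow>
     norm (pert j (base + ze *s v) - ze ^ Suc r * T j v) \<le> C j * norm ze ^ Suc (Suc r)" by metis
  define d where "d = \<rho> / (norm v + 1)"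
  have d: "d > 0" unfolding d_def using \<rho>(1) by (intro divide_pos_pos) (auto intro: add_nonneg_pos)
  have inb: "base + \<xi> *s v \<in> cball base \<rho>" if "norm \<xi> < d" for \<xi>
  proof -
    have "norm \<xi> * (norm v + 1) \<le> \<rho>"
      using that unfolding d_def by (simp add: pos_less_divide_eq add_nonneg_pos)
    then have "norm (\<xi> *s v) \<le> \<rho>" unfolding norm_vector_scalar_mult distrib_left using norm_ge_zero[of \<xi>] by linarith
    then show ?thesis by (simp add: dist_norm)
  qed
  show ?thesis
  proof (rule exI[of _ d], rule conjI[OF d], rule exI[of _ "\<Sum>j\<in>UNIV. C j"], rule conjI, rule sum_nonneg[OF C(1)], intro allI impI conjI)
    fix ze :: complex assume z: "norm ze < d"
    show "base + ze *s v \<in> dom" using inb[OF z] \<rho>(2) by blast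
    fix j
    have "norm (pert j (base + ze *s v) - ze ^ Suc r * T j v) \<le> C j * norm ze ^ Suc (Suc r)"
      by (rule C(2)) (use z in \<open>auto intro!: inb simp del: mem_cball\<close>)
    also have "\<dots> \<le> (\<Sum>j\<in>UNIV. C j) * norm ze ^ Suc (Suc r)"
      using C(1) by (intro mult_right_mono member_le_sum) auto
    finally show "norm (pert j (base + ze *s v) - ze ^ Suc r * T j v) \<le> (\<Sum>j\<in>UNIV. C j) * norm ze ^ Suc (Suc r)" .
  qed
qed

lemma limit_of_bound:
  fixes f :: "complex \<Rightarrow> complex"
  assumes "d > 0" "\<And>ze. norm ze < d \<Longrightarrow> norm (f ze - ze ^ k * c) \<le> C * norm ze ^ Suc k"
  shows "((\<lambda>ze. f ze / ze ^ k) \<longlongrightarrow> c) (at 0)"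
proof (rule LIM_zero_cancel, rule Lim_null_comparison)
  show "\<forall>\<^sub>F ze in at 0. norm (f ze / ze ^ k - c) \<le> C * norm ze"
    unfolding eventually_at
  proof (rule exI[of _ d], rule conjI[OF assms(1)], intro ballI impI)
    fix ze :: complex assume z: "ze \<noteq> 0 \<and> dist ze 0 < d"
    then have "f ze / ze ^ k - c = (f ze - ze ^ k * c) / ze ^ k" by (simp add: field_simps)
    then have "norm (f ze / ze ^ k - c) = norm (f ze - ze ^ k * c) / norm ze ^ k" by (simp add: norm_divide norm_power)
    also have "\<dots> \<le> C * norm ze ^ Suc k / norm ze ^ k" using assms(2)[of ze] z by (intro divide_right_mono) auto
    also have "\<dots> = C * norm ze" using z by simp
    finally show "norm (f ze / ze ^ k - c) \<le> C * norm ze" .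
  qed
  have "((\<lambda>ze::complex. C * norm ze) \<longlongrightarrow> C * norm (0::complex)) (at 0)" by (intro tendsto_intros)
  then show "((\<lambda>ze::complex. C * norm ze) \<longlongrightarrow> 0) (at 0)" by simp
qed

text \<open>Describes \<open>T\<close> intrinsically as a limit, so that identities for
  \<open>pert\<close> can be transferred to it without manipulating Taylor coefficients.\<close>

lemma pert_limit: "((\<lambda>ze. pert j (base + ze *s v) / ze ^ Suc r) \<longlongrightarrow> T j v) (at 0)"
proof -
  obtain d C where "d > 0" "\<forall>ze. norm ze < d \<longrightarrow> base + ze *s v \<in> dom \<and>
     (\<forall>j. norm (pert j (base + ze *s v) - ze ^ Suc r * T j v) \<le> C * norm ze ^ Suc (Suc r))" using pert_bound by blast
  then show ?thesis by (intro limit_of_bound[of d _ "Suc r" _ C]) auto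
qed

text \<open>Moving along the Darboux direction amounts to scaling:
  \<open>base + ze *s (v + h *s axis a 1)\<close> is \<open>1 + ze * (h / dlt0)\<close> times a
  point \<open>base + \<eta> *s v\<close> with \<open>\<eta>\<close> asymptotic to
  \<open>ze\<close>. Homogeneity of \<open>pert\<close> then leaves the limit unchanged.\<close>

lemma T_shift: "T j (v + h *s axis a 1) = T j v"
proof -
  define e where "e = (\<lambda>ze. 1 + ze * (h / dlt0))"
  define \<eta> where "\<eta> = (\<lambda>ze. ze / e ze)"
  obtain d where d: "d > 0" "\<And>ze. norm ze < d \<Longrightarrow> base + ze *s v \<in> dom" using pert_bound[of v] by blast
  have "(e \<longlongrightarrow> 1 + 0 * (h / dlt0)) (at 0)" unfolding e_def by (intro tendsto_add tendsto_mult tendsto_const tendsto_ident_at)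
  then have e1: "(e \<longlongrightarrow> 1) (at 0)" by simp
  then have enz: "\<forall>\<^sub>F ze in at 0. e ze \<noteq> 0" by (rule tendsto_imp_eventually_ne) simp
  have "(\<eta> \<longlongrightarrow> 0 / 1) (at 0)" unfolding \<eta>_def by (intro tendsto_divide e1 tendsto_ident_at) simp
  then have \<eta>0: "(\<eta> \<longlongrightarrow> 0) (at 0)" by simp
  have ne: "\<forall>\<^sub>F ze in at 0. ze \<noteq> (0::complex)" by (simp add: eventually_at_filter)
  have "\<forall>\<^sub>F ze in at 0. \<eta> ze \<noteq> 0" using enz ne by eventually_elim (simp add: \<eta>_def)
  with \<eta>0 have fl: "filterlim \<eta> (at 0) (at 0)" by (rule filterlim_atI)
  have sm: "\<forall>\<^sub>F ze in at 0. norm (\<eta> ze) < d" using tendstoD[OF \<eta>0 d(1)] by simp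
  have "((\<lambda>ze. pert j (base + \<eta> ze *s v) / \<eta> ze ^ Suc r / e ze ^ r) \<longlongrightarrow> T j v / 1 ^ r) (at 0)"
    by (intro tendsto_divide tendsto_power e1 filterlim_compose[OF pert_limit fl]) simp
  moreover have "\<forall>\<^sub>F ze in at 0. pert j (base + \<eta> ze *s v) / \<eta> ze ^ Suc r / e ze ^ r = pert j (base + ze *s (v + h *s axis a 1)) / ze ^ Suc r"
    using enz ne sm
  proof eventually_elim
    case (elim ze)
    have "base + ze *s (v + h *s axis a 1) = e ze *s (base + \<eta> ze *s v)"
    proof -
      have ee: "e ze * (\<eta> ze * x) = ze * x" for x using elim by (simp add: \<eta>_def)
      have b: "e ze * base $ i = base $ i + ze * (h * axis a 1 $ i)" for i using dlt0 by (simp add: e_def axis_def distrib_right)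
      show ?thesis unfolding vec_eq_iff vector_add_component vector_smult_component distrib_left b ee by (simp only: add_ac simp_thms)
    qed
    then have "pert j (base + ze *s (v + h *s axis a 1)) = e ze * pert j (base + \<eta> ze *s v)"
      using pert_scale[OF d(2)[OF elim(3)] elim(1)] by simp
    then show ?case using elim unfolding \<eta>_def by (simp add: field_simps)
  qed
  ultimately have "((\<lambda>ze. pert j (base + ze *s (v + h *s axis a 1)) / ze ^ Suc r) \<longlongrightarrow> T j v) (at 0)"
    by (simp add: filterlim_cong)
  then show ?thesis using pert_limit LIM_unique by blast
qed

text \<open>Euler's relation expresses \<open>dlt0 * pert a\<close> through \<open>rest\<close> and
  \<open>ze\<close> times the products of \<open>v\<close> with \<open>pert\<close>. As the gradient
  of \<open>rest\<close> has order \<open>Suc r\<close>, both have order \<open>Suc (Suc r)\<close>,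
  and nothing is left in degree \<open>Suc r\<close>.\<close>

lemma T_axis: "T a v = 0"
proof -
  obtain d C where d: "d > 0" "C \<ge> 0" and dC: "\<forall>ze. norm ze < d \<longrightarrow> base + ze *s v \<in> dom \<and>
     (\<forall>j. norm (pert j (base + ze *s v) - ze ^ Suc r * T j v) \<le> C * norm ze ^ Suc (Suc r))" using pert_bound by blast
  define Q where "Q = (\<Sum>j\<in>UNIV. norm (v $ j) * (norm (T j v) + C * d))"
  have pb: "norm (\<Sum>j\<in>UNIV. v $ j * pert j (base + ze *s v)) \<le> Q * norm ze ^ Suc r" if z: "norm ze < d" for ze
    unfolding Q_def sum_distrib_right
  proof (rule sum_norm_le)
    fix j
    have "norm (pert j (base + ze *s v)) \<le> norm (ze ^ Suc r * T j v) + C * norm ze ^ Suc (Suc r)"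
      using dC[rule_format, OF z, THEN conjunct2, THEN spec, of j] norm_triangle_sub[of "pert j (base + ze *s v)" "ze ^ Suc r * T j v"] by linarith
    also have "C * norm ze ^ Suc (Suc r) \<le> (C * d) * norm ze ^ Suc r"
    proof -
      have "C * norm ze * norm ze ^ Suc r \<le> C * d * norm ze ^ Suc r" using d z by (intro mult_right_mono mult_left_mono) auto
      then show ?thesis by (simp add: mult_ac)
    qed
    finally have "norm (pert j (base + ze *s v)) \<le> (norm (T j v) + C * d) * norm ze ^ Suc r"
      unfolding norm_mult norm_power distrib_right by (simp add: mult.commute)
    from mult_left_mono[OF this norm_ge_zero[of "v $ j"]]
    show "norm (v $ j * pert j (base + ze *s v)) \<le> norm (v $ j) * (norm (T j v) + C * d) * norm ze ^ Suc r"
      unfolding norm_mult by (simp only: mult.assoc)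
  qed
  define f where "f = (\<lambda>ze. rest (base + ze *s v))"
  have pert0: "pert j base = 0" for j using vanish[of 0 j] by simp
  have f0: "f 0 = 0" using rest_euler[OF base_dom] by (simp add: f_def pert0)
  have fd: "(f has_field_derivative (\<Sum>j\<in>UNIV. v $ j * pert j (base + ze *s v))) (at ze)" if z: "norm ze < d" for ze
  proof -
    have l: "((\<lambda>ze. base + ze *s v) has_derivative (\<lambda>h. h *s v)) (at ze)"
      by (rule has_derivative_eq_rhs, rule has_derivative_add[OF has_derivative_const], rule bounded_linear_imp_has_derivative,
          rule bounded_linear_intro[where K = "norm v"]) (simp_all add: norm_vector_scalar_mult vec_eq_iff algebra_simps)
    have "(f has_derivative (\<lambda>h. \<Sum>j\<in>UNIV. (h *s v) $ j * pert j (base + ze *s v))) (at ze)"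
      unfolding f_def using has_derivative_compose[OF l rest_derivative] dC z by blast
    then show ?thesis unfolding has_field_derivative_def
      by (rule has_derivative_eq_rhs) (simp add: fun_eq_iff sum_distrib_left sum_distrib_right mult_ac)
  qed
  have fb: "norm (f ze) \<le> Q * norm ze ^ Suc r * norm ze" if z: "norm ze < d" for ze
  proof -
    have "norm (f ze - f 0) \<le> (Q * norm ze ^ Suc r) * norm (ze - 0)"
    proof (rule field_differentiable_bound[of "cball 0 (norm ze)"])
      fix \<xi> :: complex assume "\<xi> \<in> cball 0 (norm ze)"
      then have x: "norm \<xi> \<le> norm ze" by simp
      show "(f has_field_derivative (\<Sum>j\<in>UNIV. v $ j * pert j (base + \<xi> *s v))) (at \<xi> within cball 0 (norm ze))"
        by (rule has_field_derivative_at_within[OF fd]) (use x z in linarith)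
      have "0 \<le> Q" unfolding Q_def using d by (intro sum_nonneg mult_nonneg_nonneg add_nonneg_nonneg) auto
      then have "Q * norm \<xi> ^ Suc r \<le> Q * norm ze ^ Suc r" using x by (intro mult_left_mono power_mono) auto
      then show "norm (\<Sum>j\<in>UNIV. v $ j * pert j (base + \<xi> *s v)) \<le> Q * norm ze ^ Suc r" using pb[of \<xi>] x z by linarith
    qed auto
    then show ?thesis by (simp add: f0)
  qed
  have "((\<lambda>ze. pert a (base + ze *s v) / ze ^ Suc r) \<longlongrightarrow> 0) (at 0)"
  proof (rule limit_of_bound[OF d(1)])
    fix ze :: complex assume z: "norm ze < d"
    have "2 * f ze = (\<Sum>j\<in>UNIV. (base + ze *s v) $ j * pert j (base + ze *s v))"
      unfolding f_def using rest_euler dC z by blast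
    also have "\<dots> = (\<Sum>j\<in>UNIV. base $ j * pert j (base + ze *s v)) + ze * (\<Sum>j\<in>UNIV. v $ j * pert j (base + ze *s v))"
      by (simp add: distrib_right sum.distrib sum_distrib_left mult.assoc)
    also have "(\<Sum>j\<in>UNIV. base $ j * pert j (base + ze *s v)) = dlt0 * pert a (base + ze *s v)"
      by (simp add: axis_def if_distrib[of "\<lambda>x. x * _"] cong: if_cong)
    finally have "pert a (base + ze *s v) = (2 * f ze - ze * (\<Sum>j\<in>UNIV. v $ j * pert j (base + ze *s v))) / dlt0"
      using dlt0 by (simp add: field_simps)
    then have "norm (pert a (base + ze *s v)) \<le> (2 * norm (f ze) + norm ze * norm (\<Sum>j\<in>UNIV. v $ j * pert j (base + ze *s v))) / norm dlt0"
      by (simp add: norm_divide divide_right_mono norm_mult order_trans[OF norm_triangle_ineq4])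
    also have "\<dots> \<le> (2 * (Q * norm ze ^ Suc r * norm ze) + norm ze * (Q * norm ze ^ Suc r)) / norm dlt0"
      using fb[OF z] pb[OF z] by (intro divide_right_mono add_mono mult_left_mono) auto
    also have "\<dots> = (3 * Q / norm dlt0) * norm ze ^ Suc (Suc r)" by (simp add: field_simps)
    finally show "norm (pert a (base + ze *s v) - ze ^ Suc r * 0) \<le> (3 * Q / norm dlt0) * norm ze ^ Suc (Suc r)" by simp
  qed
  then show ?thesis using pert_limit LIM_unique by blast
qed

section \<open>Residues of the limit field and isotropy of the loops\<close>

definition W :: "'n + 'n \<Rightarrow> complex" where "W k = (case k of Inl j \<Rightarrow> w j | Inr j \<Rightarrow> - w j)"

definition freq :: "('n + 'n) list \<Rightarrow> complex" where "freq ks = sum_list (map W ks)"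

definition tc :: "'n \<Rightarrow> ('n + 'n) list \<Rightarrow> complex" where
  "tc j ks = taylor_index (map (case_sum id id) ks) (pert j) base"

definition monom :: "complex^('n + 'n) \<Rightarrow> ('n + 'n) list \<Rightarrow> complex" where "monom c ks = prod_list (map (\<lambda>k. c $ k) ks)"

text \<open>The factor acquired by a residue when the pole moves to the next one: the exponential
  comes from \<open>exp (\<Omega> * t)\<close>, the sign from the denominator.\<close>

definition q :: "complex \<Rightarrow> complex" where "q \<Omega> = (-1) ^ r * exp (pi * \<i> * \<Omega>)"

text \<open>Up to a constant factor, the residue at the pole with index \<open>l\<close> of a
  component of the limit field for mode \<open>j\<close>, as a polynomial in the initial values:
  \<open>b = -1\<close> belongs to the components \<open>Inl\<close> and \<open>b = 1\<close> to
  \<open>Inr\<close>.\<close>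

definition Am :: "complex \<Rightarrow> 'n \<Rightarrow> nat \<Rightarrow> complex^('n + 'n) \<Rightarrow> complex" where
  "Am b j l c = (\<Sum>ks | length ks = Suc r. tc j ks * monom c ks * \<rho> r (freq ks + b * w j) * q (freq ks + b * w j) ^ l)"

lemma T_wave: "T j (wave t c) = (\<Sum>ks | length ks = Suc r. tc j ks * (monom c ks * exp (freq ks * t)))"
proof -
  let ?e = "\<lambda>k. c $ k * exp (W k * t)"
  have "wave t c $ i = (\<Sum>k | case_sum id id k = i. ?e k)" for i
  proof -
    have "{k :: 'n + 'n. case_sum id id k = i} = {Inl i, Inr i}"
    proof (rule set_eqI)
      fix k :: "'n + 'n" show "k \<in> {k. case_sum id id k = i} \<longleftrightarrow> k \<in> {Inl i, Inr i}" by (cases k) auto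
    qed
    then show ?thesis by (simp add: wave_def W_def)
  qed
  then have "T j (wave t c) = (\<Sum>ks | length ks = Suc r. taylor_index (map (case_sum id id) ks) (pert j) base * prod_list (map ?e ks))"
    unfolding T_def by (rule taylor_coeff_expand)
  moreover have "prod_list (map ?e ks) = monom c ks * exp (freq ks * t)" for ks
    by (induction ks) (simp_all add: monom_def freq_def distrib_left distrib_right exp_add mult_ac)
  ultimately show ?thesis by (simp add: tc_def)
qed

lemma loop_displacement:
  assumes "residue_box x0 y0"
  shows "((\<lambda>t. Y0 t c $ Inl j) has_contour_integral (pi * \<i> / (\<gamma> * w j)) * (\<Sum>m\<le>l. Am (-1) j m c)) (box_path x0 y0 l)"
    and "((\<lambda>t. Y0 t c $ Inr j) has_contour_integral - ((pi * \<i> / (\<gamma> * w j)) * (\<Sum>m\<le>l. Am 1 j m c))) (box_path x0 y0 l)"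
proof -
  have main: "((\<lambda>t. T j (wave t c) / \<phi> t ^ r * exp (b * w j * t) / (2 * \<gamma> * w j)) has_contour_integral (pi * \<i> / (\<gamma> * w j)) * (\<Sum>m\<le>l. Am b j m c)) (box_path x0 y0 l)" for b
  proof -
    have "((\<lambda>t. \<Sum>ks | length ks = Suc r. tc j ks * monom c ks / (2 * \<gamma> * w j) * (exp ((freq ks + b * w j) * t) / (exp t - exp (- t)) ^ r)) has_contour_integral
       (\<Sum>ks | length ks = Suc r. tc j ks * monom c ks / (2 * \<gamma> * w j) * (2 * pi * \<i> * \<rho> r (freq ks + b * w j) * (\<Sum>m\<le>l. q (freq ks + b * w j) ^ m)))) (box_path x0 y0 l)"
      unfolding q_def
      by (intro has_contour_integral_sum[OF finite_lists_length] has_contour_integral_lmul residue_box.exp_power_integral[OF assms] r)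
    moreover have "(\<lambda>t. \<Sum>ks | length ks = Suc r. tc j ks * monom c ks / (2 * \<gamma> * w j) * (exp ((freq ks + b * w j) * t) / (exp t - exp (- t)) ^ r))
       = (\<lambda>t. T j (wave t c) / \<phi> t ^ r * exp (b * w j * t) / (2 * \<gamma> * w j))"
      unfolding T_wave \<phi>_def sum_divide_distrib sum_distrib_right
      by (intro ext sum.cong refl) (simp add: distrib_left distrib_right exp_add mult_ac)
    moreover have "(\<Sum>ks | length ks = Suc r. tc j ks * monom c ks / (2 * \<gamma> * w j) * (2 * pi * \<i> * \<rho> r (freq ks + b * w j) * (\<Sum>m\<le>l. q (freq ks + b * w j) ^ m)))
       = (pi * \<i> / (\<gamma> * w j)) * (\<Sum>m\<le>l. Am b j m c)"
      unfolding Am_def by (subst sum.swap) (simp add: sum_distrib_left mult_ac)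
    ultimately show ?thesis by simp
  qed
  show "((\<lambda>t. Y0 t c $ Inl j) has_contour_integral (pi * \<i> / (\<gamma> * w j)) * (\<Sum>m\<le>l. Am (-1) j m c)) (box_path x0 y0 l)"
    using main[of "-1"] by (simp add: Y0_def kick_def)
  show "((\<lambda>t. Y0 t c $ Inr j) has_contour_integral - ((pi * \<i> / (\<gamma> * w j)) * (\<Sum>m\<le>l. Am 1 j m c))) (box_path x0 y0 l)"
    using has_contour_integral_neg[OF main[of 1]] by (simp add: Y0_def kick_def)
qed

text \<open>The integrand contains \<open>T a\<close>, which is zero. The disjunction treats the two
  relevant values of \<open>b\<close> at once.\<close>

lemma Am_axis:
  assumes "residue_box x0 y0"
  shows "(\<Sum>m\<le>l. Am b a m c) = 0 \<or> b \<noteq> 1 \<and> b \<noteq> -1"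
proof -
  have z: "Y0 t c $ Inl a = 0" "Y0 t c $ Inr a = 0" for t by (simp_all add: Y0_def kick_def T_axis)
  have "((\<lambda>t. 0) has_contour_integral 0) (box_path x0 y0 l)" by (rule has_contour_integral_0)
  then have "(pi * \<i> / (\<gamma> * w a)) * (\<Sum>m\<le>l. Am (-1) a m c) = 0" "- ((pi * \<i> / (\<gamma> * w a)) * (\<Sum>m\<le>l. Am 1 a m c)) = 0"
    using loop_displacement[OF assms, of c a l] unfolding z by (auto dest: has_contour_integral_unique)
  then show ?thesis using \<gamma> w by auto
qed

text \<open>A compact frame around the poles that contains every rectangle with parameters between 1
  and 2. Exceptional times are counted on it before the rectangle is chosen, since the choice
  depends on them.\<close>

definition Kc :: "nat \<Rightarrow> complex set" where
  "Kc l = cbox (Complex (-2) (-2)) (Complex 2 (pi * l + 2)) \<inter> ({t. 1 \<le> Re t} \<union> {t. Re t \<le> -1} \<union> {t. Im t \<le> -1} \<union> {t. pi * l + 1 \<le> Im t})"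

lemma compact_Kc: "compact (Kc l)"
  unfolding Kc_def
  by (intro compact_Int_closed compact_cbox closed_Un closed_halfspace_Re_ge closed_halfspace_Re_le closed_halfspace_Im_ge closed_halfspace_Im_le)

lemma Kc_iff: "t \<in> Kc l \<longleftrightarrow> - 2 \<le> Re t \<and> Re t \<le> 2 \<and> - 2 \<le> Im t \<and> Im t \<le> pi * l + 2 \<and> (1 \<le> Re t \<or> Re t \<le> -1 \<or> Im t \<le> -1 \<or> pi * l + 1 \<le> Im t)"
  unfolding Kc_def Int_iff in_cbox_complex_iff Un_iff mem_Collect_eq atLeastAtMost_iff complex.sel by argo

lemma \<phi>_nonzero: assumes "t \<in> Kc l" shows "\<phi> t \<noteq> 0"
proof
  assume "\<phi> t = 0"
  then obtain n :: int where "t = of_real (pi * n) * \<i>" unfolding \<phi>_def exp_diff_zero_iff by blast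
  then have t: "Re t = 0" "Im t = pi * n" by simp_all
  then have b: "- 2 \<le> pi * n" "pi * n \<le> pi * l + 2" "pi * n \<le> -1 \<or> pi * l + 1 \<le> pi * n"
    using assms unfolding Kc_iff by simp_all
  have "0 \<le> n" "n \<le> int l" using pi_multiple_bounds[of n l] b by linarith+
  then have "0 \<le> real_of_int n" "real_of_int n \<le> real l" by linarith+
  then have "0 \<le> pi * n" "pi * n \<le> pi * l" by (auto intro: mult_left_mono)
  then show False using b(3) by linarith
qed

definition loop :: "nat \<Rightarrow> complex^('n + 'n) \<Rightarrow> complex^('n + 'n)" where
  "loop l c = (\<chi> k. case k of Inl j \<Rightarrow> (pi * \<i> / (\<gamma> * w j)) * (\<Sum>m\<le>l. Am (-1) j m c) | Inr j \<Rightarrow> - ((pi * \<i> / (\<gamma> * w j)) * (\<Sum>m\<le>l. Am 1 j m c)))"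

text \<open>The sides of the rectangles can avoid finitely many exceptional times. Both rectangles
  use the same \<open>x0\<close> and \<open>y0\<close>, hence the same lower left corner, so the two
  transports are closed at one common time, as \<open>isotropic_displacements\<close>
  demands.\<close>

lemma loops_isotropic:
  assumes c: "finite {t \<in> Kc 0 \<union> Kc l. \<not> good t c}"
  shows "(\<Sum>j\<in>UNIV. w j * (loop 0 c $ Inl j * loop l c $ Inr j - loop 0 c $ Inr j * loop l c $ Inl j)) = 0"
proof -
  define Bd where "Bd = {t \<in> Kc 0 \<union> Kc l. \<not> good t c}"
  have fin: "finite Bd" using c by (simp add: Bd_def)
  have avoid: "\<exists>x. 1 < x \<and> x < 2 \<and> x \<notin> X" if "finite X" for X :: "real set"
  proof (rule ccontr)
    assume "\<not> ?thesis"
    then have "{1<..<2} \<subseteq> X" by auto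
    then have "finite {1<..<2::real}" using that by (rule finite_subset)
    then show False using infinite_Ioo[of 1 "2::real"] by simp
  qed
  obtain x0 where x0: "1 < x0" "x0 < 2" "x0 \<notin> Re ` Bd \<union> (\<lambda>s. - Re s) ` Bd" using avoid[of "Re ` Bd \<union> (\<lambda>s. - Re s) ` Bd"] fin by auto
  obtain y0 where y0: "1 < y0" "y0 < 2" "y0 \<notin> (\<lambda>s. - Im s) ` Bd \<union> Im ` Bd \<union> (\<lambda>s. Im s - pi * l) ` Bd"
    using avoid[of "(\<lambda>s. - Im s) ` Bd \<union> Im ` Bd \<union> (\<lambda>s. Im s - pi * l) ` Bd"] fin by auto
  have box: "residue_box x0 y0" using x0 y0 by unfold_locales
  have onpath: "t \<in> Kc l' \<and> t \<notin> Bd" if t: "t \<in> path_image (box_path x0 y0 l')" and l': "l' = 0 \<or> l' = l" for t l'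
  proof
    have p: "0 \<le> pi * real l'" by simp
    note t' = t[unfolded residue_box.box_path_image[OF box] Un_iff mem_Collect_eq]
    show "t \<in> Kc l'" unfolding Kc_iff using t' x0(1,2) y0(1,2) p by argo
    show "t \<notin> Bd"
    proof
      assume "t \<in> Bd"
      then have i: "Re t \<in> Re ` Bd" "- Re t \<in> (\<lambda>s. - Re s) ` Bd" "- Im t \<in> (\<lambda>s. - Im s) ` Bd" "Im t \<in> Im ` Bd" "Im t - pi * l \<in> (\<lambda>s. Im s - pi * l) ` Bd" by auto
      then have n: "x0 \<noteq> Re t" "x0 \<noteq> - Re t" "y0 \<noteq> - Im t" "y0 \<noteq> Im t" "y0 \<noteq> Im t - pi * l" using x0(3) y0(3) by auto
      have "pi * real l' = 0 \<or> pi * real l' = pi * real l" using l' by auto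
      then show False using t' n by argo
    qed
  qed
  define S where "S = path_image (box_path x0 y0 0) \<union> path_image (box_path x0 y0 l)"
  have S: "compact S" unfolding S_def by (intro compact_Un compact_path_image valid_path_imp_path residue_box.box_valid[OF box])
  have Sg: "\<phi> t \<noteq> 0" "good t c" if "t \<in> S" for t
  proof -
    have "(t \<in> Kc 0 \<or> t \<in> Kc l) \<and> t \<notin> Bd" using that onpath unfolding S_def by blast
    then show "\<phi> t \<noteq> 0" "good t c" using \<phi>_nonzero unfolding Bd_def by auto
  qed
  obtain l1 dlt B where ss: "slow_system r l1 dlt B c Y Y0 (\<lambda>i eps t c. F i (nearby t eps c)) S" using slow_system[OF S Sg] by blast
  interpret s: integrable_slow_system L initial "phase_space U" F r l1 dlt B c Y Y0 S
    by (intro integrable_slow_system.intro integrable_slow_system_axioms.intro integrable_flow_axioms ss involution)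
  let ?p = "Complex (- x0) (- y0)"
  have tr: "\<exists>k. s.transport ?p ?p k \<and> k c = loop l' c" if l': "l' = 0 \<or> l' = l" for l'
  proof -
    let ?e = "Complex x0 (pi * l' + y0)"
    have sub: "path_image (rectpath ?p ?e) \<subseteq> S" using l' unfolding S_def box_path_def by auto
    note seg = rectpath_segments[where u = ?p and v = ?e, THEN subset_trans, OF sub]
    let ?k = "\<lambda>a b c. \<chi> m. contour_integral (linepath a b) (\<lambda>t. Y0 t c $ m)"
    let ?b = "Complex (Re ?e) (Im ?p)" and ?d = "Complex (Re ?p) (Im ?e)"
    have "s.transport ?p ?p (\<lambda>c. ?k ?p ?b c + (?k ?b ?e c + (?k ?e ?d c + ?k ?d ?p c)))"
      by (intro s.transport_compose[OF s.transport_segment s.transport_compose[OF s.transport_segment s.transport_compose[OF s.transport_segment s.transport_segment]]] seg)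
    moreover have "?k ?p ?b c + (?k ?b ?e c + (?k ?e ?d c + ?k ?d ?p c)) = loop l' c"
    proof -
      have hci: "((\<lambda>t. Y0 t c $ m) has_contour_integral loop l' c $ m) (rectpath ?p ?e)" for m
        using loop_displacement[OF box, of c _ l'] unfolding box_path_def by (cases m) (simp_all add: loop_def)
      have "contour_integral (linepath ?p ?b) (\<lambda>t. Y0 t c $ m) + (contour_integral (linepath ?b ?e) (\<lambda>t. Y0 t c $ m) + (contour_integral (linepath ?e ?d) (\<lambda>t. Y0 t c $ m) + contour_integral (linepath ?d ?p) (\<lambda>t. Y0 t c $ m))) = loop l' c $ m" for m
        using contour_integral_rectpath[OF has_contour_integral_integrable[OF hci[of m]]] contour_integral_unique[OF hci[of m]] by simp
      then show ?thesis by (simp add: vec_eq_iff)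
    qed
    ultimately show ?thesis by blast
  qed
  have pS: "?p \<in> S" unfolding S_def box_path_def using rectpath_segments(1)[where u = ?p and v = "Complex x0 (pi * real l + y0)"] by auto
  obtain k0 where k0: "s.transport ?p ?p k0" "k0 c = loop 0 c" using tr[of 0] by blast
  obtain k1 where k1: "s.transport ?p ?p k1" "k1 c = loop l c" using tr[of l] by blast
  have "symplectic_form (L ?p *v k0 c) (L ?p *v k1 c) = 0"
    by (rule s.isotropic_displacements[OF k0(1) k1(1) pS Sg(2)[OF pS]])
  then show ?thesis unfolding symplectic_form_L k0 k1 using \<sigma> by simp
qed

lemma continuous_Am: "continuous_on UNIV (Am b j l)"
proof -
  have "continuous_on UNIV (\<lambda>c. monom c ks)" for ks
    unfolding monom_def by (induction ks) (auto intro!: continuous_intros)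
  then show ?thesis unfolding Am_def by (intro continuous_intros)
qed

text \<open>Isotropy is available for generic \<open>c\<close> and for the sums over the poles up to
  \<open>l\<close>. Density of generic points and continuity extend it to all \<open>c\<close>, and
  subtracting consecutive values of \<open>l\<close> isolates a single pole.\<close>

lemma residue_identity:
  "(\<Sum>j\<in>UNIV. (Am (-1) j 0 c * Am 1 j l c - Am 1 j 0 c * Am (-1) j l c) / w j) = 0"
proof -
  define E where "E = (\<lambda>l c. \<Sum>j\<in>UNIV. (Am (-1) j 0 c * Am 1 j l c - Am 1 j 0 c * Am (-1) j l c) / w j)"
  have gen: "(\<Sum>m\<le>l. E m c) = 0" if c: "finite {t \<in> Kc 0 \<union> Kc l. \<not> good t c}" for l c
  proof -
    have "(\<Sum>j\<in>UNIV. w j * (loop 0 c $ Inl j * loop l c $ Inr j - loop 0 c $ Inr j * loop l c $ Inl j))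
       = - ((pi * \<i> / \<gamma>)\<^sup>2) * (\<Sum>j\<in>UNIV. (Am (-1) j 0 c * (\<Sum>m\<le>l. Am 1 j m c) - Am 1 j 0 c * (\<Sum>m\<le>l. Am (-1) j m c)) / w j)"
    proof -
      have alg: "w j * ((K / (\<gamma> * w j)) * x * - ((K / (\<gamma> * w j)) * s) - - ((K / (\<gamma> * w j)) * y) * ((K / (\<gamma> * w j)) * s'))
         = - ((K / \<gamma>)\<^sup>2) * ((x * s - y * s') / w j)" for K x y s s' j
        using w \<gamma>(1) by (simp add: power2_eq_square field_simps)
      have l0: "loop 0 c $ Inl j = (pi * \<i> / (\<gamma> * w j)) * Am (-1) j 0 c" "loop 0 c $ Inr j = - ((pi * \<i> / (\<gamma> * w j)) * Am 1 j 0 c)" for j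
        by (simp_all add: loop_def)
      have l1: "loop l c $ Inl j = (pi * \<i> / (\<gamma> * w j)) * (\<Sum>m\<le>l. Am (-1) j m c)"
        "loop l c $ Inr j = - ((pi * \<i> / (\<gamma> * w j)) * (\<Sum>m\<le>l. Am 1 j m c))" for j by (simp_all add: loop_def)
      show ?thesis unfolding sum_distrib_left[of "- ((pi * \<i> / \<gamma>)\<^sup>2)"] l0 l1 by (intro sum.cong refl alg)
    qed
    also have "(\<Sum>j\<in>UNIV. (Am (-1) j 0 c * (\<Sum>m\<le>l. Am 1 j m c) - Am 1 j 0 c * (\<Sum>m\<le>l. Am (-1) j m c)) / w j) = (\<Sum>m\<le>l. E m c)"
      unfolding E_def by (subst sum.swap) (simp only: sum_divide_distrib[symmetric] sum_subtractf sum_distrib_left[symmetric])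
    finally show ?thesis using loops_isotropic[OF c] \<gamma>(1) by simp
  qed
  have all: "(\<Sum>m\<le>l. E m c) = 0" for l c
  proof (rule ccontr)
    let ?f = "\<lambda>c. \<Sum>m\<le>l. E m c"
    assume nz: "?f c \<noteq> 0"
    have "continuous_on UNIV ?f" unfolding E_def using w by (intro continuous_intros continuous_Am) auto
    then have "open (?f -` (- {0}))" by (intro open_vimage) (auto simp: open_Compl)
    moreover have "c \<in> ?f -` (- {0})" using nz by simp
    ultimately obtain e where e: "e > 0" "ball c e \<subseteq> ?f -` (- {0})" by (rule openE)
    have "\<exists>p. generic_on p \<and> (\<forall>c. p c \<noteq> 0 \<longrightarrow> finite {t \<in> Kc 0 \<union> Kc l. \<not> good t c})"
    proof (rule generic_good)
      show "compact (Kc 0 \<union> Kc l)" by (intro compact_Un compact_Kc)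
      show "curve t \<in> phase_space U" if "t \<in> Kc 0 \<union> Kc l" for t using that by (intro curve_in) (auto dest: \<phi>_nonzero)
    qed
    then obtain p where p: "generic_on p" "\<forall>c. p c \<noteq> 0 \<longrightarrow> finite {t \<in> Kc 0 \<union> Kc l. \<not> good t c}" by blast
    obtain c' where "c' \<in> ball c e" "p c' \<noteq> 0" using generic_on_dense[OF p(1) e(1)] by blast
    then show False using e(2) gen[OF p(2)[rule_format]] by (auto simp: subset_iff)
  qed
  have "E l c = 0" using all[of c l] all[of c "l - 1"] by (cases l) (simp_all add: atMost_Suc)
  then show ?thesis by (simp add: E_def)
qed

lemma Am_axis_zero: "Am 1 a l c = 0" "Am (-1) a l c = 0"
proof -
  have b: "residue_box (3/2) (3/2)" by unfold_locales auto
  show "Am 1 a l c = 0" using Am_axis[OF b, of 1 c l] Am_axis[OF b, of 1 c "l - 1"] by (cases l) (simp_all add: atMost_Suc)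
  show "Am (-1) a l c = 0" using Am_axis[OF b, of "-1" c l] Am_axis[OF b, of "-1" c "l - 1"] by (cases l) (simp_all add: atMost_Suc)
qed

end

section \<open>The algebraic consequences of the residue identity\<close>

locale independent_eigencoordinates = integrable_eigencoordinates U V P \<gamma> \<sigma> dlt0 w a F r
  for U :: "(complex^'n::finite) set" and V P \<gamma> \<sigma> dlt0 w a F r +
  assumes independent_w: "int_linearly_independent w"
begin

text \<open>As \<open>w a = 1\<close>, the integer on the right can be moved to the left as a
  multiple of \<open>w a\<close>; integer independence becomes independence modulo integers of the
  other frequencies.\<close>

lemma integer_combination:
  assumes "c a = 0" "(\<Sum>j\<in>UNIV. of_int (c j) * w j) = of_int n"
  shows "c j = 0"
proof -
  define c' where "c' = (\<lambda>j. c j + (if j = a then - n else 0))"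
  have "(\<Sum>j\<in>UNIV. of_int (c' j) * w j) = (\<Sum>j\<in>UNIV. of_int (c j) * w j + (if j = a then - of_int n * w a else 0))"
    by (intro sum.cong refl) (simp add: c'_def distrib_right)
  also have "\<dots> = 0" using assms(2) w by (simp add: sum.distrib)
  finally have "c' j = 0" using independent_w unfolding int_linearly_independent_def by blast
  then show ?thesis using assms(1) by (cases "j = a") (auto simp: c'_def split: if_splits)
qed

lemma exp_one:
  assumes "c a = 0" "exp (pi * \<i> * (\<Sum>j\<in>UNIV. of_int (c j) * w j)) = 1"
  shows "c j = 0"
proof -
  let ?X = "\<Sum>j\<in>UNIV. of_int (c j) * w j"
  obtain n :: int where "pi * \<i> * ?X = of_int (2 * n) * of_real pi * \<i>"
    using assms(2) exp_eq[of "pi * \<i> * ?X" 0] by (auto simp: mult.assoc)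
  then have "pi * \<i> * ?X = pi * \<i> * of_int (2 * n)" by (simp add: mult_ac)
  then have "?X = of_int (2 * n)" using pi_neq_zero by (metis complex_i_not_zero mult_cancel_left mult_eq_0_iff of_real_eq_0_iff)
  then show ?thesis by (rule integer_combination[where c = c, OF assms(1)])
qed

text \<open>The contribution of one amplitude to the exponent vector \<open>cnt\<close> of a
  product: plus one for \<open>exp (w j * t)\<close>, minus one for
  \<open>exp (- (w j * t))\<close>.\<close>

definition unit :: "'n + 'n \<Rightarrow> 'n \<Rightarrow> int" where
  "unit k i = (case k of Inl j \<Rightarrow> if j = i then 1 else 0 | Inr j \<Rightarrow> if j = i then -1 else 0)"

definition cnt :: "('n + 'n) list \<Rightarrow> 'n \<Rightarrow> int" where "cnt ks i = sum_list (map (\<lambda>k. unit k i) ks)"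

definition fm :: "'n multiset \<Rightarrow> complex" where "fm M = (\<Sum>i\<in>UNIV. of_nat (count M i) * w i)"

lemma freq_cnt: "freq ks = (\<Sum>i\<in>UNIV. of_int (cnt ks i) * w i)"
proof (induction ks)
  case (Cons k ks)
  have "W k = (\<Sum>i\<in>UNIV. of_int (unit k i) * w i)"
    by (cases k) (simp_all add: W_def unit_def if_distrib[of of_int] if_distrib[of "\<lambda>x. x * _"] cong: if_cong)
  then show ?case using Cons by (simp add: freq_def cnt_def sum.distrib distrib_right)
qed (simp add: freq_def cnt_def)

text \<open>The total of the exponent vector reaches the length only for lists without entries
  \<open>Inr\<close>; this singles out the terms of top degree.\<close>

lemma cnt_total: "(\<Sum>i\<in>UNIV. cnt ks i) \<le> int (length ks) \<and> ((\<Sum>i\<in>UNIV. cnt ks i) = int (length ks) \<longrightarrow> (\<exists>is. ks = map Inl is))"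
proof (induction ks)
  case (Cons k ks)
  have c: "(\<Sum>i\<in>UNIV. cnt (k # ks) i) = (\<Sum>i\<in>UNIV. unit k i) + (\<Sum>i\<in>UNIV. cnt ks i)" by (simp add: cnt_def sum.distrib)
  show ?case
  proof (cases k)
    case (Inl j)
    have "(\<Sum>i\<in>UNIV. unit k i) = 1" unfolding Inl by (simp add: unit_def)
    then show ?thesis using Cons unfolding c by (auto simp: Inl intro: exI[of _ "j # _"])
  next
    case (Inr j)
    have "(\<Sum>i\<in>UNIV. unit k i) = -1" unfolding Inr by (simp add: unit_def)
    then show ?thesis using Cons unfolding c by auto
  qed
qed (simp add: cnt_def)

lemma cnt_Inl: "cnt (map Inl is) i = int (count (mset is) i)"
  by (induction "is") (simp_all add: cnt_def unit_def)

lemma cnt_Inr: "cnt (map Inr is) i = - int (count (mset is) i)"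
  by (induction "is") (simp_all add: cnt_def unit_def)

definition ti :: "'n \<Rightarrow> 'n list \<Rightarrow> complex" where "ti j is = taylor_index is (pert j) base"

lemma tc_map: "tc j (map Inl is) = ti j is" "tc j (map Inr is) = ti j is"
  by (simp_all add: tc_def ti_def comp_def)

text \<open>The coefficient of the commutative monomial with exponents \<open>N\<close> in
  \<open>T j\<close>, collected from all orderings.\<close>

definition \<tau> :: "'n \<Rightarrow> 'n multiset \<Rightarrow> complex" where "\<tau> j N = (\<Sum>is | mset is = N. ti j is)"

text \<open>Lists without the mode \<open>a\<close>. Initial values are taken with zero amplitude in
  that mode, because independence modulo integers concerns the other frequencies.\<close>

definition Ks :: "('n + 'n) list set" where "Ks = {ks. length ks = Suc r \<and> Inl a \<notin> set ks \<and> Inr a \<notin> set ks}"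

lemma Ks_cnt: "ks \<in> Ks \<Longrightarrow> cnt ks a = 0"
proof -
  have "Inl a \<notin> set ks \<Longrightarrow> Inr a \<notin> set ks \<Longrightarrow> cnt ks a = 0" for ks
    by (induction ks) (auto simp: cnt_def unit_def split: sum.splits)
  then show "ks \<in> Ks \<Longrightarrow> cnt ks a = 0" by (simp add: Ks_def)
qed

lemma monom_zero: "k \<in> set ks \<Longrightarrow> c $ k = 0 \<Longrightarrow> monom c ks = 0"
  by (induction ks) (auto simp: monom_def)

lemma finite_Ks: "finite Ks"
  by (rule finite_subset[OF _ finite_lists_length[of "Suc r"]]) (auto simp: Ks_def)

lemma Am_Ks:
  assumes "c $ Inl a = 0" "c $ Inr a = 0"
  shows "Am b j l c = (\<Sum>ks\<in>Ks. tc j ks * monom c ks * \<rho> r (freq ks + b * w j) * q (freq ks + b * w j) ^ l)"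
  unfolding Am_def
proof (rule sum.mono_neutral_right[OF finite_lists_length])
  show "Ks \<subseteq> {ks. length ks = Suc r}" by (auto simp: Ks_def)
  show "\<forall>ks\<in>{ks. length ks = Suc r} - Ks. tc j ks * monom c ks * \<rho> r (freq ks + b * w j) * q (freq ks + b * w j) ^ l = 0"
    using assms monom_zero by (auto simp: Ks_def)
qed

lemma q_eq_iff: "q x = q y \<longleftrightarrow> exp (pi * \<i> * (x - y)) = 1"
  by (simp add: q_def right_diff_distrib exp_diff)

text \<open>The residue identity is an exponential sum in \<open>l\<close>, indexed by a mode, a
  list and a sign, and its part with base \<open>q (fm M)\<close> vanishes. By
  \<open>exp_one\<close> equal bases mean equal exponent vectors, and the total degree
  \<open>Suc (Suc r)\<close> is reached only by lists of \<open>Inl\<close> with the positive sign.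
  The common factor \<open>\<rho> r (fm M)\<close> is nonzero because \<open>fm M\<close> is not an
  integer.\<close>

lemma top_degree:
  assumes c: "c $ Inl a = 0" "c $ Inr a = 0" and M: "a \<notin># M" "size M = Suc (Suc r)"
  shows "(\<Sum>(j,is) | j \<noteq> a \<and> add_mset j (mset is) = M. Am (-1) j 0 c / w j * (ti j is * monom c (map Inl is))) = 0"
proof -
  define X where "X = (UNIV - {a}) \<times> Ks \<times> (UNIV :: bool set)"
  define sg where "sg = (\<lambda>b. if b then 1 else - 1 :: complex)"
  define sz where "sz = (\<lambda>b. if b then 1 else - 1 :: int)"
  define g where "g = (\<lambda>(j,ks,b). (if b then Am (-1) j 0 c else - Am 1 j 0 c) / w j * (tc j ks * monom c ks * \<rho> r (freq ks + sg b * w j)))"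
  define E where "E = (\<lambda>(j,ks,b). q (freq ks + sg b * w j))"
  have fX: "finite X" unfolding X_def using finite_Ks by auto
  have "(\<Sum>x\<in>X. g x * E x ^ l) = 0" for l
  proof -
    have "(\<Sum>x\<in>X. g x * E x ^ l) = (\<Sum>j\<in>UNIV-{a}. \<Sum>ks\<in>Ks. \<Sum>b\<in>UNIV. g (j,ks,b) * E (j,ks,b) ^ l)"
      unfolding X_def by (simp add: sum.cartesian_product)
    also have "\<dots> = (\<Sum>j\<in>UNIV-{a}. (Am (-1) j 0 c * Am 1 j l c - Am 1 j 0 c * Am (-1) j l c) / w j)"
    proof (rule sum.cong[OF refl])
      fix j
      show "(\<Sum>ks\<in>Ks. \<Sum>b\<in>UNIV. g (j,ks,b) * E (j,ks,b) ^ l) = (Am (-1) j 0 c * Am 1 j l c - Am 1 j 0 c * Am (-1) j l c) / w j"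
        unfolding Am_Ks[OF c, of 1 j l] Am_Ks[OF c, of "-1" j l]
        by (simp add: UNIV_bool g_def E_def sg_def sum.distrib sum_distrib_left sum_subtractf sum_divide_distrib sum_negf diff_divide_distrib mult_ac)
    qed
    also have "\<dots> = (\<Sum>j\<in>UNIV. (Am (-1) j 0 c * Am 1 j l c - Am 1 j 0 c * Am (-1) j l c) / w j)"
      by (rule sum.mono_neutral_left) (auto simp: Am_axis_zero)
    finally show ?thesis by (simp add: residue_identity)
  qed
  from exponential_independence[OF fX this, of "q (fm M)"]
  have 0: "(\<Sum>x | x \<in> X \<and> E x = q (fm M). g x) = 0" .
  define Z where "Z = {(j,is). j \<noteq> a \<and> add_mset j (mset is) = M}"
  define f where "f = (\<lambda>(j :: 'n, is :: 'n list). (j, map Inl is :: ('n + 'n) list, True))"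
  have inj: "inj_on f Z" by (auto simp: f_def inj_on_def)
  have fin: "freq (map Inl is) + w j = fm M" if "add_mset j (mset is) = M" for j "is"
  proof -
    have "fm M = (\<Sum>i\<in>UNIV. of_int (cnt (map Inl is) i) * w i + (if i = j then w j else 0))"
      unfolding fm_def that[symmetric] cnt_Inl by (intro sum.cong refl) (simp add: distrib_right)
    then show ?thesis by (simp add: freq_cnt sum.distrib)
  qed
  have "{x. x \<in> X \<and> E x = q (fm M)} = f ` Z"
  proof (intro equalityI subsetI)
    fix x assume "x \<in> {x. x \<in> X \<and> E x = q (fm M)}"
    then obtain j ks b where x: "x = (j, ks, b)" "j \<noteq> a" "ks \<in> Ks" "E (j, ks, b) = q (fm M)" by (auto simp: X_def)
    \<comment> \<open>The difference of the two exponent vectors; its entry at \<open>a\<close> is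
      0, as \<open>exp_one\<close> requires.\<close>
    define d where "d = (\<lambda>i. cnt ks i + sz b * (if i = j then 1 else 0) - int (count M i))"
    have "(\<Sum>i\<in>UNIV. of_int (d i) * w i) = freq ks + sg b * w j - fm M"
    proof -
      have "(\<Sum>i\<in>UNIV. of_int (d i) * w i) = (\<Sum>i\<in>UNIV. of_int (cnt ks i) * w i + (if i = j then sg b * w j else 0) - of_nat (count M i) * w i)"
        by (intro sum.cong refl) (simp add: d_def sz_def sg_def algebra_simps)
      then show ?thesis by (simp add: freq_cnt fm_def sum.distrib sum_subtractf)
    qed
    then have "exp (pi * \<i> * (\<Sum>i\<in>UNIV. of_int (d i) * w i)) = 1" using x(4) by (simp add: E_def q_eq_iff)
    moreover have "d a = 0" using x Ks_cnt M(1) by (simp add: d_def not_in_iff)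
    ultimately have d0: "d i = 0" for i using exp_one by blast
    have ci: "cnt ks i + sz b * (if i = j then 1 else 0) = int (count M i)" for i using d0[of i] by (simp add: d_def)
    have sM: "(\<Sum>i\<in>UNIV. int (count M i)) = int (size M)"
    proof -
      have "size M = (\<Sum>i\<in>set_mset M. count M i)" by (simp add: size_multiset_overloaded_eq)
      also have "\<dots> = (\<Sum>i\<in>UNIV. count M i)" by (rule sum.mono_neutral_left) (auto simp: not_in_iff)
      finally show ?thesis by simp
    qed
    have tot: "(\<Sum>i\<in>UNIV. cnt ks i) + sz b = int (Suc (Suc r))"
    proof -
      have "(\<Sum>i\<in>UNIV. cnt ks i + sz b * (if i = j then 1 else 0)) = int (Suc (Suc r))" unfolding ci sM M(2) ..
      then show ?thesis by (simp add: sum.distrib sum_distrib_left[symmetric])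
    qed
    have len: "length ks = Suc r" using x(3) by (simp add: Ks_def)
    have b: "b" using tot cnt_total[of ks] len by (cases b) (auto simp: sz_def)
    then obtain "is" where iss: "ks = map Inl is" using tot cnt_total[of ks] len by (auto simp: sz_def)
    have "count (add_mset j (mset is)) i = count M i" for i
      using ci[of i] b unfolding iss cnt_Inl by (auto simp: sz_def split: if_splits)
    then have "add_mset j (mset is) = M" by (rule multiset_eqI)
    then show "x \<in> f ` Z" using x b iss by (auto simp: f_def Z_def)
  next
    fix x assume "x \<in> f ` Z"
    then obtain j "is" where x: "x = (j, map Inl is, True)" "j \<noteq> a" "add_mset j (mset is) = M" by (auto simp: f_def Z_def)
    have "size (add_mset j (mset is)) = Suc (Suc r)" using M(2) x(3) by simp
    then have "length is = Suc r" by simp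
    moreover have "a \<notin> set is" using M(1) x(3) by auto
    ultimately have "map Inl is \<in> Ks" by (auto simp: Ks_def)
    then show "x \<in> {x. x \<in> X \<and> E x = q (fm M)}" using x fin[OF x(3)] by (simp add: X_def E_def sg_def)
  qed
  then have "(\<Sum>x\<in>f ` Z. g x) = 0" using 0 by simp
  then have "(\<Sum>x\<in>Z. g (f x)) = 0" by (simp add: sum.reindex[OF inj])
  moreover have "(\<Sum>x\<in>Z. g (f x)) = (\<Sum>x\<in>Z. (case x of (j,is) \<Rightarrow> Am (-1) j 0 c / w j * (ti j is * monom c (map Inl is))) * \<rho> r (fm M))"
    by (rule sum.cong[OF refl]) (auto simp: Z_def g_def f_def sg_def fin tc_map mult_ac)
  ultimately have "(\<Sum>x\<in>Z. (case x of (j,is) \<Rightarrow> Am (-1) j 0 c / w j * (ti j is * monom c (map Inl is)))) * \<rho> r (fm M) = 0"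
    by (simp add: sum_distrib_right)
  moreover have "\<rho> r (fm M) \<noteq> 0"
  proof (rule \<rho>_nonzero[OF r], rule notI)
    assume "fm M \<in> \<int>"
    then obtain n where n: "(\<Sum>i\<in>UNIV. of_int (int (count M i)) * w i) = of_int n" unfolding fm_def Ints_def by auto
    have "int (count M i) = 0" for i by (rule integer_combination[OF _ n]) (use M(1) in \<open>simp add: not_in_iff\<close>)
    then have "M = {#}" by (intro multiset_eqI) simp
    then show False using M(2) by simp
  qed
  ultimately show ?thesis unfolding Z_def by simp
qed

definition pt :: "(('n \<Rightarrow> complex)) \<Rightarrow> ('n \<Rightarrow> complex) \<Rightarrow> complex^('n + 'n)" where
  "pt x y = (\<chi> k. case k of Inl i \<Rightarrow> if i = a then 0 else x i | Inr i \<Rightarrow> if i = a then 0 else y i)"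

text \<open>In \<open>top_degree\<close> the amplitudes in \<open>Inl\<close> occur both in the
  monomials and inside \<open>Am (-1) j 0\<close>. Scaling them by \<open>dlt\<close>, dividing by
  the monomial of \<open>M\<close> and letting \<open>dlt\<close> tend to 0 removes them from the
  second place. The ratios \<open>e\<close> of the amplitudes remain arbitrary, and two choices of
  them separate the modes.\<close>

lemma coefficient_product:
  assumes j: "j \<noteq> a" and N: "a \<notin># N" "size N = Suc r"
  shows "Am (-1) j 0 (pt (\<lambda>_. 0) y) * \<tau> j N = 0"
proof -
  define M where "M = add_mset j N"
  have M: "a \<notin># M" "size M = Suc (Suc r)" using j N by (auto simp: M_def)
  define Z where "Z = {(j,is). j \<noteq> a \<and> add_mset j (mset is) = M}"
  have fZ: "finite Z"
  proof (rule finite_subset)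
    show "Z \<subseteq> UNIV \<times> {is. length is = Suc r}"
    proof (rule subsetI)
      fix x assume x: "x \<in> Z"
      obtain j' "is" where x': "x = (j', is)" by (cases x)
      have "size (add_mset j' (mset is)) = Suc (Suc r)" using M(2) x unfolding x' by (simp add: Z_def)
      then show "x \<in> UNIV \<times> {is. length is = Suc r}" by (simp add: x')
    qed
    show "finite ((UNIV :: 'n set) \<times> {is :: 'n list. length is = Suc r})"
      by (intro finite_cartesian_product finite_lists_length finite)
  qed
  have lim: "(\<Sum>(j',is)\<in>Z. Am (-1) j' 0 (pt (\<lambda>_. 0) y) / w j' * ti j' is / e j') = 0" if e: "\<And>i. e i \<noteq> 0" for e
  proof -
    define h where "h = (\<lambda>dlt. \<Sum>(j',is)\<in>Z. Am (-1) j' 0 (pt (\<lambda>i. dlt * e i) y) / w j' * ti j' is / e j')"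
    have "h dlt = 0" if dlt: "dlt \<noteq> 0" for dlt
    proof -
      let ?c = "pt (\<lambda>i. dlt * e i) y"
      \<comment> \<open>The monomials differ only in the removed index \<open>j'\<close>, so the
        monomial of all of \<open>M\<close> can be factored out of the sum.\<close>
      define Q where "Q = prod_mset (image_mset (\<lambda>i. dlt * e i) M)"
      have Q: "Q \<noteq> 0" unfolding Q_def using dlt e by (auto simp: prod_mset_zero_iff)
      have m: "monom ?c (map Inl is) = Q / (dlt * e j')" if z: "(j', is) \<in> Z" for j' "is"
      proof -
        have "a \<notin> set is" using z M(1) unfolding Z_def by auto
        then have "monom ?c (map Inl is) = prod_list (map (\<lambda>i. dlt * e i) is)"
          by (induction "is") (auto simp: monom_def pt_def)
        also have "\<dots> = prod_mset (image_mset (\<lambda>i. dlt * e i) (mset is))" by (simp flip: prod_mset_prod_list mset_map)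
        finally show ?thesis using z dlt e[of j'] unfolding Q_def Z_def by auto
      qed
      have "(\<Sum>(j',is)\<in>Z. Am (-1) j' 0 ?c / w j' * (ti j' is * monom ?c (map Inl is))) = 0"
        unfolding Z_def by (rule top_degree[OF _ _ M]) (simp_all add: pt_def)
      also have "(\<Sum>(j',is)\<in>Z. Am (-1) j' 0 ?c / w j' * (ti j' is * monom ?c (map Inl is))) = (Q / dlt) * h dlt"
        unfolding h_def sum_distrib_left by (rule sum.cong[OF refl]) (auto simp: m mult_ac)
      finally show ?thesis using Q dlt by simp
    qed
    then have "\<forall>\<^sub>F dlt in at 0. 0 = h dlt" by (auto simp: eventually_at_filter)
    then have "(h \<longlongrightarrow> 0) (at 0)" by (rule tendsto_eventually[OF eventually_mono]) simp
    moreover have "continuous_on UNIV h"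
    proof -
      have pc: "continuous_on UNIV (\<lambda>dlt. pt (\<lambda>i. dlt * e i) y)"
        unfolding pt_def
      proof (rule continuous_on_vec_lambda)
        fix k :: "'n + 'n"
        show "continuous_on UNIV (\<lambda>dlt. case k of Inl i \<Rightarrow> if i = a then 0 else dlt * e i | Inr i \<Rightarrow> if i = a then 0 else y i)"
        proof (cases k)
          case (Inl i)
          then show ?thesis by (cases "i = a") (auto intro!: continuous_intros)
        qed auto
      qed
      have "continuous_on UNIV (\<lambda>dlt. Am (-1) j' 0 (pt (\<lambda>i. dlt * e i) y))" for j'
        by (rule continuous_on_compose2[OF continuous_Am pc]) auto
      then show ?thesis unfolding h_def case_prod_unfold using w e by (intro continuous_intros) auto
    qed
    then have "(h \<longlongrightarrow> h 0) (at 0)" by (simp add: continuous_on_eq_continuous_at continuous_within)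
    ultimately have "h 0 = 0" using LIM_unique by blast
    then show ?thesis by (simp add: h_def)
  qed
  let ?A = "\<lambda>j'. Am (-1) j' 0 (pt (\<lambda>_. 0) y)"
  \<comment> \<open>Comparing the value 1/2 of \<open>e\<close> at \<open>j\<close> with the value 1
    leaves \<open>2 - 1\<close> times the terms of mode \<open>j\<close> and cancels all
    others.\<close>
  have "0 = (\<Sum>(j',is)\<in>Z. ?A j' / w j' * ti j' is / (if j' = j then 1/2 else 1)) - (\<Sum>(j',is)\<in>Z. ?A j' / w j' * ti j' is / 1)"
    using lim[of "\<lambda>i. if i = j then 1/2 else 1"] lim[of "\<lambda>_. 1"] by simp
  also have "\<dots> = (\<Sum>x\<in>Z. case x of (j',is) \<Rightarrow> if j' = j then ?A j / w j * ti j is else 0)"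
    unfolding sum_subtractf[symmetric] by (rule sum.cong[OF refl]) auto
  also have "\<dots> = (\<Sum>x | x \<in> Z \<and> fst x = j. case x of (j',is) \<Rightarrow> if j' = j then ?A j / w j * ti j is else 0)"
    using fZ by (intro sum.mono_neutral_right) (auto split: if_splits)
  also have "{x. x \<in> Z \<and> fst x = j} = Pair j ` {is. mset is = N}" using j by (auto simp: Z_def M_def)
  also have "(\<Sum>x\<in>Pair j ` {is. mset is = N}. case x of (j',is) \<Rightarrow> if j' = j then ?A j / w j * ti j is else 0) = ?A j / w j * \<tau> j N"
    by (subst sum.reindex) (auto simp: inj_on_def \<tau>_def sum_distrib_left)
  finally show ?thesis using w by simp
qed

text \<open>A nonzero coefficient would, by \<open>coefficient_product\<close>, make
  \<open>Am (-1) j 0\<close> vanish at all points with amplitudes only in \<open>Inr\<close>. There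
  it is a polynomial whose coefficients are those of \<open>T j\<close> times values of
  \<open>\<rho>\<close>, and the value of \<open>\<rho>\<close> at the monomial \<open>N\<close> is
  nonzero since its argument is not an integer, so the given coefficient would vanish after
  all.\<close>

lemma \<tau>_zero:
  assumes j: "j \<noteq> a" and N: "a \<notin># N" "size N = Suc r"
  shows "\<tau> j N = 0"
proof (rule ccontr)
  assume nz: "\<tau> j N \<noteq> 0"
  define Is where "Is = {is. length is = Suc r \<and> a \<notin> set is}"
  have fI: "finite Is" by (rule finite_subset[OF _ finite_lists_length[of "Suc r"]]) (auto simp: Is_def)
  define E where "E = (\<lambda>is. exp (pi * \<i> * fm (mset is)))"
  have fInr: "freq (map Inr is) = - fm (mset is)" for "is"
    by (simp add: freq_cnt cnt_Inr fm_def sum_negf)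
  have "(\<Sum>is\<in>Is. (ti j is * \<rho> r (- fm (mset is) - w j)) * E is ^ l) = 0" for l
  proof -
    \<comment> \<open>With these amplitudes every monomial becomes the \<open>l\<close>-th power of
      an exponential, and distinct monomials have distinct bases by independence, so
      \<open>exponential_independence\<close> extracts the coefficients.\<close>
    define y where "y = (\<lambda>i. exp (of_nat l * (pi * \<i> * w i)))"
    let ?c = "pt (\<lambda>_. 0) y"
    have "0 = Am (-1) j 0 ?c" using coefficient_product[OF j N, of y] nz by simp
    also have "\<dots> = (\<Sum>ks\<in>Ks. tc j ks * monom ?c ks * \<rho> r (freq ks - w j))"
      by (subst Am_Ks) (simp_all add: pt_def)
    also have "\<dots> = (\<Sum>ks\<in>map Inr ` Is. tc j ks * monom ?c ks * \<rho> r (freq ks - w j))"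
    proof (rule sum.mono_neutral_right[OF finite_Ks])
      show "map Inr ` Is \<subseteq> Ks" by (auto simp: Ks_def Is_def)
      show "\<forall>ks\<in>Ks - map Inr ` Is. tc j ks * monom ?c ks * \<rho> r (freq ks - w j) = 0"
      proof
        fix ks assume ks: "ks \<in> Ks - map Inr ` Is"
        have "\<exists>i. Inl i \<in> set ks"
        proof (rule ccontr)
          assume n: "\<not> ?thesis"
          define "is" where "is = map projr ks"
          have "ks = map Inr is" unfolding is_def map_map
          proof (rule sym, rule map_idI)
            fix x assume "x \<in> set ks"
            then show "(Inr \<circ> projr) x = x" using n by - (cases x; auto)
          qed
          moreover from this have "is \<in> Is" using ks by (auto simp: Is_def Ks_def)
          ultimately show False using ks by blast
        qed
        then obtain i where "Inl i \<in> set ks" by blast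
        then have "monom ?c ks = 0" by (rule monom_zero) (simp add: pt_def)
        then show "tc j ks * monom ?c ks * \<rho> r (freq ks - w j) = 0" by simp
      qed
    qed
    also have "\<dots> = (\<Sum>is\<in>Is. tc j (map Inr is) * monom ?c (map Inr is) * \<rho> r (freq (map Inr is) - w j))"
      by (subst sum.reindex) (auto simp: inj_on_def comp_def)
    also have "\<dots> = (\<Sum>is\<in>Is. (ti j is * \<rho> r (- fm (mset is) - w j)) * E is ^ l)"
    proof (rule sum.cong[OF refl])
      fix "is" assume "is \<in> Is"
      then have "a \<notin> set is" by (simp add: Is_def)
      then have "monom ?c (map Inr is) = E is ^ l"
      proof (induction "is")
        case (Cons i "is")
        have "fm (add_mset i (mset is)) = (\<Sum>k\<in>UNIV. of_nat (count (mset is) k) * w k + (if k = i then w i else 0))"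
          unfolding fm_def by (intro sum.cong refl) (simp add: distrib_right)
        then have "fm (add_mset i (mset is)) = fm (mset is) + w i" by (simp add: fm_def sum.distrib)
        then have "E (i # is) = E is * exp (pi * \<i> * w i)" by (simp add: E_def distrib_left exp_add)
        moreover have "y i = exp (pi * \<i> * w i) ^ l" unfolding y_def exp_of_nat_mult ..
        moreover have "monom ?c (map Inr (i # is)) = y i * monom ?c (map Inr is)"
        proof -
          have "i \<noteq> a" using Cons.prems by auto
          then show ?thesis by (simp add: monom_def pt_def)
        qed
        ultimately show ?case using Cons by (simp add: power_mult_distrib)
      qed (simp add: monom_def E_def fm_def)
      then show "tc j (map Inr is) * monom ?c (map Inr is) * \<rho> r (freq (map Inr is) - w j) = ti j is * \<rho> r (- fm (mset is) - w j) * E is ^ l"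
        by (simp add: tc_map fInr)
    qed
    finally show ?thesis by simp
  qed
  from exponential_independence[OF fI this, of "exp (pi * \<i> * fm N)"]
  have 0: "(\<Sum>is | is \<in> Is \<and> E is = exp (pi * \<i> * fm N). ti j is * \<rho> r (- fm (mset is) - w j)) = 0" .
  have "{is. is \<in> Is \<and> E is = exp (pi * \<i> * fm N)} = {is. mset is = N}"
  proof (intro equalityI subsetI)
    fix "is" assume "is \<in> {is. is \<in> Is \<and> E is = exp (pi * \<i> * fm N)}"
    then have i: "is \<in> Is" "E is = exp (pi * \<i> * fm N)" by auto
    define d where "d = (\<lambda>i. int (count (mset is) i) - int (count N i))"
    have "(\<Sum>i\<in>UNIV. of_int (d i) * w i) = fm (mset is) - fm N"
      by (simp add: d_def fm_def sum_subtractf left_diff_distrib)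
    then have "exp (pi * \<i> * (\<Sum>i\<in>UNIV. of_int (d i) * w i)) = 1" using i(2) by (simp add: E_def right_diff_distrib exp_diff)
    moreover have "d a = 0" using i(1) N(1) by (simp add: d_def Is_def not_in_iff count_mset_0_iff)
    ultimately have "d i = 0" for i using exp_one by blast
    then have "count (mset is) i = count N i" for i by (simp add: d_def)
    then show "is \<in> {is. mset is = N}" by (simp add: multiset_eqI)
  next
    fix "is" assume "is \<in> {is. mset is = N}"
    then have i: "mset is = N" by simp
    have "length is = Suc r" using N(2) i by (metis size_mset)
    moreover have "a \<notin> set is" using N(1) i by auto
    ultimately show "is \<in> {is. is \<in> Is \<and> E is = exp (pi * \<i> * fm N)}" by (simp add: Is_def E_def i)
  qed
  then have "(\<Sum>is | mset is = N. ti j is * \<rho> r (- fm (mset is) - w j)) = 0" using 0 by simp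
  moreover have "(\<Sum>is | mset is = N. ti j is * \<rho> r (- fm (mset is) - w j)) = \<tau> j N * \<rho> r (- fm N - w j)"
    unfolding \<tau>_def sum_distrib_right by (rule sum.cong) auto
  moreover have "\<rho> r (- fm N - w j) \<noteq> 0"
  proof (rule \<rho>_nonzero[OF r], rule notI)
    assume "- fm N - w j \<in> \<int>"
    then obtain n where n: "- fm N - w j = of_int n" by (auto elim: Ints_cases)
    define d where "d = (\<lambda>i. - int (count N i) - (if i = j then 1 else 0))"
    have "(\<Sum>i\<in>UNIV. of_int (d i) * w i) = (\<Sum>i\<in>UNIV. - (of_nat (count N i) * w i) - (if i = j then w j else 0))"
      by (intro sum.cong refl) (simp add: d_def left_diff_distrib)
    also have "\<dots> = of_int n" using n by (simp add: sum_subtractf sum_negf fm_def)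
    finally have "d j = 0" by (rule integer_combination[rotated]) (use j N(1) in \<open>simp add: d_def not_in_iff\<close>)
    then show False by (simp add: d_def)
  qed
  ultimately show False using nz by simp
qed

text \<open>\<open>T_shift\<close> removes the component of \<open>v\<close> along \<open>a\<close>;
  the expansion at the remaining vector only involves coefficients covered by
  \<open>\<tau>_zero\<close>.\<close>

lemma T_zero: "T j v = 0"
proof (cases "j = a")
  case False
  define u where "u = v + (- (v $ a)) *s axis a 1"
  have ua: "u $ a = 0" by (simp add: u_def)
  define Is where "Is = {is. length is = Suc r \<and> a \<notin> set is}"
  have fI: "finite Is" by (rule finite_subset[OF _ finite_lists_length[of "Suc r"]]) (auto simp: Is_def)
  have "T j u = (\<Sum>is | length is = Suc r. ti j is * prod_list (map (\<lambda>k. u $ k) is))"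
    unfolding T_def ti_def using taylor_coeff_expand[where v = u and pr = id and e = "\<lambda>k. u $ k" and n = "Suc r" and g = "pert j" and z = base] by simp
  also have "\<dots> = (\<Sum>is\<in>Is. ti j is * prod_list (map (\<lambda>k. u $ k) is))"
  proof (rule sum.mono_neutral_right[OF finite_lists_length])
    have "a \<in> set is \<Longrightarrow> prod_list (map (\<lambda>k. u $ k) is) = 0" for "is" using ua by (induction "is") auto
    then show "\<forall>is\<in>{is. length is = Suc r} - Is. ti j is * prod_list (map (\<lambda>k. u $ k) is) = 0" by (auto simp: Is_def)
  qed (auto simp: Is_def)
  also have "\<dots> = (\<Sum>N\<in>mset ` Is. \<Sum>is | is \<in> Is \<and> mset is = N. ti j is * prod_list (map (\<lambda>k. u $ k) is))"
    by (rule sum.group[symmetric]) (use fI in auto)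
  also have "\<dots> = (\<Sum>N\<in>mset ` Is. 0)"
  proof (rule sum.cong[OF refl])
    fix N assume "N \<in> mset ` Is"
    then obtain js where js: "js \<in> Is" "N = mset js" by blast
    have aN: "a \<notin># N" "size N = Suc r" using js by (auto simp: Is_def)
    have "{is. is \<in> Is \<and> mset is = N} = {is. mset is = N}"
      using js by (auto simp: Is_def dest: mset_eq_length mset_eq_setD)
    then have "(\<Sum>is | is \<in> Is \<and> mset is = N. ti j is * prod_list (map (\<lambda>k. u $ k) is)) = (\<Sum>is | mset is = N. ti j is * prod_mset (image_mset (\<lambda>k. u $ k) N))"
      by (intro sum.cong) (auto simp flip: prod_mset_prod_list mset_map)
    also have "\<dots> = \<tau> j N * prod_mset (image_mset (\<lambda>k. u $ k) N)" by (simp add: \<tau>_def sum_distrib_right)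
    finally show "(\<Sum>is | is \<in> Is \<and> mset is = N. ti j is * prod_list (map (\<lambda>k. u $ k) is)) = 0" using \<tau>_zero[OF False aN] by simp
  qed
  finally have "T j u = 0" by simp
  then show ?thesis unfolding u_def T_shift .
qed (simp add: T_axis)

end

section \<open>Quadratic potentials\<close>

lemma matrix_vector_eigenbasis:
  fixes A P :: "complex^'n^'n"
  assumes "\<And>j. A *v column j P = l j *s column j P"
  shows "A *v (P *v x) = P *v (\<chi> j. l j * x $ j)"
proof -
  have "(A *v (P *v x)) $ i = (\<Sum>j\<in>UNIV. x $ j * (A *v column j P) $ i)" for i
    unfolding matrix_vector_mult_def column_def vec_lambda_beta sum_distrib_left
    by (subst sum.swap) (simp add: mult_ac)
  then show ?thesis unfolding vec_eq_iff assms by (simp add: matrix_vector_mult_def column_def mult_ac)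
qed

text \<open>For the bilinear form an eigenvector might be isotropic and impossible to normalise.
  Distinct eigenvalues exclude this: such a vector would be orthogonal to all eigenvectors, which
  form a basis, and hence be zero.\<close>

lemma symmetric_distinct_orthonormal_eigenbasis:
  fixes A :: "complex^'n^'n"
  assumes sym: "\<And>i j. A $ i $ j = A $ j $ i" and inv: "invertible Q"
    and eig: "\<And>j. A *v column j Q = l j *s column j Q" and dist: "inj l"
  shows "\<exists>P. orthonormal_eigenbasis A l P"
proof -
  define bf where "bf = (\<lambda>x y :: complex^'n. \<Sum>i\<in>UNIV. x $ i * y $ i)"
  have bs: "bf (c *s x) y = c * bf x y" "bf x (c *s y) = c * bf x y" for c x y
    by (simp_all add: bf_def sum_distrib_left mult_ac)
  have sa: "bf (A *v x) y = bf x (A *v y)" for x y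
  proof -
    have "bf (A *v x) y = (\<Sum>i\<in>UNIV. \<Sum>j\<in>UNIV. A $ j $ i * x $ j * y $ i)"
      unfolding bf_def matrix_vector_mult_def vec_lambda_beta sum_distrib_right by (simp add: sym)
    also have "\<dots> = bf x (A *v y)"
      unfolding bf_def matrix_vector_mult_def vec_lambda_beta sum_distrib_left by (subst sum.swap) (simp add: mult_ac)
    finally show ?thesis .
  qed
  have orth: "bf (column i Q) (column j Q) = 0" if "i \<noteq> j" for i j
  proof -
    have "l i * bf (column i Q) (column j Q) = l j * bf (column i Q) (column j Q)"
      using sa[of "column i Q" "column j Q"] by (simp add: eig bs)
    then show ?thesis using that dist by (auto simp: inj_def)
  qed
  have nz: "bf (column i Q) (column i Q) \<noteq> 0" for i
  proof
    assume "bf (column i Q) (column i Q) = 0"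
    then have 0: "bf (column i Q) (column j Q) = 0" for j using orth by (cases "i = j") auto
    obtain Q' where "Q ** Q' = mat 1" using inv unfolding invertible_def by blast
    then have c: "column i Q $ k = (\<Sum>j\<in>UNIV. Q' $ j $ k * bf (column i Q) (column j Q))" for k
    proof -
      assume a: "Q ** Q' = mat 1"
      have "(\<Sum>j\<in>UNIV. Q' $ j $ k * bf (column i Q) (column j Q)) = (\<Sum>m\<in>UNIV. column i Q $ m * (Q ** Q') $ m $ k)"
        unfolding bf_def matrix_matrix_mult_def vec_lambda_beta sum_distrib_left
        by (subst sum.swap) (simp add: column_def mult_ac)
      also have "\<dots> = column i Q $ k" unfolding a by (simp add: mat_def if_distrib cong: if_cong)
      finally show ?thesis by simp
    qed
    have "column i Q = 0" unfolding vec_eq_iff c by (simp add: 0)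
    moreover obtain Q'' where q: "Q'' ** Q = mat 1" using inv unfolding invertible_def by blast
    have "(Q'' ** Q) $ i $ i = 1" unfolding q by (simp add: mat_def)
    then have "(\<Sum>m\<in>UNIV. Q'' $ i $ m * column i Q $ m) = 1" by (simp add: matrix_matrix_mult_def column_def)
    ultimately show False by simp
  qed
  define nr where "nr = (\<lambda>i. csqrt (bf (column i Q) (column i Q)))"
  have nr: "nr i * nr i = bf (column i Q) (column i Q)" "nr i \<noteq> 0" for i
    using nz[of i] by (simp_all add: nr_def flip: power2_eq_square)
  define P where "P = (\<chi> i j. Q $ i $ j / nr j)"
  have cP: "column j P = (1 / nr j) *s column j Q" for j by (simp add: P_def column_def vec_eq_iff)
  have "(transpose P ** P) $ i $ j = mat 1 $ i $ j" for i j
  proof -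
    have "(transpose P ** P) $ i $ j = bf (column i P) (column j P)"
      by (simp add: matrix_matrix_mult_def transpose_def column_def bf_def)
    also have "\<dots> = bf (column i Q) (column j Q) / (nr i * nr j)" by (simp add: cP bs)
    finally show ?thesis using orth[of i j] nr[of i] by (cases "i = j") (auto simp: mat_def)
  qed
  then have PP: "transpose P ** P = mat 1" by (simp add: vec_eq_iff)
  then have "orthogonal_matrix P" unfolding orthogonal_matrix_def using matrix_left_right_inverse by blast
  moreover have "A *v column j P = l j *s column j P" for j
    unfolding cP matrix_vector_mult_scale eig by (simp add: vec_eq_iff)
  ultimately show ?thesis unfolding orthonormal_eigenbasis_def by blast
qed

text \<open>The gradient is homogeneous of degree 1, so by Euler's relation and the symmetry of
  second derivatives the Hessian maps \<open>d\<close> to the gradient at \<open>d\<close>.\<close>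

lemma hessian_eigenvector:
  assumes "homogeneous_potential 2 U V" and d: "d \<in> U" "grad V d = \<gamma> *s d"
  shows "hessian V d *v d = \<gamma> *s d"
proof -
  have U: "open U" "mv_holomorphic_on V U" and cone: "\<And>q s. q \<in> U \<Longrightarrow> s \<noteq> 0 \<Longrightarrow> s *s q \<in> U"
    and hom: "\<And>q s. q \<in> U \<Longrightarrow> s \<noteq> 0 \<Longrightarrow> V (s *s q) = s ^ 2 * V q"
    using assms(1) unfolding homogeneous_potential_def by (auto simp: power_int_def)
  have "(\<Sum>j\<in>UNIV. d $ j * partial_deriv j (partial_deriv i V) d) = of_nat 1 * partial_deriv i V d" for i
    by (rule euler_homogeneous[OF mv_holomorphic_on_partial_deriv[OF U(2,1)] d(1)])
       (use partial_deriv_homogeneous[OF U(2,1) cone, of 1 d] hom d(1) in \<open>simp add: numeral_2_eq_2\<close>)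
  moreover have "partial_deriv j (partial_deriv i V) d = partial_deriv i (partial_deriv j V) d" for i j
    by (rule partial_deriv_commute[OF U(2,1) d(1)])
  ultimately have "(hessian V d *v d) $ i = grad V d $ i" for i
    by (simp add: matrix_vector_mult_def hessian_def grad_def mult.commute)
  then show ?thesis using d(2) by (simp add: vec_eq_iff)
qed

text \<open>Applied at the Darboux point, where an eigenbasis of the Hessian makes the right-hand
  side vanish: there the perturbation has no linear term.\<close>

lemma (in eigencoordinates) partial_deriv_pert:
  assumes "u \<in> dom"
  shows "partial_deriv k (pert j) u = (\<Sum>i\<in>UNIV. P $ i $ j * (hessian V (P *v u) *v column k P) $ i) - \<gamma> * (w j)\<^sup>2 * (if j = k then 1 else 0)"
proof (rule partial_deriv_eq)
  have pu: "P *v u \<in> U" using assms by (simp add: dom_def)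
  have d1: "((\<lambda>u. P *v u) has_derivative (\<lambda>v. P *v v)) (at u)"
    by (rule bounded_linear_imp_has_derivative[OF matrix_vector_mul_bounded_linear])
  have d2: "((\<lambda>u. partial_deriv i V (P *v u)) has_derivative (\<lambda>v. \<Sum>m\<in>UNIV. (P *v v) $ m * partial_deriv m (partial_deriv i V) (P *v u))) (at u)" for i
    by (rule has_derivative_compose[OF d1 mv_holomorphic_on_has_derivative[OF mv_holomorphic_on_partial_deriv[OF V_holomorphic open_U] pu]])
  have c: "((\<lambda>u. u $ j) has_derivative (\<lambda>v. v $ j)) (at u)"
    by (rule bounded_linear_imp_has_derivative[OF bounded_linear_vec_nth])
  have sw: "partial_deriv m (partial_deriv i V) (P *v u) = hessian V (P *v u) $ i $ m" for i m
    using partial_deriv_commute[OF V_holomorphic open_U pu, of m i] by (simp add: hessian_def)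
  have "(\<Sum>m\<in>UNIV. (P *v v) $ m * hessian V (P *v u) $ i $ m) = (\<Sum>k\<in>UNIV. v $ k * (hessian V (P *v u) *v column k P) $ i)" for v i
    unfolding matrix_vector_mult_def vec_lambda_beta column_def sum_distrib_left sum_distrib_right
    by (subst sum.swap) (simp add: mult_ac)
  note e = this
  have f: "(\<Sum>i\<in>UNIV. P $ i $ j * (\<Sum>k\<in>UNIV. v $ k * (hessian V (P *v u) *v column k P) $ i)) =
      (\<Sum>k\<in>UNIV. v $ k * (\<Sum>i\<in>UNIV. P $ i $ j * (hessian V (P *v u) *v column k P) $ i))" for v
    unfolding sum_distrib_left by (subst sum.swap) (simp add: mult_ac)
  have delta: "(\<Sum>k\<in>UNIV. v $ k * (\<gamma> * (w j)\<^sup>2 * (if j = k then 1 else 0))) = \<gamma> * (w j)\<^sup>2 * v $ j" for v :: "complex^'n"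
  proof -
    have "v $ k * (\<gamma> * (w j)\<^sup>2 * (if j = k then 1 else 0)) = (if k = j then \<gamma> * (w j)\<^sup>2 * v $ j else 0)" for k by simp
    then show ?thesis by simp
  qed
  have "(pert j has_derivative (\<lambda>v. (\<Sum>i\<in>UNIV. P $ i $ j * (\<Sum>m\<in>UNIV. (P *v v) $ m * partial_deriv m (partial_deriv i V) (P *v u))) - \<gamma> * (w j)\<^sup>2 * v $ j)) (at u)"
    unfolding pert_def by (intro has_derivative_diff has_derivative_sum has_derivative_mult_right d2 c)
  then show "(pert j has_derivative (\<lambda>v. \<Sum>k\<in>UNIV. v $ k * ((\<Sum>i\<in>UNIV. P $ i $ j * (hessian V (P *v u) *v column k P) $ i) - \<gamma> * (w j)\<^sup>2 * (if j = k then 1 else 0)))) (at u)"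
    by (rule has_derivative_eq_rhs)
       (simp only: fun_eq_iff sw e f right_diff_distrib sum_subtractf delta simp_thms)
qed

text \<open>\<open>d\<close> is an eigenvector of the Hessian with eigenvalue
  \<open>\<gamma>\<close>, so by simplicity of the spectrum it lies on one axis \<open>a\<close>
  with \<open>(\<omega> a)\<^sup>2 = 1\<close>. All Taylor parts of \<open>pert\<close> at
  \<open>d\<close> vanish by induction on the degree, and connectedness of the domain spreads this
  to every point.\<close>

lemma liouville_integrable_quadratic:
  fixes U :: "(complex^'n::finite) set"
  assumes V: "homogeneous_potential 2 U V" and d: "proper_darboux_point U V d \<gamma>"
    and P: "orthonormal_eigenbasis (hessian V d) (\<lambda>j. \<gamma> * (\<omega> j)\<^sup>2) P"
    and indep: "int_linearly_independent \<omega>" and inj: "inj (\<lambda>j. (\<omega> j)\<^sup>2)" and nz: "\<And>j. \<omega> j \<noteq> 0"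
    and integrable: "liouville_integrable U V" and Px: "P *v x \<in> U"
  shows "V (P *v x) = \<gamma> / 2 * (\<Sum>j\<in>UNIV. (\<omega> j)\<^sup>2 * (x $ j * x $ j))"
proof -
  have dU: "d \<in> U" "d \<noteq> 0" "\<gamma> \<noteq> 0" "grad V d = \<gamma> *s d" using d unfolding proper_darboux_point_def by auto
  have PT: "transpose P ** P = mat 1" "P ** transpose P = mat 1" and eig: "\<And>j. hessian V d *v column j P = (\<gamma> * (\<omega> j)\<^sup>2) *s column j P"
    using P unfolding orthonormal_eigenbasis_def orthogonal_matrix_def by auto
  define u where "u = transpose P *v d"
  have Pu: "P *v u = d" by (simp only: u_def matrix_vector_mul_assoc PT matrix_vector_mul_lid)
  have inv: "transpose P *v (P *v y) = y" for y by (simp only: matrix_vector_mul_assoc PT matrix_vector_mul_lid)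
  have "P *v (\<chi> j. \<gamma> * (\<omega> j)\<^sup>2 * u $ j) = P *v (\<gamma> *s u)"
    using hessian_eigenvector[OF V dU(1,4)] matrix_vector_eigenbasis[OF eig, of u] by (simp add: Pu matrix_vector_mult_scale)
  then have "(\<chi> j. \<gamma> * (\<omega> j)\<^sup>2 * u $ j) = \<gamma> *s u" by (metis inv)
  then have u1: "(\<omega> j)\<^sup>2 = 1" if "u $ j \<noteq> 0" for j using that dU(3) by (auto simp: vec_eq_iff dest: spec[of _ j])
  have "u \<noteq> 0" using Pu dU(2) by auto
  then obtain a where ua: "u $ a \<noteq> 0" by (auto simp: vec_eq_iff)
  \<comment> \<open>Only squares enter the Hamiltonian, so the frequency at \<open>a\<close>, which
    is 1 or -1, may be replaced by 1; independence is preserved because the sign can be moved into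
    the integer coefficient.\<close>
  define w where "w = (\<lambda>j. if j = a then 1 else \<omega> j)"
  have w2: "(w j)\<^sup>2 = (\<omega> j)\<^sup>2" for j using u1[OF ua] by (simp add: w_def)
  have ub: "u = axis a (u $ a)"
  proof -
    have "u $ j = 0" if "j \<noteq> a" for j
      using u1[OF ua] u1[of j] inj that unfolding inj_def by metis
    then show ?thesis by (simp add: vec_eq_iff axis_def)
  qed
  have indep_w: "int_linearly_independent w"
    unfolding int_linearly_independent_def
  proof (intro allI impI)
    fix c :: "'n \<Rightarrow> int" and i assume c: "(\<Sum>i\<in>UNIV. of_int (c i) * w i) = 0"
    obtain e :: int where e: "of_int e * \<omega> a = 1" "e \<noteq> 0"
    proof -
      have "\<omega> a = 1 \<or> \<omega> a = -1" using u1[OF ua] by (simp add: power2_eq_1_iff)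
      then show thesis using that[of 1] that[of "-1"] by auto
    qed
    define c' where "c' = (\<lambda>i. if i = a then e * c i else c i)"
    have "of_int (c' i) * \<omega> i = of_int (c i) * w i" for i
      using e(1) by (simp add: c'_def w_def)
    then have "(\<Sum>i\<in>UNIV. of_int (c' i) * \<omega> i) = 0" using c by simp
    then have "c' i = 0" using indep unfolding int_linearly_independent_def by blast
    then show "c i = 0" using e(2) by (auto simp: c'_def split: if_splits)
  qed
  interpret eigencoordinates U V P \<gamma> "csqrt (- \<gamma>)" "u $ a" w a
  proof
    show "P *v axis a (u $ a) \<in> U" using dU(1) Pu ub by simp
    show "V (s *s q) = s ^ 2 * V q" if "q \<in> U" "s \<noteq> 0" for s q
      using V that unfolding homogeneous_potential_def by (simp add: power_int_def)
  qed (use V dU nz PT ua in \<open>auto simp: homogeneous_potential_def w_def\<close>)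
  have bd: "base = u" using ub by simp
  have P0: "pert j base = 0" for j
  proof -
    have "(\<Sum>i\<in>UNIV. P $ i $ j * partial_deriv i V d) = (transpose P *v grad V d) $ j"
      by (simp add: matrix_vector_mult_def transpose_def grad_def)
    also have "\<dots> = \<gamma> * u $ j" by (simp add: dU(4) matrix_vector_mult_scale u_def)
    finally have "pert j base = \<gamma> * u $ j - \<gamma> * (w j)\<^sup>2 * u $ j" by (simp only: pert_def bd Pu)
    then show ?thesis using u1[of j] by (cases "u $ j = 0") (auto simp: w2)
  qed
  have P1: "partial_deriv k (pert j) base = 0" for k j
  proof -
    have "(\<Sum>i\<in>UNIV. P $ i $ j * (hessian V d *v column k P) $ i) = \<gamma> * (\<omega> k)\<^sup>2 * (transpose P ** P) $ j $ k"
      unfolding eig by (simp add: matrix_matrix_mult_def transpose_def column_def sum_distrib_left mult_ac)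
    moreover have "u \<in> dom" using base_dom unfolding bd .
    ultimately show ?thesis using partial_deriv_pert[of u k j] unfolding bd Pu by (simp add: PT mat_def w2)
  qed
  \<comment> \<open>Degree 0 is the Darboux condition and degree 1 the choice of the eigenbasis. For
    larger \<open>k\<close> the lower degrees supply the hypothesis \<open>vanish\<close> with
    \<open>r = k - 1\<close>.\<close>
  have T0: "taylor_coeff k (pert j) base v = 0" for k j v
  proof (induction k arbitrary: j v rule: less_induct)
    case (less k)
    consider "k = 0" | "k = 1" | "2 \<le> k" by linarith
    then show ?case
    proof cases
      case 3
      obtain F :: "'n \<Rightarrow> complex^('n + 'n) \<Rightarrow> complex" where F: "\<forall>i. meromorphic_first_integral (hamilton_field (hamiltonian V)) (phase_space U) (F i)"
        "functionally_independent (phase_space U) F"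
        "\<forall>i j. \<forall>z\<in>regular_points (F i) (phase_space U) \<inter> regular_points (F j) (phase_space U). poisson_bracket (F i) (F j) z = 0"
        using integrable unfolding liouville_integrable_def by (elim exE conjE) (rule that)
      define r where "r = k - 1"
      have k: "k = Suc r" using 3 by (simp add: r_def)
      interpret t: independent_eigencoordinates U V P \<gamma> "csqrt (- \<gamma>)" "u $ a" w a F r
      proof
        show "1 \<le> r" using 3 by (simp add: r_def)
        show "taylor_coeff m (pert i) base v = 0" if "m \<le> r" for i m v using less that by (simp add: k)
        show "meromorphic_first_integral (hamilton_field (hamiltonian V)) (phase_space U) (F i)" for i using F(1) by simp
        show "functionally_independent (phase_space U) F" by (rule F(2))
        show "poisson_bracket (F i) (F j) z = 0"
          if "z \<in> regular_points (F i) (phase_space U)" "z \<in> regular_points (F j) (phase_space U)" for i j z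
          using F(3)[THEN spec, THEN spec, THEN bspec, OF IntI[OF that]] .
        show "int_linearly_independent w" by (rule indep_w)
      qed
      show ?thesis using t.T_zero[of j v] by (simp add: t.T_def k)
    qed (simp_all add: P0 P1)
  qed
  have cd: "connected dom"
  proof -
    have "dom = (\<lambda>q. transpose P *v q) ` U"
    proof (intro equalityI subsetI)
      fix y assume "y \<in> dom"
      then show "y \<in> (\<lambda>q. transpose P *v q) ` U" using inv[of y] by (auto simp: dom_def intro!: image_eqI[of _ _ "P *v y"])
    next
      fix y assume "y \<in> (\<lambda>q. transpose P *v q) ` U"
      then obtain q where q: "q \<in> U" "y = transpose P *v q" by blast
      have "P *v y = q" by (simp only: q(2) matrix_vector_mul_assoc PT matrix_vector_mul_lid)
      then show "y \<in> dom" using q(1) by (simp add: dom_def)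
    qed
    moreover have "continuous_on U (\<lambda>q. transpose P *v q)"
      using matrix_vector_mul_bounded_linear linear_continuous_on by blast
    ultimately show ?thesis using V connected_continuous_image unfolding homogeneous_potential_def by metis
  qed
  have x: "x \<in> dom" using Px by (simp add: dom_def)
  have "pert j x = 0" for j
    by (rule zero_of_taylor_coeff_zero[OF pert_holomorphic open_dom cd base_dom T0 x])
  then have "rest x = 0" using rest_euler[OF x] by simp
  then show ?thesis by (simp add: rest_def w2)
qed

theorem theorem1p2:
  fixes U :: "(complex^'n) set" and V :: "complex^'n \<Rightarrow> complex"
    and d :: "complex^'n" and \<gamma> :: complex and \<omega> :: "'n \<Rightarrow> complex"
  assumes "homogeneous_potential 2 U V"
    and "proper_darboux_point U V d \<gamma>"
    and "diagonalisable_with_eigenvalues (\<chi> i j. inverse \<gamma> * hessian V d $ i $ j) (\<lambda>i. (\<omega> i)\<^sup>2)"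
    and "int_linearly_independent \<omega>"
    and "liouville_integrable U V"
  shows "(\<forall>q\<in>U. V q = 1/2 * (\<Sum>i\<in>UNIV. q $ i * (hessian V d *v q) $ i)) \<and>
    (\<exists>P. orthonormal_eigenbasis (hessian V d) (\<lambda>i. \<gamma> * (\<omega> i)\<^sup>2) P) \<and>
    (\<forall>P. orthonormal_eigenbasis (hessian V d) (\<lambda>i. \<gamma> * (\<omega> i)\<^sup>2) P \<longrightarrow>
       (\<forall>x y. P *v x \<in> U \<longrightarrow>
          hamiltonian V (phase_point (P *v x) (P *v y)) =
            1/2 * (\<Sum>i\<in>UNIV. (y $ i)\<^sup>2 + \<gamma> * (\<omega> i)\<^sup>2 * (x $ i)\<^sup>2)))"
proof -
  let ?H = "hessian V d" and ?l = "\<lambda>i. \<gamma> * (\<omega> i)\<^sup>2"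
  have \<gamma>: "\<gamma> \<noteq> 0" and d: "d \<in> U" using assms(2) by (auto simp: proper_darboux_point_def)
  have U: "open U" "mv_holomorphic_on V U" using assms(1) by (auto simp: homogeneous_potential_def)
  have unit: "(\<Sum>k\<in>UNIV. of_int (if k = i then c else 0) * \<omega> k) = of_int c * \<omega> i" for i c
    by (simp add: if_distrib[of of_int] if_distrib[of "\<lambda>x. x * _"] cong: if_cong)
  have nz: "\<omega> i \<noteq> 0" for i
  proof
    assume "\<omega> i = 0"
    then have "(\<Sum>k\<in>UNIV. of_int (if k = i then 1 else 0) * \<omega> k) = 0" unfolding unit by simp
    then have "(if i = i then 1 else 0) = (0::int)"
      by (rule assms(4)[unfolded int_linearly_independent_def, THEN spec, of "\<lambda>k. if k = i then 1 else 0", THEN mp, THEN spec])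
    then show False by simp
  qed
  \<comment> \<open>Equal squares mean that \<open>\<omega> i\<close> is \<open>\<omega> j\<close>
    or its negative, which is an integer relation; hence the spectrum is simple.\<close>
  have sq: "i = j" if ij: "(\<omega> i)\<^sup>2 = (\<omega> j)\<^sup>2" for i j
  proof (rule ccontr)
    assume ne: "i \<noteq> j"
    obtain e :: int where e: "\<omega> i = of_int e * \<omega> j"
    proof -
      have "\<omega> i = \<omega> j \<or> \<omega> i = - \<omega> j" using ij by (simp add: power2_eq_iff)
      then show thesis using that[of 1] that[of "-1"] by auto
    qed
    define c where "c = (\<lambda>k. (if k = i then 1 else 0) + (if k = j then - e else 0))"
    have "(\<Sum>k\<in>UNIV. of_int (c k) * \<omega> k) = 0"
      using e unfolding c_def of_int_add distrib_right sum.distrib unit by simp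
    then have "c i = 0" using assms(4) unfolding int_linearly_independent_def by blast
    then show False using ne by (simp add: c_def)
  qed
  have inj2: "inj (\<lambda>i. (\<omega> i)\<^sup>2)" using sq by (auto simp: inj_def)
  have injl: "inj ?l" using sq \<gamma> by (auto simp: inj_def)
  obtain Q where Q: "invertible Q" "(\<chi> i j. inverse \<gamma> * ?H $ i $ j) = Q ** diagonal_matrix (\<lambda>i. (\<omega> i)\<^sup>2) ** matrix_inv Q"
    using assms(3) unfolding diagonalisable_with_eigenvalues_def by blast
  have eigQ: "?H *v column j Q = ?l j *s column j Q" for j
  proof -
    have iv: "matrix_inv Q ** Q = mat 1"
    proof -
      have "Q ** matrix_inv Q = mat 1 \<and> matrix_inv Q ** Q = mat 1"
        using Q(1) unfolding invertible_def matrix_inv_def by (rule someI_ex)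
      then show ?thesis ..
    qed
    have "(\<chi> i j. inverse \<gamma> * ?H $ i $ j) ** Q = Q ** diagonal_matrix (\<lambda>i. (\<omega> i)\<^sup>2)"
      unfolding Q(2) by (simp add: matrix_mul_assoc[symmetric] iv)
    then have "((\<chi> i j. inverse \<gamma> * ?H $ i $ j) ** Q) $ k $ j = (Q ** diagonal_matrix (\<lambda>i. (\<omega> i)\<^sup>2)) $ k $ j" for k by simp
    then have "inverse \<gamma> * (?H *v column j Q) $ k = (\<omega> j)\<^sup>2 * Q $ k $ j" for k
      by (simp add: matrix_matrix_mult_def matrix_vector_mult_def column_def diagonal_matrix_def sum_distrib_left mult.assoc
          if_distrib[of "\<lambda>x. _ * x"] mult.commute[of "Q $ k $ j"] cong: if_cong)
    then have "(?H *v column j Q) $ k = \<gamma> * (\<omega> j)\<^sup>2 * Q $ k $ j" for k using \<gamma> by (simp add: field_simps)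
    then show ?thesis by (simp add: vec_eq_iff column_def)
  qed
  have sym: "?H $ i $ j = ?H $ j $ i" for i j
    using partial_deriv_commute[OF U(2,1) d] by (simp add: hessian_def)
  obtain P0 where P0: "orthonormal_eigenbasis ?H ?l P0"
    using symmetric_distinct_orthonormal_eigenbasis[OF sym Q(1) eigQ injl] by blast
  have form: "(\<Sum>i\<in>UNIV. (P *v x) $ i * (?H *v (P *v x)) $ i) = \<gamma> * (\<Sum>j\<in>UNIV. (\<omega> j)\<^sup>2 * (x $ j * x $ j))"
    if P: "orthonormal_eigenbasis ?H ?l P" for P x
  proof -
    have e: "?H *v (P *v x) = P *v (\<chi> j. ?l j * x $ j)"
      using P by (intro matrix_vector_eigenbasis) (simp add: orthonormal_eigenbasis_def)
    have "transpose P ** P = mat 1" using P by (simp add: orthonormal_eigenbasis_def orthogonal_matrix_def)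
    then show ?thesis unfolding e by (subst sum_orthogonal) (simp_all add: sum_distrib_left mult_ac)
  qed
  have quad: "V q = 1/2 * (\<Sum>i\<in>UNIV. q $ i * (?H *v q) $ i)" if q: "q \<in> U" for q
  proof -
    have "P0 ** transpose P0 = mat 1" using P0 by (simp add: orthonormal_eigenbasis_def orthogonal_matrix_def)
    then have e: "P0 *v (transpose P0 *v q) = q" by (simp only: matrix_vector_mul_assoc matrix_vector_mul_lid)
    have "P0 *v (transpose P0 *v q) \<in> U" unfolding e by (rule q)
    from liouville_integrable_quadratic[OF assms(1,2) P0 assms(4) inj2 nz assms(5) this] form[OF P0, of "transpose P0 *v q"]
    show ?thesis unfolding e by simp
  qed
  have "hamiltonian V (phase_point (P *v x) (P *v y)) = 1/2 * (\<Sum>i\<in>UNIV. (y $ i)\<^sup>2 + ?l i * (x $ i)\<^sup>2)"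
    if P: "orthonormal_eigenbasis ?H ?l P" and x: "P *v x \<in> U" for P x y
  proof -
    have "transpose P ** P = mat 1" using P by (simp add: orthonormal_eigenbasis_def orthogonal_matrix_def)
    from sum_orthogonal[OF this, of y y] have "(\<Sum>i\<in>UNIV. ((P *v y) $ i)\<^sup>2) = (\<Sum>i\<in>UNIV. (y $ i)\<^sup>2)" by (simp add: power2_eq_square)
    moreover have "position (phase_point (P *v x) (P *v y)) = P *v x" "momentum (phase_point (P *v x) (P *v y)) = P *v y"
      by (simp_all add: position_def momentum_def phase_point_def vec_eq_iff)
    ultimately show ?thesis unfolding hamiltonian_def using quad[OF x] form[OF P, of x]
      by (simp add: sum.distrib sum_distrib_left distrib_left power2_eq_square mult_ac)
  qed
  then show ?thesis using quad P0 by blast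
qed

end
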